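(* The model-checking problem for the fragment $\mathrm{LTL}_B(\mathbf{F},\land,\lor)$ belongs to NP.
   Context: A $d$-dimensional constant-rate multi-mode system (MMS) is a finite set $\mathcal{M}\subseteq\mathbb{R}^d$ ($d\ge 1$) of vectors called modes. A schedule is a finite or infinite sequence $\pi=(\alpha_1,\vec m_1)(\alpha_2,\vec m_2)\cdots$ with $\alpha_i\in\mathbb{R}_{>0}$, $\vec m_i\in\mathcal{M}$; an infinite schedule is non-Zeno if $\sum_i\alpha_i=\infty$. A point $\vec x_0$ and a schedule $\pi$ induce the execution $\sigma$: with $\vec x_j=\vec x_{j-1}+\alpha_j\vec m_j$, $t_0=0$, $t_j=t_{j-1}+\alpha_j$, for $\tau\in[t_j,t_{j+1}]$ let $\sigma(\tau)=\vec x_j+\frac{\tau-t_j}{t_{j+1}-t_j}(\vec x_{j+1}-\vec x_j)$. A zone is a set $\{\vec x\in\mathbb{R}^d : A\vec x\le \vec b\}$ with $A\in\mathbb{Z}^{k\times d}$, $\vec b\in\mathbb{Z}^k$. LTL over a finite set $AP$ of zones has syntax $\varphi::=\mathrm{true}\mid Z\mid\neg\varphi\mid\varphi\land\varphi\mid\varphi\lor\varphi\mid \mathbf{F}\varphi\mid\mathbf{G}\varphi\mid\varphi\,\mathbf{U}\,\varphi$ ($Z\in AP$), interpreted over infinite executions at times $\tau\ge0$: $\sigma,\tau\models Z$ iff $\sigma(\tau)\in Z$; Boolean connectives as usual; $\sigma,\tau\models\mathbf{F}\varphi$ iff $\exists\tau'\ge\tau$: $\sigma,\tau'\models\varphi$;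 $\sigma,\tau\models\mathbf{G}\varphi$ iff $\forall\tau'\ge\tau$: $\sigma,\tau'\models\varphi$; $\sigma,\tau\models\varphi\,\mathbf{U}\,\varphi'$ iff $\exists\tau'\ge\tau$ with $\sigma,\tau'\models\varphi'$ and $\sigma,\tau''\models\varphi$ for all $\tau''\in[\tau,\tau')$. We write $\vec x\models_{\mathcal M}\varphi$ iff some non-Zeno infinite schedule $\pi$ of $\mathcal M$ induces from $\vec x$ an execution $\sigma$ with $\sigma,0\models\varphi$. For a set $X$ of operators, $\mathrm{LTL}_B(X)$ denotes the formulas using only operators from $X$ (besides $\mathrm{true}$ and zones) in which all zones are bounded. The model-checking problem for a fragment asks, given an MMS $\mathcal M$, a point $\vec x$ and a formula $\varphi$ of the fragment, whether $\vec x\models_{\mathcal M}\varphi$. *)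

theory Defs
  imports
    Complex_Main
    "HOL-Computational_Algebra.Polynomial"
    "Jordan_Normal_Form.Matrix"
begin

section \<open>Constant-rate multi-mode systems\<close>

text \<open>The dimension is part of the input of the model-checking problem, so points are vectors
  with an explicit carrier \<open>carrier_vec d\<close>.\<close>

definition is_mms :: "nat \<Rightarrow> real vec set \<Rightarrow> bool" where
  "is_mms d M \<longleftrightarrow> d \<ge> 1 \<and> finite M \<and> M \<subseteq> carrier_vec d"

type_synonym schedule = "nat \<Rightarrow> real \<times> real vec"

definition is_schedule :: "real vec set \<Rightarrow> schedule \<Rightarrow> bool" where
  "is_schedule M \<pi> \<longleftrightarrow> (\<forall>i. fst (\<pi> i) > 0 \<and> snd (\<pi> i) \<in> M)"

definition time_at :: "schedule \<Rightarrow> nat \<Rightarrow> real" where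
  "time_at \<pi> j = (\<Sum>i<j. fst (\<pi> i))"

definition non_Zeno :: "schedule \<Rightarrow> bool" where
  "non_Zeno \<pi> \<longleftrightarrow> filterlim (time_at \<pi>) at_top sequentially"

fun point_at :: "real vec \<Rightarrow> schedule \<Rightarrow> nat \<Rightarrow> real vec" where
  "point_at x \<pi> 0 = x"
| "point_at x \<pi> (Suc j) = point_at x \<pi> j + fst (\<pi> j) \<cdot>\<^sub>v snd (\<pi> j)"

text \<open>For a non-Zeno schedule the intervals \<open>[t\<^sub>j, t\<^sub>j\<^sub>+\<^sub>1]\<close> cover \<open>[0, \<infinity>)\<close> and the prescribed values
  agree at common endpoints, so this determines \<open>\<sigma>\<close> on \<open>[0, \<infinity>)\<close>, the only times at which it is
  ever evaluated.\<close>

definition induces :: "real vec \<Rightarrow> schedule \<Rightarrow> (real \<Rightarrow> real vec) \<Rightarrow> bool" where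
  "induces x \<pi> \<sigma> \<longleftrightarrow>
     (\<forall>j. \<forall>\<tau>\<in>{time_at \<pi> j..time_at \<pi> (Suc j)}.
        \<sigma> \<tau> = point_at x \<pi> j
          + ((\<tau> - time_at \<pi> j) / (time_at \<pi> (Suc j) - time_at \<pi> j))
              \<cdot>\<^sub>v (point_at x \<pi> (Suc j) - point_at x \<pi> j))"


section \<open>Linear temporal logic over zones\<close>

type_synonym zone = "int mat \<times> int vec"

definition is_zone :: "nat \<Rightarrow> zone \<Rightarrow> bool" where
  "is_zone d z \<longleftrightarrow> (\<exists>k. fst z \<in> carrier_mat k d \<and> snd z \<in> carrier_vec k)"

definition zone_set :: "zone \<Rightarrow> real vec set" where
  "zone_set z = {x \<in> carrier_vec (dim_col (fst z)).
     map_mat real_of_int (fst z) *\<^sub>v x \<le> map_vec real_of_int (snd z)}"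

definition bounded_zone :: "zone \<Rightarrow> bool" where
  "bounded_zone z \<longleftrightarrow> (\<exists>B. \<forall>x\<in>zone_set z. \<forall>i<dim_vec x. \<bar>x $ i\<bar> \<le> B)"

datatype ltl =
    TrueF
  | Zone zone
  | Neg ltl
  | Conj ltl ltl
  | Disj ltl ltl
  | Finally ltl
  | Globally ltl
  | Until ltl ltl

fun sat :: "(real \<Rightarrow> real vec) \<Rightarrow> real \<Rightarrow> ltl \<Rightarrow> bool" where
  "sat \<sigma> \<tau> TrueF \<longleftrightarrow> True"
| "sat \<sigma> \<tau> (Zone z) \<longleftrightarrow> \<sigma> \<tau> \<in> zone_set z"
| "sat \<sigma> \<tau> (Neg \<phi>) \<longleftrightarrow> \<not> sat \<sigma> \<tau> \<phi>"
| "sat \<sigma> \<tau> (Conj \<phi> \<psi>) \<longleftrightarrow> sat \<sigma> \<tau> \<phi> \<and> sat \<sigma> \<tau> \<psi>"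
| "sat \<sigma> \<tau> (Disj \<phi> \<psi>) \<longleftrightarrow> sat \<sigma> \<tau> \<phi> \<or> sat \<sigma> \<tau> \<psi>"
| "sat \<sigma> \<tau> (Finally \<phi>) \<longleftrightarrow> (\<exists>\<tau>'\<ge>\<tau>. sat \<sigma> \<tau>' \<phi>)"
| "sat \<sigma> \<tau> (Globally \<phi>) \<longleftrightarrow> (\<forall>\<tau>'\<ge>\<tau>. sat \<sigma> \<tau>' \<phi>)"
| "sat \<sigma> \<tau> (Until \<phi> \<psi>) \<longleftrightarrow>
     (\<exists>\<tau>'\<ge>\<tau>. sat \<sigma> \<tau>' \<psi> \<and> (\<forall>\<tau>''\<in>{\<tau>..<\<tau>'}. sat \<sigma> \<tau>'' \<phi>))"

definition models :: "real vec set \<Rightarrow> real vec \<Rightarrow> ltl \<Rightarrow> bool" where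
  "models M x \<phi> \<longleftrightarrow>
     (\<exists>\<pi> \<sigma>. is_schedule M \<pi> \<and> non_Zeno \<pi> \<and> induces x \<pi> \<sigma> \<and> sat \<sigma> 0 \<phi>)"

datatype ltl_op = Op_Neg | Op_Conj | Op_Disj | Op_F | Op_G | Op_U

fun ops :: "ltl \<Rightarrow> ltl_op set" where
  "ops TrueF = {}"
| "ops (Zone z) = {}"
| "ops (Neg \<phi>) = {Op_Neg} \<union> ops \<phi>"
| "ops (Conj \<phi> \<psi>) = {Op_Conj} \<union> ops \<phi> \<union> ops \<psi>"
| "ops (Disj \<phi> \<psi>) = {Op_Disj} \<union> ops \<phi> \<union> ops \<psi>"
| "ops (Finally \<phi>) = {Op_F} \<union> ops \<phi>"
| "ops (Globally \<phi>) = {Op_G} \<union> ops \<phi>"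
| "ops (Until \<phi> \<psi>) = {Op_U} \<union> ops \<phi> \<union> ops \<psi>"

fun zones :: "ltl \<Rightarrow> zone set" where
  "zones TrueF = {}"
| "zones (Zone z) = {z}"
| "zones (Neg \<phi>) = zones \<phi>"
| "zones (Conj \<phi> \<psi>) = zones \<phi> \<union> zones \<psi>"
| "zones (Disj \<phi> \<psi>) = zones \<phi> \<union> zones \<psi>"
| "zones (Finally \<phi>) = zones \<phi>"
| "zones (Globally \<phi>) = zones \<phi>"
| "zones (Until \<phi> \<psi>) = zones \<phi> \<union> zones \<psi>"

definition LTL_B :: "nat \<Rightarrow> ltl_op set \<Rightarrow> ltl set" where
  "LTL_B d X = {\<phi>. ops \<phi> \<subseteq> X \<and> (\<forall>z\<in>zones \<phi>. is_zone d z \<and> bounded_zone z)}"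


section \<open>The class NP\<close>

text \<open>Nondeterministic Turing machines with finitely many two-way infinite tapes. States and
  auxiliary tape symbols are numbered; since the transition table is finite, only finitely many
  of them occur in a machine. A transition \<open>(q, rs, q', as)\<close> is enabled in state \<open>q\<close> when the heads
  read \<open>rs\<close>, and on every tape it writes a symbol and then moves the head.\<close>

datatype 'a cell = Blank | Input 'a | Aux nat

datatype move = Go_Left | Stay | Go_Right

type_synonym 'a tape = "(int \<Rightarrow> 'a cell) \<times> int"

record 'a ntm =
  tape_count :: nat
  start_state :: nat
  accept_state :: nat
  transitions :: "(nat \<times> 'a cell list \<times> nat \<times> ('a cell \<times> move) list) set"

definition is_ntm :: "'a ntm \<Rightarrow> bool" where
  "is_ntm T \<longleftrightarrow> tape_count T \<ge> 1 \<and> finite (transitions T) \<and>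
     (\<forall>(q, rs, q', as)\<in>transitions T.
        length rs = tape_count T \<and> length as = tape_count T)"

fun offset :: "move \<Rightarrow> int" where
  "offset Go_Left = -1"
| "offset Stay = 0"
| "offset Go_Right = 1"

definition read_tape :: "'a tape \<Rightarrow> 'a cell" where
  "read_tape t = fst t (snd t)"

definition act_tape :: "'a cell \<times> move \<Rightarrow> 'a tape \<Rightarrow> 'a tape" where
  "act_tape a t = ((fst t)(snd t := fst a), snd t + offset (snd a))"

type_synonym 'a config = "nat \<times> 'a tape list"

definition step :: "'a ntm \<Rightarrow> 'a config \<Rightarrow> 'a config \<Rightarrow> bool" where
  "step T c c' \<longleftrightarrow> (\<exists>as. (fst c, map read_tape (snd c), fst c', as) \<in> transitions T \<and>
     snd c' = map2 act_tape as (snd c))"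

definition blank_tape :: "'a tape" where
  "blank_tape = (\<lambda>_. Blank, 0)"

definition input_tape :: "'a list \<Rightarrow> 'a tape" where
  "input_tape w = (\<lambda>i. if 0 \<le> i \<and> i < int (length w) then Input (w ! nat i) else Blank, 0)"

definition init_config :: "'a ntm \<Rightarrow> 'a list \<Rightarrow> 'a config" where
  "init_config T w = (start_state T, input_tape w # replicate (tape_count T - 1) blank_tape)"

definition accepts_in :: "'a ntm \<Rightarrow> 'a list \<Rightarrow> nat \<Rightarrow> bool" where
  "accepts_in T w n \<longleftrightarrow>
     (\<exists>c. (step T ^^ n) (init_config T w) c \<and> fst c = accept_state T)"

definition ntm_language :: "'a ntm \<Rightarrow> 'a list set" where
  "ntm_language T = {w. \<exists>n. accepts_in T w n}"

text \<open>The running time on an accepted word is that of a shortest accepting computation, as in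
  Aho, Hopcroft and Ullman (1974) and Garey and Johnson (1979).\<close>

definition in_NP :: "'a::finite list set \<Rightarrow> bool" where
  "in_NP L \<longleftrightarrow> (\<exists>(T :: 'a ntm) (p :: nat poly). is_ntm T \<and> ntm_language T = L \<and>
     (\<forall>w\<in>L. \<exists>n\<le>poly p (length w). accepts_in T w n))"


section \<open>The model-checking problem as a formal language\<close>

text \<open>Modes and points in the input have rational entries, given as fractions that need not be
  in lowest terms. All numbers are written in binary, least significant digit first.\<close>

type_synonym frac = "int \<times> nat"

definition frac_vec :: "nat \<Rightarrow> frac vec \<Rightarrow> bool" where
  "frac_vec d v \<longleftrightarrow> v \<in> carrier_vec d \<and> (\<forall>i<d. snd (v $ i) > 0)"

definition val_vec :: "frac vec \<Rightarrow> real vec" where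
  "val_vec = map_vec (\<lambda>(p, q). real_of_int p / real q)"

datatype letter =
    L_0 | L_1 | L_Plus | L_Minus | L_Item | L_End
  | L_True | L_Zone | L_Neg | L_Conj | L_Disj | L_F | L_G | L_U

instance letter :: finite
proof
  have "(UNIV :: letter set) \<subseteq> {L_0, L_1, L_Plus, L_Minus, L_Item, L_End,
      L_True, L_Zone, L_Neg, L_Conj, L_Disj, L_F, L_G, L_U}"
    using letter.exhaust by blast
  then show "finite (UNIV :: letter set)"
    by (rule finite_subset) simp
qed

fun bits :: "nat \<Rightarrow> letter list" where
  "bits n = (if n = 0 then [] else (if odd n then L_1 else L_0) # bits (n div 2))"

declare bits.simps [simp del]

definition enc_nat :: "nat \<Rightarrow> letter list" where
  "enc_nat n = bits n @ [L_End]"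

definition enc_int :: "int \<Rightarrow> letter list" where
  "enc_int z = (if z < 0 then L_Minus else L_Plus) # enc_nat (nat \<bar>z\<bar>)"

definition enc_frac :: "frac \<Rightarrow> letter list" where
  "enc_frac r = enc_int (fst r) @ enc_nat (snd r)"

definition enc_list :: "('b \<Rightarrow> letter list) \<Rightarrow> 'b list \<Rightarrow> letter list" where
  "enc_list e xs = concat (map (\<lambda>x. L_Item # e x) xs) @ [L_End]"

definition enc_zone :: "zone \<Rightarrow> letter list" where
  "enc_zone z = enc_list (enc_list enc_int) (mat_to_list (fst z))
     @ enc_list enc_int (list_of_vec (snd z))"

fun enc_ltl :: "ltl \<Rightarrow> letter list" where
  "enc_ltl TrueF = [L_True]"
| "enc_ltl (Zone z) = L_Zone # enc_zone z"
| "enc_ltl (Neg \<phi>) = L_Neg # enc_ltl \<phi>"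
| "enc_ltl (Conj \<phi> \<psi>) = L_Conj # enc_ltl \<phi> @ enc_ltl \<psi>"
| "enc_ltl (Disj \<phi> \<psi>) = L_Disj # enc_ltl \<phi> @ enc_ltl \<psi>"
| "enc_ltl (Finally \<phi>) = L_F # enc_ltl \<phi>"
| "enc_ltl (Globally \<phi>) = L_G # enc_ltl \<phi>"
| "enc_ltl (Until \<phi> \<psi>) = L_U # enc_ltl \<phi> @ enc_ltl \<psi>"

definition enc_instance :: "frac vec list \<Rightarrow> frac vec \<Rightarrow> ltl \<Rightarrow> letter list" where
  "enc_instance ms x \<phi> =
     enc_list (enc_list enc_frac) (map list_of_vec ms) @ enc_list enc_frac (list_of_vec x)
     @ enc_ltl \<phi>"

text \<open>The dimension is recovered from the encoded point. A word that does not encode an instance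
  of the fragment (in particular one with an unbounded zone) is not in the language.\<close>

definition model_checking :: "ltl_op set \<Rightarrow> letter list set" where
  "model_checking X = {enc_instance ms x \<phi> | d ms x \<phi>.
     (\<forall>m\<in>set ms. frac_vec d m) \<and> is_mms d (val_vec ` set ms) \<and> frac_vec d x \<and>
     \<phi> \<in> LTL_B d X \<and> models (val_vec ` set ms) (val_vec x) \<phi>}"

end

theory Submission
  imports Defs "Jordan_Normal_Form.Determinant"
begin

text \<open>A formula of the fragment holds along an execution because of its behaviour at a few witness times,
  at most one for every \<open>F\<close>. Between two consecutive witness times only the total time spent in each
  mode matters for the endpoint, so that this part of the execution can be replaced by one pass
  through the list of modes. Hence the formula holds at vertices of a polygon with polynomially many
  edges; conversely, a polygon extends to an execution with any mode after its last vertex. Given which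
  vertices have to lie in which zones, the lengths of the edges solve a system of linear inequalities,
  and by Cramer's rule some solution has numerators and a common denominator of polynomially many
  digits. The boundedness of the zones, which is part of the problem, is certified by Farkas' lemma.

  The verification of such certificates is expressed by the rules of a logic program whose predicates
  are relations between words. Soundness means that the rules preserve the intended relations, and
  completeness that every instance in the language has a derivation with polynomially many steps and
  polynomially long words. A nondeterministic machine finds such a derivation: it keeps the list of
  goals on one stack, guesses a rule and the values of its variables, and matches the first goal.\<close>

section \<open>Programs on stacks\<close>

text \<open>No Turing machine for this problem is written down by hand: everything specific to it
  sits in a finite list of rules, and one generic compiler serves them. Three constraints shape the
  rules. A machine can only guess and compare, so division, subtraction and inequalities become
  guessed words that are checked by addition and multiplication. Rules are local, and several of
  them accept an argument without testing it; the relation meant by such a predicate is an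
  implication, whose premise is supplied only by the rule for \<open>PTop\<close>. The dimension
  travels as a zero vector handed to \<open>PModes\<close>, \<open>PZoneOK\<close> and
  \<open>PSat\<close>, since a zone without rows or a formula without zones does not display it.
  Small numbers are needed twice: for the step lengths, whose linear system has a block of
  inequalities for each vertex and each zone containing it, and for the Farkas multipliers of the
  zones; both come from the same \<open>solution_bound\<close>.\<close>

datatype 'c instr = Push nat 'c | Pop nat 'c | Empty nat | Loop "'c instr list list"

type_synonym 'c stacks = "nat \<Rightarrow> 'c list"

text \<open>\<open>Loop ps\<close> is the Kleene star of the choice between its bodies, so programs
  are regular expressions over stack operations, and loops are the only source of nondeterminism.
  The number counts executed instructions, loop exits included. A failing \<open>Pop\<close> or
  \<open>Empty\<close> blocks the run, so a run exists only if the whole program is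
  consumed.\<close>

inductive run :: "nat \<Rightarrow> 'c instr list \<Rightarrow> 'c stacks \<Rightarrow> 'c stacks \<Rightarrow> bool" where
  run_Nil: "run 0 [] s s"
| run_Push: "run n p (s(k := c # s k)) s' \<Longrightarrow> run (Suc n) (Push k c # p) s s'"
| run_Pop: "s k = c # w \<Longrightarrow> run n p (s(k := w)) s' \<Longrightarrow> run (Suc n) (Pop k c # p) s s'"
| run_Empty: "s k = [] \<Longrightarrow> run n p s s' \<Longrightarrow> run (Suc n) (Empty k # p) s s'"
| run_exit: "run n p s s' \<Longrightarrow> run (Suc n) (Loop ps # p) s s'"
| run_iter: "q \<in> set ps \<Longrightarrow> run n (q @ Loop ps # p) s s' \<Longrightarrow> run (Suc n) (Loop ps # p) s s'"

inductive_simps run_Nil_iff: "run n [] s s'"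
inductive_simps run_Push_iff: "run n (Push k c # p) s s'"
inductive_simps run_Pop_iff: "run n (Pop k c # p) s s'"
inductive_simps run_Empty_iff: "run n (Empty k # p) s s'"
inductive_simps run_Loop_iff: "run n (Loop ps # p) s s'"

text \<open>These are the partial derivatives of the regular expression: everything that can remain
  to be executed. They are finitely many and become the control states of the machine.\<close>

fun residuals :: "'c instr list \<Rightarrow> 'c instr list set" where
  "residuals [] = {[]}"
| "residuals (Loop ps # p) = insert (Loop ps # p) (residuals p \<union>
     (\<Union>q\<in>set ps. (\<lambda>x. x @ Loop ps # p) ` residuals q))"
| "residuals (i # p) = insert (i # p) (residuals p)"

lemma finite_residuals: "finite (residuals p)"
  by (induction p rule: residuals.induct) auto

lemma self_in_residuals: "p \<in> residuals p"
  by (cases p rule: residuals.cases) auto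

lemma Nil_in_residuals: "[] \<in> residuals p"
  by (induction p rule: residuals.induct) auto

fun successors :: "'c instr list \<Rightarrow> 'c instr list set" where
  "successors [] = {}"
| "successors (Loop ps # p) = insert p ((\<lambda>q. q @ Loop ps # p) ` set ps)"
| "successors (i # p) = {p}"

lemma successors_append:
  "x \<noteq> [] \<Longrightarrow> successors (x @ y) = (\<lambda>z. z @ y) ` successors x"
  by (cases x rule: successors.cases) auto

text \<open>A loop body that has been entered is followed by the loop itself, and the last component
  of \<open>residuals\<close> consists of exactly such concatenations. Hence control never leaves
  the finite set.\<close>

lemma residuals_closed: "c \<in> residuals p \<Longrightarrow> successors c \<subseteq> residuals p"
proof (induction p arbitrary: c rule: residuals.induct)
  case (2 ps p)
  have loop: "successors (Loop ps # p) \<subseteq> residuals (Loop ps # p)"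
    using self_in_residuals by fastforce
  consider "c = Loop ps # p" | "c \<in> residuals p"
    | q x where "q \<in> set ps" "x \<in> residuals q" "c = x @ Loop ps # p"
    using 2(3) by auto
  then show ?case
  proof cases
    case 3
    show ?thesis
    proof (cases "x = []")
      case False
      then have "successors c = (\<lambda>z. z @ Loop ps # p) ` successors x"
        using 3 by (simp add: successors_append)
      then show ?thesis using 2(2)[OF 3(1,2)] 3(1) by auto
    qed (use loop 3 in simp)
  qed (use loop 2(1) in auto)
qed (auto simp: self_in_residuals)

fun uses :: "nat \<Rightarrow> 'c set \<Rightarrow> 'c instr list \<Rightarrow> bool" where
  "uses k S [] \<longleftrightarrow> True"
| "uses k S (Push i c # p) \<longleftrightarrow> i < k \<and> c \<in> S \<and> uses k S p"
| "uses k S (Pop i c # p) \<longleftrightarrow> i < k \<and> c \<in> S \<and> uses k S p"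
| "uses k S (Empty i # p) \<longleftrightarrow> i < k \<and> uses k S p"
| "uses k S (Loop ps # p) \<longleftrightarrow> (\<forall>q\<in>set ps. uses k S q) \<and> uses k S p"

lemma uses_append [simp]: "uses k S (p @ q) \<longleftrightarrow> uses k S p \<and> uses k S q"
  by (induction p rule: uses.induct) auto

lemma uses_concat [simp]: "uses k S (concat ps) \<longleftrightarrow> (\<forall>p\<in>set ps. uses k S p)"
  by (induction ps) auto

lemma uses_residuals: "uses k S p \<Longrightarrow> c \<in> residuals p \<Longrightarrow> uses k S c"
proof (induction p arbitrary: c rule: residuals.induct)
  case 1
  then show ?case by (metis residuals.simps(1) singletonD)
next
  case (2 ps p)
  consider "c = Loop ps # p" | "c \<in> residuals p"
    | q x where "q \<in> set ps" "x \<in> residuals q" "c = x @ Loop ps # p"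
    using 2(4) unfolding residuals.simps by blast
  moreover have "\<forall>q\<in>set ps. uses k S q" "uses k S p" using 2(3) uses.simps(5) by blast+
  ultimately show ?case
    using 2(1) 2(2) 2(3) by (metis uses_append)
next
  case ("3_1" i a p)
  then show ?case by (metis insertE residuals.simps(3) uses.simps(2))
next
  case ("3_2" i a p)
  then show ?case by (metis insertE residuals.simps(4) uses.simps(3))
next
  case ("3_3" i p)
  then show ?case by (metis insertE residuals.simps(5) uses.simps(4))
qed

section \<open>Turing machines for programs\<close>

text \<open>The stack grows to the left and the head rests on its top; all other cells are blank. An
  empty stack therefore shows \<open>Blank\<close>, and emptiness can be tested as long as
  \<open>Blank\<close> is not a stack letter.\<close>

definition stack_tape :: "int \<Rightarrow> 'a cell list \<Rightarrow> 'a tape" where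
  "stack_tape h w = ((\<lambda>i. if h \<le> i \<and> i < h + int (length w) then w ! nat (i - h) else Blank), h)"

definition top_cell :: "'a cell list \<Rightarrow> 'a cell" where
  "top_cell w = (case w of [] \<Rightarrow> Blank | c # _ \<Rightarrow> c)"

lemma read_stack_tape [simp]: "read_tape (stack_tape h w) = top_cell w"
  by (simp add: read_tape_def stack_tape_def top_cell_def split: list.split)

lemma act_stay [simp]: "act_tape (read_tape t, Stay) t = t"
  by (simp add: act_tape_def read_tape_def)

text \<open>A transition writes before it moves. So the first action rewrites the old top and goes
  left, and only the second can write the new letter.\<close>

lemma act_stack_tape_push:
  "act_tape (c, Stay) (act_tape (top_cell w, Go_Left) (stack_tape h w)) = stack_tape (h - 1) (c # w)"
proof -
  have "act_tape (top_cell w, Go_Left) (stack_tape h w) = (fst (stack_tape h w), h - 1)"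
    by (cases w) (auto simp: act_tape_def stack_tape_def top_cell_def fun_eq_iff)
  moreover have "(fst (stack_tape h w))(h - 1 := c) = fst (stack_tape (h - 1) (c # w))"
  proof
    fix i
    have "nat (i - (h - 1)) = Suc (nat (i - h))" if "i \<ge> h" using that by simp
    then show "((fst (stack_tape h w))(h - 1 := c)) i = fst (stack_tape (h - 1) (c # w)) i"
      by (cases "i \<ge> h") (auto simp: stack_tape_def)
  qed
  ultimately show ?thesis by (simp add: act_tape_def stack_tape_def)
qed

lemma act_stack_tape_pop:
  "act_tape (Blank, Go_Right) (stack_tape h (c # w)) = stack_tape (h + 1) w"
proof -
  have "(fst (stack_tape h (c # w)))(h := Blank) = fst (stack_tape (h + 1) w)"
  proof
    fix i
    have "nat (i - h) = Suc (nat (i - (h + 1)))" if "i \<ge> h + 1" using that by simp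
    then show "((fst (stack_tape h (c # w)))(h := Blank)) i = fst (stack_tape (h + 1) w) i"
      by (cases "i \<ge> h + 1") (auto simp: stack_tape_def)
  qed
  then show ?thesis by (simp add: act_tape_def stack_tape_def)
qed

text \<open>The position \<open>h\<close> is quantified away because the heads drift as the stacks
  grow and shrink.\<close>

definition represents :: "nat \<Rightarrow> 'a tape list \<Rightarrow> 'a cell stacks \<Rightarrow> bool" where
  "represents k ts s \<longleftrightarrow> length ts = k \<and> (\<forall>i<k. \<exists>h. ts ! i = stack_tape h (s i))"

definition stay_all :: "'a cell list \<Rightarrow> ('a cell \<times> move) list" where
  "stay_all rs = map (\<lambda>c. (c, Stay)) rs"

text \<open>A push takes two steps; the flag marks the configuration between them.\<close>

inductive trans_rel :: "bool \<times> 'a cell instr list \<Rightarrow> 'a cell list \<Rightarrow>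
    bool \<times> 'a cell instr list \<Rightarrow> ('a cell \<times> move) list \<Rightarrow> bool" where
  tr_left: "trans_rel (False, Push i c # p) rs (True, Push i c # p) ((stay_all rs)[i := (rs ! i, Go_Left)])"
| tr_write: "trans_rel (True, Push i c # p) rs (False, p) ((stay_all rs)[i := (c, Stay)])"
| tr_pop: "rs ! i = c \<Longrightarrow> trans_rel (False, Pop i c # p) rs (False, p) ((stay_all rs)[i := (Blank, Go_Right)])"
| tr_empty: "rs ! i = Blank \<Longrightarrow> trans_rel (False, Empty i # p) rs (False, p) (stay_all rs)"
| tr_exit: "trans_rel (False, Loop ps # p) rs (False, p) (stay_all rs)"
| tr_iter: "q \<in> set ps \<Longrightarrow> trans_rel (False, Loop ps # p) rs (False, q @ Loop ps # p) (stay_all rs)"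

lemma length_stay_all [simp]: "length (stay_all rs) = length rs"
  by (simp add: stay_all_def)

lemma map2_stay_all:
  assumes "length ts = k" "i < k"
  shows "map2 act_tape ((stay_all (map read_tape ts))[i := a]) ts = ts[i := act_tape a (ts ! i)]"
  using assms by (intro nth_equalityI) (auto simp: stay_all_def nth_list_update)

lemma map2_stay_all': "map2 act_tape (stay_all (map read_tape ts)) ts = ts"
  by (intro nth_equalityI) (auto simp: stay_all_def)

lemma represents_update:
  "represents k ts s \<Longrightarrow> i < k \<Longrightarrow> represents k (ts[i := stack_tape h w]) (s(i := w))"
  by (auto simp: represents_def nth_list_update)

context
  fixes k :: nat and S :: "'a cell set" and p0 :: "'a cell instr list"
    and f :: "bool \<times> 'a cell instr list \<Rightarrow> nat"
  assumes finS: "finite S" and blank: "Blank \<notin> S" and uses0: "uses k S p0" and k1: "k \<ge> 1"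
    and inj: "inj_on f (UNIV \<times> residuals p0)"
begin

text \<open>Restricting all symbols to \<open>insert Blank S\<close> makes the table finite, and it
  obliges the simulation to show that every cell read lies in this set.\<close>

definition machine :: "'a ntm" where
  "machine = \<lparr>tape_count = k, start_state = f (False, p0), accept_state = f (False, []),
     transitions = {(f l, rs, f l', as) | l rs l' as. l \<in> UNIV \<times> residuals p0 \<and> l' \<in> UNIV \<times> residuals p0 \<and>
        length rs = k \<and> set rs \<subseteq> insert Blank S \<and> length as = k \<and> set as \<subseteq> insert Blank S \<times> UNIV \<and>
        trans_rel l rs l' as}\<rparr>"

lemma UNIV_move: "UNIV = {Go_Left, Stay, Go_Right}"
  using move.exhaust by auto

lemma is_ntm_machine: "is_ntm machine"
proof -
  let ?L = "UNIV \<times> residuals p0 :: (bool \<times> _) set"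
  let ?A = "{rs. set rs \<subseteq> insert Blank S \<and> length rs = k}"
  let ?B = "{as. set as \<subseteq> insert Blank S \<times> (UNIV :: move set) \<and> length as = k}"
  have "finite (UNIV :: move set)" by (simp add: UNIV_move)
  then have "finite (f ` ?L \<times> ?A \<times> f ` ?L \<times> ?B)"
    using finS finite_residuals[of p0] by (intro finite_cartesian_product finite_imageI finite_lists_length_eq) auto
  moreover have "transitions machine \<subseteq> f ` ?L \<times> ?A \<times> f ` ?L \<times> ?B"
    by (auto simp: machine_def)
  ultimately have "finite (transitions machine)" by (rule rev_finite_subset)
  then show ?thesis using k1 by (auto simp: is_ntm_def machine_def)
qed

definition clean :: "'a cell stacks \<Rightarrow> bool" where
  "clean s \<longleftrightarrow> (\<forall>i<k. set (s i) \<subseteq> S)"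

text \<open>The second alternative is the configuration halfway through a push: head
  \<open>i\<close> has already moved left, while \<open>p\<close> and \<open>s\<close> still
  describe the situation before the push.\<close>

definition conf :: "'a config \<Rightarrow> 'a cell instr list \<Rightarrow> 'a cell stacks \<Rightarrow> bool" where
  "conf c p s \<longleftrightarrow> p \<in> residuals p0 \<and> clean s \<and>
     ((fst c = f (False, p) \<and> represents k (snd c) s) \<or>
      (\<exists>i a q ts. p = Push i a # q \<and> i < k \<and> fst c = f (True, p) \<and> represents k ts s \<and>
          snd c = ts[i := act_tape (top_cell (s i), Go_Left) (ts ! i)]))"

lemma top_cell_in: "clean s \<Longrightarrow> i < k \<Longrightarrow> top_cell (s i) \<in> insert Blank S"
  unfolding clean_def top_cell_def by (cases "s i"; force)

lemma represents_read: "represents k ts s \<Longrightarrow> i < k \<Longrightarrow> read_tape (ts ! i) = top_cell (s i)"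
  unfolding represents_def by (metis read_stack_tape)

text \<open>States are numbers, and a number may occur in many entries of the table; injectivity of
  \<open>f\<close> is what recovers the residual program from it.\<close>

lemma step_machine_iff:
  assumes "l \<in> UNIV \<times> residuals p0" "length ts = k" "set (map read_tape ts) \<subseteq> insert Blank S"
  shows "step machine (f l, ts) c' \<longleftrightarrow> (\<exists>l' as. c' = (f l', map2 act_tape as ts) \<and> l' \<in> UNIV \<times> residuals p0 \<and>
     length as = k \<and> set as \<subseteq> insert Blank S \<times> UNIV \<and> trans_rel l (map read_tape ts) l' as)"
    (is "?l \<longleftrightarrow> ?r")
proof
  assume ?l
  then obtain as where as: "(f l, map read_tape ts, fst c', as) \<in> transitions machine"
    "snd c' = map2 act_tape as ts" by (auto simp: step_def)
  then obtain l2 l' where l2: "f l2 = f l" "fst c' = f l'" "l2 \<in> UNIV \<times> residuals p0" "l' \<in> UNIV \<times> residuals p0"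
     "length as = k" "set as \<subseteq> insert Blank S \<times> UNIV" "trans_rel l2 (map read_tape ts) l' as"
    by (auto simp: machine_def)
  then have "l2 = l" using inj assms(1) by (meson inj_onD)
  with l2 as show ?r
    by (intro exI[of _ l'] exI[of _ as] conjI) (simp_all add: prod_eq_iff)
next
  assume ?r
  then show ?l using assms unfolding step_def machine_def by fastforce
qed

lemma set_stay_all_update:
  "set rs \<subseteq> insert Blank S \<Longrightarrow> a \<in> insert Blank S \<Longrightarrow> set ((stay_all rs)[i := (a, m)]) \<subseteq> insert Blank S \<times> UNIV"
  by (rule order_trans[OF set_update_subset_insert]) (auto simp: stay_all_def)

text \<open>A backward simulation: whatever run is possible after the step extends to a run before
  it. The first half of a push leaves \<open>p\<close> and \<open>s\<close> unchanged, which is why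
  the lengths of the runs are not related here.\<close>

lemma step_sound:
  assumes c: "conf c p s" and st: "step machine c c'"
  shows "\<exists>p' s'. conf c' p' s' \<and> (\<forall>n r. run n p' s' r \<longrightarrow> (\<exists>m. run m p s r))"
proof -
  have p: "p \<in> residuals p0" and cl: "clean s" using c by (auto simp: conf_def)
  have up: "uses k S p" using uses_residuals[OF uses0 p] .
  consider (main) ts where "c = (f (False, p), ts)" "represents k ts s"
    | (mid) i a q ts where "p = Push i a # q" "i < k" "represents k ts s"
       "c = (f (True, p), ts[i := act_tape (top_cell (s i), Go_Left) (ts ! i)])"
    using c by (cases c) (auto simp: conf_def)
  then show ?thesis
  proof cases
    case main
    have len: "length ts = k" using main by (simp add: represents_def)
    have rd: "map read_tape ts ! i = top_cell (s i)" if "i < k" for i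
      using represents_read[OF main(2) that] len that by simp
    have rs: "set (map read_tape ts) \<subseteq> insert Blank S"
      using rd top_cell_in[OF cl] len by (metis in_set_conv_nth length_map subsetI)
    have pl: "(False, p) \<in> UNIV \<times> residuals p0" using p by simp
    obtain l' as where l': "c' = (f l', map2 act_tape as ts)" "l' \<in> UNIV \<times> residuals p0"
      "trans_rel (False, p) (map read_tape ts) l' as"
      using st step_machine_iff[OF pl len rs] unfolding main(1) by blast
    from l'(3) show ?thesis
    proof cases
      case (tr_left i x q)
      then have i: "i < k" using up by auto
      have "conf c' p s"
        using main i cl p l' tr_left map2_stay_all[OF len i] rd[OF i] by (auto simp: conf_def)
      then show ?thesis by blast
    next
      case (tr_pop i x q)
      then have i: "i < k" and x: "x \<in> S" using up by auto
      have "top_cell (s i) = x" using tr_pop rd[OF i] by simp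
      then obtain w where w: "s i = x # w" using x blank by (auto simp: top_cell_def split: list.splits)
      obtain h where h: "ts ! i = stack_tape h (s i)" using main(2) i by (auto simp: represents_def)
      have "represents k (map2 act_tape as ts) (s(i := w))"
        using represents_update[OF main(2) i] tr_pop(3) map2_stay_all[OF len i] h w by (simp add: act_stack_tape_pop)
      moreover have "clean (s(i := w))" using cl w i unfolding clean_def by (metis fun_upd_apply set_subset_Cons subset_trans)
      ultimately have "conf c' q (s(i := w))" using l' tr_pop by (auto simp: conf_def)
      moreover have "run (Suc n) p s r" if "run n q (s(i := w)) r" for n r
        using run_Pop[of s i x w n q r] w that tr_pop by simp
      ultimately show ?thesis by blast
    next
      case (tr_empty i q)
      then have i: "i < k" using up by auto
      have "s i = []" using tr_empty rd[OF i] blank cl i by (auto simp: top_cell_def clean_def split: list.splits)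
      moreover have "conf c' q s" using l' tr_empty main(2) cl map2_stay_all'[of ts] by (auto simp: conf_def)
      ultimately show ?thesis using tr_empty run_Empty[of s i _ q] by blast
    next
      case (tr_exit ps q)
      have "conf c' q s" using l' tr_exit main(2) cl map2_stay_all'[of ts] by (auto simp: conf_def)
      then show ?thesis using tr_exit run_exit by blast
    next
      case (tr_iter x ps q)
      have "conf c' (x @ Loop ps # q) s" using l' tr_iter main(2) cl map2_stay_all'[of ts] by (auto simp: conf_def)
      then show ?thesis using tr_iter run_iter by blast
    qed simp
  next
    case mid
    let ?ts = "ts[i := act_tape (top_cell (s i), Go_Left) (ts ! i)]"
    have a: "a \<in> S" using up mid by simp
    have "snd c' = map2 act_tape as ?ts" "fst c' = f (False, q)" "q \<in> residuals p0"
      "as = (stay_all (map read_tape ?ts))[i := (a, Stay)]"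
      if "(fst c, map read_tape (snd c), fst c', as) \<in> transitions machine" "snd c' = map2 act_tape as (snd c)" for as
    proof -
      from that(1) obtain l l' where l: "f l = f (True, p)" "fst c' = f l'" "l \<in> UNIV \<times> residuals p0" "l' \<in> UNIV \<times> residuals p0"
        "trans_rel l (map read_tape ?ts) l' as"
        using mid(4) by (auto simp: machine_def)
      have "l = (True, p)" by (rule inj_onD[OF inj l(1,3)]) (use p in simp)
      with l mid(1) have "l' = (False, q)" "as = (stay_all (map read_tape ?ts))[i := (a, Stay)]"
        by (auto elim: trans_rel.cases)
      then show "snd c' = map2 act_tape as ?ts" "fst c' = f (False, q)" "q \<in> residuals p0"
      "as = (stay_all (map read_tape ?ts))[i := (a, Stay)]" using l that mid(4) by auto
    qed
    then have c': "snd c' = map2 act_tape ((stay_all (map read_tape ?ts))[i := (a, Stay)]) ?ts" "fst c' = f (False, q)" "q \<in> residuals p0"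
      using st unfolding step_def by blast+
    obtain h where h: "ts ! i = stack_tape h (s i)" using mid by (auto simp: represents_def)
    have len: "length ts = k" using mid by (simp add: represents_def)
    have "snd c' = ts[i := stack_tape (h - 1) (a # s i)]"
      unfolding c'(1) using map2_stay_all[of ?ts k i] len mid(2) h by (simp add: act_stack_tape_push)
    then have "represents k (snd c') (s(i := a # s i))" using represents_update[OF mid(3,2)] by simp
    moreover have "clean (s(i := a # s i))" using cl a by (auto simp: clean_def)
    ultimately have "conf c' q (s(i := a # s i))" using c' by (simp add: conf_def)
    moreover have "run (Suc n) p s r" if "run n q (s(i := a # s i)) r" for n r
      using run_Push[OF that] mid(1) by simp
    ultimately show ?thesis by blast
  qed
qed

lemma steps_sound:
  assumes "(step machine ^^ n) c c'" "conf c p s" "fst c' = f (False, [])"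
  shows "\<exists>m s'. run m p s s'"
  using assms
proof (induction n arbitrary: c p s)
  case 0
  then have "f (False, []) \<in> {f (False, p), f (True, p)}" "p \<in> residuals p0"
    by (auto simp: conf_def)
  then have "p = []"
    using inj_onD[OF inj, of "(False, [])"] Nil_in_residuals[of p0] by auto
  then show ?case using run_Nil by blast
next
  case (Suc n)
  then obtain c1 where c1: "step machine c c1" "(step machine ^^ n) c1 c'"
    by (metis relpowp_Suc_D2)
  obtain p' s' where "conf c1 p' s'" "\<forall>n r. run n p' s' r \<longrightarrow> (\<exists>m. run m p s r)"
    using step_sound[OF Suc.prems(2) c1(1)] by blast
  then show ?case using Suc.IH[OF c1(2)] Suc.prems(3) by blast
qed

lemma step_complete:
  assumes "represents k ts s" "clean s" "p \<in> residuals p0" "trans_rel (False, p) (map read_tape ts) (b, p') as"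
    "p' \<in> residuals p0" "length as = k" "set as \<subseteq> insert Blank S \<times> UNIV"
  shows "step machine (f (False, p), ts) (f (b, p'), map2 act_tape as ts)"
proof -
  have len: "length ts = k" using assms by (simp add: represents_def)
  have "set (map read_tape ts) \<subseteq> insert Blank S"
    using represents_read[OF assms(1)] top_cell_in[OF assms(2)] len by (metis (no_types, lifting) in_set_conv_nth length_map nth_map subsetI)
  then show ?thesis using step_machine_iff[of "(False, p)" ts] len assms by auto
qed

lemma stay_step:
  assumes "represents k ts s" "clean s" "p \<in> residuals p0" "trans_rel (False, p) (map read_tape ts) (False, p') (stay_all (map read_tape ts))"
    "p' \<in> residuals p0"
  shows "step machine (f (False, p), ts) (f (False, p'), ts)"
proof -
  have len: "length ts = k" using assms by (simp add: represents_def)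
  have "set (map read_tape ts) \<subseteq> insert Blank S"
    using represents_read[OF assms(1)] top_cell_in[OF assms(2)] len by (metis (no_types, lifting) in_set_conv_nth length_map nth_map subsetI)
  then show ?thesis
    using step_complete[OF assms] len map2_stay_all'[of ts] by (auto simp: stay_all_def)
qed

text \<open>The factor 2 pays for the two transitions of a push; every other instruction takes
  one.\<close>

lemma run_complete:
  assumes "run n p s s'" "represents k ts s" "clean s" "p \<in> residuals p0"
  shows "\<exists>m\<le>2 * n. \<exists>ts'. (step machine ^^ m) (f (False, p), ts) (f (False, []), ts')"
  using assms
proof (induction arbitrary: ts rule: run.induct)
  case (run_Nil s)
  then show ?case by (intro exI[of _ 0]) auto
next
  case (run_Push n p s i c s')
  have up: "i < k" "c \<in> S" using uses_residuals[OF uses0 run_Push.prems(3)] by auto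
  have p: "p \<in> residuals p0" using residuals_closed[OF run_Push.prems(3)] by simp
  have len: "length ts = k" using run_Push.prems by (simp add: represents_def)
  obtain h where h: "ts ! i = stack_tape h (s i)" using run_Push.prems up by (auto simp: represents_def)
  have rs: "set (map read_tape ts) \<subseteq> insert Blank S"
    using represents_read[OF run_Push.prems(1)] top_cell_in[OF run_Push.prems(2)] len by (metis (no_types, lifting) in_set_conv_nth length_map nth_map subsetI)
  let ?ts = "ts[i := act_tape (top_cell (s i), Go_Left) (ts ! i)]"
  have "map2 act_tape ((stay_all (map read_tape ts))[i := (map read_tape ts ! i, Go_Left)]) ts = ?ts"
    using map2_stay_all[OF len up(1)] h len up by simp
  then have 1: "step machine (f (False, Push i c # p), ts) (f (True, Push i c # p), ?ts)"
    using step_complete[OF run_Push.prems tr_left run_Push.prems(3)] len up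
      set_stay_all_update[OF rs, of "map read_tape ts ! i" i Go_Left] rs
    by (simp add: stay_all_def subset_iff)
  \<comment> \<open>The table has no entries outside \<open>insert Blank S\<close>, so the second
    transition of the push needs to know that the cell left of the top holds a symbol of this set.
    It is shown for all cells of the tape.\<close>
  have "fst (stack_tape h (s i)) j \<in> insert Blank S" for j
  proof (cases "h \<le> j \<and> j < h + int (length (s i))")
    case True
    then have "nat (j - h) < length (s i)" by auto
    then have "s i ! nat (j - h) \<in> S"
      using run_Push.prems(2) up nth_mem unfolding clean_def by blast
    then show ?thesis using True by (simp add: stack_tape_def)
  qed (auto simp: stack_tape_def)
  then have "fst (act_tape (top_cell (s i), Go_Left) (ts ! i)) j \<in> insert Blank S" for j
    using h top_cell_in[OF run_Push.prems(2) up(1)] by (auto simp: act_tape_def)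
  then have "read_tape (act_tape (top_cell (s i), Go_Left) (ts ! i)) \<in> insert Blank S"
    unfolding read_tape_def by blast
  then have rs': "set (map read_tape ?ts) \<subseteq> insert Blank S"
    using rs set_update_subset_insert[of ts i] by fastforce
  have "step machine (f (True, Push i c # p), ?ts) (f (False, p), map2 act_tape ((stay_all (map read_tape ?ts))[i := (c, Stay)]) ?ts)"
    using run_Push.prems(3) p len set_stay_all_update[OF rs', of c i Stay] up tr_write[of i c p]
    by (subst step_machine_iff[OF _ _ rs'])
      (auto intro!: exI[of _ False] exI[of _ p] exI[of _ "(stay_all (map read_tape ?ts))[i := (c, Stay)]"])
  then have 2: "step machine (f (True, Push i c # p), ?ts) (f (False, p), ts[i := stack_tape (h - 1) (c # s i)])"
    using map2_stay_all[of ?ts k i] len up h by (simp add: act_stack_tape_push)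
  have "clean (s(i := c # s i))" using run_Push.prems(2) up by (auto simp: clean_def)
  then obtain m ts' where "m \<le> 2 * n" "(step machine ^^ m) (f (False, p), ts[i := stack_tape (h - 1) (c # s i)]) (f (False, []), ts')"
    using run_Push.IH[OF represents_update[OF run_Push.prems(1) up(1)] _ p] by blast
  then have "(step machine ^^ Suc (Suc m)) (f (False, Push i c # p), ts) (f (False, []), ts')"
    using 1 2 by (blast intro: relpowp_Suc_I2)
  then show ?case using \<open>m \<le> 2 * n\<close> by (intro exI[of _ "Suc (Suc m)"]) auto
next
  case (run_Pop s i c w n p s')
  have up: "i < k" "c \<in> S" using uses_residuals[OF uses0 run_Pop.prems(3)] by auto
  have p: "p \<in> residuals p0" using residuals_closed[OF run_Pop.prems(3)] by simp
  have len: "length ts = k" using run_Pop.prems by (simp add: represents_def)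
  obtain h where h: "ts ! i = stack_tape h (s i)" using run_Pop.prems up by (auto simp: represents_def)
  have rs: "set (map read_tape ts) \<subseteq> insert Blank S"
    using represents_read[OF run_Pop.prems(1)] top_cell_in[OF run_Pop.prems(2)] len by (metis (no_types, lifting) in_set_conv_nth length_map nth_map subsetI)
  have "map read_tape ts ! i = c" using len up h run_Pop(1) by (simp add: top_cell_def)
  then have "step machine (f (False, Pop i c # p), ts)
     (f (False, p), map2 act_tape ((stay_all (map read_tape ts))[i := (Blank, Go_Right)]) ts)"
    using len set_stay_all_update[OF rs, of Blank i Go_Right] p
    by (intro step_complete[OF run_Pop.prems tr_pop]) (auto simp: stay_all_def)
  then have 1: "step machine (f (False, Pop i c # p), ts) (f (False, p), ts[i := stack_tape (h + 1) w])"
    using map2_stay_all[OF len up(1)] h run_Pop(1) by (simp add: act_stack_tape_pop)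
  have "clean (s(i := w))" using run_Pop.prems(2) up run_Pop(1) unfolding clean_def by (metis fun_upd_apply set_subset_Cons subset_trans)
  then obtain m ts' where "m \<le> 2 * n" "(step machine ^^ m) (f (False, p), ts[i := stack_tape (h + 1) w]) (f (False, []), ts')"
    using run_Pop.IH[OF represents_update[OF run_Pop.prems(1) up(1)] _ p] by blast
  then have "(step machine ^^ Suc m) (f (False, Pop i c # p), ts) (f (False, []), ts')"
    using 1 by (blast intro: relpowp_Suc_I2)
  then show ?case using \<open>m \<le> 2 * n\<close> by (intro exI[of _ "Suc m"]) auto
next
  case (run_Empty s i n p s')
  have up: "i < k" using uses_residuals[OF uses0 run_Empty.prems(3)] by auto
  have p: "p \<in> residuals p0" using residuals_closed[OF run_Empty.prems(3)] by simp
  have rd: "map read_tape ts ! i = Blank"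
    using represents_read[OF run_Empty.prems(1) up] run_Empty.prems(1) up run_Empty(1) by (simp add: top_cell_def represents_def)
  have 1: "step machine (f (False, Empty i # p), ts) (f (False, p), ts)"
    using stay_step[OF run_Empty.prems tr_empty[OF rd] p] .
  obtain m ts' where "m \<le> 2 * n" "(step machine ^^ m) (f (False, p), ts) (f (False, []), ts')"
    using run_Empty.IH[OF run_Empty.prems(1,2) p] by blast
  then have "(step machine ^^ Suc m) (f (False, Empty i # p), ts) (f (False, []), ts')"
    using 1 by (blast intro: relpowp_Suc_I2)
  then show ?case using \<open>m \<le> 2 * n\<close> by (intro exI[of _ "Suc m"]) auto
next
  case (run_exit n p s s' ps)
  have p: "p \<in> residuals p0" using residuals_closed[OF run_exit.prems(3)] by simp
  have 1: "step machine (f (False, Loop ps # p), ts) (f (False, p), ts)"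
    using stay_step[OF run_exit.prems tr_exit p] .
  obtain m ts' where "m \<le> 2 * n" "(step machine ^^ m) (f (False, p), ts) (f (False, []), ts')"
    using run_exit.IH[OF run_exit.prems(1,2) p] by blast
  then have "(step machine ^^ Suc m) (f (False, Loop ps # p), ts) (f (False, []), ts')"
    using 1 by (blast intro: relpowp_Suc_I2)
  then show ?case using \<open>m \<le> 2 * n\<close> by (intro exI[of _ "Suc m"]) auto
next
  case (run_iter q ps n p s s')
  have p: "q @ Loop ps # p \<in> residuals p0" using residuals_closed[OF run_iter.prems(3)] run_iter(1) by auto
  have 1: "step machine (f (False, Loop ps # p), ts) (f (False, q @ Loop ps # p), ts)"
    using stay_step[OF run_iter.prems tr_iter[OF run_iter(1)] p] .
  obtain m ts' where "m \<le> 2 * n" "(step machine ^^ m) (f (False, q @ Loop ps # p), ts) (f (False, []), ts')"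
    using run_iter.IH[OF run_iter.prems(1,2) p] by blast
  then have "(step machine ^^ Suc m) (f (False, Loop ps # p), ts) (f (False, []), ts')"
    using 1 by (blast intro: relpowp_Suc_I2)
  then show ?case using \<open>m \<le> 2 * n\<close> by (intro exI[of _ "Suc m"]) auto
qed

lemma accepts_machine:
  "accepts_in machine w n \<Longrightarrow> Input ` UNIV \<subseteq> S \<Longrightarrow> \<exists>m s'. run m p0 ((\<lambda>_. [])(0 := map Input w)) s'"
  "run m p0 ((\<lambda>_. [])(0 := map Input w)) s' \<Longrightarrow> Input ` UNIV \<subseteq> S \<Longrightarrow> \<exists>n\<le>2 * m. accepts_in machine w n"
proof -
  let ?s = "(\<lambda>_. [])(0 := map Input w)"
  have in0: "input_tape w = stack_tape 0 (map Input w)"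
    by (auto simp: input_tape_def stack_tape_def fun_eq_iff)
  have bl: "blank_tape = stack_tape 0 []" by (auto simp: blank_tape_def stack_tape_def fun_eq_iff)
  have init: "init_config machine w = (f (False, p0), input_tape w # replicate (k - 1) blank_tape)"
    by (simp add: init_config_def machine_def)
  have rep: "represents k (input_tape w # replicate (k - 1) blank_tape) ?s"
    unfolding represents_def using k1 in0 bl by (auto simp: nth_Cons')
  have acc: "accept_state machine = f (False, [])" by (simp add: machine_def)
  have cl: "clean ?s" if "Input ` UNIV \<subseteq> S" using that by (auto simp: clean_def)
  show "\<exists>m s'. run m p0 ?s s'" if acc_n: "accepts_in machine w n" and "Input ` UNIV \<subseteq> S"
  proof -
    obtain c where c: "(step machine ^^ n) (init_config machine w) c" "fst c = f (False, [])"
      using acc_n unfolding accepts_in_def acc by blast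
    have "conf (init_config machine w) p0 ?s"
      using rep cl that self_in_residuals by (auto simp: conf_def init)
    then show ?thesis using steps_sound c by blast
  qed
  show "\<exists>n\<le>2 * m. accepts_in machine w n" if "run m p0 ?s s'" "Input ` UNIV \<subseteq> S"
    using run_complete[OF that(1) rep cl[OF that(2)] self_in_residuals]
    by (auto simp: accepts_in_def init acc)
qed

end

lemma program_machine:
  fixes p :: "'a::finite cell instr list"
  assumes "finite S" "Blank \<notin> S" "uses k S p" "k \<ge> 1" "Input ` UNIV \<subseteq> S"
  obtains T :: "'a ntm" where "is_ntm T"
    "\<And>w n. accepts_in T w n \<Longrightarrow> \<exists>m s'. run m p ((\<lambda>_. [])(0 := map Input w)) s'"
    "\<And>w m s'. run m p ((\<lambda>_. [])(0 := map Input w)) s' \<Longrightarrow> \<exists>n\<le>2 * m. accepts_in T w n"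
proof -
  have "finite ((UNIV :: bool set) \<times> residuals p)" by (simp add: finite_residuals)
  then obtain f :: "bool \<times> 'a cell instr list \<Rightarrow> nat" where f: "inj_on f (UNIV \<times> residuals p)"
    using finite_imp_inj_to_nat_seg by blast
  show ?thesis
    using that[OF is_ntm_machine[OF assms(1-4) f]] accepts_machine[OF assms(1-4) f _ assms(5)] by blast
qed


section \<open>Logic programs on words\<close>

text \<open>A variable stands for an arbitrary word, so one pattern can match a word in several
  ways. The substitution is guessed, never computed.\<close>

datatype 'a psym = V nat | C 'a

type_synonym ('p, 'a) goal = "'p \<times> 'a list list"
type_synonym ('p, 'a) pgoal = "'p \<times> 'a psym list list"
type_synonym ('p, 'a) clause = "('p, 'a) pgoal \<times> ('p, 'a) pgoal list"

fun inst_sym :: "(nat \<Rightarrow> 'a list) \<Rightarrow> 'a psym \<Rightarrow> 'a list" where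
  "inst_sym \<theta> (V i) = \<theta> i"
| "inst_sym \<theta> (C a) = [a]"

definition inst :: "(nat \<Rightarrow> 'a list) \<Rightarrow> 'a psym list \<Rightarrow> 'a list" where
  "inst \<theta> p = concat (map (inst_sym \<theta>) p)"

definition inst_goal :: "(nat \<Rightarrow> 'a list) \<Rightarrow> ('p, 'a) pgoal \<Rightarrow> ('p, 'a) goal" where
  "inst_goal \<theta> g = (fst g, map (inst \<theta>) (snd g))"

lemma inst_simps [simp]:
  "inst \<theta> [] = []" "inst \<theta> (V i # p) = \<theta> i @ inst \<theta> p" "inst \<theta> (C a # p) = a # inst \<theta> p"
  by (auto simp: inst_def)

lemma inst_append [simp]: "inst \<theta> (p @ q) = inst \<theta> p @ inst \<theta> q"
  by (simp add: inst_def)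

text \<open>The bound \<open>K\<close> on the words that instantiate the variables is what allows a machine to guess them
  in polynomial time.\<close>

inductive drv :: "('p, 'a) clause set \<Rightarrow> nat \<Rightarrow> nat \<Rightarrow> ('p, 'a) goal list \<Rightarrow> bool" for P K where
  drv_Nil: "drv P K 0 []"
| drv_rule: "(h, bs) \<in> P \<Longrightarrow> \<forall>i. length (\<theta> i) \<le> K \<Longrightarrow> drv P K n (map (inst_goal \<theta>) bs @ gs) \<Longrightarrow>
    drv P K (Suc n) (inst_goal \<theta> h # gs)"

lemma drv_append: "drv P K m xs \<Longrightarrow> drv P K n ys \<Longrightarrow> drv P K (m + n) (xs @ ys)"
  by (induction rule: drv.induct) (auto intro: drv_rule)

subsection \<open>Straight-line code and loops\<close>

fun exec :: "'c instr list \<Rightarrow> 'c stacks \<Rightarrow> 'c stacks option" where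
  "exec [] s = Some s"
| "exec (Push k c # p) s = exec p (s(k := c # s k))"
| "exec (Pop k c # p) s = (case s k of [] \<Rightarrow> None | d # w \<Rightarrow> if d = c then exec p (s(k := w)) else None)"
| "exec (Empty k # p) s = (if s k = [] then exec p s else None)"
| "exec (Loop ps # p) s = None"

fun straight :: "'c instr list \<Rightarrow> bool" where
  "straight [] \<longleftrightarrow> True"
| "straight (Loop ps # p) \<longleftrightarrow> False"
| "straight (i # p) \<longleftrightarrow> straight p"

lemma run_straight:
  "straight p \<Longrightarrow> run n (p @ q) s s' \<longleftrightarrow> (\<exists>m s1. n = m + length p \<and> exec p s = Some s1 \<and> run m q s1 s')"
proof (induction p arbitrary: n s rule: straight.induct)
  case ("3_1" k c p)
  then show ?case by (auto simp: run_Push_iff)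
next
  case ("3_2" k c p)
  then show ?case by (auto simp: run_Pop_iff split: list.splits)
next
  case ("3_3" k p)
  then show ?case by (auto simp: run_Empty_iff)
qed auto

fun exec_word :: "('c \<Rightarrow> 'c instr list) \<Rightarrow> 'c list \<Rightarrow> 'c stacks \<Rightarrow> 'c stacks option" where
  "exec_word b [] s = Some s"
| "exec_word b (a # w) s = Option.bind (exec (b a) s) (exec_word b w)"

text \<open>If the bodies are indexed by letters, the choices made in the loop spell a word, and the
  loop acts like a fold along this guessed word. Each letter costs the \<open>L\<close> instructions
  of its body and one for the loop; the final 1 is the exit.\<close>

lemma run_Loop_word:
  assumes b: "\<And>a. straight (b a) \<and> length (b a) = L"
  shows "run n (Loop (map b as) # q) s s' \<longleftrightarrow> (\<exists>w m s1. set w \<subseteq> set as \<and> n = m + (L + 1) * length w + 1 \<and>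
    exec_word b w s = Some s1 \<and> run m q s1 s')"
proof (induction n arbitrary: s rule: less_induct)
  case (less n)
  have *: "run n (Loop (map b as) # q) s s' \<longleftrightarrow> (\<exists>m. n = Suc m \<and> (run m q s s' \<or>
     (\<exists>a\<in>set as. \<exists>m' s1. m = m' + L \<and> exec (b a) s = Some s1 \<and> run m' (Loop (map b as) # q) s1 s')))"
    by (subst run_Loop_iff) (use run_straight[of "b _" _ "Loop (map b as) # q"] b in auto)
  show ?case
  proof
    assume "run n (Loop (map b as) # q) s s'"
    then consider m where "n = Suc m" "run m q s s'"
      | a m' s1 where "a \<in> set as" "n = Suc (m' + L)" "exec (b a) s = Some s1" "run m' (Loop (map b as) # q) s1 s'"
      using * by blast
    then show "\<exists>w m s1. set w \<subseteq> set as \<and> n = m + (L + 1) * length w + 1 \<and> exec_word b w s = Some s1 \<and> run m q s1 s'"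
    proof cases
      case 1
      then show ?thesis by (intro exI[of _ "[]"]) auto
    next
      case 2
      then obtain w m s2 where "set w \<subseteq> set as" "m' = m + (L + 1) * length w + 1" "exec_word b w s1 = Some s2" "run m q s2 s'"
        using less[of m' s1] by auto
      then show ?thesis using 2 by (intro exI[of _ "a # w"] exI[of _ m] exI[of _ s2]) auto
    qed
  next
    assume "\<exists>w m s1. set w \<subseteq> set as \<and> n = m + (L + 1) * length w + 1 \<and> exec_word b w s = Some s1 \<and> run m q s1 s'"
    then obtain w m s1 where w: "set w \<subseteq> set as" "n = m + (L + 1) * length w + 1" "exec_word b w s = Some s1" "run m q s1 s'"
      by blast
    show "run n (Loop (map b as) # q) s s'"
    proof (cases w)
      case Nil
      then show ?thesis using w * by auto
    next
      case (Cons a v)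
      then obtain s2 where s2: "exec (b a) s = Some s2" "exec_word b v s2 = Some s1"
        using w(3) by (cases "exec (b a) s") auto
      have "run (m + (L + 1) * length v + 1) (Loop (map b as) # q) s2 s'"
        using less[of "m + (L + 1) * length v + 1" s2] w s2 Cons by auto
      moreover have "n = Suc (m + (L + 1) * length v + 1 + L)" using w(2) Cons by simp
      ultimately show ?thesis using * s2 w(1) Cons by auto
    qed
  qed
qed

lemma exec_word_push: "exec_word (\<lambda>a. [Push i a]) w s = Some (s(i := rev w @ s i))"
  by (induction w arbitrary: s) auto

lemma exec_word_pop: "exec_word (\<lambda>a. [Pop i a]) w s = Some s1 \<longleftrightarrow> (\<exists>r. s i = w @ r \<and> s1 = s(i := r))"
  by (induction w arbitrary: s) (auto split: list.splits)

text \<open>Letters moved one by one arrive in reverse order. As variables are stored with the last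
  letter on top, a move out of a variable puts its first letter on top, which is the order of the
  worklist.\<close>

lemma exec_word_move:
  "i \<noteq> j \<Longrightarrow> exec_word (\<lambda>a. [Pop i a, Push j a]) w s = Some s1 \<longleftrightarrow>
    (\<exists>r. s i = w @ r \<and> s1 = s(i := r, j := rev w @ s j))"
  by (induction w arbitrary: s) (auto split: list.splits simp: fun_upd_twist)

lemma exec_word_split:
  "i \<noteq> j \<Longrightarrow> i \<noteq> l \<Longrightarrow> j \<noteq> l \<Longrightarrow> exec_word (\<lambda>a. [Pop i a, Push j a, Push l a]) w s = Some s1 \<longleftrightarrow>
    (\<exists>r. s i = w @ r \<and> s1 = s(i := r, j := rev w @ s j, l := rev w @ s l))"
  by (induction w arbitrary: s) (auto split: list.splits simp: fun_upd_twist)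

lemma exec_word_match:
  "i \<noteq> j \<Longrightarrow> i \<noteq> l \<Longrightarrow> j \<noteq> l \<Longrightarrow> exec_word (\<lambda>a. [Pop i a, Pop j a, Push l a]) w s = Some s1 \<longleftrightarrow>
    (\<exists>r t. s i = w @ r \<and> s j = w @ t \<and> s1 = s(i := r, j := t, l := rev w @ s l))"
  by (induction w arbitrary: s) (auto split: list.splits simp: fun_upd_twist)

subsection \<open>Pattern matching on the worklist\<close>

text \<open>Stack \<open>0\<close> holds the worklist, stack \<open>1\<close> is scratch space and stack \<open>i + 2\<close> holds the value of
  variable \<open>i\<close>, last letter on top.\<close>

definition store :: "'c list \<Rightarrow> (nat \<Rightarrow> 'c list) \<Rightarrow> 'c stacks" where
  "store W \<theta> k = (if k = 0 then W else if k = 1 then [] else rev (\<theta> (k - 2)))"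

lemma store_simps [simp]:
  "store W \<theta> 0 = W" "store W \<theta> (Suc 0) = []" "store W \<theta> (Suc (Suc i)) = rev (\<theta> i)"
  "(store W \<theta>)(0 := W') = store W' \<theta>" "(store W \<theta>)(Suc (Suc i) := w) = store W (\<theta>(i := rev w))"
  by (auto simp: store_def fun_eq_iff)

definition guess :: "'c list \<Rightarrow> nat \<Rightarrow> 'c instr list" where
  "guess as i = [Loop (map (\<lambda>a. [Push (i + 2) a]) as)]"

definition erase :: "'c list \<Rightarrow> nat \<Rightarrow> 'c instr list" where
  "erase as i = [Loop (map (\<lambda>a. [Pop (i + 2) a]) as), Empty (i + 2)]"

text \<open>The value must survive because a variable may occur several times. It is moved to the
  scratch stack, which brings its first letter to the top, and is compared with the worklist while
  it moves back; the \<open>Empty\<close> tests force both loops to run to the end. The cost is 3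
  and then 4 instructions per letter, and 2 for each exit with its test.\<close>

fun pop_sym :: "'c list \<Rightarrow> 'c psym \<Rightarrow> 'c instr list" where
  "pop_sym as (C c) = [Pop 0 c]"
| "pop_sym as (V i) = [Loop (map (\<lambda>a. [Pop (i + 2) a, Push 1 a]) as), Empty (i + 2),
     Loop (map (\<lambda>a. [Pop 1 a, Pop 0 a, Push (i + 2) a]) as), Empty 1]"

text \<open>The copy is made during the move to the scratch stack, where it reaches the worklist
  with its first letter on top.\<close>

fun push_sym :: "'c list \<Rightarrow> 'c psym \<Rightarrow> 'c instr list" where
  "push_sym as (C c) = [Push 0 c]"
| "push_sym as (V i) = [Loop (map (\<lambda>a. [Pop (i + 2) a, Push 1 a, Push 0 a]) as), Empty (i + 2),
     Loop (map (\<lambda>a. [Pop 1 a, Push (i + 2) a]) as), Empty 1]"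

lemma run_guess: "run n (guess as i @ q) (store W \<theta>) s' \<longleftrightarrow>
   (\<exists>w m. set w \<subseteq> set as \<and> n = m + 2 * length w + 1 \<and> run m q (store W (\<theta>(i := \<theta> i @ w))) s')"
  by (auto simp: guess_def run_Loop_word[where L = 1] exec_word_push)

lemma run_erase:
  assumes "set (\<theta> i) \<subseteq> set as"
  shows "run n (erase as i @ q) (store W \<theta>) s' \<longleftrightarrow>
   (\<exists>m. n = m + 2 * length (\<theta> i) + 2 \<and> run m q (store W (\<theta>(i := []))) s')"
proof -
  show ?thesis using assms
    by (auto simp: erase_def run_Loop_word[where L = 1] exec_word_pop run_Empty_iff
        intro!: exI[of _ "rev (\<theta> i)"])
qed

lemma run_pop_sym_V:
  assumes "set (\<theta> i) \<subseteq> set as"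
  shows "run n (pop_sym as (V i) @ q) (store W \<theta>) s' \<longleftrightarrow>
   (\<exists>m W'. n = m + 7 * length (\<theta> i) + 4 \<and> W = \<theta> i @ W' \<and> run m q (store W' \<theta>) s')"
proof -
  have 1: "(store W \<theta>)(Suc (Suc i) := [], Suc 0 := \<theta> i, Suc 0 := [], 0 := W', Suc (Suc i) := rev (\<theta> i)) = store W' \<theta>" for W'
    by (auto simp: store_def fun_eq_iff)
  have 2: "(store W \<theta>)(Suc (Suc i) := [], Suc 0 := [], 0 := W', Suc (Suc i) := rev (\<theta> i)) = store W' \<theta>" for W'
    by (auto simp: store_def fun_eq_iff)
  have 3: "(store W'' \<theta>)(Suc 0 := [], 0 := W', Suc (Suc i) := rev (\<theta> i)) = store W' \<theta>" for W' W''
    by (auto simp: store_def fun_eq_iff)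
  show ?thesis
  proof
    assume "run n (pop_sym as (V i) @ q) (store W \<theta>) s'"
    then show "\<exists>m W'. n = m + 7 * length (\<theta> i) + 4 \<and> W = \<theta> i @ W' \<and> run m q (store W' \<theta>) s'"
      by (auto simp: run_Loop_word[where L = 2] run_Loop_word[where L = 3] exec_word_move exec_word_match run_Empty_iff 1 2 3
          simp del: fun_upd_upd store_simps(4,5))
  next
    assume "\<exists>m W'. n = m + 7 * length (\<theta> i) + 4 \<and> W = \<theta> i @ W' \<and> run m q (store W' \<theta>) s'"
    then obtain m W' where m: "n = m + 7 * length (\<theta> i) + 4" "W = \<theta> i @ W'" "run m q (store W' \<theta>) s'" by blast
    have "run (Suc (Suc (4 * length (\<theta> i) + m))) (Loop (map (\<lambda>a. [Pop 1 a, Pop 0 a, Push (i + 2) a]) as) # Empty 1 # q)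
       ((store W \<theta>)(Suc (Suc i) := [], Suc 0 := \<theta> i)) s'"
      using m assms 1[of W'] by (subst run_Loop_word[where L = 3]) (auto simp: exec_word_match run_Empty_iff simp del: fun_upd_upd store_simps(4,5)
          intro!: exI[of _ "\<theta> i"] exI[of _ "Suc m"])
    then show "run n (pop_sym as (V i) @ q) (store W \<theta>) s'"
      using m assms by (auto simp: run_Loop_word[where L = 2] exec_word_move run_Empty_iff simp del: store_simps(4,5)
          intro!: exI[of _ "rev (\<theta> i)"])
  qed
qed

lemma run_push_sym_V:
  assumes "set (\<theta> i) \<subseteq> set as"
  shows "run n (push_sym as (V i) @ q) (store W \<theta>) s' \<longleftrightarrow>
   (\<exists>m. n = m + 7 * length (\<theta> i) + 4 \<and> run m q (store (\<theta> i @ W) \<theta>) s')"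
proof -
  have 1: "(store W \<theta>)(Suc (Suc i) := [], Suc 0 := \<theta> i, 0 := \<theta> i @ W, Suc 0 := [], Suc (Suc i) := rev (\<theta> i)) = store (\<theta> i @ W) \<theta>"
    by (auto simp: store_def fun_eq_iff)
  have 2: "(store W'' \<theta>)(0 := W', Suc 0 := [], Suc (Suc i) := rev (\<theta> i)) = store W' \<theta>" for W' W''
    by (auto simp: store_def fun_eq_iff)
  show ?thesis
  proof
    assume "run n (push_sym as (V i) @ q) (store W \<theta>) s'"
    then show "\<exists>m. n = m + 7 * length (\<theta> i) + 4 \<and> run m q (store (\<theta> i @ W) \<theta>) s'"
      by (auto simp: run_Loop_word[where L = 2] run_Loop_word[where L = 3] exec_word_move exec_word_split run_Empty_iff 1 2
          simp del: fun_upd_upd store_simps(4,5))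
  next
    assume "\<exists>m. n = m + 7 * length (\<theta> i) + 4 \<and> run m q (store (\<theta> i @ W) \<theta>) s'"
    then obtain m where m: "n = m + 7 * length (\<theta> i) + 4" "run m q (store (\<theta> i @ W) \<theta>) s'" by blast
    have "run (Suc (Suc (3 * length (\<theta> i) + m))) (Loop (map (\<lambda>a. [Pop 1 a, Push (i + 2) a]) as) # Empty 1 # q)
       ((store W \<theta>)(Suc (Suc i) := [], Suc 0 := \<theta> i, 0 := \<theta> i @ W)) s'"
      using m assms 1 by (subst run_Loop_word[where L = 2]) (auto simp: exec_word_move run_Empty_iff simp del: fun_upd_upd store_simps(4,5)
          intro!: exI[of _ "\<theta> i"] exI[of _ "Suc m"])
    then show "run n (push_sym as (V i) @ q) (store W \<theta>) s'"
      using m assms by (auto simp: run_Loop_word[where L = 3] exec_word_split run_Empty_iff simp del: store_simps(4,5)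
          intro!: exI[of _ "rev (\<theta> i)"])
  qed
qed

lemma run_pop_sym:
  assumes "\<forall>i. set (\<theta> i) \<subseteq> set as"
  shows "run n (pop_sym as x @ q) (store W \<theta>) s' \<longleftrightarrow>
   (\<exists>m W'. n = m + (case x of V i \<Rightarrow> 7 * length (\<theta> i) + 4 | C c \<Rightarrow> 1) \<and> W = inst_sym \<theta> x @ W' \<and> run m q (store W' \<theta>) s')"
  using assms run_pop_sym_V[of \<theta> _ as n q W s']
  by (cases x) (auto simp: run_Pop_iff)

lemma run_push_sym:
  assumes "\<forall>i. set (\<theta> i) \<subseteq> set as"
  shows "run n (push_sym as x @ q) (store W \<theta>) s' \<longleftrightarrow>
   (\<exists>m. n = m + (case x of V i \<Rightarrow> 7 * length (\<theta> i) + 4 | C c \<Rightarrow> 1) \<and> run m q (store (inst_sym \<theta> x @ W) \<theta>) s')"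
  using assms run_push_sym_V[of \<theta> _ as n q W s']
  by (cases x) (auto simp: run_Push_iff)

definition cost :: "(nat \<Rightarrow> 'c list) \<Rightarrow> 'c psym list \<Rightarrow> nat" where
  "cost \<theta> p = (\<Sum>x\<leftarrow>p. case x of V i \<Rightarrow> 7 * length (\<theta> i) + 4 | C c \<Rightarrow> 1)"

lemma cost_le: "\<forall>i. length (\<theta> i) \<le> K \<Longrightarrow> cost \<theta> p \<le> length p * (7 * K + 4)"
proof (induction p)
  case (Cons x p)
  have "cost \<theta> (x # p) = (case x of V i \<Rightarrow> 7 * length (\<theta> i) + 4 | C c \<Rightarrow> 1) + cost \<theta> p"
    by (simp add: cost_def)
  moreover have "(case x of V i \<Rightarrow> 7 * length (\<theta> i) + 4 | C c \<Rightarrow> 1) \<le> 7 * K + 4"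
    using Cons.prems by (cases x) auto
  ultimately show ?case using Cons by simp
qed (simp add: cost_def)

definition pops :: "'c list \<Rightarrow> 'c psym list \<Rightarrow> 'c instr list" where
  "pops as p = concat (map (pop_sym as) p)"

text \<open>Reversed because the symbol pushed last ends on top.\<close>

definition pushes :: "'c list \<Rightarrow> 'c psym list \<Rightarrow> 'c instr list" where
  "pushes as p = concat (map (push_sym as) (rev p))"

lemma run_pops:
  assumes "\<forall>i. set (\<theta> i) \<subseteq> set as"
  shows "run n (pops as p @ q) (store W \<theta>) s' \<longleftrightarrow>
   (\<exists>m W'. n = m + cost \<theta> p \<and> W = inst \<theta> p @ W' \<and> run m q (store W' \<theta>) s')"
proof (induction p arbitrary: n W)
  case (Cons x p)
  have "run n (pops as (x # p) @ q) (store W \<theta>) s' \<longleftrightarrow> run n (pop_sym as x @ pops as p @ q) (store W \<theta>) s'"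
    by (simp add: pops_def)
  also have "\<dots> \<longleftrightarrow> (\<exists>m W'. n = m + cost \<theta> (x # p) \<and> W = inst \<theta> (x # p) @ W' \<and> run m q (store W' \<theta>) s')"
    unfolding run_pop_sym[OF assms] Cons.IH by (auto simp: cost_def inst_def add.assoc)
  finally show ?case .
qed (auto simp: pops_def cost_def)

lemma run_pushes:
  assumes "\<forall>i. set (\<theta> i) \<subseteq> set as"
  shows "run n (pushes as p @ q) (store W \<theta>) s' \<longleftrightarrow>
   (\<exists>m. n = m + cost \<theta> p \<and> run m q (store (inst \<theta> p @ W) \<theta>) s')"
proof (induction p arbitrary: n q)
  case (Cons x p)
  have "run n (pushes as (x # p) @ q) (store W \<theta>) s' \<longleftrightarrow> run n (pushes as p @ push_sym as x @ q) (store W \<theta>) s'"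
    by (simp add: pushes_def)
  also have "\<dots> \<longleftrightarrow> (\<exists>m. n = m + cost \<theta> (x # p) \<and> run m q (store (inst \<theta> (x # p) @ W) \<theta>) s')"
  proof -
    have "cost \<theta> (x # p) = (case x of V i \<Rightarrow> 7 * length (\<theta> i) + 4 | C c \<Rightarrow> 1) + cost \<theta> p"
      by (simp add: cost_def)
    then show ?thesis unfolding Cons.IH run_push_sym[OF assms] by (auto simp: inst_def ac_simps)
  qed
  finally show ?case .
qed (auto simp: pushes_def cost_def)

lemma run_guesses:
  assumes "distinct is" "\<forall>i\<in>set is. \<theta> i = []"
  shows "run n (concat (map (guess as) is) @ q) (store W \<theta>) s' \<longleftrightarrow>
   (\<exists>\<eta> m. (\<forall>i. set (\<eta> i) \<subseteq> set as) \<and> n = m + (\<Sum>i\<leftarrow>is. 2 * length (\<eta> i) + 1) \<and>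
      run m q (store W (\<lambda>i. if i \<in> set is then \<eta> i else \<theta> i)) s')"
  using assms
proof (induction "is" arbitrary: n \<theta>)
  case Nil
  then show ?case by (auto intro!: exI[of _ "\<lambda>_. []"])
next
  case (Cons i js)
  have IH: "run m (concat (map (guess as) js) @ q) (store W (\<theta>(i := w))) s' \<longleftrightarrow>
    (\<exists>\<eta> m'. (\<forall>i. set (\<eta> i) \<subseteq> set as) \<and> m = m' + (\<Sum>i\<leftarrow>js. 2 * length (\<eta> i) + 1) \<and>
      run m' q (store W (\<lambda>j. if j \<in> set js then \<eta> j else (\<theta>(i := w)) j)) s')" for m w
    using Cons by (intro Cons.IH) auto
  have 1: "run n (concat (map (guess as) (i # js)) @ q) (store W \<theta>) s' \<longleftrightarrow>
     (\<exists>w m. set w \<subseteq> set as \<and> n = m + 2 * length w + 1 \<and> run m (concat (map (guess as) js) @ q) (store W (\<theta>(i := w))) s')"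
    using run_guess[of n as i "concat (map (guess as) js) @ q" W \<theta> s'] Cons.prems by simp
  show ?case (is "?l \<longleftrightarrow> ?r")
  proof
    assume ?l
    then obtain w m \<eta> m' where w: "set w \<subseteq> set as" "n = m + 2 * length w + 1" "\<forall>i. set (\<eta> i) \<subseteq> set as"
      "m = m' + (\<Sum>i\<leftarrow>js. 2 * length (\<eta> i) + 1)" "run m' q (store W (\<lambda>j. if j \<in> set js then \<eta> j else (\<theta>(i := w)) j)) s'"
      unfolding 1 IH by blast
    have "(\<lambda>j. if j \<in> set js then \<eta> j else (\<theta>(i := w)) j) = (\<lambda>j. if j \<in> set (i # js) then (\<eta>(i := w)) j else \<theta> j)"
      using Cons.prems by auto
    moreover have "(\<Sum>k\<leftarrow>js. 2 * length ((\<eta>(i := w)) k) + 1) = (\<Sum>k\<leftarrow>js. 2 * length (\<eta> k) + 1)"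
      using Cons.prems by (intro arg_cong[where f = sum_list] map_cong) auto
    ultimately show ?r using w by (intro exI[of _ "\<eta>(i := w)"] exI[of _ m']) simp
  next
    assume ?r
    then obtain \<eta> m where e: "\<forall>i. set (\<eta> i) \<subseteq> set as" "n = m + (\<Sum>i\<leftarrow>i # js. 2 * length (\<eta> i) + 1)"
      "run m q (store W (\<lambda>j. if j \<in> set (i # js) then \<eta> j else \<theta> j)) s'" by blast
    have "(\<lambda>j. if j \<in> set (i # js) then \<eta> j else \<theta> j) = (\<lambda>j. if j \<in> set js then \<eta> j else (\<theta>(i := \<eta> i)) j)"
      by auto
    then have "run (m + (\<Sum>i\<leftarrow>js. 2 * length (\<eta> i) + 1)) (concat (map (guess as) js) @ q) (store W (\<theta>(i := \<eta> i))) s'"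
      unfolding IH using e by (intro exI[of _ \<eta>] exI[of _ m]) simp
    then show ?l unfolding 1 using e by (intro exI[of _ "\<eta> i"]) auto
  qed
qed

lemma run_erases:
  assumes "\<forall>i. set (\<theta> i) \<subseteq> set as" "distinct is"
  shows "run n (concat (map (erase as) is) @ q) (store W \<theta>) s' \<longleftrightarrow>
   (\<exists>m. n = m + (\<Sum>i\<leftarrow>is. 2 * length (\<theta> i) + 2) \<and> run m q (store W (\<lambda>i. if i \<in> set is then [] else \<theta> i)) s')"
  using assms
proof (induction "is" arbitrary: n \<theta>)
  case (Cons i js)
  have 1: "map (\<lambda>k. 2 * length ((\<theta>(i := [])) k) + 2) js = map (\<lambda>k. 2 * length (\<theta> k) + 2) js"
    using Cons.prems by (intro map_cong) auto
  have 2: "(\<lambda>j. if j \<in> set js then [] else (\<theta>(i := [])) j) = (\<lambda>j. if j \<in> set (i # js) then [] else \<theta> j)"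
    by auto
  have "run m (concat (map (erase as) js) @ q) (store W (\<theta>(i := []))) s' \<longleftrightarrow>
    (\<exists>m'. m = m' + (\<Sum>i\<leftarrow>js. 2 * length (\<theta> i) + 2) \<and>
      run m' q (store W (\<lambda>j. if j \<in> set (i # js) then [] else \<theta> j)) s')" for m
    using Cons.IH[of "\<theta>(i := [])" m] Cons.prems unfolding 1 2 by (fastforce simp only: fun_upd_apply distinct.simps list.set empty_subsetI split: if_splits)
  then show ?case using run_erase[of \<theta> i as n "concat (map (erase as) js) @ q" W s'] Cons.prems by auto
qed auto

subsection \<open>The machine of a logic program\<close>

text \<open>The separators are auxiliary symbols and so never occur in an argument. Predicate codes
  are shifted by 2 in goal words to stay apart from the separators 0 and 1.\<close>

definition args_word :: "'a list list \<Rightarrow> 'a cell list" where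
  "args_word ws = concat (map (\<lambda>w. map Input w @ [Aux 0]) ws) @ [Aux 1]"

definition goal_word :: "('p \<Rightarrow> nat) \<Rightarrow> ('p, 'a) goal \<Rightarrow> 'a cell list" where
  "goal_word code g = Aux (code (fst g) + 2) # args_word (snd g)"

definition pat_syms :: "('p \<Rightarrow> nat) \<Rightarrow> ('p, 'a) pgoal \<Rightarrow> 'a cell psym list" where
  "pat_syms code g = C (Aux (code (fst g) + 2)) #
     concat (map (\<lambda>q. map (map_psym Input) q @ [C (Aux 0)]) (snd g)) @ [C (Aux 1)]"

lemma inst_map_psym: "inst (\<lambda>i. map f (\<theta> i)) (map (map_psym f) q) = map f (inst \<theta> q)"
proof (induction q)
  case (Cons x q)
  then show ?case by (cases x) auto
qed simp

lemma inst_pat_syms: "inst (\<lambda>i. map Input (\<theta> i)) (pat_syms code g) = goal_word code (inst_goal \<theta> g)"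
proof -
  have "inst (\<lambda>i. map Input (\<theta> i)) (concat (map (\<lambda>q. map (map_psym Input) q @ [C (Aux 0)]) qs) @ [C (Aux 1)])
    = args_word (map (inst \<theta>) qs)" for qs
    by (induction qs) (auto simp: args_word_def inst_map_psym)
  then show ?thesis by (simp add: pat_syms_def goal_word_def inst_goal_def)
qed

lemma inst_pat_syms_list:
  "inst (\<lambda>i. map Input (\<theta> i)) (concat (map (pat_syms code) gs)) = concat (map (goal_word code) (map (inst_goal \<theta>) gs))"
  by (induction gs) (auto simp: inst_pat_syms)

lemma Input_Aux_split: "map Input w @ Aux m # X = map Input v @ Aux m # Y \<longleftrightarrow> w = v \<and> X = Y"
proof (induction w arbitrary: v)
  case Nil
  then show ?case by (cases v) auto
next
  case (Cons a w)
  then show ?case by (cases v) auto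
qed

lemma args_word_prefix_free: "args_word ws @ X = args_word vs @ Y \<Longrightarrow> ws = vs \<and> X = Y"
proof (induction ws arbitrary: vs)
  case Nil
  then show ?case
  proof (cases vs)
    case (Cons v vs')
    then show ?thesis using Nil by (cases v) (auto simp: args_word_def)
  qed (auto simp: args_word_def)
next
  case (Cons w ws)
  show ?case
  proof (cases vs)
    case Nil
    then show ?thesis using Cons.prems by (cases w) (auto simp: args_word_def)
  next
    case (Cons v vs')
    then have "map Input w @ Aux 0 # (args_word ws @ X) = map Input v @ Aux 0 # (args_word vs' @ Y)"
      using Cons.prems by (simp add: args_word_def)
    then show ?thesis using Cons.IH Cons unfolding Input_Aux_split by blast
  qed
qed

text \<open>The first goal on the worklist can be read in only one way, so matching the head of a
  rule never cuts across two goals.\<close>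

lemma goal_word_prefix_free:
  "inj code \<Longrightarrow> goal_word code g @ X = goal_word code h @ Y \<Longrightarrow> g = h \<and> X = Y"
  by (auto simp: goal_word_def prod_eq_iff dest: injD args_word_prefix_free)

text \<open>One resolution step. Erasing the variables at the end lets every iteration of the main
  loop start from empty variable stacks.\<close>

definition clause_prog :: "('p \<Rightarrow> nat) \<Rightarrow> 'a cell list \<Rightarrow> nat \<Rightarrow> ('p, 'a) clause \<Rightarrow> 'a cell instr list" where
  "clause_prog code as nv c = concat (map (guess as) [0..<nv]) @ pops as (pat_syms code (fst c)) @
     pushes as (concat (map (pat_syms code) (snd c))) @ concat (map (erase as) [0..<nv])"

fun sym_below :: "nat \<Rightarrow> 'a psym \<Rightarrow> bool" where
  "sym_below n (V i) \<longleftrightarrow> i < n"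
| "sym_below n (C a) \<longleftrightarrow> True"

definition goal_below :: "nat \<Rightarrow> ('p, 'a) pgoal \<Rightarrow> bool" where
  "goal_below n g \<longleftrightarrow> (\<forall>p\<in>set (snd g). \<forall>x\<in>set p. sym_below n x)"

definition clause_below :: "nat \<Rightarrow> ('p, 'a) clause \<Rightarrow> bool" where
  "clause_below n c \<longleftrightarrow> (\<forall>g\<in>set (fst c # snd c). goal_below n g)"

lemma inst_cong_below:
  "\<forall>x\<in>set p. sym_below n x \<Longrightarrow> \<forall>i<n. \<theta> i = \<eta> i \<Longrightarrow> inst \<theta> p = inst \<eta> p"
proof (induction p)
  case (Cons x p)
  then show ?case by (cases x) auto
qed simp

lemma inst_goal_cong_below: "goal_below n g \<Longrightarrow> \<forall>i<n. \<theta> i = \<eta> i \<Longrightarrow> inst_goal \<theta> g = inst_goal \<eta> g"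
  by (auto simp: inst_goal_def goal_below_def intro!: inst_cong_below)

lemma sym_below_mono: "sym_below m x \<Longrightarrow> m \<le> n \<Longrightarrow> sym_below n x"
  by (cases x) auto

lemma sym_below_ex: "\<exists>n. \<forall>x\<in>set p. sym_below n x"
proof (induction p)
  case (Cons x p)
  then obtain n where "\<forall>x\<in>set p. sym_below n x" by blast
  moreover obtain m where "sym_below m x" by (cases x) auto
  ultimately show ?case
    by (intro exI[of _ "max m n"]) (auto intro: sym_below_mono)
qed simp

lemma clauses_below_ex: "\<exists>n\<ge>1. \<forall>c\<in>set cls. clause_below n c"
proof -
  obtain n where n: "\<forall>x\<in>set (concat (concat (map (\<lambda>c. concat (map snd (fst c # snd c))) cls))). sym_below n x"
    using sym_below_ex by blast
  have "clause_below (Suc n) c" if "c \<in> set cls" for c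
    unfolding clause_below_def goal_below_def
  proof (intro ballI)
    fix g p x assume "g \<in> set (fst c # snd c)" "p \<in> set (snd g)" "x \<in> set p"
    then have "sym_below n x" using n that by fastforce
    then show "sym_below (Suc n) x" by (rule sym_below_mono) simp
  qed
  then show ?thesis by (intro exI[of _ "Suc n"]) auto
qed

context
  fixes code :: "'p \<Rightarrow> nat" and as :: "'a cell list" and nv :: nat
  assumes inj_code: "inj code" and as: "set as = Input ` UNIV"
begin

lemma as_words: "\<exists>\<theta>. \<eta> = (\<lambda>i. map Input (\<theta> i))" if "\<forall>i. set (\<eta> i) \<subseteq> set as"
proof -
  have "\<exists>w. \<eta> i = map Input w" for i
    using that as by (metis ex_map_conv image_iff subsetD)
  then show ?thesis by metis
qed

lemma run_clause_prog_sound: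
  assumes "run n (clause_prog code as nv c @ q) (store W (\<lambda>_. [])) s'"
  shows "\<exists>\<theta> W' m. m \<le> n \<and> W = goal_word code (inst_goal \<theta> (fst c)) @ W' \<and>
    run m q (store (concat (map (goal_word code) (map (inst_goal \<theta>) (snd c))) @ W') (\<lambda>_. [])) s'"
proof -
  let ?q1 = "concat (map (erase as) [0..<nv]) @ q"
  let ?q2 = "pushes as (concat (map (pat_syms code) (snd c))) @ ?q1"
  let ?q3 = "pops as (pat_syms code (fst c)) @ ?q2"
  have "run n (concat (map (guess as) [0..<nv]) @ ?q3) (store W (\<lambda>_. [])) s'"
    using assms by (simp add: clause_prog_def)
  then obtain \<eta> m where e: "\<forall>i. set (\<eta> i) \<subseteq> set as" "n = m + (\<Sum>i\<leftarrow>[0..<nv]. 2 * length (\<eta> i) + 1)"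
     "run m ?q3 (store W (\<lambda>i. if i \<in> set [0..<nv] then \<eta> i else [])) s'"
    using run_guesses[of "[0..<nv]" "\<lambda>_. []" n as ?q3 W s'] by auto
  \<comment> \<open>Variables from \<open>nv\<close> on are never guessed; their stacks are empty,
    so they take the empty word as value.\<close>
  define \<zeta> where "\<zeta> = (\<lambda>i. if i \<in> set [0..<nv] then \<eta> i else [])"
  have z: "\<forall>i. set (\<zeta> i) \<subseteq> set as" using e(1) unfolding \<zeta>_def by (metis empty_subsetI list.set(1))
  then obtain \<theta> where t: "\<zeta> = (\<lambda>i. map Input (\<theta> i))" using as_words by blast
  obtain m2 W' where 2: "m2 \<le> m" "W = inst \<zeta> (pat_syms code (fst c)) @ W'" "run m2 ?q2 (store W' \<zeta>) s'"
    using e(3) unfolding \<zeta>_def[symmetric] run_pops[OF z] by (metis le_add1)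
  obtain m3 where 3: "m3 \<le> m2" "run m3 ?q1 (store (inst \<zeta> (concat (map (pat_syms code) (snd c))) @ W') \<zeta>) s'"
    using 2(3) unfolding run_pushes[OF z] by (metis le_add1)
  obtain m4 where "m3 = m4 + (\<Sum>i\<leftarrow>[0..<nv]. 2 * length (\<zeta> i) + 2)"
    and 4: "run m4 q (store (inst \<zeta> (concat (map (pat_syms code) (snd c))) @ W')
      (\<lambda>i. if i \<in> set [0..<nv] then [] else \<zeta> i)) s'"
    using 3(2) unfolding run_erases[OF z distinct_upt] by (elim exE conjE)
  then have "m4 \<le> m3" by simp
  have "(\<lambda>i. if i \<in> set [0..<nv] then [] else \<zeta> i) = (\<lambda>_. [])" by (auto simp: \<zeta>_def)
  then show ?thesis using 2(1,2) 3(1) 4 \<open>m4 \<le> m3\<close> e(2) unfolding t inst_pat_syms inst_pat_syms_list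
    by (intro exI[of _ \<theta>] exI[of _ W'] exI[of _ m4]) auto
qed

text \<open>Guessing and erasing a variable of length at most \<open>K\<close> costs at most
  \<open>4 * K + 3\<close>, and a pattern symbol at most \<open>7 * K + 4\<close>; both are absorbed
  by multiplying with \<open>K + 1\<close>.\<close>

definition size_bound :: "('p, 'a) clause \<Rightarrow> nat" where
  "size_bound c = 4 * nv + 7 * (length (pat_syms code (fst c)) + length (concat (map (pat_syms code) (snd c))))"

lemma run_clause_prog_complete:
  assumes len: "\<forall>i. length (\<theta> i) \<le> K" and c: "clause_below nv c"
    and run: "run m q (store (concat (map (goal_word code) (map (inst_goal \<theta>) (snd c))) @ W') (\<lambda>_. [])) s'"
  shows "\<exists>n\<le>m + size_bound c * (K + 1).
    run n (clause_prog code as nv c @ q) (store (goal_word code (inst_goal \<theta> (fst c)) @ W') (\<lambda>_. [])) s'"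
proof -
  \<comment> \<open>The machine can only produce substitutions that are empty from \<open>nv\<close>
    on. Cutting \<open>\<theta>\<close> off there leaves the instances of a clause below
    \<open>nv\<close> as they are.\<close>
  define \<theta>' where "\<theta>' = (\<lambda>i. if i < nv then \<theta> i else [])"
  define \<zeta> :: "nat \<Rightarrow> 'a cell list" where "\<zeta> = (\<lambda>i. map Input (\<theta>' i))"
  let ?h = "pat_syms code (fst c)" and ?b = "concat (map (pat_syms code) (snd c))"
  let ?q1 = "concat (map (erase as) [0..<nv]) @ q"
  let ?q2 = "pushes as ?b @ ?q1"
  let ?q3 = "pops as ?h @ ?q2"
  have eq: "inst_goal \<theta>' g = inst_goal \<theta> g" if "g \<in> set (fst c # snd c)" for g
    using c that by (intro inst_goal_cong_below[of nv]) (auto simp: \<theta>'_def clause_below_def)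
  have h: "inst \<zeta> ?h = goal_word code (inst_goal \<theta> (fst c))"
    unfolding \<zeta>_def inst_pat_syms using eq by simp
  have b: "inst \<zeta> ?b = concat (map (goal_word code) (map (inst_goal \<theta>) (snd c)))"
    unfolding \<zeta>_def inst_pat_syms_list using eq by (intro arg_cong[where f = concat]) auto
  have z: "\<forall>i. set (\<zeta> i) \<subseteq> set as" unfolding \<zeta>_def as by auto
  have zl: "\<forall>i. length (\<zeta> i) \<le> K" using len by (simp add: \<zeta>_def \<theta>'_def)
  have z0: "(\<lambda>i. if i \<in> set [0..<nv] then [] else \<zeta> i) = (\<lambda>_. [])" by (auto simp: \<zeta>_def \<theta>'_def)
  have z1: "(\<lambda>i. if i \<in> set [0..<nv] then \<zeta> i else []) = \<zeta>" by (auto simp: \<zeta>_def \<theta>'_def)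
  let ?m1 = "m + (\<Sum>i\<leftarrow>[0..<nv]. 2 * length (\<zeta> i) + 2)"
  have 1: "run ?m1 ?q1 (store (inst \<zeta> ?b @ W') \<zeta>) s'"
    using run run_erases[OF z, of "[0..<nv]"] unfolding b z0 by auto
  have 2: "run (?m1 + cost \<zeta> ?b) ?q2 (store W' \<zeta>) s'"
    using 1 run_pushes[OF z] by blast
  have 3: "run (?m1 + cost \<zeta> ?b + cost \<zeta> ?h) ?q3 (store (inst \<zeta> ?h @ W') \<zeta>) s'"
    using 2 run_pops[OF z] by blast
  let ?n = "?m1 + cost \<zeta> ?b + cost \<zeta> ?h + (\<Sum>i\<leftarrow>[0..<nv]. 2 * length (\<zeta> i) + 1)"
  have "run ?n (concat (map (guess as) [0..<nv]) @ ?q3) (store (inst \<zeta> ?h @ W') (\<lambda>_. [])) s'"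
    using 3 z z1 by (subst run_guesses) (auto intro!: exI[of _ \<zeta>])
  moreover have "(\<Sum>i\<leftarrow>[0..<nv]. 2 * length (\<zeta> i) + d) \<le> nv * (2 * K + d)" for d
    using sum_list_mono[of "[0..<nv]" "\<lambda>i. 2 * length (\<zeta> i) + d" "\<lambda>_. 2 * K + d"] zl
    by (simp add: sum_list_triv)
  from this[of 1] this[of 2] have "?n \<le> m + nv * (2 * K + 2) + length ?b * (7 * K + 4) + length ?h * (7 * K + 4) + nv * (2 * K + 1)"
    using cost_le[OF zl, of ?b] cost_le[OF zl, of ?h] by linarith
  moreover have "nv * (2 * K + 2) + length ?b * (7 * K + 4) + length ?h * (7 * K + 4) + nv * (2 * K + 1)
     \<le> size_bound c * (K + 1)" unfolding size_bound_def by (simp add: algebra_simps)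
  ultimately show ?thesis unfolding clause_prog_def append_assoc h by (intro exI[of _ ?n]) auto
qed

definition solver :: "('p, 'a) clause list \<Rightarrow> 'a cell instr list" where
  "solver cls = [Loop (map (clause_prog code as nv) cls), Empty 0]"

text \<open>Induction on the remaining running time: if the run after a resolution step succeeds,
  all goals then on the worklist hold, among them the instantiated body, and closure of
  \<open>sem\<close> under the rules yields the goal that was replaced.\<close>

lemma run_solver_sound:
  assumes rules: "\<And>c \<theta>. c \<in> set cls \<Longrightarrow> \<forall>b\<in>set (snd c). sem (inst_goal \<theta> b) \<Longrightarrow> sem (inst_goal \<theta> (fst c))"
  shows "run n (solver cls) (store (concat (map (goal_word code) gs)) (\<lambda>_. [])) s' \<Longrightarrow> \<forall>g\<in>set gs. sem g"
proof (induction n arbitrary: gs rule: less_induct)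
  case (less n)
  then consider m where "run m [Empty 0] (store (concat (map (goal_word code) gs)) (\<lambda>_. [])) s'"
    | m c where "n = Suc m" "c \<in> set cls"
      "run m (clause_prog code as nv c @ solver cls) (store (concat (map (goal_word code) gs)) (\<lambda>_. [])) s'"
    unfolding solver_def by (subst (asm) run_Loop_iff) auto
  then show ?case
  proof cases
    case 1
    then have "concat (map (goal_word code) gs) = []" by (auto simp: run_Empty_iff)
    then show ?thesis by (cases gs) (auto simp: goal_word_def)
  next
    case 2
    obtain \<theta> W' m' where c: "m' \<le> m" "concat (map (goal_word code) gs) = goal_word code (inst_goal \<theta> (fst c)) @ W'"
      "run m' (solver cls) (store (concat (map (goal_word code) (map (inst_goal \<theta>) (snd c))) @ W') (\<lambda>_. [])) s'"
      using run_clause_prog_sound[OF 2(3)] by blast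
    then obtain g gs' where gs: "gs = g # gs'" by (cases gs) (auto simp: goal_word_def)
    then have g: "g = inst_goal \<theta> (fst c)" "W' = concat (map (goal_word code) gs')"
      using goal_word_prefix_free[OF inj_code, of g _ "inst_goal \<theta> (fst c)" W'] c(2) by auto
    have "\<forall>g\<in>set (map (inst_goal \<theta>) (snd c) @ gs'). sem g"
      using less.IH[of m' "map (inst_goal \<theta>) (snd c) @ gs'"] c 2(1) g(2) by simp
    then show ?thesis using rules[OF 2(2)] gs g by auto
  qed
qed

lemma run_solver_complete:
  assumes "drv (set cls) K n gs" "\<forall>c\<in>set cls. clause_below nv c \<and> size_bound c \<le> B"
  shows "\<exists>m\<le>2 + n * (1 + B * (K + 1)). \<exists>s'. run m (solver cls) (store (concat (map (goal_word code) gs)) (\<lambda>_. [])) s'"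
  using assms(1)
proof induction
  case drv_Nil
  have "run 2 (solver cls) (store [] (\<lambda>_. [])) (store [] (\<lambda>_. []))"
    unfolding solver_def numeral_2_eq_2 by (intro run_exit run_Empty run_Nil) auto
  then show ?case by (intro exI[of _ 2]) auto
next
  case (drv_rule h bs \<theta> n gs)
  then obtain m s' where m: "m \<le> 2 + n * (1 + B * (K + 1))"
    "run m (solver cls) (store (concat (map (goal_word code) (map (inst_goal \<theta>) bs @ gs))) (\<lambda>_. [])) s'"
    by blast
  have c: "clause_below nv (h, bs)" "size_bound (h, bs) \<le> B" using assms(2) drv_rule(1) by auto
  obtain k where k: "k \<le> m + size_bound (h, bs) * (K + 1)"
    "run k (clause_prog code as nv (h, bs) @ solver cls)
      (store (goal_word code (inst_goal \<theta> h) @ concat (map (goal_word code) gs)) (\<lambda>_. [])) s'"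
    using run_clause_prog_complete[OF drv_rule(2) c(1), of m "solver cls" "concat (map (goal_word code) gs)" s'] m(2)
    by auto
  have "run (Suc k) (solver cls) (store (concat (map (goal_word code) (inst_goal \<theta> h # gs))) (\<lambda>_. [])) s'"
    unfolding solver_def using k(2) drv_rule(1) by (intro run_iter[of "clause_prog code as nv (h, bs)"]) (auto simp: solver_def)
  moreover have "size_bound (h, bs) * (K + 1) \<le> B * (K + 1)" using c(2) by (rule mult_le_mono1)
  then have "Suc k \<le> 2 + Suc n * (1 + B * (K + 1))" using k(1) m(1) by simp
  ultimately show ?case by blast
qed

text \<open>The input is not yet a goal. It is guessed as variable 0, checked against the input
  stack, which must then be empty, and pushed again in the format of a goal.\<close>

definition main_prog :: "'p \<Rightarrow> ('p, 'a) clause list \<Rightarrow> 'a cell instr list" where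
  "main_prog t cls = guess as 0 @ pops as [V 0] @ Empty 0 # pushes as (pat_syms code (t, [[V 0]])) @
     erase as 0 @ solver cls"

text \<open>With \<open>n = length w\<close> the constants add up from guessing
  \<open>2 * n + 1\<close>, matching \<open>7 * n + 4\<close>, the test \<open>1\<close>, pushing
  \<open>7 * n + 7\<close> and erasing \<open>2 * n + 2\<close>.\<close>

lemma run_main_prog:
  "run n (main_prog t cls) ((\<lambda>_. [])(0 := map Input w)) s' \<longleftrightarrow>
   (\<exists>m. n = m + 18 * length w + 15 \<and> run m (solver cls) (store (goal_word code (t, [w])) (\<lambda>_. [])) s')"
proof -
  have s0: "(\<lambda>_. [])(0 := map Input w) = store (map Input w :: 'a cell list) (\<lambda>_. [])"
    by (auto simp: store_def fun_eq_iff)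
  have *: "run n (main_prog t cls) ((\<lambda>_. [])(0 := map Input w)) s' \<longleftrightarrow> (\<exists>v k. set v \<subseteq> set as \<and> n = k + 2 * length v + 1 \<and>
     run k (pops as [V 0] @ Empty 0 # pushes as (pat_syms code (t, [[V 0]])) @ erase as 0 @ solver cls)
       (store (map Input w) ((\<lambda>_. [])(0 := v))) s')"
    unfolding main_prog_def s0 by (subst run_guess) simp
  have rest: "run k (pops as [V 0] @ Empty 0 # pushes as (pat_syms code (t, [[V 0]])) @ erase as 0 @ solver cls)
       (store (map Input w) ((\<lambda>_. [])(0 := v))) s' \<longleftrightarrow>
     (\<exists>m. v = map Input w \<and> k = m + 16 * length w + 14 \<and> run m (solver cls) (store (goal_word code (t, [w])) (\<lambda>_. [])) s')"
    if v: "set v \<subseteq> set as" for v k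
  proof -
    let ?\<theta> = "(\<lambda>_. [])(0 := v) :: nat \<Rightarrow> 'a cell list"
    have z: "\<forall>i. set (?\<theta> i) \<subseteq> set as" using v by (metis empty_subsetI fun_upd_apply list.set(1))
    have i: "inst ?\<theta> (pat_syms code (t, [[V 0]])) = goal_word code (t, [w])" if "v = map Input w"
      using inst_pat_syms[of "(\<lambda>_. [])(0 := w)" code "(t, [[V 0]])"] that
      by (auto simp: inst_goal_def fun_upd_def if_distrib cong: if_cong)
    have c: "cost ?\<theta> [V 0] = 7 * length v + 4" "cost ?\<theta> (pat_syms code (t, [[V 0]])) = 7 * length v + 7"
      by (auto simp: cost_def pat_syms_def)
    have t0: "?\<theta>(0 := []) = (\<lambda>_. [])" by auto
    show ?thesis
      unfolding run_pops[OF z] run_Empty_iff run_pushes[OF z] run_erase[of ?\<theta> 0, OF z[rule_format]] c t0 using i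
      by (auto simp: t0 intro!: exI[of _ "[]"])
  qed
  show ?thesis
  proof
    assume "\<exists>m. n = m + 18 * length w + 15 \<and> run m (solver cls) (store (goal_word code (t, [w])) (\<lambda>_. [])) s'"
    then obtain m where m: "n = m + 18 * length w + 15" "run m (solver cls) (store (goal_word code (t, [w])) (\<lambda>_. [])) s'"
      by blast
    have v: "set (map Input w) \<subseteq> set as" using as by auto
    show "run n (main_prog t cls) ((\<lambda>_. [])(0 := map Input w)) s'"
      unfolding * using rest[OF v, of "m + 16 * length w + 14"] m v
      by (intro exI[of _ "map Input w"] exI[of _ "m + 16 * length w + 14"]) auto
  qed (use rest in \<open>unfold *, auto\<close>)
qed

lemma uses_guess: "i < nv \<Longrightarrow> uses (nv + 2) (S \<union> set as) (guess as i)"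
  by (auto simp: guess_def)

lemma uses_erase: "i < nv \<Longrightarrow> uses (nv + 2) (S \<union> set as) (erase as i)"
  by (auto simp: erase_def)

lemma uses_pop_sym: "sym_below nv x \<Longrightarrow> (\<forall>c. x = C c \<longrightarrow> c \<in> S \<union> set as) \<Longrightarrow> uses (nv + 2) (S \<union> set as) (pop_sym as x)"
  by (cases x) auto

lemma uses_push_sym: "sym_below nv x \<Longrightarrow> (\<forall>c. x = C c \<longrightarrow> c \<in> S \<union> set as) \<Longrightarrow> uses (nv + 2) (S \<union> set as) (push_sym as x)"
  by (cases x) auto

lemma pat_syms_ok:
  assumes "goal_below nv g" "x \<in> set (pat_syms code g)" "S = {Aux 0, Aux 1} \<union> range (\<lambda>p. Aux (code p + 2))"
  shows "sym_below nv x \<and> (\<forall>c. x = C c \<longrightarrow> c \<in> S \<union> set as)"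
proof -
  have "sym_below nv (map_psym Input y) \<and> (\<forall>c. map_psym Input y = C c \<longrightarrow> c \<in> set as)" if "sym_below nv y" for y :: "'a psym"
    using that as by (cases y) auto
  moreover have "x \<in> C ` S \<or> (\<exists>q\<in>set (snd g). \<exists>y\<in>set q. x = map_psym Input y)"
    using assms(2) unfolding assms(3) pat_syms_def by (auto split: if_splits)
  ultimately show ?thesis using assms(1) unfolding goal_below_def by (elim disjE) auto
qed

lemma uses_main_prog:
  assumes "\<forall>c\<in>set cls. clause_below nv c" "nv \<ge> 1" "S = {Aux 0, Aux 1} \<union> range (\<lambda>p. Aux (code p + 2))"
  shows "uses (nv + 2) (S \<union> set as) (main_prog t cls)"
proof -
  have cl: "uses (nv + 2) (S \<union> set as) (clause_prog code as nv c)" if "c \<in> set cls" for c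
  proof -
    have "goal_below nv (fst c)" "\<forall>g\<in>set (snd c). goal_below nv g"
      using assms(1) that by (auto simp: clause_below_def)
    then show ?thesis unfolding clause_prog_def pops_def pushes_def
      by (auto simp del: add_2_eq_Suc' intro!: uses_guess uses_erase uses_pop_sym uses_push_sym dest: pat_syms_ok[OF _ _ assms(3)])
  qed
  have t: "goal_below nv (t, [[V 0 :: 'a psym]])" using assms(2) by (simp add: goal_below_def)
  have "uses (nv + 2) (S \<union> set as) (solver cls)" using cl by (simp add: solver_def)
  moreover have "uses (nv + 2) (S \<union> set as) (pushes as (pat_syms code (t, [[V 0]])))"
    unfolding pushes_def using pat_syms_ok[OF t _ assms(3)] by (auto simp del: add_2_eq_Suc' intro!: uses_push_sym)
  moreover have "uses (nv + 2) (S \<union> set as) (pops as [V 0])"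
    unfolding pops_def using assms(2) by (auto simp del: pop_sym.simps add_2_eq_Suc' intro!: uses_pop_sym)
  ultimately show ?thesis using assms(2) uses_guess[of 0 S] uses_erase[of 0 S] by (simp add: main_prog_def)
qed

end

text \<open>\<open>sem\<close> may be any interpretation closed under the rules, so that it holds
  for every derivable goal. Completeness is asked separately, only for goals \<open>(t, [w])\<close>
  and with polynomial bounds on both the words and the number of rule applications.\<close>

theorem logic_program_in_NP:
  fixes cls :: "('p::finite, 'a::finite) clause list" and K q :: "nat poly"
  assumes rules: "\<And>c \<theta>. c \<in> set cls \<Longrightarrow> \<forall>b\<in>set (snd c). sem (inst_goal \<theta> b) \<Longrightarrow> sem (inst_goal \<theta> (fst c))"
    and sound: "\<And>w. sem (t, [w]) \<Longrightarrow> w \<in> L"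
    and complete: "\<And>w. w \<in> L \<Longrightarrow> \<exists>n\<le>poly q (length w). drv (set cls) (poly K (length w)) n [(t, [w])]"
  shows "in_NP L"
proof -
  obtain code :: "'p \<Rightarrow> nat" where code: "inj code"
    using finite_imp_inj_to_nat_seg[OF finite_UNIV] by blast
  obtain as where as: "set as = (Input ` UNIV :: 'a cell set)"
    using finite_list[of "Input ` (UNIV :: 'a set)"] by auto
  obtain nv where nv: "nv \<ge> 1" "\<forall>c\<in>set cls. clause_below nv c" using clauses_below_ex by blast
  define S where "S = {Aux 0, Aux 1} \<union> range (\<lambda>p. Aux (code p + 2) :: 'a cell)"
  have S: "finite (S \<union> set as)" "Blank \<notin> S \<union> set as" "Input ` UNIV \<subseteq> S \<union> set as"
    by (auto simp: S_def as)
  obtain T :: "'a ntm" where T: "is_ntm T"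
    "\<And>w n. accepts_in T w n \<Longrightarrow> \<exists>m s'. run m (main_prog code as nv t cls) ((\<lambda>_. [])(0 := map Input w)) s'"
    "\<And>w m s'. run m (main_prog code as nv t cls) ((\<lambda>_. [])(0 := map Input w)) s' \<Longrightarrow> \<exists>n\<le>2 * m. accepts_in T w n"
    using program_machine[OF S(1,2) uses_main_prog[OF code as nv(2,1) S_def] _ S(3), of t] by auto
  define B where "B = (\<Sum>c\<leftarrow>cls. size_bound code nv c)"
  have B: "\<forall>c\<in>set cls. clause_below nv c \<and> size_bound code nv c \<le> B"
    using nv(2) by (auto simp: B_def intro: member_le_sum_list)
  have LT: "w \<in> L" if acc: "accepts_in T w n" for w n
  proof -
    obtain m s' where m: "run m (solver code as nv cls) (store (goal_word code (t, [w])) (\<lambda>_. [])) s'"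
      using T(2)[OF acc] unfolding run_main_prog[OF code as] by blast
    show ?thesis
      using run_solver_sound[OF code as, of cls sem m nv "[(t, [w])]" s'] rules m sound by simp
  qed
  \<comment> \<open>The 17 is the 15 of \<open>run_main_prog\<close> plus the 2 of
    \<open>run_solver_complete\<close>; the outer factor 2 is the slowdown of the machine.\<close>
  define p where "p = [:2:] * ([:17:] + [:0, 18:] + q * ([:1:] + [:B:] * (K + [:1:])))"
  have TL: "\<exists>n\<le>poly p (length w). accepts_in T w n" if w: "w \<in> L" for w
  proof -
    obtain n where n: "n \<le> poly q (length w)" "drv (set cls) (poly K (length w)) n [(t, [w])]"
      using complete[OF w] by blast
    let ?k = "poly K (length w)"
    obtain m s' where m: "m \<le> 2 + n * (1 + B * (?k + 1))"
      "run m (solver code as nv cls) (store (goal_word code (t, [w])) (\<lambda>_. [])) s'"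
      using run_solver_complete[OF code as n(2) B] by auto
    have "run (m + 18 * length w + 15) (main_prog code as nv t cls) ((\<lambda>_. [])(0 := map Input w)) s'"
      unfolding run_main_prog[OF code as] using m(2) by blast
    then obtain r where r: "r \<le> 2 * (m + 18 * length w + 15)" "accepts_in T w r" using T(3) by blast
    have "n * (1 + B * (?k + 1)) \<le> poly q (length w) * (1 + B * (?k + 1))"
      using n(1) by (rule mult_le_mono1)
    then have "r \<le> poly p (length w)" using r(1) m(1) by (simp add: p_def)
    then show ?thesis using r(2) by blast
  qed
  show ?thesis unfolding in_NP_def ntm_language_def using T(1) LT TL by blast
qed


section \<open>Small solutions of linear systems\<close>

text \<open>The ratio test of the simplex method: moving from \<open>x\<close> against
  \<open>z\<close> until the first coordinate reaches 0 keeps the equations and the signs and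
  removes a coordinate from the support.\<close>

lemma reduce_support:
  fixes A :: "'i \<Rightarrow> 'j \<Rightarrow> real"
  assumes J: "finite J" and x: "\<forall>j\<in>J. x j \<ge> 0" "\<forall>i\<in>I. (\<Sum>j\<in>J. A i j * x j) = b i"
    and z: "\<forall>j\<in>J. x j = 0 \<longrightarrow> z j = 0" "\<forall>i\<in>I. (\<Sum>j\<in>J. A i j * z j) = 0" and k: "k \<in> J" "z k > 0"
  shows "\<exists>x'. (\<forall>j\<in>J. x' j \<ge> 0) \<and> (\<forall>i\<in>I. (\<Sum>j\<in>J. A i j * x' j) = b i) \<and>
     card {j\<in>J. x' j \<noteq> 0} < card {j\<in>J. x j \<noteq> 0}"
proof -
  let ?P = "{j\<in>J. z j > 0}"
  define t where "t = Min ((\<lambda>j. x j / z j) ` ?P)"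
  have fin: "finite ((\<lambda>j. x j / z j) ` ?P)" "(\<lambda>j. x j / z j) ` ?P \<noteq> {}" using J k by auto
  obtain l where l: "l \<in> ?P" "t = x l / z l" using Min_in[OF fin] unfolding t_def by auto
  have tle: "t \<le> x j / z j" if "j \<in> ?P" for j unfolding t_def using fin that by (intro Min_le) auto
  have t0: "t \<ge> 0" using l x(1) by simp
  define x' where "x' = (\<lambda>j. x j - t * z j)"
  have "x' j \<ge> 0" if j: "j \<in> J" for j
  proof (cases "z j > 0")
    case True
    then have "t \<le> x j / z j" using tle j by simp
    then show ?thesis using True by (simp add: x'_def field_simps)
  next
    case False
    then have "t * z j \<le> 0" using t0 by (simp add: mult_nonneg_nonpos)
    moreover have "x j \<ge> 0" using x(1) j by simp
    ultimately show ?thesis by (simp add: x'_def)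
  qed
  moreover have "(\<Sum>j\<in>J. A i j * x' j) = b i" if "i \<in> I" for i
  proof -
    have "(\<Sum>j\<in>J. A i j * x' j) = (\<Sum>j\<in>J. A i j * x j) - t * (\<Sum>j\<in>J. A i j * z j)"
      by (simp add: x'_def algebra_simps sum_subtractf sum_distrib_left)
    then show ?thesis using x z that by simp
  qed
  moreover have "{j\<in>J. x' j \<noteq> 0} \<subset> {j\<in>J. x j \<noteq> 0}"
  proof
    show "{j\<in>J. x' j \<noteq> 0} \<subseteq> {j\<in>J. x j \<noteq> 0}" using z(1) by (auto simp: x'_def)
    have "x' l = 0" "x l \<noteq> 0" "l \<in> J" using l z(1) by (auto simp: x'_def)
    then show "{j\<in>J. x' j \<noteq> 0} \<noteq> {j\<in>J. x j \<noteq> 0}" by auto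
  qed
  then have "card {j\<in>J. x' j \<noteq> 0} < card {j\<in>J. x j \<noteq> 0}" using J by (intro psubset_card_mono) auto
  ultimately show ?thesis by blast
qed

text \<open>A solution of least support is a basic one: a non-zero kernel vector on its support, or
  its negative, would have a positive coordinate, and \<open>reduce_support\<close> would shrink the
  support further.\<close>

lemma minimal_support_solution:
  fixes A :: "'i \<Rightarrow> 'j \<Rightarrow> real"
  assumes J: "finite J" and x: "\<forall>j\<in>J. x j \<ge> 0" "\<forall>i\<in>I. (\<Sum>j\<in>J. A i j * x j) = b i"
  shows "\<exists>x'. (\<forall>j\<in>J. x' j \<ge> 0) \<and> (\<forall>i\<in>I. (\<Sum>j\<in>J. A i j * x' j) = b i) \<and>
    (\<forall>z. (\<forall>j\<in>J. x' j = 0 \<longrightarrow> z j = 0) \<longrightarrow> (\<forall>i\<in>I. (\<Sum>j\<in>J. A i j * z j) = 0) \<longrightarrow> (\<forall>j\<in>J. z j = 0))"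
proof -
  let ?P = "\<lambda>x. (\<forall>j\<in>J. x j \<ge> 0) \<and> (\<forall>i\<in>I. (\<Sum>j\<in>J. A i j * x j) = b i)"
  obtain x' where x': "?P x'" "\<forall>y. ?P y \<longrightarrow> card {j\<in>J. x' j \<noteq> 0} \<le> card {j\<in>J. y j \<noteq> 0}"
    using ex_has_least_nat[of ?P x "\<lambda>x. card {j\<in>J. x j \<noteq> 0}"] x by blast
  have "\<forall>j\<in>J. z j = 0" if z: "\<forall>j\<in>J. x' j = 0 \<longrightarrow> z j = 0" "\<forall>i\<in>I. (\<Sum>j\<in>J. A i j * z j) = 0" for z
  proof (rule ccontr)
    assume "\<not> (\<forall>j\<in>J. z j = 0)"
    then obtain k where k: "k \<in> J" "z k > 0 \<or> - z k > 0" by force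
    have neg: "\<forall>j\<in>J. x' j = 0 \<longrightarrow> - z j = 0" "\<forall>i\<in>I. (\<Sum>j\<in>J. A i j * - z j) = 0"
      using z by (auto simp: sum_negf)
    from k(2) have "\<exists>y. ?P y \<and> card {j\<in>J. y j \<noteq> 0} < card {j\<in>J. x' j \<noteq> 0}"
      using reduce_support[OF J _ _ z k(1), of b] reduce_support[OF J _ _ neg k(1), of b] x'(1) by blast
    then show False using x'(2) by (meson leD)
  qed
  then show ?thesis using x'(1) by (intro exI[of _ x']) simp
qed

text \<open>Leibniz expansion into \<open>n!\<close> products of \<open>n\<close> entries. The bound
  is crude, but its number of digits is polynomial in \<open>n\<close> and the number of digits of
  \<open>c\<close>.\<close>

lemma abs_det_le:
  fixes A :: "int mat"
  assumes A: "A \<in> carrier_mat n n" and c: "\<And>i j. i < n \<Longrightarrow> j < n \<Longrightarrow> \<bar>A $$ (i, j)\<bar> \<le> c"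
  shows "\<bar>det A\<bar> \<le> fact n * c ^ n"
proof -
  have "\<bar>det A\<bar> \<le> (\<Sum>p\<in>{p. p permutes {0..<n}}. \<bar>signof p * (\<Prod>i = 0..<n. A $$ (i, p i))\<bar>)"
    unfolding det_def'[OF A] by (rule sum_abs)
  also have "\<dots> \<le> (\<Sum>p\<in>{p. p permutes {0..<n}}. c ^ n)"
  proof (rule sum_mono)
    fix p assume "p \<in> {p. p permutes {0..<n}}"
    then have p: "p i < n" if "i < n" for i using that permutes_in_image[of p "{0..<n}" i] by simp
    have "\<bar>signof p * (\<Prod>i = 0..<n. A $$ (i, p i))\<bar> = (\<Prod>i = 0..<n. \<bar>A $$ (i, p i)\<bar>)"
      by (simp add: abs_mult sign_def abs_prod)
    also have "\<dots> \<le> (\<Prod>i = 0..<n. c)" using c p by (intro prod_mono) auto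
    finally show "\<bar>signof p * (\<Prod>i = 0..<n. A $$ (i, p i))\<bar> \<le> c ^ n" by simp
  qed
  also have "\<dots> = fact n * c ^ n" by (simp add: card_permutations)
  finally show ?thesis .
qed

text \<open>A bound for determinants of order at most \<open>n\<close> whose entries are sums of
  \<open>m\<close> products of two numbers up to \<open>M\<close>. The summand 1 keeps the base
  positive for \<open>m = 0\<close>, so that the bound is monotone in \<open>n\<close>.\<close>

definition solution_bound :: "nat \<Rightarrow> nat \<Rightarrow> nat \<Rightarrow> nat" where
  "solution_bound m n M = fact n * ((m + 1) * M ^ 2) ^ n"

text \<open>The columns belonging to a solution of minimal support are linearly independent, so that
  solution is determined by Cramer's rule from the invertible Gram matrix of these columns.\<close>

lemma small_solution:
  fixes A :: "'i \<Rightarrow> 'j \<Rightarrow> int" and x :: "'j \<Rightarrow> real"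
  assumes I: "finite I" and J: "finite J" and x: "\<forall>j\<in>J. x j \<ge> 0" "\<forall>i\<in>I. (\<Sum>j\<in>J. of_int (A i j) * x j) = of_int (b i)"
    and M: "\<forall>i\<in>I. \<forall>j\<in>J. \<bar>A i j\<bar> \<le> int M" "\<forall>i\<in>I. \<bar>b i\<bar> \<le> int M" "M \<ge> 1"
  shows "\<exists>D X. D > 0 \<and> (\<forall>i\<in>I. (\<Sum>j\<in>J. A i j * int (X j)) = int D * b i) \<and>
     D \<le> solution_bound (card I) (card J) M \<and> (\<forall>j\<in>J. X j \<le> solution_bound (card I) (card J) M)"
proof -
  obtain y :: "'j \<Rightarrow> real" where y: "\<forall>j\<in>J. y j \<ge> 0" "\<forall>i\<in>I. (\<Sum>j\<in>J. of_int (A i j) * y j) = of_int (b i)"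
    and indep: "\<And>z. \<forall>j\<in>J. y j = 0 \<longrightarrow> z j = 0 \<Longrightarrow> \<forall>i\<in>I. (\<Sum>j\<in>J. of_int (A i j) * z j) = (0::real) \<Longrightarrow> \<forall>j\<in>J. z j = 0"
    using minimal_support_solution[OF J x] by blast
  define S where "S = {j\<in>J. y j \<noteq> 0}"
  define n where "n = card S"
  have S: "finite S" "S \<subseteq> J" using J by (auto simp: S_def)
  obtain h where h: "bij_betw h {0..<n} S" using ex_bij_betw_nat_finite[OF S(1)] n_def by auto
  have hS: "h k \<in> S" "h k \<in> J" if "k < n" for k using h that S(2) by (auto simp: bij_betw_def)
  have sumS: "(\<Sum>j\<in>J. f j * z j) = (\<Sum>k = 0..<n. f (h k) * z (h k))" if "\<forall>j\<in>J. y j = 0 \<longrightarrow> z j = 0" for f z :: "'j \<Rightarrow> real"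
  proof -
    have "(\<Sum>j\<in>J. f j * z j) = (\<Sum>j\<in>S. f j * z j)"
      using J S that by (intro sum.mono_neutral_right) (auto simp: S_def)
    also have "\<dots> = (\<Sum>k = 0..<n. f (h k) * z (h k))"
      using sum.reindex_bij_betw[OF h, of "\<lambda>j. f j * z j"] by simp
    finally show ?thesis .
  qed
  define G where "G = mat n n (\<lambda>(k, l). \<Sum>i\<in>I. A i (h k) * A i (h l))"
  define c where "c = vec n (\<lambda>k. \<Sum>i\<in>I. A i (h k) * b i)"
  let ?G = "map_mat real_of_int G"
  have G: "G \<in> carrier_mat n n" by (simp add: G_def)
  then have G': "?G \<in> carrier_mat n n" by simp
  have Gv: "(?G *\<^sub>v vec n v) $ k = (\<Sum>i\<in>I. of_int (A i (h k)) * (\<Sum>l = 0..<n. of_int (A i (h l)) * v l))"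
    if "k < n" for k v
  proof -
    have "(?G *\<^sub>v vec n v) $ k = (\<Sum>l = 0..<n. \<Sum>i\<in>I. of_int (A i (h k)) * of_int (A i (h l)) * v l)"
      using that by (simp add: G_def scalar_prod_def sum_distrib_right)
    also have "\<dots> = (\<Sum>i\<in>I. \<Sum>l = 0..<n. of_int (A i (h k)) * of_int (A i (h l)) * v l)"
      by (rule sum.swap)
    finally show ?thesis by (simp add: sum_distrib_left mult.assoc)
  qed
  \<comment> \<open>If \<open>G v = 0\<close>, then the squared norm of \<open>A v\<close> equals
    \<open>v G v = 0\<close>, so \<open>A v = 0\<close>. Extended by zeros, \<open>v\<close> is a
    kernel vector on the support and must vanish.\<close>
  have "det G \<noteq> 0"
  proof
    assume "det G = 0"
    then have "det ?G = 0" by (simp add: of_int_hom.hom_det)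
    then obtain v where v: "v \<in> carrier_vec n" "v \<noteq> 0\<^sub>v n" "?G *\<^sub>v v = 0\<^sub>v n"
      using det_0_iff_vec_prod_zero_field[OF G'] by blast
    define w where "w = (\<lambda>i. \<Sum>l = 0..<n. of_int (A i (h l)) * v $ l)"
    have "(\<Sum>i\<in>I. w i * w i) = (\<Sum>k = 0..<n. v $ k * (\<Sum>i\<in>I. of_int (A i (h k)) * w i))"
    proof -
      have "(\<Sum>i\<in>I. w i * w i) = (\<Sum>i\<in>I. \<Sum>k = 0..<n. of_int (A i (h k)) * v $ k * w i)"
        by (subst (2) w_def) (simp add: sum_distrib_left ac_simps)
      also have "\<dots> = (\<Sum>k = 0..<n. \<Sum>i\<in>I. of_int (A i (h k)) * v $ k * w i)"
        by (rule sum.swap)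
      finally show ?thesis by (simp add: sum_distrib_left ac_simps)
    qed
    also have "\<dots> = (\<Sum>k = 0..<n. v $ k * (?G *\<^sub>v v) $ k)"
    proof -
      have "vec n (($) v) = v" using v(1) by auto
      then show ?thesis using Gv[of _ "($) v"] by (simp add: w_def)
    qed
    also have "\<dots> = 0" using v by simp
    finally have w0: "\<forall>i\<in>I. w i = 0" using I by (simp add: sum_nonneg_eq_0_iff)
    define z where "z = (\<lambda>j. if j \<in> S then v $ (inv_into {0..<n} h j) else 0)"
    have zh: "z (h k) = v $ k" if "k < n" for k
      using that h hS by (simp add: z_def bij_betw_def inv_into_f_f)
    have z0: "\<forall>j\<in>J. y j = 0 \<longrightarrow> z j = 0" by (simp add: z_def S_def)
    have "\<forall>i\<in>I. (\<Sum>j\<in>J. of_int (A i j) * z j) = (0::real)"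
      using w0 sumS[OF z0] by (simp add: w_def zh)
    then have "\<forall>j\<in>J. z j = 0" using indep z0 by blast
    then have "v = 0\<^sub>v n" using zh hS v(1) by (intro eq_vecI) force+
    then show False using v(2) by simp
  qed
  define u where "u = vec n (\<lambda>k. y (h k))"
  have Gu: "?G *\<^sub>v u = map_vec real_of_int c"
  proof (rule eq_vecI)
    fix k assume "k < dim_vec (map_vec real_of_int c)"
    then have k: "k < n" by (simp add: c_def)
    have "(\<Sum>l = 0..<n. of_int (A i (h l)) * y (h l)) = of_int (b i)" if "i \<in> I" for i
      using sumS[of y "\<lambda>j. of_int (A i j)"] y(2) that by simp
    then show "(?G *\<^sub>v u) $ k = map_vec real_of_int c $ k"
      unfolding u_def Gv[OF k] using k by (simp add: c_def)
  qed (simp add: c_def G_def)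
  \<comment> \<open>Absolute values are harmless: since \<open>y\<close> is nonnegative, Cramer's
    rule gives the absolute value of this determinant as \<open>y j\<close> times that of
    \<open>det G\<close>.\<close>
  define X where "X = (\<lambda>j. if j \<in> S then nat \<bar>det (replace_col G c (inv_into {0..<n} h j))\<bar> else 0)"
  define D where "D = nat \<bar>det G\<bar>"
  have Xh: "X (h k) = nat \<bar>det (replace_col G c k)\<bar>" if "k < n" for k
    using that h hS by (simp add: X_def bij_betw_def inv_into_f_f)
  have XD: "real (X j) = real D * y j" if "j \<in> J" for j
  proof (cases "j \<in> S")
    case True
    then obtain k where k: "k < n" "j = h k" using h by (auto simp: bij_betw_def)
    have "real_of_int (det (replace_col G c k)) = det (replace_col ?G (?G *\<^sub>v u) k)"
      unfolding Gu of_int_hom.hom_det[symmetric]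
      by (rule arg_cong[where f = det]) (auto simp: replace_col_def G_def c_def)
    also have "\<dots> = u $ k * det ?G" by (rule cramer_lemma_mat[OF G' _ k(1)]) (simp add: u_def)
    finally have "\<bar>real_of_int (det (replace_col G c k))\<bar> = y j * \<bar>real_of_int (det G)\<bar>"
      using k y(1) that by (simp add: u_def abs_mult of_int_hom.hom_det)
    then show ?thesis using Xh[OF k(1)] k(2) by (simp add: D_def)
  next
    case False
    then show ?thesis using that by (simp add: X_def S_def)
  qed
  have "D > 0" using \<open>det G \<noteq> 0\<close> by (simp add: D_def)
  moreover have "(\<Sum>j\<in>J. A i j * int (X j)) = int D * b i" if "i \<in> I" for i
  proof -
    have "real_of_int (\<Sum>j\<in>J. A i j * int (X j)) = real D * (\<Sum>j\<in>J. of_int (A i j) * y j)"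
      by (simp add: XD sum_distrib_left ac_simps)
    also have "\<dots> = real_of_int (int D * b i)" using y(2) that by simp
    finally show ?thesis by linarith
  qed
  moreover define cc where "cc = (card I + 1) * M ^ 2"
  have cc1: "cc \<ge> 1" using M(3) by (simp add: cc_def Suc_le_eq)
  have prod_le: "\<bar>p * q\<bar> \<le> int (M ^ 2)" if "\<bar>p\<bar> \<le> int M" "\<bar>q\<bar> \<le> int M" for p q :: int
    using that by (simp add: abs_mult power2_eq_square mult_mono)
  have ent: "\<bar>\<Sum>i\<in>I. p i * q i\<bar> \<le> int cc" if "\<forall>i\<in>I. \<bar>p i\<bar> \<le> int M" "\<forall>i\<in>I. \<bar>q i\<bar> \<le> int M" for p q :: "'i \<Rightarrow> int"
  proof -
    have "\<bar>\<Sum>i\<in>I. p i * q i\<bar> \<le> (\<Sum>i\<in>I. \<bar>p i * q i\<bar>)" by (rule sum_abs)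
    also have "\<dots> \<le> (\<Sum>i\<in>I. int (M ^ 2))" using that prod_le by (intro sum_mono) blast
    also have "\<dots> \<le> int cc" by (simp add: cc_def algebra_simps)
    finally show ?thesis .
  qed
  have Gle: "\<bar>G $$ (k, l)\<bar> \<le> int cc" if "k < n" "l < n" for k l
    using that hS M(1) by (auto simp: G_def intro!: ent)
  have cle: "\<bar>c $ k\<bar> \<le> int cc" if "k < n" for k
    using that hS M(1,2) by (auto simp: c_def intro!: ent)
  have nJ: "n \<le> card J" unfolding n_def using J S(2) by (rule card_mono)
  have bd: "nat z \<le> solution_bound (card I) (card J) M" if "z \<le> fact n * int cc ^ n" for z
  proof -
    have "nat z \<le> nat (int (fact n * cc ^ n))" using that by (intro nat_mono) simp
    also have "\<dots> \<le> fact (card J) * cc ^ card J"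
      unfolding nat_int using nJ cc1 by (intro mult_mono fact_mono_nat power_increasing) auto
    finally show ?thesis by (simp add: solution_bound_def cc_def)
  qed
  have "D \<le> solution_bound (card I) (card J) M" unfolding D_def
    using abs_det_le[OF G, of "int cc"] Gle by (intro bd) auto
  moreover have "X j \<le> solution_bound (card I) (card J) M" if "j \<in> J" for j
  proof (cases "j \<in> S")
    case True
    then obtain k where k: "k < n" "j = h k" using h by (auto simp: bij_betw_def)
    have R: "replace_col G c k \<in> carrier_mat n n" by (simp add: replace_col_def G_def)
    have "\<bar>det (replace_col G c k)\<bar> \<le> fact n * int cc ^ n"
      using Gle cle G by (intro abs_det_le[OF R]) (auto simp: replace_col_def)
    then show ?thesis using Xh[OF k(1)] k(2) bd by simp
  qed (simp add: X_def)
  ultimately show ?thesis by blast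
qed

text \<open>One slack variable per inequality turns the system into equations, which is why
  \<open>card I\<close> is added to the number of columns. The slack values are dropped at the
  end.\<close>

lemma small_solution_ineq:
  fixes A :: "'i \<Rightarrow> 'j \<Rightarrow> int" and x :: "'j \<Rightarrow> real"
  assumes I: "finite I" and J: "finite J" and x: "\<forall>j\<in>J. x j \<ge> 0" "\<forall>i\<in>I. (\<Sum>j\<in>J. of_int (A i j) * x j) \<le> of_int (b i)"
    and M: "\<forall>i\<in>I. \<forall>j\<in>J. \<bar>A i j\<bar> \<le> int M" "\<forall>i\<in>I. \<bar>b i\<bar> \<le> int M" "M \<ge> 1"
  shows "\<exists>D X. D > 0 \<and> (\<forall>i\<in>I. (\<Sum>j\<in>J. A i j * int (X j)) \<le> int D * b i) \<and>
     D \<le> solution_bound (card I) (card J + card I) M \<and> (\<forall>j\<in>J. X j \<le> solution_bound (card I) (card J + card I) M)"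
proof -
  let ?J = "Inl ` J \<union> Inr ` I :: ('j + 'i) set"
  define A' where "A' = (\<lambda>i. case_sum (A i) (\<lambda>k. if k = i then 1 else 0))"
  define x' where "x' = case_sum x (\<lambda>i. of_int (b i) - (\<Sum>j\<in>J. of_int (A i j) * x j))"
  have card: "card ?J = card J + card I"
    using I J by (subst card_Un_disjoint) (auto simp: card_image)
  have sum': "(\<Sum>j\<in>?J. f j) = (\<Sum>j\<in>J. f (Inl j)) + (\<Sum>i\<in>I. f (Inr i))" for f :: "'j + 'i \<Rightarrow> 'z::comm_monoid_add"
    using I J by (subst sum.union_disjoint) (auto simp: sum.reindex)
  have slack: "(\<Sum>k\<in>I. A' i (Inr k) * f k) = f i" if "i \<in> I" for i and f :: "'i \<Rightarrow> int"
  proof -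
    have "(\<Sum>k\<in>I. A' i (Inr k) * f k) = (\<Sum>k\<in>I. if k = i then f k else 0)"
      by (intro sum.cong) (auto simp: A'_def)
    then show ?thesis using I that by simp
  qed
  have slack': "(\<Sum>k\<in>I. of_int (A' i (Inr k)) * f k) = f i" if "i \<in> I" for i and f :: "'i \<Rightarrow> real"
  proof -
    have "(\<Sum>k\<in>I. of_int (A' i (Inr k)) * f k) = (\<Sum>k\<in>I. if k = i then f k else 0)"
      by (intro sum.cong) (auto simp: A'_def)
    then show ?thesis using I that by simp
  qed
  have "\<exists>D X. D > 0 \<and> (\<forall>i\<in>I. (\<Sum>j\<in>?J. A' i j * int (X j)) = int D * b i) \<and>
     D \<le> solution_bound (card I) (card ?J) M \<and> (\<forall>j\<in>?J. X j \<le> solution_bound (card I) (card ?J) M)"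
  proof (rule small_solution)
    show "\<forall>j\<in>?J. x' j \<ge> 0" using x by (auto simp: x'_def)
    show "\<forall>i\<in>I. (\<Sum>j\<in>?J. of_int (A' i j) * x' j) = of_int (b i)"
      unfolding sum' using slack'[of _ "\<lambda>i. x' (Inr i)"] by (simp add: x'_def A'_def)
    show "\<forall>i\<in>I. \<forall>j\<in>?J. \<bar>A' i j\<bar> \<le> int M" using M by (auto simp: A'_def)
  qed (use I J M in auto)
  then obtain D X where X: "D > 0" "\<forall>i\<in>I. (\<Sum>j\<in>?J. A' i j * int (X j)) = int D * b i"
     "D \<le> solution_bound (card I) (card ?J) M" "\<forall>j\<in>?J. X j \<le> solution_bound (card I) (card ?J) M" by blast
  have "(\<Sum>j\<in>J. A i j * int (X (Inl j))) \<le> int D * b i" if "i \<in> I" for i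
  proof -
    have "(\<Sum>j\<in>J. A i j * int (X (Inl j))) + int (X (Inr i)) = int D * b i"
      using X(2) that slack[OF that, of "\<lambda>i. int (X (Inr i))"] unfolding sum' by (auto simp: A'_def)
    then show ?thesis by linarith
  qed
  then show ?thesis using X unfolding card by (intro exI[of _ D] exI[of _ "\<lambda>j. X (Inl j)"]) auto
qed

section \<open>Farkas' lemma and bounded polyhedra\<close>

definition lin :: "nat \<Rightarrow> (nat \<Rightarrow> real) \<Rightarrow> (nat \<Rightarrow> real) \<Rightarrow> real" where
  "lin n a x = (\<Sum>j<n. a j * x j)"

lemma lin_left: "lin n (\<lambda>j. a j - c * b j) x = lin n a x - c * lin n b x"
  by (simp add: lin_def algebra_simps sum_subtractf sum_distrib_left)

lemma lin_right: "lin n a (\<lambda>j. x j - c * y j) = lin n a x - c * lin n a y"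
  by (simp add: lin_def algebra_simps sum_subtractf sum_distrib_left)

text \<open>The elimination step is that of Bartl: if the last inequality is not redundant, then subtracting
  suitable multiples of it removes it from the system.\<close>

lemma farkas:
  fixes a :: "nat \<Rightarrow> nat \<Rightarrow> real"
  assumes "\<And>x. \<forall>i<m. lin n (a i) x \<le> 0 \<Longrightarrow> lin n b x \<le> 0"
  shows "\<exists>y. (\<forall>i<m. y i \<ge> 0) \<and> (\<forall>j<n. b j = (\<Sum>i<m. y i * a i j))"
  using assms
proof (induction m arbitrary: a b)
  case 0
  \<comment> \<open>Without inequalities the assumption applies to \<open>x = b\<close>, which
    forces \<open>b = 0\<close>.\<close>
  have "lin n b b \<le> 0" using 0 by simp
  then have "\<forall>j<n. b j * b j = 0"
    unfolding lin_def using sum_nonneg_eq_0_iff[of "{..<n}" "\<lambda>j. b j * b j"] by (simp add: antisym sum_nonneg)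
  then show ?case by auto
next
  case (Suc m)
  show ?case
  proof (cases "\<forall>x. (\<forall>i<m. lin n (a i) x \<le> 0) \<longrightarrow> lin n b x \<le> 0")
    case True
    then obtain y where y: "\<forall>i<m. y i \<ge> 0" "\<forall>j<n. b j = (\<Sum>i<m. y i * a i j)"
      using Suc.IH[of a b] by blast
    then show ?thesis by (intro exI[of _ "y(m := 0)"]) (auto simp: less_Suc_eq)
  next
    case False
    then obtain x1 where x1: "\<forall>i<m. lin n (a i) x1 \<le> 0" "lin n b x1 > 0" by force
    define s where "s = lin n (a m) x1"
    have s: "s > 0" using Suc.prems[of x1] x1 by (force simp: s_def less_Suc_eq)
    \<comment> \<open>Normalised so that the last functional takes the value 1 at \<open>x0\<close>.
      Subtracting \<open>lin n (a m) x\<close> times \<open>x0\<close> then projects any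
      \<open>x\<close> to the hyperplane on which this functional vanishes.\<close>
    define x0 where "x0 = (\<lambda>j. x1 j / s)"
    have scale: "lin n c x0 = lin n c x1 / s" for c
      by (simp add: lin_def x0_def sum_divide_distrib)
    have x0: "\<forall>i<m. lin n (a i) x0 \<le> 0" "lin n b x0 > 0" "lin n (a m) x0 = 1"
      using x1 s by (auto simp: scale divide_nonpos_pos) (simp add: s_def)
    define a' where "a' = (\<lambda>i j. a i j - lin n (a i) x0 * a m j)"
    define b' where "b' = (\<lambda>j. b j - lin n b x0 * a m j)"
    have "lin n b' x \<le> 0" if "\<forall>i<m. lin n (a' i) x \<le> 0" for x
    proof -
      let ?x = "\<lambda>j. x j - lin n (a m) x * x0 j"
      have "lin n (a i) ?x = lin n (a' i) x" for i by (simp add: a'_def lin_left lin_right)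
      moreover have "lin n (a m) ?x = 0" using x0(3) by (simp add: lin_right)
      ultimately have "\<forall>i<Suc m. lin n (a i) ?x \<le> 0" using that by (auto simp: less_Suc_eq)
      then have "lin n b ?x \<le> 0" using Suc.prems by blast
      moreover have "lin n b ?x = lin n b' x" by (simp add: b'_def lin_left lin_right)
      ultimately show ?thesis by simp
    qed
    then obtain y where y: "\<forall>i<m. y i \<ge> 0" "\<forall>j<n. b' j = (\<Sum>i<m. y i * a' i j)"
      using Suc.IH[of a' b'] by blast
    \<comment> \<open>The multiplier of the last inequality balances the multiples of
      \<open>a m\<close> that were subtracted from \<open>b\<close> and from the other rows.\<close>
    define t where "t = lin n b x0 - (\<Sum>i<m. y i * lin n (a i) x0)"
    have "(\<Sum>i<m. y i * lin n (a i) x0) \<le> 0" using y(1) x0(1) by (intro sum_nonpos) (simp add: mult_nonneg_nonpos)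
    then have t: "t \<ge> 0" using x0(2) by (simp add: t_def)
    have "b j = (\<Sum>i<Suc m. (y(m := t)) i * a i j)" if "j < n" for j
    proof -
      have "b j = (\<Sum>i<m. y i * a' i j) + lin n b x0 * a m j" using y(2)[rule_format, OF that] unfolding b'_def by linarith
      also have "(\<Sum>i<m. y i * a' i j) = (\<Sum>i<m. y i * a i j) - (\<Sum>i<m. y i * lin n (a i) x0) * a m j"
        by (simp add: a'_def algebra_simps sum_subtractf sum_distrib_left sum_distrib_right)
      finally show ?thesis by (simp add: t_def algebra_simps)
    qed
    then show ?thesis using y(1) t by (intro exI[of _ "y(m := t)"]) (auto simp: less_Suc_eq)
  qed
qed

text \<open>A bounded polyhedron is empty, or the inequality \<open>x\<^sub>i \<le> 0\<close> and its negative follow from the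
  homogeneous system for every coordinate; both have Farkas certificates.\<close>

lemma bounded_polyhedron_certificate:
  fixes A :: "nat \<Rightarrow> nat \<Rightarrow> real"
  assumes bounded: "\<And>x i. \<forall>r<k. lin d (A r) x \<le> b r \<Longrightarrow> i < d \<Longrightarrow> \<bar>x i\<bar> \<le> B"
  shows "(\<exists>y. (\<forall>r<k. y r \<ge> 0) \<and> (\<forall>j<d. (\<Sum>r<k. y r * A r j) = 0) \<and> (\<Sum>r<k. y r * b r) = -1) \<or>
    (\<forall>i<d. \<forall>e\<in>{1, -1}. \<exists>y. (\<forall>r<k. y r \<ge> 0) \<and> (\<forall>j<d. (\<Sum>r<k. y r * A r j) = (if j = i then e else 0)))"
proof (cases "\<exists>x. \<forall>r<k. lin d (A r) x \<le> b r")
  case True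
  then obtain x0 where x0: "\<forall>r<k. lin d (A r) x0 \<le> b r" by blast
  have "\<exists>y. (\<forall>r<k. y r \<ge> 0) \<and> (\<forall>j<d. (\<Sum>r<k. y r * A r j) = (if j = i then e else 0))"
    if i: "i < d" and e: "e \<in> {1, -1}" for i and e :: real
  proof -
    have lin_e: "lin d (\<lambda>j. if j = i then e else 0) z = e * z i" for z
    proof -
      have "lin d (\<lambda>j. if j = i then e else 0) z = (\<Sum>j<d. if j = i then e * z j else 0)"
        unfolding lin_def by (intro sum.cong) auto
      then show ?thesis using i by simp
    qed
    have H: "lin d (\<lambda>j. if j = i then e else 0) z \<le> 0" if z: "\<forall>r<k. lin d (A r) z \<le> 0" for z
    proof (rule ccontr)
      assume "\<not> ?thesis"
      then have pos: "e * z i > 0" by (simp add: lin_e)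
      \<comment> \<open>Far enough along the ray that coordinate \<open>i\<close> exceeds
        \<open>B\<close> in absolute value, whatever \<open>x0 i\<close> was.\<close>
      define t where "t = (\<bar>B\<bar> + 1 + \<bar>x0 i\<bar>) / (e * z i)"
      have t: "t > 0" using pos by (simp add: t_def)
      let ?x = "\<lambda>j. x0 j - (- t) * z j"
      have "lin d (A r) ?x \<le> b r" if "r < k" for r
      proof -
        have "lin d (A r) ?x = lin d (A r) x0 + t * lin d (A r) z" by (simp only: lin_right)
        moreover have "t * lin d (A r) z \<le> 0" using t z that by (simp add: mult_nonneg_nonpos)
        ultimately show ?thesis using x0[rule_format, OF that] by linarith
      qed
      then have "\<bar>?x i\<bar> \<le> B" using bounded i by blast
      moreover have "t * (e * z i) = \<bar>B\<bar> + 1 + \<bar>x0 i\<bar>" using pos by (auto simp: t_def)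
      then have "e * ?x i = e * x0 i + (\<bar>B\<bar> + 1 + \<bar>x0 i\<bar>)" by (simp add: algebra_simps)
      moreover have "\<bar>e * ?x i\<bar> = \<bar>?x i\<bar>" "\<bar>e * x0 i\<bar> = \<bar>x0 i\<bar>" using e by auto
      ultimately show False by linarith
    qed
    have "\<exists>y. (\<forall>r<k. y r \<ge> 0) \<and> (\<forall>j<d. (if j = i then e else 0) = (\<Sum>r<k. y r * A r j))"
      by (rule farkas, rule H)
    then obtain y where "\<forall>r<k. y r \<ge> 0" "\<forall>j<d. (if j = i then e else 0) = (\<Sum>r<k. y r * A r j)"
      by (elim exE conjE)
    then show ?thesis by (intro exI[of _ y]) auto
  qed
  then show ?thesis by blast
next
  case False
  \<comment> \<open>Homogenisation: the additional coordinate \<open>d\<close> carries the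
    right-hand sides, and infeasibility means that the homogeneous inequalities never allow it to be
    positive.\<close>
  let ?a = "\<lambda>r j. if j < d then A r j else - b r"
  have lin_Suc: "lin (Suc d) (?a r) z = lin d (A r) z - b r * z d" for r z
  proof -
    have "(\<Sum>j<d. ?a r j * z j) = (\<Sum>j<d. A r j * z j)" by (rule sum.cong) auto
    then show ?thesis by (simp add: lin_def)
  qed
  have H: "lin (Suc d) (\<lambda>j. if j = d then 1 else 0) z \<le> 0" if z: "\<forall>r<k. lin (Suc d) (?a r) z \<le> 0" for z
  proof (rule ccontr)
    have "lin (Suc d) (\<lambda>j. if j = d then 1 else 0) z = z d" by (simp add: lin_def)
    moreover assume "\<not> ?thesis"
    ultimately have p: "z d > 0" by simp
    have "lin d (A r) (\<lambda>j. z j / z d) \<le> b r" if "r < k" for r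
    proof -
      have "lin d (A r) (\<lambda>j. z j / z d) = lin d (A r) z / z d" by (simp add: lin_def sum_divide_distrib)
      moreover have "lin d (A r) z \<le> b r * z d" using z[rule_format, OF that] unfolding lin_Suc by simp
      ultimately show ?thesis using p by (simp add: divide_le_eq)
    qed
    then show False using False by blast
  qed
  have "\<exists>y. (\<forall>r<k. y r \<ge> 0) \<and> (\<forall>j<Suc d. (if j = d then 1 else 0) = (\<Sum>r<k. y r * ?a r j))"
    by (rule farkas, rule H)
  then obtain y where y: "\<forall>r<k. y r \<ge> 0" "\<forall>j<Suc d. (if j = d then 1 else 0) = (\<Sum>r<k. y r * ?a r j)"
    by (elim exE conjE)
  have "(\<Sum>r<k. y r * A r j) = 0" if "j < d" for j using y(2)[rule_format, of j] that by simp
  moreover have "(\<Sum>r<k. y r * b r) = -1" using y(2)[rule_format, of d] by (simp add: sum_negf)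
  ultimately show ?thesis using y(1) by blast
qed


section \<open>Executions and polygons\<close>

lemma zone_set_iff:
  assumes "is_zone d z" "x \<in> carrier_vec d"
  shows "x \<in> zone_set z \<longleftrightarrow> (\<forall>r<dim_row (fst z). (\<Sum>j<d. of_int (fst z $$ (r, j)) * x $ j) \<le> of_int (snd z $ r))"
proof -
  obtain k where k: "fst z \<in> carrier_mat k d" "snd z \<in> carrier_vec k" using assms(1) by (auto simp: is_zone_def)
  then show ?thesis using assms(2)
    by (auto simp: zone_set_def less_eq_vec_def scalar_prod_def lessThan_atLeast0)
qed

text \<open>Time is replaced by the vertices \<open>0..N\<close>, and \<open>F\<close> has to find
  its witness among them. Operators outside the fragment are set to false.\<close>

fun isat :: "(nat \<Rightarrow> real vec) \<Rightarrow> nat \<Rightarrow> nat \<Rightarrow> ltl \<Rightarrow> bool" where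
  "isat P N k TrueF \<longleftrightarrow> True"
| "isat P N k (Zone z) \<longleftrightarrow> P k \<in> zone_set z"
| "isat P N k (Conj \<phi> \<psi>) \<longleftrightarrow> isat P N k \<phi> \<and> isat P N k \<psi>"
| "isat P N k (Disj \<phi> \<psi>) \<longleftrightarrow> isat P N k \<phi> \<or> isat P N k \<psi>"
| "isat P N k (Finally \<phi>) \<longleftrightarrow> (\<exists>k'\<ge>k. k' \<le> N \<and> isat P N k' \<phi>)"
| "isat P N k _ \<longleftrightarrow> False"

text \<open>Negation is absent, so a vertex may be exchanged for another one that lies in at least
  the same zones. This is what allows real step lengths to be replaced by small rational
  ones.\<close>

lemma isat_mono:
  "isat P N k \<phi> \<Longrightarrow> k \<le> N \<Longrightarrow> \<forall>k\<le>N. \<forall>z\<in>zones \<phi>. P k \<in> zone_set z \<longrightarrow> Q k \<in> zone_set z \<Longrightarrow> isat Q N k \<phi>"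
  by (induction \<phi> arbitrary: k) auto

lemma point_at_carrier:
  "is_schedule M \<pi> \<Longrightarrow> M \<subseteq> carrier_vec d \<Longrightarrow> x \<in> carrier_vec d \<Longrightarrow> point_at x \<pi> j \<in> carrier_vec d"
  by (induction j) (auto simp: is_schedule_def intro!: add_carrier_vec)

lemma point_at_index:
  assumes "is_schedule M \<pi>" "M \<subseteq> carrier_vec d" "x \<in> carrier_vec d" "i < d"
  shows "point_at x \<pi> j $ i = x $ i + (\<Sum>p<j. fst (\<pi> p) * snd (\<pi> p) $ i)"
proof (induction j)
  case (Suc j)
  have "snd (\<pi> j) \<in> carrier_vec d" using assms by (auto simp: is_schedule_def)
  then show ?case using Suc point_at_carrier[OF assms(1-3), of j] assms(4) by (auto simp: add.assoc)
qed simp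

lemma time_at_Suc: "time_at \<pi> (Suc j) = time_at \<pi> j + fst (\<pi> j)"
  by (simp add: time_at_def)

lemma time_at_strict_mono: "is_schedule M \<pi> \<Longrightarrow> i < j \<Longrightarrow> time_at \<pi> i < time_at \<pi> j"
  by (rule strict_monoD[of "time_at \<pi>"]) (auto simp: strict_mono_Suc_iff time_at_Suc is_schedule_def)

lemma time_at_mono: "is_schedule M \<pi> \<Longrightarrow> i \<le> j \<Longrightarrow> time_at \<pi> i \<le> time_at \<pi> j"
  by (metis le_less time_at_strict_mono)

lemma time_at_0 [simp]: "time_at \<pi> 0 = 0"
  by (simp add: time_at_def)

lemma time_interval_ex:
  assumes "is_schedule M \<pi>" "non_Zeno \<pi>" "0 \<le> \<tau>"
  shows "\<exists>j. \<tau> \<in> {time_at \<pi> j..time_at \<pi> (Suc j)}"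
proof -
  obtain N where "\<tau> \<le> time_at \<pi> N"
    using assms(2) unfolding non_Zeno_def filterlim_at_top eventually_sequentially by blast
  define j where "j = (LEAST j. \<tau> \<le> time_at \<pi> j)"
  have j: "\<tau> \<le> time_at \<pi> j" unfolding j_def by (rule LeastI) fact
  show ?thesis
  proof (cases j)
    case 0
    then show ?thesis using j assms(3) time_at_mono[OF assms(1), of 0 "Suc 0"] by (intro exI[of _ 0]) auto
  next
    case (Suc k)
    then have "\<not> \<tau> \<le> time_at \<pi> k" using not_less_Least[of k "\<lambda>j. \<tau> \<le> time_at \<pi> j"] j_def by auto
    then show ?thesis using j Suc by (intro exI[of _ k]) auto
  qed
qed

text \<open>Neighbouring pieces agree at their common break time, so it is safe to use the first
  interval whose right end is not before \<open>\<tau>\<close>.\<close>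

lemma induces_ex:
  assumes "is_schedule M \<pi>" "M \<subseteq> carrier_vec d" "x \<in> carrier_vec d"
  shows "\<exists>\<sigma>. induces x \<pi> \<sigma>"
proof -
  let ?v = "\<lambda>j \<tau>. point_at x \<pi> j + ((\<tau> - time_at \<pi> j) / (time_at \<pi> (Suc j) - time_at \<pi> j)) \<cdot>\<^sub>v
     (point_at x \<pi> (Suc j) - point_at x \<pi> j)"
  define \<sigma> where "\<sigma> = (\<lambda>\<tau>. ?v (LEAST j. \<tau> \<le> time_at \<pi> (Suc j)) \<tau>)"
  have c: "point_at x \<pi> j \<in> carrier_vec d" for j using point_at_carrier assms by blast
  have "\<sigma> \<tau> = ?v j \<tau>" if t: "\<tau> \<in> {time_at \<pi> j..time_at \<pi> (Suc j)}" for j \<tau>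
  proof -
    define k where "k = (LEAST j. \<tau> \<le> time_at \<pi> (Suc j))"
    have k: "\<tau> \<le> time_at \<pi> (Suc k)" "k \<le> j"
      unfolding k_def using t by (auto intro: LeastI[of _ j] Least_le)
    show ?thesis
    proof (cases "k = j")
      case False
      then have "Suc k \<le> j" using k by simp
      then have "time_at \<pi> (Suc k) \<le> time_at \<pi> j" using time_at_mono assms(1) by blast
      then have eq: "\<tau> = time_at \<pi> (Suc k)" "\<tau> = time_at \<pi> j" using k t by auto
      \<comment> \<open>Break times increase strictly, so two intervals that share a point are
        adjacent.\<close>
      then have j: "j = Suc k" using time_at_strict_mono[OF assms(1), of "Suc k" j] \<open>Suc k \<le> j\<close> by fastforce
      have "time_at \<pi> k < time_at \<pi> (Suc k)" using time_at_strict_mono[OF assms(1)] by simp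
      then have "?v k \<tau> = point_at x \<pi> (Suc k)" using c[of k] c[of "Suc k"] eq by (intro eq_vecI) (auto simp del: point_at.simps)
      moreover have "?v j \<tau> = point_at x \<pi> j" using c[of j] c[of "Suc j"] eq by (intro eq_vecI) (auto simp del: point_at.simps)
      ultimately show ?thesis using j by (simp add: \<sigma>_def k_def)
    qed (simp add: \<sigma>_def k_def)
  qed
  then have "induces x \<pi> \<sigma>" unfolding induces_def by blast
  then show ?thesis by (rule exI[of "induces x \<pi>"])
qed

lemma induces_at:
  assumes "is_schedule M \<pi>" "M \<subseteq> carrier_vec d" "x \<in> carrier_vec d" "induces x \<pi> \<sigma>"
  shows "\<sigma> (time_at \<pi> j) = point_at x \<pi> j"
proof -
  have "time_at \<pi> j \<in> {time_at \<pi> j..time_at \<pi> (Suc j)}" using time_at_mono[OF assms(1), of j "Suc j"] by simp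
  then have "\<sigma> (time_at \<pi> j) = point_at x \<pi> j + ((time_at \<pi> j - time_at \<pi> j) / (time_at \<pi> (Suc j) - time_at \<pi> j)) \<cdot>\<^sub>v
     (point_at x \<pi> (Suc j) - point_at x \<pi> j)"
    using assms(4) unfolding induces_def by blast
  then show ?thesis
    using point_at_carrier[OF assms(1-3), of j] point_at_carrier[OF assms(1-3), of "Suc j"] by (auto intro!: eq_vecI simp del: point_at.simps)
qed

subsection \<open>From polygons to executions\<close>

definition walk :: "real vec \<Rightarrow> (real \<times> real vec) list \<Rightarrow> real vec" where
  "walk x ps = foldl (\<lambda>p (a, m). p + a \<cdot>\<^sub>v m) x ps"

lemma walk_point_at: "(\<And>i. i < j \<Longrightarrow> \<pi> i = ps ! i) \<Longrightarrow> j \<le> length ps \<Longrightarrow> point_at x \<pi> j = walk x (take j ps)"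
proof (induction j)
  case (Suc j)
  then show ?case by (simp add: walk_def take_Suc_conv_app_nth case_prod_beta)
qed (simp add: walk_def)

text \<open>Steps of length \<open>0\<close> do not occur in schedules, so they are dropped; \<open>f k\<close> is the number of
  remaining steps among the first \<open>k\<close>.\<close>

lemma drop_zero_steps:
  assumes "\<forall>k<N. l k \<ge> 0 \<and> m k \<in> M \<and> P (Suc k) = P k + l k \<cdot>\<^sub>v m k" "M \<subseteq> carrier_vec d" "\<forall>k\<le>N. P k \<in> carrier_vec d"
  shows "\<exists>ps f. (\<forall>(a, v)\<in>set ps. a > 0 \<and> v \<in> M) \<and> f N = length ps \<and> (\<forall>i j. i \<le> j \<longrightarrow> j \<le> N \<longrightarrow> f i \<le> f j) \<and>
     (\<forall>k\<le>N. walk (P 0) (take (f k) ps) = P k)"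
  using assms(1,3)
proof (induction N)
  case 0
  then show ?case by (intro exI[of _ "[]"] exI[of _ "\<lambda>_. 0"]) (auto simp: walk_def)
next
  case (Suc N)
  then obtain ps f where ps: "\<forall>(a, v)\<in>set ps. a > 0 \<and> v \<in> M" "f N = length ps" "\<forall>i j. i \<le> j \<longrightarrow> j \<le> N \<longrightarrow> f i \<le> f j"
     "\<forall>k\<le>N. walk (P 0) (take (f k) ps) = P k" by auto
  have mN: "m N \<in> carrier_vec d" "P N \<in> carrier_vec d" using Suc.prems assms(2) by auto
  have fle: "f k \<le> length ps" if "k \<le> N" for k using ps(2,3) that by force
  show ?case
  proof (cases "l N = 0")
    case True
    have "P (Suc N) = P N + 0 \<cdot>\<^sub>v m N" using Suc.prems(1) True by simp
    also have "\<dots> = P N" using mN by (intro eq_vecI) auto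
    finally show ?thesis using ps
      by (intro exI[of _ ps] exI[of _ "f(Suc N := length ps)"]) (auto simp: le_Suc_eq fle)
  next
    case False
    then have lN: "l N > 0" "m N \<in> M" "P (Suc N) = P N + l N \<cdot>\<^sub>v m N" using Suc.prems(1) by force+
    have full: "walk (P 0) ps = P N" using ps(2,4) by (metis order_refl take_all)
    have "walk (P 0) (ps @ [(l N, m N)]) = P (Suc N)" using full lN(3) by (simp add: walk_def)
    then show ?thesis using ps lN
      by (intro exI[of _ "ps @ [(l N, m N)]"] exI[of _ "f(Suc N := Suc (length ps))"]) (auto simp: le_Suc_eq fle le_SucI)
  qed
qed

lemma isat_imp_sat:
  assumes "\<forall>k\<le>N. \<sigma> (T k) = P k" "\<forall>i j. i \<le> j \<longrightarrow> j \<le> N \<longrightarrow> T i \<le> T j"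
  shows "isat P N k \<phi> \<Longrightarrow> k \<le> N \<Longrightarrow> sat \<sigma> (T k) \<phi>"
proof (induction \<phi> arbitrary: k)
  case (Finally \<phi>)
  then obtain k' where "k' \<ge> k" "k' \<le> N" "isat P N k' \<phi>" by auto
  then show ?case using Finally.IH assms(2) by auto
qed (use assms in auto)

lemma polygon_models:
  assumes "M \<subseteq> carrier_vec d" "M \<noteq> {}" "\<forall>k\<le>N. P k \<in> carrier_vec d"
    "\<forall>k<N. l k \<ge> 0 \<and> m k \<in> M \<and> P (Suc k) = P k + l k \<cdot>\<^sub>v m k" "isat P N 0 \<phi>"
  shows "models M (P 0) \<phi>"
proof -
  obtain ps f where ps: "\<forall>(a, v)\<in>set ps. a > 0 \<and> v \<in> M" "f N = length ps" "\<forall>i j. i \<le> j \<longrightarrow> j \<le> N \<longrightarrow> f i \<le> f j"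
     "\<forall>k\<le>N. walk (P 0) (take (f k) ps) = P k"
    using drop_zero_steps[OF assms(4,1,3)] by blast
  obtain m0 where m0: "m0 \<in> M" using assms(2) by blast
  \<comment> \<open>The unit durations after the last edge make the schedule non-Zeno.\<close>
  define \<pi> where "\<pi> = (\<lambda>i. if i < length ps then ps ! i else (1, m0))"
  have sch: "is_schedule M \<pi>"
    using ps(1) m0 by (auto simp: is_schedule_def \<pi>_def case_prod_beta)
  have ta: "time_at \<pi> j \<ge> real j - real (length ps)" for j
  proof (induction j)
    case (Suc j)
    then show ?case
    proof (cases "j < length ps")
      case True
      then show ?thesis using time_at_mono[OF sch, of 0 "Suc j"] by simp
    next
      case False
      then show ?thesis using Suc by (simp add: time_at_Suc \<pi>_def)
    qed
  qed simp
  have nz: "non_Zeno \<pi>"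
    unfolding non_Zeno_def filterlim_at_top eventually_sequentially
  proof
    fix Z :: real
    have "Z \<le> time_at \<pi> j" if "j \<ge> nat \<lceil>Z\<rceil> + length ps" for j
      using ta[of j] that real_nat_ceiling_ge[of Z] by linarith
    then show "\<exists>N. \<forall>j\<ge>N. Z \<le> time_at \<pi> j" by blast
  qed
  have P0: "P 0 \<in> carrier_vec d" using assms(3) by simp
  obtain \<sigma> where \<sigma>: "induces (P 0) \<pi> \<sigma>" using induces_ex[OF sch assms(1) P0] by blast
  define T where "T = (\<lambda>k. time_at \<pi> (f k))"
  have fle: "f k \<le> length ps" if "k \<le> N" for k using ps(2,3) that by force
  have eq: "\<sigma> (T k) = P k" if "k \<le> N" for k
    unfolding T_def induces_at[OF sch assms(1) P0 \<sigma>]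
    using walk_point_at[of "f k" \<pi> ps "P 0"] fle[OF that] ps(4) that by (auto simp: \<pi>_def)
  have "sat \<sigma> (T 0) \<phi>"
    using isat_imp_sat[of N \<sigma> T P 0 \<phi>] eq ps(3) time_at_mono[OF sch] assms(5) by (auto simp: T_def)
  moreover have "T 0 \<ge> 0" unfolding T_def using time_at_mono[OF sch, of 0] by simp
  ultimately have "sat \<sigma> (T 0) \<phi>" "T 0 \<ge> 0" by auto
  have "sat \<sigma> 0 \<phi>"
  proof -
    \<comment> \<open>\<open>f 0\<close> is not known to be 0. The first vertex is therefore moved
      to time 0 explicitly, where the execution has the value \<open>P 0\<close> as well.\<close>
    define T' where "T' = T(0 := 0)"
    have "\<sigma> (T' k) = P k" if "k \<le> N" for k
      using eq[OF that] induces_at[OF sch assms(1) P0 \<sigma>, of 0] by (auto simp: T'_def)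
    moreover have "T' i \<le> T' j" if "i \<le> j" "j \<le> N" for i j
      using that ps(3) time_at_mono[OF sch] by (auto simp: T'_def T_def time_at_mono[OF sch, of 0, simplified])
    ultimately show ?thesis
      using isat_imp_sat[of N \<sigma> T' P 0 \<phi>] assms(5) by (auto simp: T'_def)
  qed
  then show ?thesis using sch nz \<sigma> by (auto simp: models_def)
qed

subsection \<open>From executions to polygons\<close>

text \<open>\<open>clamp (fst (\<pi> p)) (\<tau> - time_at \<pi> p)\<close> is the part of step
  \<open>p\<close> that has elapsed at time \<open>\<tau>\<close>: nothing before the step begins,
  and its whole duration once it is over.\<close>

definition clamp :: "real \<Rightarrow> real \<Rightarrow> real" where
  "clamp a t = max 0 (min t a)"

lemma clamp_mono: "s \<le> t \<Longrightarrow> clamp a s \<le> clamp a t"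
  by (auto simp: clamp_def)

text \<open>Counting elapsed parts expresses the position as a sum over any sufficiently long range
  of steps. Two times can thus share one range, and their positions can be subtracted term by
  term.\<close>

lemma induces_index:
  assumes sch: "is_schedule M \<pi>" and M: "M \<subseteq> carrier_vec d" and x: "x \<in> carrier_vec d" and \<sigma>: "induces x \<pi> \<sigma>"
    and j: "\<tau> \<in> {time_at \<pi> j..time_at \<pi> (Suc j)}" "j < J" and i: "i < d"
  shows "\<sigma> \<tau> $ i = x $ i + (\<Sum>p<J. clamp (fst (\<pi> p)) (\<tau> - time_at \<pi> p) * snd (\<pi> p) $ i)"
proof -
  have pos: "fst (\<pi> p) > 0" "snd (\<pi> p) \<in> carrier_vec d" for p using sch M by (auto simp: is_schedule_def)
  have c: "point_at x \<pi> k \<in> carrier_vec d" for k using point_at_carrier[OF sch M x] .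
  have "\<sigma> \<tau> = point_at x \<pi> j + ((\<tau> - time_at \<pi> j) / fst (\<pi> j)) \<cdot>\<^sub>v (point_at x \<pi> (Suc j) - point_at x \<pi> j)"
    using \<sigma> j by (auto simp: induces_def time_at_Suc)
  then have "\<sigma> \<tau> $ i = point_at x \<pi> j $ i + (\<tau> - time_at \<pi> j) * snd (\<pi> j) $ i"
    using c[of j] c[of "Suc j"] i pos[of j] by auto
  also have "\<dots> = x $ i + ((\<Sum>p<j. fst (\<pi> p) * snd (\<pi> p) $ i) + (\<tau> - time_at \<pi> j) * snd (\<pi> j) $ i)"
    by (simp add: point_at_index[OF sch M x i])
  also have "(\<Sum>p<j. fst (\<pi> p) * snd (\<pi> p) $ i) + (\<tau> - time_at \<pi> j) * snd (\<pi> j) $ i =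
     (\<Sum>p<Suc j. clamp (fst (\<pi> p)) (\<tau> - time_at \<pi> p) * snd (\<pi> p) $ i)"
  proof -
    have "clamp (fst (\<pi> p)) (\<tau> - time_at \<pi> p) = fst (\<pi> p)" if "p < j" for p
      using time_at_mono[OF sch, of "Suc p" j] that j(1) pos[of p] by (auto simp: clamp_def time_at_Suc)
    moreover have "clamp (fst (\<pi> j)) (\<tau> - time_at \<pi> j) = \<tau> - time_at \<pi> j"
      using j(1) by (auto simp: clamp_def time_at_Suc)
    ultimately show ?thesis by simp
  qed
  also have "\<dots> = (\<Sum>p<J. clamp (fst (\<pi> p)) (\<tau> - time_at \<pi> p) * snd (\<pi> p) $ i)"
  proof (rule sum.mono_neutral_left)
    show "\<forall>p\<in>{..<J} - {..<Suc j}. clamp (fst (\<pi> p)) (\<tau> - time_at \<pi> p) * snd (\<pi> p) $ i = 0"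
    proof
      fix p assume "p \<in> {..<J} - {..<Suc j}"
      then have "time_at \<pi> (Suc j) \<le> time_at \<pi> p" using time_at_mono[OF sch, of "Suc j" p] by auto
      then show "clamp (fst (\<pi> p)) (\<tau> - time_at \<pi> p) * snd (\<pi> p) $ i = 0"
        using j(1) pos[of p] by (auto simp: clamp_def)
    qed
  qed (use j in auto)
  finally show ?thesis .
qed

text \<open>What elapses of each step between the two times is nonnegative because
  \<open>clamp\<close> is monotone; grouping these amounts by mode gives the total time spent in
  each mode.\<close>

lemma displacement:
  assumes sch: "is_schedule (set ms) \<pi>" and M: "set ms \<subseteq> carrier_vec d" and x: "x \<in> carrier_vec d" and \<sigma>: "induces x \<pi> \<sigma>"
    and nz: "non_Zeno \<pi>" and t: "0 \<le> \<tau>" "\<tau> \<le> \<tau>'"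
  shows "\<exists>l. (\<forall>q<length ms. l q \<ge> 0) \<and> (\<forall>i<d. \<sigma> \<tau>' $ i = \<sigma> \<tau> $ i + (\<Sum>q<length ms. l q * ms ! q $ i))"
proof -
  obtain j j' where j: "\<tau> \<in> {time_at \<pi> j..time_at \<pi> (Suc j)}" "\<tau>' \<in> {time_at \<pi> j'..time_at \<pi> (Suc j')}"
    using time_interval_ex[OF sch nz] t by (meson order_trans)
  define J where "J = Suc (max j j')"
  define c where "c = (\<lambda>p. clamp (fst (\<pi> p)) (\<tau>' - time_at \<pi> p) - clamp (fst (\<pi> p)) (\<tau> - time_at \<pi> p))"
  have c0: "c p \<ge> 0" for p using t(2) by (auto simp: c_def intro!: clamp_mono)
  have "\<forall>p. \<exists>q<length ms. ms ! q = snd (\<pi> p)" using sch by (auto simp: is_schedule_def in_set_conv_nth)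
  then obtain g where g: "\<And>p. g p < length ms" "\<And>p. ms ! g p = snd (\<pi> p)" by metis
  \<comment> \<open>The time of a step is booked at the one position that \<open>g\<close> chose for
    it, so modes listed repeatedly in \<open>ms\<close> are not counted twice.\<close>
  define l where "l = (\<lambda>q. \<Sum>p\<in>{p\<in>{..<J}. g p = q}. c p)"
  have "\<sigma> \<tau>' $ i = \<sigma> \<tau> $ i + (\<Sum>q<length ms. l q * ms ! q $ i)" if i: "i < d" for i
  proof -
    have "\<sigma> \<tau>' $ i - \<sigma> \<tau> $ i = (\<Sum>p<J. c p * snd (\<pi> p) $ i)"
      using induces_index[OF sch M x \<sigma> j(1) _ i, of J] induces_index[OF sch M x \<sigma> j(2) _ i, of J]
      by (simp add: J_def c_def left_diff_distrib sum_subtractf)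
    also have "\<dots> = (\<Sum>q<length ms. \<Sum>p\<in>{p\<in>{..<J}. g p = q}. c p * snd (\<pi> p) $ i)"
      by (rule sum.group[symmetric]) (use g in auto)
    also have "\<dots> = (\<Sum>q<length ms. l q * ms ! q $ i)"
      unfolding l_def sum_distrib_right using g(2) by (intro sum.cong) auto
    finally show ?thesis by simp
  qed
  then show ?thesis using c0 by (intro exI[of _ l]) (auto simp: l_def intro!: sum_nonneg)
qed

text \<open>All witnesses of \<open>F\<close> are drawn from one set \<open>W\<close>; with
  \<open>W\<close> finite, the formula depends on finitely many points of the execution.\<close>

fun tsat :: "real set \<Rightarrow> (real \<Rightarrow> real vec) \<Rightarrow> real \<Rightarrow> ltl \<Rightarrow> bool" where
  "tsat W \<sigma> \<tau> TrueF \<longleftrightarrow> True"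
| "tsat W \<sigma> \<tau> (Zone z) \<longleftrightarrow> \<sigma> \<tau> \<in> zone_set z"
| "tsat W \<sigma> \<tau> (Conj \<phi> \<psi>) \<longleftrightarrow> tsat W \<sigma> \<tau> \<phi> \<and> tsat W \<sigma> \<tau> \<psi>"
| "tsat W \<sigma> \<tau> (Disj \<phi> \<psi>) \<longleftrightarrow> tsat W \<sigma> \<tau> \<phi> \<or> tsat W \<sigma> \<tau> \<psi>"
| "tsat W \<sigma> \<tau> (Finally \<phi>) \<longleftrightarrow> (\<exists>\<tau>'\<in>W. \<tau> \<le> \<tau>' \<and> tsat W \<sigma> \<tau>' \<phi>)"
| "tsat W \<sigma> \<tau> _ \<longleftrightarrow> False"

lemma tsat_mono: "tsat W \<sigma> \<tau> \<phi> \<Longrightarrow> W \<subseteq> W' \<Longrightarrow> tsat W' \<sigma> \<tau> \<phi>"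
  by (induction \<phi> arbitrary: \<tau>) auto

fun modal_count :: "ltl \<Rightarrow> nat" where
  "modal_count (Conj \<phi> \<psi>) = modal_count \<phi> + modal_count \<psi>"
| "modal_count (Disj \<phi> \<psi>) = modal_count \<phi> + modal_count \<psi>"
| "modal_count (Finally \<phi>) = Suc (modal_count \<phi>)"
| "modal_count _ = 0"

text \<open>Each \<open>F\<close> contributes one witness, and only one side of a disjunction is
  followed. For a conjunction the two witness sets are united, which is harmless because
  \<open>tsat\<close> is monotone in \<open>W\<close>.\<close>

lemma sat_imp_tsat:
  "sat \<sigma> \<tau> \<phi> \<Longrightarrow> ops \<phi> \<subseteq> {Op_F, Op_Conj, Op_Disj} \<Longrightarrow>
    \<exists>W. finite W \<and> card W \<le> modal_count \<phi> \<and> W \<subseteq> {\<tau>..} \<and> tsat W \<sigma> \<tau> \<phi>"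
proof (induction \<phi> arbitrary: \<tau>)
  case (Conj \<phi> \<psi>)
  then have "sat \<sigma> \<tau> \<phi>" "sat \<sigma> \<tau> \<psi>" "ops \<phi> \<subseteq> {Op_F, Op_Conj, Op_Disj}" "ops \<psi> \<subseteq> {Op_F, Op_Conj, Op_Disj}" by auto
  then obtain U W where "finite U" "card U \<le> modal_count \<phi>" "U \<subseteq> {\<tau>..}" "tsat U \<sigma> \<tau> \<phi>"
    "finite W" "card W \<le> modal_count \<psi>" "W \<subseteq> {\<tau>..}" "tsat W \<sigma> \<tau> \<psi>"
    using Conj.IH by meson
  then show ?case
    using card_Un_le[of U W] by (intro exI[of _ "U \<union> W"]) (auto intro: tsat_mono[of U] tsat_mono[of W])
next
  case (Disj \<phi> \<psi>)
  then consider "sat \<sigma> \<tau> \<phi>" | "sat \<sigma> \<tau> \<psi>" by auto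
  then show ?case
  proof cases
    case 1
    then show ?thesis using Disj.IH(1)[of \<tau>] Disj.prems(2) by fastforce
  next
    case 2
    then show ?thesis using Disj.IH(2)[of \<tau>] Disj.prems(2) by fastforce
  qed
next
  case (Finally \<phi>)
  then obtain \<tau>' where t: "\<tau>' \<ge> \<tau>" "sat \<sigma> \<tau>' \<phi>" by auto
  then obtain W where W: "finite W" "card W \<le> modal_count \<phi>" "W \<subseteq> {\<tau>'..}" "tsat W \<sigma> \<tau>' \<phi>"
    using Finally.IH[of \<tau>'] Finally.prems(2) by auto
  then show ?case using t
    by (intro exI[of _ "insert \<tau>' W"]) (auto simp: card_insert_if intro: tsat_mono[of W])
qed (auto intro!: exI[of _ "{}"])

definition polygon :: "nat \<Rightarrow> real vec \<Rightarrow> (nat \<Rightarrow> real vec) \<Rightarrow> (nat \<Rightarrow> real) \<Rightarrow> nat \<Rightarrow> real vec" where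
  "polygon d x v l k = vec d (\<lambda>i. x $ i + (\<Sum>p<k. l p * v p $ i))"

lemma sum_lessThan_add: "(\<Sum>i<a + n. f i) = (\<Sum>i<a. f i) + (\<Sum>q<n. f (a + q))"
  for f :: "nat \<Rightarrow> 'a::comm_monoid_add" and n :: nat
  by (induction n) (auto simp: add.assoc)

lemma models_polygon:
  assumes M: "set ms \<subseteq> carrier_vec d" and x: "x \<in> carrier_vec d" and sat: "models (set ms) x \<phi>"
    and ops: "ops \<phi> \<subseteq> {Op_F, Op_Conj, Op_Disj}"
  shows "ms \<noteq> [] \<and> (\<exists>N\<le>modal_count \<phi> * length ms. \<exists>l. (\<forall>p<N. l p \<ge> 0) \<and>
    isat (polygon d x (\<lambda>p. ms ! (p mod length ms)) l) N 0 \<phi>)"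
proof -
  obtain \<pi> \<sigma> where sch: "is_schedule (set ms) \<pi>" and nz: "non_Zeno \<pi>" and \<sigma>: "induces x \<pi> \<sigma>" and s: "sat \<sigma> 0 \<phi>"
    using sat by (auto simp: models_def)
  have ne: "ms \<noteq> []" using sch by (auto simp: is_schedule_def)
  obtain W where W: "finite W" "card W \<le> modal_count \<phi>" "W \<subseteq> {0..}" "tsat W \<sigma> 0 \<phi>"
    using sat_imp_tsat[OF s ops] by blast
  define n where "n = length ms"
  have n: "n > 0" using ne by (simp add: n_def)
  \<comment> \<open>Time 0 is inserted because the polygon starts there. The number of parts between
    consecutive times is still at most the number of witnesses.\<close>
  define ts where "ts = sorted_list_of_set (insert 0 W)"
  have ts: "set ts = insert 0 W" "sorted ts" "distinct ts" using W(1)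
    by (simp_all add: ts_def del: sorted_list_of_set_insert_remove)
  define B where "B = length ts - 1"
  have lts: "length ts = Suc B" using ts(1) by (cases ts) (auto simp: B_def)
  have "length ts = card (insert 0 W)" using ts by (metis distinct_card)
  then have B: "B \<le> modal_count \<phi>" using W(1,2) lts by (auto simp: card_insert_if split: if_splits)
  have ts_mono: "ts ! i \<le> ts ! j" if "i \<le> j" "j \<le> B" for i j
    using sorted_nth_mono[OF ts(2), of i j] that lts by simp
  have ts0: "ts ! 0 = 0"
  proof -
    obtain k where k: "k < length ts" "ts ! k = 0" using ts(1) by (metis in_set_conv_nth insertI1)
    have "ts ! 0 \<in> insert 0 W" using ts(1) lts by (metis nth_mem zero_less_Suc)
    then have "ts ! 0 \<ge> 0" using W(3) by auto
    moreover have "ts ! 0 \<le> 0" using ts_mono[of 0 k] k lts by simp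
    ultimately show ?thesis by simp
  qed
  have ts_nonneg: "ts ! j \<ge> 0" if "j \<le> B" for j using ts_mono[of 0 j] that ts0 by simp
  have "\<exists>l. (\<forall>q<n. l q \<ge> 0) \<and> (\<forall>i<d. \<sigma> (ts ! Suc j) $ i = \<sigma> (ts ! j) $ i + (\<Sum>q<n. l q * ms ! q $ i))" if "j < B" for j
    unfolding n_def using that ts_mono[of j "Suc j"] ts_nonneg[of j] by (intro displacement[OF sch M x \<sigma> nz]) auto
  then obtain L where L: "\<And>j q. j < B \<Longrightarrow> q < n \<Longrightarrow> L j q \<ge> 0"
    "\<And>j i. j < B \<Longrightarrow> i < d \<Longrightarrow> \<sigma> (ts ! Suc j) $ i = \<sigma> (ts ! j) $ i + (\<Sum>q<n. L j q * ms ! q $ i)"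
    by metis
  \<comment> \<open>Edge \<open>p\<close> belongs to block \<open>p div n\<close> and uses mode
    \<open>p mod n\<close>, so the vertices that correspond to witness times are the multiples of
    \<open>n\<close>.\<close>
  define l where "l = (\<lambda>p. L (p div n) (p mod n))"
  let ?P = "polygon d x (\<lambda>p. ms ! (p mod n)) l"
  have lpos: "l p \<ge> 0" if "p < B * n" for p
    using that n L(1)[of "p div n" "p mod n"] by (simp add: l_def less_mult_imp_div_less)
  have val: "?P (j * n) $ i = \<sigma> (ts ! j) $ i" if "j \<le> B" "i < d" for i j
    using that(1)
  proof (induction j)
    case 0
    have "\<sigma> 0 = x" using induces_at[OF sch M x \<sigma>, of 0] by simp
    then show ?case using ts0 that(2) by (simp add: polygon_def)
  next
    case (Suc j)
    have "(\<Sum>p<Suc j * n. l p * ms ! (p mod n) $ i) = (\<Sum>p<j * n. l p * ms ! (p mod n) $ i) + (\<Sum>q<n. L j q * ms ! q $ i)"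
      using sum_lessThan_add[of "\<lambda>p. l p * ms ! (p mod n) $ i" "j * n" n] n
      by (simp add: l_def add.commute)
    then have "?P (Suc j * n) $ i = ?P (j * n) $ i + (\<Sum>q<n. L j q * ms ! q $ i)"
      using that(2) by (simp add: polygon_def)
    then show ?case using Suc L(2)[of j i] that(2) by simp
  qed
  have \<sigma>c: "\<sigma> \<tau> \<in> carrier_vec d" if "\<tau> \<ge> 0" for \<tau>
  proof -
    obtain j where j: "\<tau> \<in> {time_at \<pi> j..time_at \<pi> (Suc j)}" using time_interval_ex[OF sch nz] \<open>\<tau> \<ge> 0\<close> by blast
    have "\<sigma> \<tau> = point_at x \<pi> j + ((\<tau> - time_at \<pi> j) / (time_at \<pi> (Suc j) - time_at \<pi> j)) \<cdot>\<^sub>v (point_at x \<pi> (Suc j) - point_at x \<pi> j)"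
      using \<sigma> j unfolding induces_def by blast
    then show ?thesis using point_at_carrier[OF sch M x] by (metis add_carrier_vec minus_carrier_vec smult_carrier_vec)
  qed
  have eq: "?P (j * n) = \<sigma> (ts ! j)" if "j \<le> B" for j
    using val[OF that] \<sigma>c[OF ts_nonneg[OF that]] by (intro eq_vecI) (auto simp: polygon_def)
  have "isat ?P (B * n) (j * n) \<psi>" if "tsat W \<sigma> (ts ! j) \<psi>" "j \<le> B" for j \<psi>
    using that
  proof (induction \<psi> arbitrary: j)
    case (Finally \<psi>)
    then obtain \<tau>' where t: "\<tau>' \<in> W" "ts ! j \<le> \<tau>'" "tsat W \<sigma> \<tau>' \<psi>" by auto
    then obtain j' where j': "j' \<le> B" "\<tau>' = ts ! j'" using ts(1) lts by (metis in_set_conv_nth insertCI less_Suc_eq_le)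
    show ?case
    proof (cases "j \<le> j'")
      case True
      then show ?thesis using Finally.IH[of j'] t j' by (auto intro!: exI[of _ "j' * n"])
    next
      case False
      \<comment> \<open>An earlier position can only carry the same time, so the current vertex
        itself serves as witness.\<close>
      then have "ts ! j' = ts ! j" using ts_mono[of j' j] t(2) j' Finally.prems by simp
      then show ?thesis using Finally.IH[of j] t j' Finally.prems(2) by (auto intro!: exI[of _ "j * n"])
    qed
  qed (auto simp: eq)
  from this[of 0 \<phi>] have "isat ?P (B * n) 0 \<phi>" using W(4) ts0 by simp
  moreover have "B * n \<le> modal_count \<phi> * length ms" using B by (simp add: n_def)
  ultimately show ?thesis using lpos ne unfolding n_def by blast
qed


section \<open>The logic program for model checking\<close>

datatype pred = PAdd | PZero | PMul | PPos | PNat | PScale | PMove | PModes | PZeroVec | PIntRow | PComb | PEqZero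
  | PDirs | PZoneOK | PDot | PZoneAt | PTable | PSat | PTop

instance pred :: finite
proof
  have "(UNIV :: pred set) \<subseteq> {PAdd, PZero, PMul, PPos, PNat, PScale, PMove, PModes, PZeroVec, PIntRow, PComb, PEqZero,
      PDirs, PZoneOK, PDot, PZoneAt, PTable, PSat, PTop}"
    using pred.exhaust by blast
  then show "finite (UNIV :: pred set)" by (rule finite_subset) simp
qed

abbreviation "e \<equiv> C L_End"
abbreviation "it \<equiv> C L_Item"
abbreviation "b0 \<equiv> C L_0"
abbreviation "b1 \<equiv> C L_1"

text \<open>The numbers of a certificate are words of binary digits, all of the same length, so that they can
  be added digit by digit; the numbers of the input are in canonical form. The first argument of
  \<open>PAdd\<close> is the carry.\<close>

definition add_rules :: "(pred, letter) clause list" where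
  "add_rules = ((PAdd, [[b0], [], [], []]), []) #
    map (\<lambda>(c, x, y, z, c'). ((PAdd, [[C c], [C x, V 0], [C y, V 1], [C z, V 2]]), [(PAdd, [[C c'], [V 0], [V 1], [V 2]])]))
     [(L_0, L_0, L_0, L_0, L_0), (L_0, L_0, L_1, L_1, L_0), (L_0, L_1, L_0, L_1, L_0), (L_0, L_1, L_1, L_0, L_1),
      (L_1, L_0, L_0, L_1, L_0), (L_1, L_0, L_1, L_0, L_1), (L_1, L_1, L_0, L_0, L_1), (L_1, L_1, L_1, L_1, L_1)]"

text \<open>\<open>PZero\<close> pairs a digit word with the zero word of the same length and
  doubles as the test that a word consists of digits. \<open>PMul\<close> recurses on the digits of
  its first factor; doubling turns \<open>V 2, b0\<close> into \<open>b0, V 2\<close>, which is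
  possible only if the leading digit is 0, so overflow cannot go unnoticed. \<open>PPos\<close> and
  \<open>PNat\<close> accept exactly the canonical numerals of the input.\<close>

definition num_rules :: "(pred, letter) clause list" where
  "num_rules =
   [((PZero, [[], []]), []),
    ((PZero, [[b0, V 0], [b0, V 1]]), [(PZero, [[V 0], [V 1]])]),
    ((PZero, [[b1, V 0], [b0, V 1]]), [(PZero, [[V 0], [V 1]])]),
    ((PMul, [[], [V 0], [V 1]]), [(PZero, [[V 0], [V 1]])]),
    ((PMul, [[b0, V 0], [V 1], [b0, V 2]]), [(PMul, [[V 0], [V 1], [V 2, b0]])]),
    ((PMul, [[b1, V 0], [V 1], [V 3]]), [(PMul, [[V 0], [V 1], [V 2, b0]]), (PAdd, [[b0], [b0, V 2], [V 1], [V 3]])]),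
    ((PPos, [[b1]]), []),
    ((PPos, [[b0, V 0]]), [(PPos, [[V 0]])]),
    ((PPos, [[b1, V 0]]), [(PPos, [[V 0]])]),
    ((PNat, [[]]), []),
    ((PNat, [[V 0]]), [(PPos, [[V 0]])])]"

text \<open>An integer is a sign followed by binary digits; the digits of \<open>-n\<close> are those of a positive number.\<close>

definition signs :: "(letter \<times> pred) list" where
  "signs = [(L_Plus, PNat), (L_Minus, PPos)]"

text \<open>Scaling a fraction \<open>p / q\<close> by \<open>G\<close> needs no division: the
  result \<open>t\<close> is guessed, and \<open>q * t = p * G\<close> is checked by two
  multiplications with the same product \<open>V 6\<close>. The sign is copied.\<close>

definition scale_rules :: "(pred, letter) clause list" where
  "scale_rules = ((PScale, [[V 0], [e], [e]]), []) #
    map (\<lambda>(s, chk). ((PScale, [[V 0], [it, C s, V 1, e, V 2, e, V 3], [it, C s, V 4, e, V 5]]),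
      [(chk, [[V 1]]), (PPos, [[V 2]]), (PMul, [[V 2], [V 4], [V 6]]), (PMul, [[V 1], [V 0], [V 6]]),
       (PScale, [[V 0], [V 3], [V 5]])])) signs"

text \<open>Adds the multiple \<open>V 0\<close> of a row to a vector. The sign of an entry decides
  whether the positive or the negative part of the coordinate grows; \<open>PZero\<close> tests that
  the other part consists of digits.\<close>

definition move_rules :: "(pred, letter) clause list" where
  "move_rules =
   [((PMove, [[V 0], [e], [e], [e]]), []),
    ((PMove, [[V 0], [it, V 1, e, V 2, e, V 3], [it, V 4, e, V 2, e, V 5], [it, C L_Plus, V 6, e, V 7]]),
      [(PMul, [[V 6], [V 0], [V 8]]), (PAdd, [[b0], [V 1], [V 8], [V 4]]), (PZero, [[V 2], [V 9]]),
       (PMove, [[V 0], [V 3], [V 5], [V 7]])]),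
    ((PMove, [[V 0], [it, V 2, e, V 1, e, V 3], [it, V 2, e, V 4, e, V 5], [it, C L_Minus, V 6, e, V 7]]),
      [(PMul, [[V 6], [V 0], [V 8]]), (PAdd, [[b0], [V 1], [V 8], [V 4]]), (PZero, [[V 2], [V 9]]),
       (PMove, [[V 0], [V 3], [V 5], [V 7]])])]"

text \<open>A pattern with \<open>b1\<close> in the middle says that a number is positive, here the
  scaling factor of a mode. The \<open>PMove\<close> in \<open>PModes\<close> is a test of lengths:
  the row with an additional 0 in front must fit the zero vector, which has one entry more than the
  dimension.\<close>

definition vec_rules :: "(pred, letter) clause list" where
  "vec_rules =
   [((PModes, [[V 0], [e], [e]]), []),
    ((PModes, [[V 0], [it, V 1, V 2], [it, V 3, V 4]]),
      [(PScale, [[V 5, b1, V 6], [V 1], [V 3]]), (PMove, [[V 7], [V 0], [V 8], [it, C L_Plus, e, V 3]]),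
       (PModes, [[V 0], [V 2], [V 4]])]),
    ((PZeroVec, [[e]]), []),
    ((PZeroVec, [[it, V 0, e, V 0, e, V 1]]), [(PZero, [[V 0], [V 0]]), (PZeroVec, [[V 1]])]),
    ((PEqZero, [[e]]), []),
    ((PEqZero, [[it, V 0, e, V 0, e, V 1]]), [(PZero, [[V 0], [V 2]]), (PEqZero, [[V 1]])])]"

text \<open>\<open>PComb\<close> adds to a vector a combination of the rows, each with its
  right-hand side in front. The coefficients \<open>V 6\<close> are guessed and do not appear in the
  goal; as digit words they are nonnegative.\<close>

definition comb_rules :: "(pred, letter) clause list" where
  "comb_rules = [((PIntRow, [[e]]), []), ((PComb, [[e], [e], [V 0], [V 0]]), [])] @
    map (\<lambda>(s, chk). ((PIntRow, [[it, C s, V 0, e, V 1]]), [(chk, [[V 0]]), (PIntRow, [[V 1]])])) signs @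
    map (\<lambda>(s, chk). ((PComb, [[it, V 0, V 1], [it, C s, V 2, e, V 3], [V 4], [V 5]]),
      [(chk, [[V 2]]), (PIntRow, [[V 0]]), (PMove, [[V 6], [V 4], [V 7], [it, C s, V 2, e, V 0]]),
       (PComb, [[V 1], [V 3], [V 7], [V 5]])])) signs"

text \<open>\<open>PDirs\<close> treats the coordinates in turn and keeps the zeros already passed
  in \<open>V 2\<close>. A vector with \<open>c\<close>, and then one with \<open>- c\<close>, at
  the current coordinate and 0 elsewhere has to be cancelled by a combination of rows, except at its
  first entry, which takes up the right-hand sides. The first rule for \<open>PZoneOK\<close> asks
  instead for a combination with zero left-hand side and negative right-hand side.\<close>

definition zone_ok_rules :: "(pred, letter) clause list" where
  "zone_ok_rules =
   [((PDirs, [[V 0], [V 1], [V 2], [e]]), []),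
    ((PDirs, [[V 0], [V 1], [V 2], [it, V 3, e, V 3, e, V 4]]),
      [(PZero, [[V 3], [V 3]]), (PZero, [[V 5, b1, V 6], [V 7]]),
       (PComb, [[V 0], [V 1], [it, V 3, e, V 3, e, V 2, it, V 5, b1, V 6, e, V 3, e, V 4], [it, V 8, e, V 9, e, V 10]]),
       (PZero, [[V 8], [V 11]]), (PZero, [[V 9], [V 12]]), (PEqZero, [[V 10]]),
       (PComb, [[V 0], [V 1], [it, V 3, e, V 3, e, V 2, it, V 3, e, V 5, b1, V 6, e, V 4], [it, V 13, e, V 14, e, V 15]]),
       (PZero, [[V 13], [V 16]]), (PZero, [[V 14], [V 17]]), (PEqZero, [[V 15]]),
       (PDirs, [[V 0], [V 1], [V 2, it, V 3, e, V 3, e], [V 4]])]),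
    ((PZoneOK, [[V 0], [V 1], [V 2]]),
      [(PComb, [[V 0], [V 1], [V 2], [it, V 3, e, V 4, e, V 5]]), (PEqZero, [[V 5]]),
       (PAdd, [[b0], [V 3], [V 6, b1, V 7], [V 4]])]),
    ((PZoneOK, [[V 0], [V 1], [it, V 2, e, V 2, e, V 3]]),
      [(PZero, [[V 2], [V 2]]), (PDirs, [[V 0], [V 1], [], [V 3]])])]"

text \<open>\<open>PDot\<close> collects positive and negative contributions in two accumulators
  that start with equal values, so the sign of a scalar product is a comparison, made by guessing
  the difference \<open>V 8\<close>. In the rule for a zone without rows, \<open>PDot\<close> serves
  as the test that \<open>V 0\<close> is a vector.\<close>

definition zone_at_rules :: "(pred, letter) clause list" where
  "zone_at_rules =
   [((PDot, [[e], [e], [V 0], [V 1], [V 0], [V 1]]), []),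
    ((PDot, [[it, C L_Plus, V 0, e, V 1], [it, V 2, e, V 3, e, V 4], [V 5], [V 6], [V 7], [V 8]]),
      [(PMul, [[V 0], [V 2], [V 9]]), (PAdd, [[b0], [V 5], [V 9], [V 11]]),
       (PMul, [[V 0], [V 3], [V 10]]), (PAdd, [[b0], [V 6], [V 10], [V 12]]),
       (PDot, [[V 1], [V 4], [V 11], [V 12], [V 7], [V 8]])]),
    ((PDot, [[it, C L_Minus, V 0, e, V 1], [it, V 2, e, V 3, e, V 4], [V 5], [V 6], [V 7], [V 8]]),
      [(PMul, [[V 0], [V 3], [V 9]]), (PAdd, [[b0], [V 5], [V 9], [V 11]]),
       (PMul, [[V 0], [V 2], [V 10]]), (PAdd, [[b0], [V 6], [V 10], [V 12]]),
       (PDot, [[V 1], [V 4], [V 11], [V 12], [V 7], [V 8]])]),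
    ((PZoneAt, [[e], [e], [V 0]]), [(PDot, [[V 1], [V 0], [V 2], [V 2], [V 3], [V 4]])])] @
    map (\<lambda>(s, chk). ((PZoneAt, [[it, V 0, V 1], [it, C s, V 2, e, V 3], [V 4]]),
      [(chk, [[V 2]]), (PDot, [[it, C s, V 2, e, V 0], [V 4], [V 5], [V 5], [V 6], [V 7]]),
       (PAdd, [[b0], [V 6], [V 8], [V 7]]), (PZoneAt, [[V 1], [V 3], [V 4]])])) signs"

text \<open>The first argument lists the modes left in the current pass, the second all modes; the
  last rule starts a new pass. The letter \<open>L_F\<close> is reused to introduce a vertex, since
  it cannot occur inside a vector.\<close>

definition table_rules :: "(pred, letter) clause list" where
  "table_rules =
   [((PTable, [[V 0], [V 1], [V 2], []]), []),
    ((PTable, [[it, V 0, V 1], [V 2], [V 3], [C L_F, V 4, V 5]]),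
      [(PMove, [[V 6], [V 3], [V 4], [it, C L_Plus, e, V 0]]), (PTable, [[V 1], [V 2], [V 4], [V 5]])]),
    ((PTable, [[e], [V 2], [V 3], [V 5]]), [(PTable, [[V 2], [V 2], [V 3], [V 5]])])]"

text \<open>The last argument of \<open>PSat\<close> lists the vertices of a polygon from the current one on. With the empty
  word instead, only the well-formedness of the formula is checked, which is all that matters for a
  disjunct that is not used.\<close>

definition sat_rules :: "(pred, letter) clause list" where
  "sat_rules =
   [((PSat, [[V 0], [C L_True], [V 1]]), []),
    ((PSat, [[V 0], [C L_Conj, V 2, V 3], [V 1]]), [(PSat, [[V 0], [V 2], [V 1]]), (PSat, [[V 0], [V 3], [V 1]])]),
    ((PSat, [[V 0], [C L_Disj, V 2, V 3], [V 1]]), [(PSat, [[V 0], [V 2], [V 1]]), (PSat, [[V 0], [V 3], []])]),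
    ((PSat, [[V 0], [C L_Disj, V 2, V 3], [V 1]]), [(PSat, [[V 0], [V 2], []]), (PSat, [[V 0], [V 3], [V 1]])]),
    ((PSat, [[V 0], [C L_F, V 2], [V 1, C L_F, V 3]]), [(PSat, [[V 0], [V 2], [C L_F, V 3]])]),
    ((PSat, [[V 0], [C L_F, V 2], []]), [(PSat, [[V 0], [V 2], []])]),
    ((PSat, [[V 0], [C L_Zone, V 2, V 3], [C L_F, V 4, V 5]]), [(PZoneOK, [[V 2], [V 3], [V 0]]), (PZoneAt, [[V 2], [V 3], [V 4]])]),
    ((PSat, [[V 0], [C L_Zone, V 2, V 3], []]), [(PZoneOK, [[V 2], [V 3], [V 0]])])]"

text \<open>\<open>V 3, b1, V 4\<close> is a common denominator \<open>D\<close> of the input point,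
  and the first vertex is a positive multiple of the row \<open>- D, V 6\<close>. The multiple is
  guessed, because the later vertices may need a larger common denominator. The leading
  \<open>L_Item\<close> enforces a mode, and the two explicit entries of the zero vector enforce a
  positive dimension.\<close>

definition top_rules :: "(pred, letter) clause list" where
  "top_rules =
   [((PTop, [[it, V 0, V 1, V 2]]),
      [(PZero, [[V 3, b1, V 4], [V 5]]), (PZero, [[V 7], [V 14]]), (PScale, [[V 3, b1, V 4], [V 1], [V 6]]),
       (PZeroVec, [[it, V 7, e, V 7, e, it, V 7, e, V 7, e, V 8]]),
       (PModes, [[it, V 7, e, V 7, e, it, V 7, e, V 7, e, V 8], [it, V 0], [V 9]]),
       (PMove, [[V 10, b1, V 11], [it, V 7, e, V 7, e, it, V 7, e, V 7, e, V 8], [V 12], [it, C L_Minus, V 3, b1, V 4, e, V 6]]),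
       (PTable, [[V 9], [V 9], [V 12], [V 13]]),
       (PSat, [[it, V 7, e, V 7, e, it, V 7, e, V 7, e, V 8], [V 2], [C L_F, V 12, V 13]])])]"

definition rules :: "(pred, letter) clause list" where
  "rules = add_rules @ num_rules @ scale_rules @ move_rules @ vec_rules @ comb_rules @ zone_ok_rules @
     zone_at_rules @ table_rules @ sat_rules @ top_rules"

subsection \<open>Words for numbers and vectors\<close>

fun val :: "letter list \<Rightarrow> nat" where
  "val [] = 0"
| "val (a # w) = (if a = L_1 then 1 else 0) + 2 * val w"

definition bitw :: "letter list \<Rightarrow> bool" where
  "bitw w \<longleftrightarrow> set w \<subseteq> {L_0, L_1}"

lemma bitw_simps [simp]: "bitw []" "bitw (a # w) \<longleftrightarrow> (a = L_0 \<or> a = L_1) \<and> bitw w" "bitw (v @ w) \<longleftrightarrow> bitw v \<and> bitw w"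
  by (auto simp: bitw_def)

lemma val_append: "val (v @ w) = val v + 2 ^ length v * val w"
  by (induction v) (auto simp: algebra_simps)

lemma val_pos: "val (v @ L_1 # w) > 0"
  by (simp add: val_append)

lemma bits_0 [simp]: "bits 0 = []"
  by (simp add: bits.simps)

lemma bits_double [simp]: "n > 0 \<Longrightarrow> bits (2 * n) = L_0 # bits n" "bits (Suc (2 * n)) = L_1 # bits n"
  by (subst bits.simps, simp)+

lemma val_bits [simp]: "val (bits n) = n"
proof (induction n rule: bits.induct)
  case (1 n)
  then show ?case by (cases "n = 0") (simp_all add: bits.simps[of n])
qed

lemma bitw_bits [simp]: "bitw (bits n)"
proof (induction n rule: bits.induct)
  case (1 n)
  then show ?case by (cases "n = 0") (simp_all add: bits.simps[of n])
qed

fun encI :: "letter \<times> letter list \<Rightarrow> letter list" where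
  "encI (s, a) = s # a @ [L_End]"

fun ival :: "letter \<times> letter list \<Rightarrow> int" where
  "ival (s, a) = (if s = L_Minus then - int (val a) else int (val a))"

fun okI :: "letter \<times> letter list \<Rightarrow> bool" where
  "okI (s, a) \<longleftrightarrow> (s = L_Plus \<or> s = L_Minus) \<and> bitw a"

text \<open>A point \<open>x\<close> of a certificate has homogeneous coordinates \<open>(-c, c x\<^sub>1, \<dots>, c x\<^sub>n)\<close> with \<open>c > 0\<close>, so that
  \<open>a x \<le> b\<close> says that the product with the row \<open>(b, a)\<close> is at most \<open>0\<close>. Each coordinate is a difference of
  two natural numbers, which avoids subtraction.\<close>

fun encP :: "letter list \<times> letter list \<Rightarrow> letter list" where
  "encP (u, v) = u @ [L_End] @ v @ [L_End]"

fun pval :: "letter list \<times> letter list \<Rightarrow> int" where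
  "pval (u, v) = int (val u) - int (val v)"

fun okP :: "letter list \<times> letter list \<Rightarrow> bool" where
  "okP (u, v) \<longleftrightarrow> bitw u \<and> bitw v"

definition int_code :: "int \<Rightarrow> letter \<times> letter list" where
  "int_code z = ((if z < 0 then L_Minus else L_Plus), bits (nat \<bar>z\<bar>))"

lemma enc_int_code: "enc_int = encI \<circ> int_code"
  by (auto simp: enc_int_def enc_nat_def int_code_def)

lemma okI_int_code [simp]: "okI (int_code z)"
  by (simp add: int_code_def)

lemma ival_int_code [simp]: "ival (int_code z) = z"
  by (simp add: int_code_def)

text \<open>Unique parsing in front of any continuation. Every identification of an argument word
  with a list of numbers, rows or vertices rests on it.\<close>

definition prefix_free :: "'b set \<Rightarrow> ('b \<Rightarrow> letter list) \<Rightarrow> bool" where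
  "prefix_free S f \<longleftrightarrow> (\<forall>x\<in>S. \<forall>y\<in>S. \<forall>u v. f x @ u = f y @ v \<longrightarrow> x = y \<and> u = v)"

lemma prefix_freeD: "prefix_free S f \<Longrightarrow> x \<in> S \<Longrightarrow> y \<in> S \<Longrightarrow> f x @ u = f y @ v \<Longrightarrow> x = y \<and> u = v"
  unfolding prefix_free_def by blast

lemma bitw_End: "bitw a \<Longrightarrow> bitw b \<Longrightarrow> a @ L_End # u = b @ L_End # v \<longleftrightarrow> a = b \<and> u = v"
proof (induction a arbitrary: b)
  case Nil
  then show ?case by (cases b) auto
next
  case (Cons x a)
  then show ?case by (cases b) auto
qed

lemma prefix_free_encI: "prefix_free {t. okI t} encI"
  unfolding prefix_free_def by (auto simp: bitw_End)

lemma prefix_free_encP: "prefix_free {t. okP t} encP"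
  unfolding prefix_free_def by (auto simp: bitw_End)

lemma enc_list_simps [simp]: "enc_list f [] = [L_End]" "enc_list f (x # xs) = L_Item # f x @ enc_list f xs"
  by (auto simp: enc_list_def)

lemma enc_list_map: "enc_list f (map g xs) = enc_list (f \<circ> g) xs"
  by (induction xs) auto

lemma prefix_free_enc_list:
  assumes "prefix_free S f"
  shows "prefix_free (lists S) (enc_list f)"
proof -
  have "xs \<in> lists S \<Longrightarrow> ys \<in> lists S \<Longrightarrow> enc_list f xs @ u = enc_list f ys @ v \<Longrightarrow> xs = ys \<and> u = v" for xs ys u v
  proof (induction xs arbitrary: ys)
    case Nil
    then show ?case by (cases ys) auto
  next
    case (Cons x xs)
    then obtain y ys' where ys: "ys = y # ys'" by (cases ys) auto
    then have "f x @ enc_list f xs @ u = f y @ enc_list f ys' @ v" "x \<in> S" "y \<in> S" using Cons.prems by auto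
    then have "x = y" "enc_list f xs @ u = enc_list f ys' @ v" using prefix_freeD[OF assms] by blast+
    then show ?case using Cons.IH[of ys'] Cons.prems ys by auto
  qed
  then show ?thesis unfolding prefix_free_def by blast
qed

definition isvec :: "letter list \<Rightarrow> (letter list \<times> letter list) list \<Rightarrow> bool" where
  "isvec w ps \<longleftrightarrow> w = enc_list encP ps \<and> ps \<in> lists {p. okP p}"

definition isrow :: "letter list \<Rightarrow> (letter \<times> letter list) list \<Rightarrow> bool" where
  "isrow w ts \<longleftrightarrow> w = enc_list encI ts \<and> ts \<in> lists {t. okI t}"

lemma isvec_unique: "isvec w ps \<Longrightarrow> isvec (w @ x) qs \<Longrightarrow> qs = ps \<and> x = []"
  unfolding isvec_def using prefix_freeD[OF prefix_free_enc_list[OF prefix_free_encP], of qs ps "[]" x] by auto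

lemma isrow_unique: "isrow w ps \<Longrightarrow> isrow w qs \<Longrightarrow> qs = ps"
  unfolding isrow_def using prefix_freeD[OF prefix_free_enc_list[OF prefix_free_encI], of qs ps "[]" "[]"] by auto

lemma isvec_simps [simp]:
  "isvec [L_End] ps \<longleftrightarrow> ps = []"
  "isvec w [] \<longleftrightarrow> w = [L_End]"
  "isvec w ((u, v) # ps) \<longleftrightarrow> bitw u \<and> bitw v \<and> (\<exists>w'. w = L_Item # u @ L_End # v @ L_End # w' \<and> isvec w' ps)"
  by (cases ps; auto simp: isvec_def)+

lemma isrow_simps [simp]:
  "isrow [L_End] ts \<longleftrightarrow> ts = []"
  "isrow w [] \<longleftrightarrow> w = [L_End]"
  "isrow w ((s, a) # ts) \<longleftrightarrow> (s = L_Plus \<or> s = L_Minus) \<and> bitw a \<and> (\<exists>w'. w = L_Item # s # a @ L_End # w' \<and> isrow w' ts)"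
  by (cases ts; auto simp: isrow_def)+

lemma isvec_Item:
  assumes "bitw u" "bitw v"
  shows "isvec (L_Item # u @ L_End # v @ L_End # w) ps \<longleftrightarrow> (\<exists>qs. ps = (u, v) # qs \<and> isvec w qs)"
  using assms by (cases ps) (auto simp: bitw_End)

lemma isrow_Item:
  assumes "bitw a"
  shows "isrow (L_Item # s # a @ L_End # w) ts \<longleftrightarrow> (s = L_Plus \<or> s = L_Minus) \<and> (\<exists>qs. ts = (s, a) # qs \<and> isrow w qs)"
  using assms by (cases ts) (auto simp: bitw_End)

subsection \<open>Meaning of the arithmetic predicates\<close>

definition s_add where "s_add c x y z \<longleftrightarrow> bitw x \<and> bitw y \<and> bitw z \<and> val x + val y + val c = val z"
definition s_zero where "s_zero x y \<longleftrightarrow> bitw x \<and> bitw y \<and> val y = 0"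
definition s_mul where "s_mul a b r \<longleftrightarrow> bitw a \<and> bitw b \<and> bitw r \<and> val r = val a * val b"
definition s_pos where "s_pos w \<longleftrightarrow> (\<exists>n>0. w = bits n)"
definition s_nat where "s_nat w \<longleftrightarrow> (\<exists>n. w = bits n)"

definition scaled :: "nat \<Rightarrow> frac \<Rightarrow> letter \<times> letter list \<Rightarrow> bool" where
  "scaled g f t \<longleftrightarrow> snd f > 0 \<and> okI t \<and> ival t * int (snd f) = int g * fst f"

definition s_scale where "s_scale G m r \<longleftrightarrow> (\<exists>fs ts. m = enc_list enc_frac fs \<and> isrow r ts \<and> list_all2 (scaled (val G)) fs ts)"

definition moved :: "nat \<Rightarrow> (letter list \<times> letter list) list \<Rightarrow> (letter list \<times> letter list) list \<Rightarrow> (letter \<times> letter list) list \<Rightarrow> bool" where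
  "moved y ps ps' ts \<longleftrightarrow> length ps = length ts \<and> length ps' = length ts \<and>
     (\<forall>i<length ts. pval (ps' ! i) = pval (ps ! i) + int y * ival (ts ! i))"

definition s_move where "s_move y w w' r \<longleftrightarrow> (\<exists>ps ps' ts. isvec w ps \<and> isvec w' ps' \<and> isrow r ts \<and> moved (val y) ps ps' ts)"

text \<open>Each mode may have a scaling factor of its own, since scaling a mode only changes
  durations. The last condition is an implication because the rule for the empty list says nothing
  about \<open>O'\<close>.\<close>

definition s_modes where "s_modes O' Ms Rs \<longleftrightarrow> (\<exists>fss tss. Ms = enc_list (enc_list enc_frac) fss \<and> Rs = enc_list (enc_list encI) tss \<and>
   tss \<in> lists (lists {t. okI t}) \<and> list_all2 (\<lambda>fs ts. \<exists>g>0. list_all2 (scaled g) fs ts) fss tss \<and>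
   (\<forall>os. isvec O' os \<longrightarrow> (\<forall>ts\<in>set tss. length ts + 1 = length os)))"

definition s_zerovec where "s_zerovec w \<longleftrightarrow> (\<exists>ps. isvec w ps \<and> (\<forall>p\<in>set ps. pval p = 0))"

lemma s_zero_simps: "s_zero [] []" "s_zero x y \<Longrightarrow> s_zero (L_0 # x) (L_0 # y)" "s_zero x y \<Longrightarrow> s_zero (L_1 # x) (L_0 # y)"
  by (auto simp: s_zero_def)

lemma s_mul_Nil: "s_zero x y \<Longrightarrow> s_mul [] x y"
  by (auto simp: s_zero_def s_mul_def)

lemma s_mul_0: "s_mul a x (y @ [L_0]) \<Longrightarrow> s_mul (L_0 # a) x (L_0 # y)"
  by (auto simp: s_mul_def val_append)

lemma s_mul_1: "s_mul a x (y @ [L_0]) \<Longrightarrow> s_add [L_0] (L_0 # y) x z \<Longrightarrow> s_mul (L_1 # a) x z"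
  by (auto simp: s_mul_def s_add_def val_append algebra_simps)

lemma s_pos_1: "s_pos [L_1]"
  unfolding s_pos_def using bits_double(2)[of 0] by (intro exI[of _ 1]) auto

lemma s_pos_Cons: "s_pos w \<Longrightarrow> s_pos (L_0 # w)" "s_pos w \<Longrightarrow> s_pos (L_1 # w)"
proof -
  assume "s_pos w"
  then obtain n where n: "n > 0" "w = bits n" by (auto simp: s_pos_def)
  show "s_pos (L_0 # w)" unfolding s_pos_def using n by (intro exI[of _ "2 * n"]) auto
  show "s_pos (L_1 # w)" unfolding s_pos_def using n by (intro exI[of _ "Suc (2 * n)"]) auto
qed

lemma s_nat_intros: "s_nat []" "s_pos w \<Longrightarrow> s_nat w"
proof -
  show "s_nat []" unfolding s_nat_def by (rule exI[of _ 0]) simp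
qed (auto simp: s_nat_def s_pos_def)

lemma s_chk_enc_int:
  "s_nat a \<Longrightarrow> \<exists>z. L_Plus # a @ [L_End] = enc_int z \<and> (L_Plus, a) = int_code z"
  "s_pos a \<Longrightarrow> \<exists>z. L_Minus # a @ [L_End] = enc_int z \<and> (L_Minus, a) = int_code z"
proof -
  assume "s_nat a"
  then obtain n where "a = bits n" by (auto simp: s_nat_def)
  then show "\<exists>z. L_Plus # a @ [L_End] = enc_int z \<and> (L_Plus, a) = int_code z"
    by (intro exI[of _ "int n"]) (auto simp: enc_int_def enc_nat_def int_code_def)
next
  assume "s_pos a"
  then obtain n where "a = bits n" "n > 0" by (auto simp: s_pos_def)
  then show "\<exists>z. L_Minus # a @ [L_End] = enc_int z \<and> (L_Minus, a) = int_code z"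
    by (intro exI[of _ "- int n"]) (auto simp: enc_int_def enc_nat_def int_code_def)
qed

lemma s_scale_Nil: "s_scale G [L_End] [L_End]"
  unfolding s_scale_def by (intro exI[of _ "[]"]) auto

lemma s_scale_Cons:
  assumes "(L_Plus = s \<and> s_nat a) \<or> (L_Minus = s \<and> s_pos a)" "s_pos f" "s_mul f t z" "s_mul a G z" "s_scale G M R"
  shows "s_scale G (L_Item # s # a @ L_End # f @ L_End # M) (L_Item # s # t @ L_End # R)"
proof -
  obtain k where k: "s # a @ [L_End] = enc_int k" "(s, a) = int_code k" using assms(1) s_chk_enc_int by blast
  obtain n where n: "n > 0" "f = bits n" using assms(2) by (auto simp: s_pos_def)
  obtain fs ts where ft: "M = enc_list enc_frac fs" "isrow R ts" "list_all2 (scaled (val G)) fs ts"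
    using assms(5) by (auto simp: s_scale_def)
  have v: "val a * val G = n * val t" "bitw t" using assms(3,4) n by (auto simp: s_mul_def)
  have vi: "int (val a) * int (val G) = int n * int (val t)" using v(1) by (metis of_nat_mult)
  have s: "s = L_Plus \<or> s = L_Minus" using assms(1) by auto
  have "k = ival (s, a)" using k(2) by simp
  then have "scaled (val G) (k, n) (s, t)"
    using n(1) v(2) s vi by (auto simp: scaled_def algebra_simps)
  moreover have "L_Item # s # a @ L_End # f @ L_End # M = enc_list enc_frac ((k, n) # fs)"
    using k(1)[symmetric] n ft(1) by (simp add: enc_frac_def enc_nat_def)
  moreover have "isrow (L_Item # s # t @ L_End # R) ((s, t) # ts)" using ft v s by simp
  ultimately show ?thesis unfolding s_scale_def using ft(3)
    by (intro exI[of _ "(k, n) # fs"] exI[of _ "(s, t) # ts"]) auto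
qed

lemma s_move_Nil: "s_move y [L_End] [L_End] [L_End]"
  unfolding s_move_def by (intro exI[of _ "[]"]) (auto simp: moved_def)

lemma moved_Cons: "moved y (p # ps) (p' # ps') (t # ts) \<longleftrightarrow> pval p' = pval p + int y * ival t \<and> moved y ps ps' ts"
  by (auto simp: moved_def nth_Cons' less_Suc_eq_0_disj)

lemma s_move_Plus:
  assumes "s_mul a y t" "s_add [L_0] u t u'" "s_zero v z" "s_move y w w' r"
  shows "s_move y (L_Item # u @ L_End # v @ L_End # w) (L_Item # u' @ L_End # v @ L_End # w') (L_Item # L_Plus # a @ L_End # r)"
proof -
  obtain ps ps' ts where m: "isvec w ps" "isvec w' ps'" "isrow r ts" "moved (val y) ps ps' ts"
    using assms(4) by (auto simp: s_move_def)
  have "pval (u', v) = pval (u, v) + int (val y) * ival (L_Plus, a)" "bitw u" "bitw u'" "bitw v" "bitw a"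
    using assms(1-3) by (auto simp: s_mul_def s_add_def s_zero_def algebra_simps simp flip: of_nat_mult of_nat_add)
  then show ?thesis unfolding s_move_def using m
    by (intro exI[of _ "(u, v) # ps"] exI[of _ "(u', v) # ps'"] exI[of _ "(L_Plus, a) # ts"]) (auto simp: moved_Cons)
qed

lemma s_move_Minus:
  assumes "s_mul a y t" "s_add [L_0] v t v'" "s_zero u z" "s_move y w w' r"
  shows "s_move y (L_Item # u @ L_End # v @ L_End # w) (L_Item # u @ L_End # v' @ L_End # w') (L_Item # L_Minus # a @ L_End # r)"
proof -
  obtain ps ps' ts where m: "isvec w ps" "isvec w' ps'" "isrow r ts" "moved (val y) ps ps' ts"
    using assms(4) by (auto simp: s_move_def)
  have "pval (u, v') = pval (u, v) + int (val y) * ival (L_Minus, a)" "bitw u" "bitw v'" "bitw v" "bitw a"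
    using assms(1-3) by (auto simp: s_mul_def s_add_def s_zero_def algebra_simps simp flip: of_nat_mult of_nat_add)
  then show ?thesis unfolding s_move_def using m
    by (intro exI[of _ "(u, v) # ps"] exI[of _ "(u, v') # ps'"] exI[of _ "(L_Minus, a) # ts"]) (auto simp: moved_Cons)
qed

lemma s_modes_Nil: "s_modes O' [L_End] [L_End]"
  unfolding s_modes_def by (intro exI[of _ "[]"]) auto

lemma isrow_word: "isrow r ts \<Longrightarrow> r = enc_list encI ts" "isrow r ts \<Longrightarrow> ts \<in> lists {t. okI t}"
  by (auto simp: isrow_def)

lemma s_modes_Cons:
  assumes "s_scale G m r" "val G > 0" "s_move y O' W (L_Item # L_Plus # L_End # r)" "s_modes O' Ms Rs"
  shows "s_modes O' (L_Item # m @ Ms) (L_Item # r @ Rs)"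
proof -
  obtain fs ts where f: "m = enc_list enc_frac fs" "isrow r ts" "list_all2 (scaled (val G)) fs ts"
    using assms(1) by (auto simp: s_scale_def)
  obtain fss tss where m: "Ms = enc_list (enc_list enc_frac) fss" "Rs = enc_list (enc_list encI) tss" "tss \<in> lists (lists {t. okI t})"
   "list_all2 (\<lambda>fs ts. \<exists>g>0. list_all2 (scaled g) fs ts) fss tss"
   "\<forall>os. isvec O' os \<longrightarrow> (\<forall>ts\<in>set tss. length ts + 1 = length os)"
    using assms(4) by (auto simp: s_modes_def)
  obtain ps ps' ts' where mv: "isvec O' ps" "isrow (L_Item # L_Plus # [] @ L_End # r) ts'" "moved (val y) ps ps' ts'"
    using assms(3) by (auto simp: s_move_def)
  have "ts' = (L_Plus, []) # ts" using mv(2) f(2) isrow_unique by (subst (asm) isrow_Item) auto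
  then have l: "length ts + 1 = length ps" using mv(3) by (simp add: moved_def)
  have "length ts + 1 = length os" if "isvec O' os" for os
    using isvec_unique[OF mv(1), of "[]" os] that l by simp
  then show ?thesis unfolding s_modes_def using f m assms(2) isrow_word[OF f(2)]
    by (intro exI[of _ "fs # fss"] exI[of _ "ts # tss"]) auto
qed

lemma s_zerovec_Nil: "s_zerovec [L_End]"
  unfolding s_zerovec_def by (intro exI[of _ "[]"]) auto

lemma s_zerovec_Cons: "s_zero u z \<Longrightarrow> s_zerovec w \<Longrightarrow> s_zerovec (L_Item # u @ L_End # u @ L_End # w)"
  unfolding s_zerovec_def s_zero_def by (elim exE conjE, rule_tac x = "(u, u) # ps" in exI) auto


subsection \<open>Meaning of the predicates for zones\<close>

definition s_introw where "s_introw w \<longleftrightarrow> (\<exists>zs. w = enc_list enc_int zs)"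

lemma prefix_free_enc_int: "prefix_free UNIV enc_int"
  unfolding prefix_free_def
proof (intro ballI allI impI)
  fix x y u v assume "enc_int x @ u = enc_int y @ v"
  then have "int_code x = int_code y \<and> u = v"
    using prefix_freeD[OF prefix_free_encI, of "int_code x" "int_code y" u v] by (simp add: enc_int_code)
  then show "x = y \<and> u = v" by (metis ival_int_code)
qed

lemma prefix_free_enc_ints: "prefix_free UNIV (enc_list enc_int)"
  using prefix_free_enc_list[OF prefix_free_enc_int] by simp

lemma enc_list_unique: "prefix_free UNIV f \<Longrightarrow> enc_list f xs = enc_list f ys \<Longrightarrow> xs = ys"
  using prefix_freeD[OF prefix_free_enc_list, of UNIV f xs ys "[]" "[]"] by auto

lemma isrow_ints: "isrow (enc_list enc_int zs) (map int_code zs)"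
  by (auto simp: isrow_def enc_list_map enc_int_code simp del: okI.simps)

lemma s_introw_Nil: "s_introw [L_End]"
  unfolding s_introw_def by (intro exI[of _ "[]"]) simp

lemma s_introw_Cons:
  "(L_Plus = s \<and> s_nat a) \<or> (L_Minus = s \<and> s_pos a) \<Longrightarrow> s_introw r \<Longrightarrow> s_introw (L_Item # s # a @ L_End # r)"
proof -
  assume s: "(L_Plus = s \<and> s_nat a) \<or> (L_Minus = s \<and> s_pos a)" "s_introw r"
  obtain k where k: "s # a @ [L_End] = enc_int k" using s(1) s_chk_enc_int by blast
  obtain zs where "r = enc_list enc_int zs" using s(2) by (auto simp: s_introw_def)
  then show ?thesis unfolding s_introw_def using k[symmetric] by (intro exI[of _ "k # zs"]) simp
qed

definition encrows :: "int list list \<Rightarrow> letter list" where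
  "encrows = enc_list (enc_list enc_int)"

text \<open>The right-hand sides \<open>bs\<close> are the first entries of the rows, in line with the homogeneous coordinates.\<close>

definition combined :: "nat list \<Rightarrow> int list list \<Rightarrow> int list \<Rightarrow> int list \<Rightarrow> int list \<Rightarrow> bool" where
  "combined ys rws bs vs vs' \<longleftrightarrow> length ys = length rws \<and> length bs = length rws \<and> length vs' = length vs \<and>
     (\<forall>row\<in>set rws. length row + 1 = length vs) \<and>
     (\<forall>j<length vs. vs' ! j = vs ! j + (\<Sum>r<length rws. int (ys ! r) * (bs ! r # rws ! r) ! j))"

text \<open>An implication over \<open>ps\<close>, because the rule for no rows accepts every word
  \<open>w\<close>. A reading of \<open>w\<close> as a vector is carried over to
  \<open>w'\<close>.\<close>

definition s_comb where "s_comb A B w w' \<longleftrightarrow> (\<exists>rws bs. A = encrows rws \<and> B = enc_list enc_int bs \<and> length bs = length rws \<and>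
   (\<forall>ps. isvec w ps \<longrightarrow> (\<exists>ps' ys. isvec w' ps' \<and> combined ys rws bs (map pval ps) (map pval ps'))))"

lemma s_comb_Nil: "s_comb [L_End] [L_End] w w"
  unfolding s_comb_def encrows_def by (intro exI[of _ "[]"]) (auto simp: combined_def)

lemma s_comb_Cons:
  assumes "(L_Plus = s \<and> s_nat a) \<or> (L_Minus = s \<and> s_pos a)" "s_introw r" "s_move y w w' (L_Item # s # a @ L_End # r)" "s_comb A B w' w''"
  shows "s_comb (L_Item # r @ A) (L_Item # s # a @ L_End # B) w w''"
proof -
  obtain k where k: "s # a @ [L_End] = enc_int k" "(s, a) = int_code k" using assms(1) s_chk_enc_int by blast
  obtain zs where zs: "r = enc_list enc_int zs" using assms(2) by (auto simp: s_introw_def)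
  obtain rws bs where rb: "A = encrows rws" "B = enc_list enc_int bs" "length bs = length rws"
   "\<And>ps. isvec w' ps \<Longrightarrow> (\<exists>ps' ys. isvec w'' ps' \<and> combined ys rws bs (map pval ps) (map pval ps'))"
    using assms(4) by (auto simp: s_comb_def)
  obtain ps ps' ts where m: "isvec w ps" "isvec w' ps'" "isrow (L_Item # s # a @ L_End # r) ts" "moved (val y) ps ps' ts"
    using assms(3) by (auto simp: s_move_def)
  have "L_Item # s # a @ L_End # r = enc_list enc_int (k # zs)" using k(1)[symmetric] zs by simp
  then have ts: "ts = map int_code (k # zs)" using m(3) isrow_unique isrow_ints by metis
  obtain ps'' ys where c: "isvec w'' ps''" "combined ys rws bs (map pval ps') (map pval ps'')" using rb(4)[OF m(2)] by blast
  have "combined (val y # ys) (zs # rws) (k # bs) (map pval ps) (map pval ps'')"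
    unfolding combined_def
  proof (intro conjI allI impI ballI)
    fix j assume j: "j < length (map pval ps)"
    have l: "length ps = Suc (length zs)" "length ps' = length ps" using m(4) ts by (auto simp: moved_def)
    have "pval (ps' ! j) = pval (ps ! j) + int (val y) * (k # zs) ! j"
      using m(4) ts j l by (auto simp: moved_def nth_Cons split: nat.splits)
    moreover have "pval (ps'' ! j) = pval (ps' ! j) + (\<Sum>r<length rws. int (ys ! r) * (bs ! r # rws ! r) ! j)"
      using c(2) j l by (auto simp: combined_def)
    moreover have "length ps'' = length ps" using c(2) l by (simp add: combined_def)
    ultimately show "map pval ps'' ! j = map pval ps ! j +
       (\<Sum>r<length (zs # rws). int ((val y # ys) ! r) * ((k # bs) ! r # (zs # rws) ! r) ! j)"
      using j by (simp add: sum.lessThan_Suc_shift del: sum.lessThan_Suc)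
  qed (use m(4) ts c(2) in \<open>auto simp: combined_def moved_def\<close>)
  moreover have "ps = qs" if "isvec w qs" for qs using isvec_unique[OF m(1), of "[]" qs] that by simp
  ultimately show ?thesis unfolding s_comb_def using c(1) rb(1-3) zs k(1)[symmetric]
    by (intro exI[of _ "zs # rws"] exI[of _ "k # bs"]) (auto simp: encrows_def)
qed

definition s_eqzero where "s_eqzero w \<longleftrightarrow> (\<exists>ps. isvec w ps \<and> (\<forall>p\<in>set ps. pval p = 0))"

lemma s_eqzero_Nil: "s_eqzero [L_End]"
  unfolding s_eqzero_def by (intro exI[of _ "[]"]) auto

lemma s_eqzero_Cons: "s_zero u z \<Longrightarrow> s_eqzero w \<Longrightarrow> s_eqzero (L_Item # u @ L_End # u @ L_End # w)"
  unfolding s_eqzero_def s_zero_def by (elim exE conjE, rule_tac x = "(u, u) # ps" in exI) auto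

text \<open>A combination of the rows (with some coefficients) that is a positive or negative multiple of the
  \<open>i\<close>-th unit vector bounds the \<open>i\<close>-th coordinate from one side.\<close>

definition dir_cert :: "int list list \<Rightarrow> int list \<Rightarrow> nat \<Rightarrow> nat \<Rightarrow> int \<Rightarrow> bool" where
  "dir_cert rws bs n i sg \<longleftrightarrow> length bs = length rws \<and> (\<forall>row\<in>set rws. length row = n) \<and>
     (\<exists>c>0. \<exists>ys::nat list. \<forall>j<n. (\<Sum>r<length rws. int (ys ! r) * rws ! r ! j) = (if j = i then sg * c else 0))"

text \<open>The empty remainder is accepted without a test, so the statement presupposes that
  \<open>X\<close> and \<open>Y\<close> consist of zeros, and it speaks only about the coordinates
  from \<open>length xs\<close> on.\<close>

definition s_dirs where "s_dirs A B X Y \<longleftrightarrow> (\<forall>xs ys. X = concat (map (\<lambda>p. L_Item # encP p) xs) \<and> xs \<in> lists {p. okP p} \<and>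
   (\<forall>p\<in>set xs. pval p = 0) \<and> isvec Y ys \<and> (\<forall>p\<in>set ys. pval p = 0) \<longrightarrow>
   (\<forall>i\<ge>length xs. i < length xs + length ys \<longrightarrow> (\<exists>rws bs. A = encrows rws \<and> B = enc_list enc_int bs \<and>
      (\<forall>sg\<in>{1, -1}. dir_cert rws bs (length xs + length ys) i sg))))"

lemma s_dirs_Nil: "s_dirs A B X [L_End]"
  by (auto simp: s_dirs_def)

lemma rows_unique: "encrows rws = encrows rws' \<Longrightarrow> rws = rws'"
  unfolding encrows_def by (rule enc_list_unique[OF prefix_free_enc_ints])

lemma ints_unique: "enc_list enc_int zs = enc_list enc_int zs' \<Longrightarrow> zs = zs'"
  by (rule enc_list_unique[OF prefix_free_enc_int])

lemma isvec_append:
  assumes "xs \<in> lists {p. okP p}" "isvec Y ys"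
  shows "isvec (concat (map (\<lambda>p. L_Item # encP p) xs) @ Y) (xs @ ys)"
  using assms by (induction xs) (auto simp: isvec_def)

text \<open>If a vector whose only non-zero entry is \<open>- sg * c\<close> is carried to one that
  vanishes behind its first entry, then the combination added must be \<open>sg * c\<close> times a
  unit vector. The first entry remains free.\<close>

lemma dir_certI:
  assumes comb: "s_comb A B (L_Item # z @ L_End # z @ L_End # X @ L_Item # u @ L_End # v @ L_End # Y) (L_Item # p @ L_End # q @ L_End # Vw)"
    and eq: "s_eqzero Vw" and pq: "bitw p" "bitw q" and zuv: "bitw z" "bitw u" "bitw v" and d: "int (val u) - int (val v) = - sg * c" "c > 0"
    and X: "X = concat (map (\<lambda>p. L_Item # encP p) xs)" "xs \<in> lists {p. okP p}" "\<forall>p\<in>set xs. pval p = 0"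
    and Y: "isvec Y ys" "\<forall>p\<in>set ys. pval p = 0"
  shows "\<exists>rws bs. A = encrows rws \<and> B = enc_list enc_int bs \<and> dir_cert rws bs (length xs + Suc (length ys)) (length xs) sg"
proof -
  let ?ps = "(z, z) # xs @ (u, v) # ys"
  have "isvec (X @ L_Item # u @ L_End # v @ L_End # Y) (xs @ (u, v) # ys)"
    unfolding X(1) using Y(1) zuv by (intro isvec_append X(2)) auto
  then have ps: "isvec (L_Item # z @ L_End # z @ L_End # X @ L_Item # u @ L_End # v @ L_End # Y) ?ps"
    using zuv by simp
  obtain rws bs where rb: "A = encrows rws" "B = enc_list enc_int bs" "length bs = length rws"
   "\<And>ps. isvec (L_Item # z @ L_End # z @ L_End # X @ L_Item # u @ L_End # v @ L_End # Y) ps \<Longrightarrow>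
      (\<exists>ps' ys. isvec (L_Item # p @ L_End # q @ L_End # Vw) ps' \<and> combined ys rws bs (map pval ps) (map pval ps'))"
    using comb by (auto simp: s_comb_def)
  obtain ps' cs where c: "isvec (L_Item # p @ L_End # q @ L_End # Vw) ps'" "combined cs rws bs (map pval ?ps) (map pval ps')"
    using rb(4)[OF ps] by blast
  obtain qs where qs: "ps' = (p, q) # qs" "isvec Vw qs" using c(1) isvec_Item[OF pq] by auto
  obtain qs' where "isvec Vw qs'" "\<forall>p\<in>set qs'. pval p = 0" using eq by (auto simp: s_eqzero_def)
  then have q0: "\<forall>p\<in>set qs. pval p = 0" using isvec_unique[OF qs(2), of "[]" qs'] by simp
  let ?n = "length xs + Suc (length ys)"
  have lq: "length qs = ?n" using c(2) qs by (simp add: combined_def)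
  have cj: "\<forall>j<length (map pval ?ps). map pval ps' ! j = map pval ?ps ! j + (\<Sum>r<length rws. int (cs ! r) * (bs ! r # rws ! r) ! j)"
    using c(2) unfolding combined_def by (elim conjE)
  have "(\<Sum>r<length rws. int (cs ! r) * rws ! r ! j) = (if j = length xs then sg * c else 0)" if j: "j < ?n" for j
  proof -
    have "map pval ps' ! Suc j = map pval ?ps ! Suc j + (\<Sum>r<length rws. int (cs ! r) * (bs ! r # rws ! r) ! Suc j)"
      by (rule cj[rule_format]) (use j in simp)
    moreover have "map pval ps' ! Suc j = 0" using q0 qs(1) lq j by simp
    moreover have "map pval ?ps ! Suc j = (if j = length xs then - sg * c else 0)"
      using X(3) Y(2) d j by (auto simp: nth_append nth_Cons')
    ultimately show ?thesis by (auto split: if_splits)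
  qed
  moreover have "\<forall>row\<in>set rws. length row = ?n" using c(2) by (simp add: combined_def)
  ultimately have "dir_cert rws bs ?n (length xs) sg" unfolding dir_cert_def using rb(3) d(2) by blast
  then show ?thesis using rb by blast
qed

text \<open>The two combinations settle coordinate \<open>length xs\<close>; for later ones the
  current zero is moved to the end of \<open>X\<close> and the premise for \<open>Y\<close> applies.
  Both certificates speak about the same rows because \<open>A\<close> and \<open>B\<close> can be
  read in only one way.\<close>

lemma s_dirs_Cons:
  assumes "s_zero z z" "s_zero (c1 @ L_1 # c2) t"
    "s_comb A B (L_Item # z @ L_End # z @ L_End # X @ L_Item # c1 @ L_1 # c2 @ L_End # z @ L_End # Y) (L_Item # p @ L_End # q @ L_End # Vw)"
    "s_zero p t1" "s_zero q t2" "s_eqzero Vw"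
    "s_comb A B (L_Item # z @ L_End # z @ L_End # X @ L_Item # z @ L_End # c1 @ L_1 # c2 @ L_End # Y) (L_Item # p' @ L_End # q' @ L_End # Vw')"
    "s_zero p' t3" "s_zero q' t4" "s_eqzero Vw'"
    "s_dirs A B (X @ L_Item # z @ L_End # z @ [L_End]) Y"
  shows "s_dirs A B X (L_Item # z @ L_End # z @ L_End # Y)"
  unfolding s_dirs_def
proof (intro allI impI, elim conjE)
  fix xs ys i
  assume X: "X = concat (map (\<lambda>p. L_Item # encP p) xs)" "xs \<in> lists {p. okP p}" "\<forall>p\<in>set xs. pval p = 0"
    and Y: "isvec (L_Item # z @ L_End # z @ L_End # Y) ys" "\<forall>p\<in>set ys. pval p = 0"
    and i: "length xs \<le> i" "i < length xs + length ys"
  have z: "bitw z" "val z = 0" using assms(1) by (auto simp: s_zero_def)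
  obtain ys' where ys: "ys = (z, z) # ys'" "isvec Y ys'" using Y(1) isvec_Item[OF z(1) z(1)] by auto
  have Y': "\<forall>p\<in>set ys'. pval p = 0" using Y(2) ys by auto
  let ?c = "c1 @ L_1 # c2"
  have c: "bitw ?c" "val ?c > 0" using assms(2) val_pos by (auto simp: s_zero_def)
  show "\<exists>rws bs. A = encrows rws \<and> B = enc_list enc_int bs \<and> (\<forall>sg\<in>{1, -1}. dir_cert rws bs (length xs + length ys) i sg)"
  proof (cases "i = length xs")
    case True
    have bp: "bitw p" "bitw q" "bitw p'" "bitw q'" using assms by (auto simp: s_zero_def)
    obtain rws bs where 1: "A = encrows rws" "B = enc_list enc_int bs" "dir_cert rws bs (length xs + Suc (length ys')) (length xs) (-1)"
      using dir_certI[of A B z X ?c z Y p q Vw "-1" "int (val ?c)" xs ys'] assms(3,6) bp z c X ys(2) Y' by auto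
    obtain rws' bs' where 2: "A = encrows rws'" "B = enc_list enc_int bs'" "dir_cert rws' bs' (length xs + Suc (length ys')) (length xs) 1"
      using dir_certI[of A B z X z ?c Y p' q' Vw' 1 "int (val ?c)" xs ys'] assms(7,10) bp z c X ys(2) Y' by auto
    have "rws' = rws" "bs' = bs" using 1 2 rows_unique ints_unique by metis+
    then show ?thesis using 1 2 ys(1) True by (intro exI[of _ rws] exI[of _ bs]) auto
  next
    case False
    have "X @ L_Item # z @ L_End # z @ [L_End] = concat (map (\<lambda>p. L_Item # encP p) (xs @ [(z, z)]))" using X(1) by simp
    moreover have "xs @ [(z, z)] \<in> lists {p. okP p}" "\<forall>p\<in>set (xs @ [(z, z)]). pval p = 0" using X z by auto
    ultimately show ?thesis using assms(11)[unfolded s_dirs_def, rule_format, of "xs @ [(z, z)]" ys' i] ys Y' i False by auto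
  qed
qed

definition zone_cert :: "int list list \<Rightarrow> int list \<Rightarrow> nat \<Rightarrow> bool" where
  "zone_cert rws bs n \<longleftrightarrow> length bs = length rws \<and> (\<forall>row\<in>set rws. length row = n) \<and>
     ((\<exists>ys::nat list. (\<forall>j<n. (\<Sum>r<length rws. int (ys ! r) * rws ! r ! j) = 0) \<and> (\<Sum>r<length rws. int (ys ! r) * bs ! r) < 0) \<or>
      (\<forall>i<n. \<forall>sg\<in>{1, -1}. dir_cert rws bs n i sg))"

definition zerovec :: "letter list \<Rightarrow> (letter list \<times> letter list) list \<Rightarrow> bool" where
  "zerovec w os \<longleftrightarrow> isvec w os \<and> (\<forall>p\<in>set os. pval p = 0) \<and> length os \<ge> 2"

definition s_zone_ok where "s_zone_ok A B O' \<longleftrightarrow> (\<forall>os. zerovec O' os \<longrightarrow>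
   (\<exists>rws bs. A = encrows rws \<and> B = enc_list enc_int bs \<and> zone_cert rws bs (length os - 1)))"

lemma s_zone_ok_empty:
  assumes "s_comb A B O' (L_Item # u @ L_End # v @ L_End # Vw)" "s_eqzero Vw" "s_add [L_0] u (t1 @ L_1 # t2) v"
  shows "s_zone_ok A B O'"
  unfolding s_zone_ok_def
proof (intro allI impI)
  fix os assume os: "zerovec O' os"
  have uv: "bitw u" "bitw v" "val u < val v" using assms(3) val_pos[of t1 t2] by (auto simp: s_add_def)
  obtain rws bs where rb: "A = encrows rws" "B = enc_list enc_int bs" "length bs = length rws"
   "\<And>ps. isvec O' ps \<Longrightarrow> (\<exists>ps' ys. isvec (L_Item # u @ L_End # v @ L_End # Vw) ps' \<and> combined ys rws bs (map pval ps) (map pval ps'))"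
    using assms(1) by (auto simp: s_comb_def)
  obtain ps' cs where c: "isvec (L_Item # u @ L_End # v @ L_End # Vw) ps'" "combined cs rws bs (map pval os) (map pval ps')"
    using rb(4)[of os] os unfolding zerovec_def by blast
  obtain qs where qs: "ps' = (u, v) # qs" "isvec Vw qs" using c(1) isvec_Item[OF uv(1,2)] by auto
  obtain qs' where "isvec Vw qs'" "\<forall>p\<in>set qs'. pval p = 0" using assms(2) by (auto simp: s_eqzero_def)
  then have q0: "\<forall>p\<in>set qs. pval p = 0" using isvec_unique[OF qs(2), of "[]" qs'] by simp
  have l: "length os = Suc (length qs)" using c(2) qs by (simp add: combined_def)
  have *: "map pval ps' ! j = (\<Sum>r<length rws. int (cs ! r) * (bs ! r # rws ! r) ! j)" if "j < length os" for j
    using c(2) that os by (auto simp: combined_def zerovec_def)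
  have "(\<Sum>r<length rws. int (cs ! r) * rws ! r ! j) = 0" if "j < length os - 1" for j
    using *[of "Suc j"] that l qs(1) q0 by simp
  moreover have "(\<Sum>r<length rws. int (cs ! r) * bs ! r) < 0" using *[of 0] l qs(1) uv(3) by simp
  moreover have "\<forall>row\<in>set rws. length row = length os - 1" using c(2) by (auto simp: combined_def)
  ultimately show "\<exists>rws bs. A = encrows rws \<and> B = enc_list enc_int bs \<and> zone_cert rws bs (length os - 1)"
    using rb(1-3) unfolding zone_cert_def by blast
qed

lemma s_zone_ok_dirs:
  assumes "s_zero z z" "s_dirs A B [] Y"
  shows "s_zone_ok A B (L_Item # z @ L_End # z @ L_End # Y)"
  unfolding s_zone_ok_def
proof (intro allI impI)
  fix os assume os: "zerovec (L_Item # z @ L_End # z @ L_End # Y) os"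
  have z: "bitw z" "val z = 0" using assms(1) by (auto simp: s_zero_def)
  obtain ys where ys: "os = (z, z) # ys" "isvec Y ys" using os isvec_Item[OF z(1) z(1)] by (auto simp: zerovec_def)
  have y0: "\<forall>p\<in>set ys. pval p = 0" and n1: "length ys \<ge> 1" using os ys by (auto simp: zerovec_def)
  have n0: "0 < length ys" using n1 by linarith
  have d: "\<exists>rws bs. A = encrows rws \<and> B = enc_list enc_int bs \<and> (\<forall>sg\<in>{1, -1}. dir_cert rws bs (length ys) i sg)"
    if "i < length ys" for i
    using assms(2)[unfolded s_dirs_def, rule_format, of "[]" ys i] ys(2) y0 that by auto
  obtain rws bs where rb: "A = encrows rws" "B = enc_list enc_int bs" "dir_cert rws bs (length ys) 0 1" using d[OF n0] by blast
  have "\<forall>sg\<in>{1, -1}. dir_cert rws bs (length ys) i sg" if "i < length ys" for i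
    using d[OF that] rb(1,2) rows_unique ints_unique by metis
  then have "zone_cert rws bs (length ys)" using rb(3) unfolding zone_cert_def dir_cert_def by blast
  then show "\<exists>rws bs. A = encrows rws \<and> B = enc_list enc_int bs \<and> zone_cert rws bs (length os - 1)"
    using rb(1,2) ys(1) by auto
qed

section \<open>Zones rebuilt from lists, and why certified zones are bounded\<close>

lemma list_of_mat_rows:
  assumes "\<forall>row\<in>set rws. length row = n"
  shows "mat_to_list (mat_of_rows_list n rws) = rws"
  using assms by (auto simp: mat_to_list_def mat_of_rows_list_def intro!: nth_equalityI)

text \<open>The width \<open>n\<close> is a separate argument because a list without rows does not
  reveal it.\<close>

definition zone_of :: "nat \<Rightarrow> int list list \<Rightarrow> int list \<Rightarrow> zone" where
  "zone_of n rws bs = (mat_of_rows_list n rws, vec_of_list bs)"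

lemma enc_zone_of:
  "\<forall>row\<in>set rws. length row = n \<Longrightarrow> enc_zone (zone_of n rws bs) = encrows rws @ enc_list enc_int bs"
  by (simp add: enc_zone_def zone_of_def encrows_def list_of_mat_rows list_vec)

lemma is_zone_of: "length bs = length rws \<Longrightarrow> is_zone n (zone_of n rws bs)"
  by (auto simp: is_zone_def zone_of_def mat_of_rows_list_def intro!: exI[of _ "length rws"] carrier_vecI)

lemma zone_of_iff:
  assumes "length bs = length rws" "\<forall>row\<in>set rws. length row = n" "x \<in> carrier_vec n"
  shows "x \<in> zone_set (zone_of n rws bs) \<longleftrightarrow> (\<forall>r<length rws. (\<Sum>j<n. of_int (rws ! r ! j) * x $ j) \<le> of_int (bs ! r))"
  unfolding zone_set_iff[OF is_zone_of[OF assms(1)] assms(3)]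
  using assms(1) by (auto simp: zone_of_def mat_of_rows_list_def vec_of_list_index)

text \<open>Weak duality: nonnegative combinations of the inequalities hold at all points of the
  zone. Either one of them is contradictory and the zone is empty, or they bound every coordinate on
  both sides.\<close>

lemma zone_cert_bounded:
  assumes "zone_cert rws bs n"
  shows "is_zone n (zone_of n rws bs) \<and> bounded_zone (zone_of n rws bs)"
proof -
  have l: "length bs = length rws" "\<forall>row\<in>set rws. length row = n" using assms by (auto simp: zone_cert_def)
  let ?Z = "zone_set (zone_of n rws bs)"
  have car: "x \<in> carrier_vec n" if "x \<in> ?Z" for x using that by (simp add: zone_set_def zone_of_def mat_of_rows_list_def)
  have key: "(\<Sum>j<n. of_int (\<Sum>r<length rws. int (ys ! r) * rws ! r ! j) * x $ j) \<le> of_int (\<Sum>r<length rws. int (ys ! r) * bs ! r)"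
    if x: "x \<in> ?Z" for x :: "real vec" and ys :: "nat list"
  proof -
    have "(\<Sum>j<n. of_int (\<Sum>r<length rws. int (ys ! r) * rws ! r ! j) * x $ j)
       = (\<Sum>j<n. \<Sum>r<length rws. real (ys ! r) * (of_int (rws ! r ! j) * x $ j))"
      by (simp add: sum_distrib_right mult.assoc)
    also have "\<dots> = (\<Sum>r<length rws. real (ys ! r) * (\<Sum>j<n. of_int (rws ! r ! j) * x $ j))"
      by (subst sum.swap) (simp add: sum_distrib_left)
    also have "\<dots> \<le> (\<Sum>r<length rws. real (ys ! r) * of_int (bs ! r))"
      using x zone_of_iff[OF l car[OF x]] by (intro sum_mono mult_left_mono) auto
    finally show ?thesis by simp
  qed
  have "bounded_zone (zone_of n rws bs)"
  proof (cases "\<exists>ys::nat list. (\<forall>j<n. (\<Sum>r<length rws. int (ys ! r) * rws ! r ! j) = 0) \<and> (\<Sum>r<length rws. int (ys ! r) * bs ! r) < 0")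
    case True
    then obtain ys :: "nat list" where ys: "\<forall>j<n. (\<Sum>r<length rws. int (ys ! r) * rws ! r ! j) = 0" "(\<Sum>r<length rws. int (ys ! r) * bs ! r) < 0" by blast
    have "x \<notin> ?Z" for x
    proof
      assume x: "x \<in> ?Z"
      have "(\<Sum>j<n. of_int (\<Sum>r<length rws. int (ys ! r) * rws ! r ! j) * x $ j) = 0"
        using ys(1) by (intro sum.neutral) auto
      then have "0 \<le> real_of_int (\<Sum>r<length rws. int (ys ! r) * bs ! r)" using key[OF x, of ys] by linarith
      then show False using ys(2) by linarith
    qed
    then show ?thesis by (auto simp: bounded_zone_def)
  next
    case False
    then have dc: "dir_cert rws bs n i sg" if "i < n" "sg \<in> {1, -1}" for i sg using assms that by (auto simp: zone_cert_def)
    have "\<exists>b. \<forall>x\<in>?Z. of_int sg * x $ i \<le> b" if i: "i < n" and sg: "sg \<in> {1, -1}" for i sg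
    proof -
      obtain c and ys :: "nat list" where c: "c > 0" "\<forall>j<n. (\<Sum>r<length rws. int (ys ! r) * rws ! r ! j) = (if j = i then sg * c else 0)"
        using dc[OF i sg] by (auto simp: dir_cert_def)
      have "of_int sg * x $ i \<le> of_int (\<Sum>r<length rws. int (ys ! r) * bs ! r) / of_int c" if x: "x \<in> ?Z" for x
      proof -
        have "(\<Sum>j<n. of_int (\<Sum>r<length rws. int (ys ! r) * rws ! r ! j) * x $ j) = (\<Sum>j<n. if j = i then of_int (sg * c) * x $ j else 0)"
          using c(2) by (intro sum.cong) auto
        also have "\<dots> = of_int (sg * c) * x $ i" using i by simp
        finally show ?thesis using key[OF x, of ys] c(1) by (simp add: pos_le_divide_eq algebra_simps)
      qed
      then show ?thesis by blast
    qed
    then obtain b where b: "\<And>i sg x. i < n \<Longrightarrow> sg \<in> {1, -1::int} \<Longrightarrow> x \<in> ?Z \<Longrightarrow> of_int sg * x $ i \<le> b i sg" by metis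
    define B where "B = (\<Sum>i<n. \<bar>b i 1\<bar> + \<bar>b i (-1)\<bar>)"
    have "\<bar>x $ i\<bar> \<le> B" if x: "x \<in> ?Z" and i: "i < dim_vec x" for x i
    proof -
      have i: "i < n" using i car[OF x] by auto
      have "\<bar>x $ i\<bar> \<le> \<bar>b i 1\<bar> + \<bar>b i (-1)\<bar>" using b[OF i _ x, of 1] b[OF i _ x, of "-1"] by auto
      also have "\<dots> \<le> B" unfolding B_def using i by (intro member_le_sum) auto
      finally show ?thesis .
    qed
    then show ?thesis unfolding bounded_zone_def by blast
  qed
  then show ?thesis using is_zone_of[OF l(1)] by simp
qed

subsection \<open>Meaning of the predicates for points and formulas\<close>

definition s_dot where "s_dot r w p q p' q' \<longleftrightarrow> (\<exists>ts ps. isrow r ts \<and> isvec w ps \<and> length ts = length ps \<and>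
   int (val p') - int (val q') = int (val p) - int (val q) + (\<Sum>i<length ts. ival (ts ! i) * pval (ps ! i)))"

lemma s_dot_Nil: "s_dot [L_End] [L_End] p q p q"
  unfolding s_dot_def by (intro exI[of _ "[]"]) auto

lemma s_dot_Cons:
  assumes "s_dot r w p1 q1 p' q'" "s = L_Plus \<or> s = L_Minus" "bitw a" "bitw u" "bitw v"
    "int (val p1) - int (val q1) = int (val p) - int (val q) + ival (s, a) * pval (u, v)"
  shows "s_dot (L_Item # s # a @ L_End # r) (L_Item # u @ L_End # v @ L_End # w) p q p' q'"
proof -
  obtain ts ps where t: "isrow r ts" "isvec w ps" "length ts = length ps"
   "int (val p') - int (val q') = int (val p1) - int (val q1) + (\<Sum>i<length ts. ival (ts ! i) * pval (ps ! i))"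
    using assms(1) by (auto simp: s_dot_def)
  have "(\<Sum>i<length ((s, a) # ts). ival (((s, a) # ts) ! i) * pval (((u, v) # ps) ! i)) =
     ival (s, a) * pval (u, v) + (\<Sum>i<length ts. ival (ts ! i) * pval (ps ! i))"
    by (simp add: sum.lessThan_Suc_shift del: sum.lessThan_Suc ival.simps pval.simps)
  then show ?thesis unfolding s_dot_def using t assms(2-6)
    by (intro exI[of _ "(s, a) # ts"] exI[of _ "(u, v) # ps"]) (auto simp del: ival.simps pval.simps sum.lessThan_Suc)
qed

lemma s_dot_Plus:
  assumes "s_mul a u s" "s_add [L_0] p s p1" "s_mul a v t" "s_add [L_0] q t q1" "s_dot r w p1 q1 p' q'"
  shows "s_dot (L_Item # L_Plus # a @ L_End # r) (L_Item # u @ L_End # v @ L_End # w) p q p' q'"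
proof (rule s_dot_Cons[OF assms(5)])
  have "int (val p1) = int (val p) + int (val a) * int (val u)" "int (val q1) = int (val q) + int (val a) * int (val v)"
    using assms by (auto simp: s_mul_def s_add_def simp flip: of_nat_mult of_nat_add)
  then show "int (val p1) - int (val q1) = int (val p) - int (val q) + ival (L_Plus, a) * pval (u, v)"
    by (simp add: algebra_simps)
qed (use assms in \<open>auto simp: s_mul_def\<close>)

lemma s_dot_Minus:
  assumes "s_mul a v s" "s_add [L_0] p s p1" "s_mul a u t" "s_add [L_0] q t q1" "s_dot r w p1 q1 p' q'"
  shows "s_dot (L_Item # L_Minus # a @ L_End # r) (L_Item # u @ L_End # v @ L_End # w) p q p' q'"
proof (rule s_dot_Cons[OF assms(5)])
  have "int (val p1) = int (val p) + int (val a) * int (val v)" "int (val q1) = int (val q) + int (val a) * int (val u)"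
    using assms by (auto simp: s_mul_def s_add_def simp flip: of_nat_mult of_nat_add)
  then show "int (val p1) - int (val q1) = int (val p) - int (val q) + ival (L_Minus, a) * pval (u, v)"
    by (simp add: algebra_simps)
qed (use assms in \<open>auto simp: s_mul_def\<close>)

text \<open>Conditional on a reading of \<open>A\<close> and \<open>B\<close>, since
  \<open>PZoneAt\<close> does not demand canonical digits inside the rows; that is left to
  \<open>PZoneOK\<close>.\<close>

definition s_zone_at where "s_zone_at A B w \<longleftrightarrow> (\<exists>ps. isvec w ps \<and> (\<forall>rws bs. A = encrows rws \<and> B = enc_list enc_int bs \<longrightarrow>
   length bs = length rws \<and> (\<forall>r<length rws. length (rws ! r) + 1 = length ps \<and>
     (\<Sum>i<length ps. (bs ! r # rws ! r) ! i * pval (ps ! i)) \<le> 0)))"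

lemma s_zone_at_Nil: "s_dot r w z z p q \<Longrightarrow> s_zone_at [L_End] [L_End] w"
proof -
  assume "s_dot r w z z p q"
  then obtain ps where "isvec w ps" by (auto simp: s_dot_def)
  moreover have "rws = []" if "[L_End] = encrows rws" for rws using that by (cases rws) (auto simp: encrows_def)
  moreover have "bs = []" if "[L_End] = enc_list enc_int bs" for bs using that by (cases bs) auto
  ultimately have "isvec w ps \<and> (\<forall>rws bs. [L_End] = encrows rws \<and> [L_End] = enc_list enc_int bs \<longrightarrow>
    length bs = length rws \<and> (\<forall>r<length rws. length (rws ! r) + 1 = length ps \<and>
     (\<Sum>i<length ps. (bs ! r # rws ! r) ! i * pval (ps ! i)) \<le> 0))"
    by (metis less_nat_zero_code list.size(3))
  then show ?thesis unfolding s_zone_at_def by blast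
qed

lemma s_zone_at_Cons:
  assumes "(L_Plus = s \<and> s_nat a) \<or> (L_Minus = s \<and> s_pos a)" "s_dot (L_Item # s # a @ L_End # r) w z z p q" "s_add [L_0] p t q" "s_zone_at A B w"
  shows "s_zone_at (L_Item # r @ A) (L_Item # s # a @ L_End # B) w"
proof -
  obtain ps where ps: "isvec w ps" and rec: "\<And>rws bs. A = encrows rws \<Longrightarrow> B = enc_list enc_int bs \<Longrightarrow>
   length bs = length rws \<and> (\<forall>r<length rws. length (rws ! r) + 1 = length ps \<and>
     (\<Sum>i<length ps. (bs ! r # rws ! r) ! i * pval (ps ! i)) \<le> 0)"
    using assms(4) by (auto simp: s_zone_at_def)
  obtain ts ps' where t: "isrow (L_Item # s # a @ L_End # r) ts" "isvec w ps'" "length ts = length ps'"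
    "int (val p) - int (val q) = (\<Sum>i<length ts. ival (ts ! i) * pval (ps' ! i))"
    using assms(2) by (auto simp: s_dot_def)
  have ps': "ps' = ps" using isvec_unique[OF ps, of "[]" ps'] t(2) by simp
  have le: "(\<Sum>i<length ts. ival (ts ! i) * pval (ps ! i)) \<le> 0" using t(4) assms(3) ps' by (auto simp: s_add_def)
  obtain k where k: "s # a @ [L_End] = enc_int k" "(s, a) = int_code k" using assms(1) s_chk_enc_int by blast
  have ba: "bitw a" using assms(1) by (auto simp: s_nat_def s_pos_def)
  obtain ts' where ts': "ts = (s, a) # ts'" "isrow r ts'" using t(1) isrow_Item[OF ba] by auto
  have "length bs = length rws \<and> (\<forall>r<length rws. length (rws ! r) + 1 = length ps \<and>
     (\<Sum>i<length ps. (bs ! r # rws ! r) ! i * pval (ps ! i)) \<le> 0)"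
    if A: "L_Item # r @ A = encrows rws" and B: "L_Item # s # a @ L_End # B = enc_list enc_int bs" for rws bs
  proof -
    obtain row rws' where rws: "rws = row # rws'" using A by (cases rws) (auto simp: encrows_def)
    obtain b bs' where bs: "bs = b # bs'" using B by (cases bs) auto
    \<comment> \<open>\<open>PDot\<close> has read \<open>r\<close> as a row of signed digit words.
      Prefix-freeness identifies this reading with the first row of the encoded matrix.\<close>
    have "enc_list encI ts' @ A = enc_list encI (map int_code row) @ encrows rws'"
      using A rws isrow_word(1)[OF ts'(2)] isrow_word(1)[OF isrow_ints[of row]] by (simp add: encrows_def)
    then have 1: "ts' = map int_code row" "A = encrows rws'"
      using prefix_freeD[OF prefix_free_enc_list[OF prefix_free_encI], of ts' "map int_code row" A "encrows rws'"]
        isrow_word(2)[OF ts'(2)] isrow_word(2)[OF isrow_ints[of row]] by auto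
    have "enc_int k @ B = enc_int b @ enc_list enc_int bs'" using B bs k(1)[symmetric] by simp
    then have 2: "k = b" "B = enc_list enc_int bs'" using prefix_freeD[OF prefix_free_enc_int] by blast+
    have "length row + 1 = length ps" using t(3) ps' ts' 1 by simp
    moreover have "ival (ts ! i) = (b # row) ! i" if "i < length ts" for i
      using that ts'(1) 1(1) k(2) 2(1) by (auto simp: nth_Cons' simp del: ival.simps)
    then have "(\<Sum>i<length ps. (b # row) ! i * pval (ps ! i)) \<le> 0" using le t(3) ps' by simp
    ultimately show ?thesis using rec[OF 1(2) 2(2)] rws bs by (auto simp: nth_Cons' less_Suc_eq_0_disj)
  qed
  then show ?thesis unfolding s_zone_at_def using ps by blast
qed

section \<open>Tables of polygon vertices\<close>

type_synonym point = "(letter list \<times> letter list) list"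

definition tabw :: "point list \<Rightarrow> letter list" where
  "tabw Ps = concat (map (\<lambda>ps. L_F # enc_list encP ps) Ps)"

text \<open>The entry \<open>(L_Plus, [])\<close> in front of the mode is a 0, so the homogenising
  coordinate, and with it the denominator, is constant along an edge.\<close>

definition step_row :: "(letter \<times> letter list) list set \<Rightarrow> point \<Rightarrow> point \<Rightarrow> bool" where
  "step_row S ps ps' \<longleftrightarrow> (\<exists>y. \<exists>ts\<in>S. moved y ps ps' ((L_Plus, []) # ts))"

definition linked :: "(letter \<times> letter list) list set \<Rightarrow> point list \<Rightarrow> bool" where
  "linked S Ps \<longleftrightarrow> (\<forall>k. Suc k < length Ps \<longrightarrow> step_row S (Ps ! k) (Ps ! Suc k))"

text \<open>The cyclic order of the modes is forgotten: for soundness an edge may use any mode. The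
  premises are there because the rule for the empty table tests none of its arguments.\<close>

definition s_table where "s_table Rs' Rs w R \<longleftrightarrow> (\<forall>tss' tss ps. Rs' = enc_list (enc_list encI) tss' \<and> Rs = enc_list (enc_list encI) tss \<and>
   tss' \<in> lists (lists {t. okI t}) \<and> tss \<in> lists (lists {t. okI t}) \<and> isvec w ps \<longrightarrow>
   (\<exists>Ps. R = tabw Ps \<and> Ps \<in> lists (lists {p. okP p}) \<and> linked (set tss' \<union> set tss) (ps # Ps)))"

lemma s_table_Nil: "s_table Rs' Rs w []"
  unfolding s_table_def by (auto simp: tabw_def linked_def intro!: exI[of _ "[]"])

lemma linked_Cons: "linked S (p # p' # Ps) \<longleftrightarrow> step_row S p p' \<and> linked S (p' # Ps)"
proof -
  have "(\<forall>k. Q k) \<longleftrightarrow> Q 0 \<and> (\<forall>k. Q (Suc k))" for Q :: "nat \<Rightarrow> bool" by (metis not0_implies_Suc)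
  note this[of "\<lambda>k. Suc k < length (p # p' # Ps) \<longrightarrow> step_row S ((p # p' # Ps) ! k) ((p # p' # Ps) ! Suc k)"]
  then show ?thesis unfolding linked_def by simp
qed

lemma linked_mono: "linked S Ps \<Longrightarrow> S \<subseteq> S' \<Longrightarrow> linked S' Ps"
  unfolding linked_def step_row_def by blast

lemma s_table_step:
  assumes "s_move y w w' (L_Item # L_Plus # L_End # r)" "s_table Rs' Rs w' R"
  shows "s_table (L_Item # r @ Rs') Rs w (L_F # w' @ R)"
  unfolding s_table_def
proof (intro allI impI, elim conjE)
  fix tss' tss ps
  assume R': "L_Item # r @ Rs' = enc_list (enc_list encI) tss'" and Rs: "Rs = enc_list (enc_list encI) tss"
    and ok: "tss' \<in> lists (lists {t. okI t})" "tss \<in> lists (lists {t. okI t})" and ps: "isvec w ps"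
  obtain qs ps' ts' where mv: "isvec w qs" "isvec w' ps'" "isrow (L_Item # L_Plus # [] @ L_End # r) ts'" "moved (val y) qs ps' ts'"
    using assms(1) by (auto simp: s_move_def)
  have qs: "qs = ps" using isvec_unique[OF ps, of "[]" qs] mv(1) by simp
  obtain ts where ts: "ts' = (L_Plus, []) # ts" "isrow r ts" using mv(3) isrow_Item[of "[]"] by auto
  obtain ts1 tss1 where t1: "tss' = ts1 # tss1" using R' by (cases tss') auto
  have "enc_list encI ts @ Rs' = enc_list encI ts1 @ enc_list (enc_list encI) tss1"
    using R' t1 isrow_word(1)[OF ts(2)] by simp
  then have 1: "ts = ts1" "Rs' = enc_list (enc_list encI) tss1"
    using prefix_freeD[OF prefix_free_enc_list[OF prefix_free_encI], of ts ts1] isrow_word(2)[OF ts(2)] ok(1) t1 by auto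
  have ok1: "tss1 \<in> lists (lists {t. okI t})" using ok(1) t1 by simp
  obtain Ps where Ps: "R = tabw Ps" "Ps \<in> lists (lists {p. okP p})" "linked (set tss1 \<union> set tss) (ps' # Ps)"
    using assms(2)[unfolded s_table_def, rule_format, of tss1 tss ps'] 1(2) Rs ok1 ok(2) mv(2) by blast
  have "step_row (set tss' \<union> set tss) ps ps'" unfolding step_row_def using mv(4) qs ts 1 t1 by auto
  then have "linked (set tss' \<union> set tss) (ps # ps' # Ps)"
    unfolding linked_Cons using linked_mono[OF Ps(3), of "set tss' \<union> set tss"] t1 by auto
  then show "\<exists>Ps. L_F # w' @ R = tabw Ps \<and> Ps \<in> lists (lists {p. okP p}) \<and> linked (set tss' \<union> set tss) (ps # Ps)"
    using Ps mv(2) by (intro exI[of _ "ps' # Ps"]) (auto simp: tabw_def isvec_def)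
qed

lemma s_table_cycle: "s_table Rs Rs w R \<Longrightarrow> s_table [L_End] Rs w R"
  unfolding s_table_def
proof (intro allI impI, elim conjE)
  fix tss' tss ps
  assume a: "[L_End] = enc_list (enc_list encI) tss'" "Rs = enc_list (enc_list encI) tss" "tss \<in> lists (lists {t. okI t})" "isvec w ps"
    and b: "\<forall>tss' tss ps. Rs = enc_list (enc_list encI) tss' \<and> Rs = enc_list (enc_list encI) tss \<and>
      tss' \<in> lists (lists {t. okI t}) \<and> tss \<in> lists (lists {t. okI t}) \<and> isvec w ps \<longrightarrow>
     (\<exists>Ps. R = tabw Ps \<and> Ps \<in> lists (lists {p. okP p}) \<and> linked (set tss' \<union> set tss) (ps # Ps))"
  have "tss' = []" using a(1) by (cases tss') auto
  then show "\<exists>Ps. R = tabw Ps \<and> Ps \<in> lists (lists {p. okP p}) \<and> linked (set tss' \<union> set tss) (ps # Ps)"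
    using b[rule_format, of tss tss ps] a(2-4) by simp
qed


section \<open>Formulas evaluated on tables\<close>

abbreviation "fragment \<equiv> {Op_F, Op_Conj, Op_Disj}"

definition pnt :: "point \<Rightarrow> real vec" where
  "pnt ps = vec (length ps - 1) (\<lambda>i. of_int (pval (ps ! Suc i)) / of_int (- pval (ps ! 0)))"

definition table_points :: "nat \<Rightarrow> point list \<Rightarrow> bool" where
  "table_points n Ps \<longleftrightarrow> (\<forall>ps\<in>set Ps. ps \<in> lists {p. okP p} \<and> length ps = n \<and> pval (ps ! 0) < 0)"

definition s_sat where "s_sat O' w T \<longleftrightarrow> (\<forall>os. zerovec O' os \<longrightarrow> (\<exists>\<phi>. w = enc_ltl \<phi> \<and> \<phi> \<in> LTL_B (length os - 1) fragment \<and>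
   (\<forall>Ps. T = tabw Ps \<and> Ps \<noteq> [] \<and> table_points (length os) Ps \<longrightarrow> isat (\<lambda>k. pnt (Ps ! k)) (length Ps - 1) 0 \<phi>)))"

lemma LTL_B_simps:
  "TrueF \<in> LTL_B d fragment"
  "Zone z \<in> LTL_B d fragment \<longleftrightarrow> is_zone d z \<and> bounded_zone z"
  "Conj \<phi> \<psi> \<in> LTL_B d fragment \<longleftrightarrow> \<phi> \<in> LTL_B d fragment \<and> \<psi> \<in> LTL_B d fragment"
  "Disj \<phi> \<psi> \<in> LTL_B d fragment \<longleftrightarrow> \<phi> \<in> LTL_B d fragment \<and> \<psi> \<in> LTL_B d fragment"
  "Finally \<phi> \<in> LTL_B d fragment \<longleftrightarrow> \<phi> \<in> LTL_B d fragment"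
  by (auto simp: LTL_B_def)

lemma tabw_Nil_iff [simp]: "tabw Ps = [] \<longleftrightarrow> Ps = []" "[] = tabw Ps \<longleftrightarrow> Ps = []"
  by (cases Ps; auto simp: tabw_def)+

lemma s_sat_True: "s_sat O' [L_True] T"
  unfolding s_sat_def by (auto intro!: exI[of _ TrueF] simp: LTL_B_simps)

lemma s_satE:
  assumes "s_sat O' w T" "zerovec O' os"
  obtains \<phi> where "w = enc_ltl \<phi>" "\<phi> \<in> LTL_B (length os - 1) fragment"
    "\<And>Ps. T = tabw Ps \<Longrightarrow> Ps \<noteq> [] \<Longrightarrow> table_points (length os) Ps \<Longrightarrow> isat (\<lambda>k. pnt (Ps ! k)) (length Ps - 1) 0 \<phi>"
  using assms unfolding s_sat_def by blast

lemma s_satI: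
  assumes "\<And>os. zerovec O' os \<Longrightarrow> \<exists>\<phi>. w = enc_ltl \<phi> \<and> \<phi> \<in> LTL_B (length os - 1) fragment \<and>
    (\<forall>Ps. T = tabw Ps \<longrightarrow> Ps \<noteq> [] \<longrightarrow> table_points (length os) Ps \<longrightarrow> isat (\<lambda>k. pnt (Ps ! k)) (length Ps - 1) 0 \<phi>)"
  shows "s_sat O' w T"
  using assms unfolding s_sat_def by blast

lemma s_sat_Conj: assumes "s_sat O' a T" "s_sat O' b T" shows "s_sat O' (L_Conj # a @ b) T"
proof (rule s_satI)
  fix os assume os: "zerovec O' os"
  from s_satE[OF assms(1) os] obtain \<phi> where 1: "a = enc_ltl \<phi>" "\<phi> \<in> LTL_B (length os - 1) fragment"
    "\<And>Ps. T = tabw Ps \<Longrightarrow> Ps \<noteq> [] \<Longrightarrow> table_points (length os) Ps \<Longrightarrow> isat (\<lambda>k. pnt (Ps ! k)) (length Ps - 1) 0 \<phi>" by blast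
  from s_satE[OF assms(2) os] obtain \<psi> where 2: "b = enc_ltl \<psi>" "\<psi> \<in> LTL_B (length os - 1) fragment"
    "\<And>Ps. T = tabw Ps \<Longrightarrow> Ps \<noteq> [] \<Longrightarrow> table_points (length os) Ps \<Longrightarrow> isat (\<lambda>k. pnt (Ps ! k)) (length Ps - 1) 0 \<psi>" by blast
  show "\<exists>\<phi>. L_Conj # a @ b = enc_ltl \<phi> \<and> \<phi> \<in> LTL_B (length os - 1) fragment \<and>
    (\<forall>Ps. T = tabw Ps \<longrightarrow> Ps \<noteq> [] \<longrightarrow> table_points (length os) Ps \<longrightarrow> isat (\<lambda>k. pnt (Ps ! k)) (length Ps - 1) 0 \<phi>)"
    using 1 2 by (intro exI[of _ "Conj \<phi> \<psi>"]) (simp add: LTL_B_simps)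
qed

lemma s_sat_Disj1: assumes "s_sat O' a T" "s_sat O' b []" shows "s_sat O' (L_Disj # a @ b) T"
proof (rule s_satI)
  fix os assume os: "zerovec O' os"
  from s_satE[OF assms(1) os] obtain \<phi> where 1: "a = enc_ltl \<phi>" "\<phi> \<in> LTL_B (length os - 1) fragment"
    "\<And>Ps. T = tabw Ps \<Longrightarrow> Ps \<noteq> [] \<Longrightarrow> table_points (length os) Ps \<Longrightarrow> isat (\<lambda>k. pnt (Ps ! k)) (length Ps - 1) 0 \<phi>" by blast
  from s_satE[OF assms(2) os] obtain \<psi> where 2: "b = enc_ltl \<psi>" "\<psi> \<in> LTL_B (length os - 1) fragment" by blast
  show "\<exists>\<phi>. L_Disj # a @ b = enc_ltl \<phi> \<and> \<phi> \<in> LTL_B (length os - 1) fragment \<and>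
    (\<forall>Ps. T = tabw Ps \<longrightarrow> Ps \<noteq> [] \<longrightarrow> table_points (length os) Ps \<longrightarrow> isat (\<lambda>k. pnt (Ps ! k)) (length Ps - 1) 0 \<phi>)"
    using 1 2 by (intro exI[of _ "Disj \<phi> \<psi>"]) (simp add: LTL_B_simps)
qed

lemma s_sat_Disj2: assumes "s_sat O' a []" "s_sat O' b T" shows "s_sat O' (L_Disj # a @ b) T"
proof (rule s_satI)
  fix os assume os: "zerovec O' os"
  from s_satE[OF assms(1) os] obtain \<phi> where 1: "a = enc_ltl \<phi>" "\<phi> \<in> LTL_B (length os - 1) fragment" by blast
  from s_satE[OF assms(2) os] obtain \<psi> where 2: "b = enc_ltl \<psi>" "\<psi> \<in> LTL_B (length os - 1) fragment"
    "\<And>Ps. T = tabw Ps \<Longrightarrow> Ps \<noteq> [] \<Longrightarrow> table_points (length os) Ps \<Longrightarrow> isat (\<lambda>k. pnt (Ps ! k)) (length Ps - 1) 0 \<psi>" by blast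
  show "\<exists>\<phi>. L_Disj # a @ b = enc_ltl \<phi> \<and> \<phi> \<in> LTL_B (length os - 1) fragment \<and>
    (\<forall>Ps. T = tabw Ps \<longrightarrow> Ps \<noteq> [] \<longrightarrow> table_points (length os) Ps \<longrightarrow> isat (\<lambda>k. pnt (Ps ! k)) (length Ps - 1) 0 \<phi>)"
    using 1 2 by (intro exI[of _ "Disj \<phi> \<psi>"]) (simp add: LTL_B_simps)
qed

lemma s_sat_F_Nil: assumes "s_sat O' a []" shows "s_sat O' (L_F # a) []"
proof (rule s_satI)
  fix os assume os: "zerovec O' os"
  from s_satE[OF assms os] obtain \<phi> where 1: "a = enc_ltl \<phi>" "\<phi> \<in> LTL_B (length os - 1) fragment" by blast
  show "\<exists>\<phi>. L_F # a = enc_ltl \<phi> \<and> \<phi> \<in> LTL_B (length os - 1) fragment \<and>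
    (\<forall>Ps. [] = tabw Ps \<longrightarrow> Ps \<noteq> [] \<longrightarrow> table_points (length os) Ps \<longrightarrow> isat (\<lambda>k. pnt (Ps ! k)) (length Ps - 1) 0 \<phi>)"
    using 1 by (intro exI[of _ "Finally \<phi>"]) (simp add: LTL_B_simps)
qed

lemma L_F_notin: "ps \<in> lists {p. okP p} \<Longrightarrow> L_F \<notin> set (enc_list encP ps)"
  by (induction ps) (auto simp: bitw_def)

text \<open>In a table \<open>L_F\<close> occurs only at the start of a vertex, so cutting the word
  in front of any \<open>L_F\<close> leaves the table of a later part of the polygon. This lets the
  rule for \<open>F\<close> choose its witness by splitting a word.\<close>

lemma tabw_suffix:
  "\<forall>ps\<in>set Ps. ps \<in> lists {p. okP p} \<Longrightarrow> tabw Ps = X @ L_F # R \<Longrightarrow> \<exists>j<length Ps. tabw (drop j Ps) = L_F # R"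
proof (induction Ps arbitrary: X)
  case (Cons ps Ps)
  show ?case
  proof (cases X)
    case Nil
    then show ?thesis using Cons.prems by (intro exI[of _ 0]) auto
  next
    case (Cons x X')
    then have "enc_list encP ps @ tabw Ps = X' @ L_F # R" using Cons.prems(2) by (simp add: tabw_def)
    then obtain us where us: "(enc_list encP ps = X' @ us \<and> us @ tabw Ps = L_F # R) \<or>
        (enc_list encP ps @ us = X' \<and> tabw Ps = us @ L_F # R)"
      unfolding append_eq_append_conv2 by blast
    consider Y where "X' = enc_list encP ps @ Y" "tabw Ps = Y @ L_F # R"
      | Y where "enc_list encP ps = X' @ Y" "Y @ tabw Ps = L_F # R" "Y \<noteq> []"
      using us by (cases "us = []") auto
    then show ?thesis
    proof cases
      case 1
      then obtain j where "j < length Ps" "tabw (drop j Ps) = L_F # R" using Cons.IH Cons.prems(1) by auto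
      then show ?thesis by (intro exI[of _ "Suc j"]) auto
    next
      case 2
      then have "L_F \<in> set (enc_list encP ps)" by (cases Y) auto
      then show ?thesis using L_F_notin Cons.prems(1) by auto
    qed
  qed
qed (simp add: tabw_def)

lemma isat_shift: "isat (\<lambda>k. P (k + j)) N i \<phi> \<Longrightarrow> isat P (N + j) (i + j) \<phi>"
proof (induction \<phi> arbitrary: i)
  case (Finally \<phi>)
  then obtain k where "k \<ge> i" "k \<le> N" "isat (\<lambda>k. P (k + j)) N k \<phi>" by auto
  then show ?case using Finally.IH by (auto intro!: exI[of _ "k + j"])
qed auto

lemma s_sat_F: "s_sat O' a (L_F # R) \<Longrightarrow> s_sat O' (L_F # a) (X @ L_F # R)"
  unfolding s_sat_def
proof (intro allI impI)
  fix os
  assume 1: "\<forall>os. zerovec O' os \<longrightarrow> (\<exists>\<phi>. a = enc_ltl \<phi> \<and> \<phi> \<in> LTL_B (length os - 1) fragment \<and>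
   (\<forall>Ps. L_F # R = tabw Ps \<and> Ps \<noteq> [] \<and> table_points (length os) Ps \<longrightarrow> isat (\<lambda>k. pnt (Ps ! k)) (length Ps - 1) 0 \<phi>))"
   and os: "zerovec O' os"
  obtain \<phi> where \<phi>: "a = enc_ltl \<phi>" "\<phi> \<in> LTL_B (length os - 1) fragment"
    "\<And>Ps. L_F # R = tabw Ps \<Longrightarrow> Ps \<noteq> [] \<Longrightarrow> table_points (length os) Ps \<Longrightarrow> isat (\<lambda>k. pnt (Ps ! k)) (length Ps - 1) 0 \<phi>"
    using 1 os by blast
  have "isat (\<lambda>k. pnt (Ps ! k)) (length Ps - 1) 0 (Finally \<phi>)"
    if Ps: "X @ L_F # R = tabw Ps" "Ps \<noteq> []" "table_points (length os) Ps" for Ps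
  proof -
    obtain j where j: "j < length Ps" "tabw (drop j Ps) = L_F # R"
      using tabw_suffix[of Ps X R] Ps(1,3) by (auto simp: table_points_def)
    have "table_points (length os) (drop j Ps)" using Ps(3) by (auto simp: table_points_def dest: in_set_dropD)
    then have "isat (\<lambda>k. pnt (drop j Ps ! k)) (length (drop j Ps) - 1) 0 \<phi>" using \<phi>(3)[of "drop j Ps"] j by simp
    moreover have "(\<lambda>k. pnt (drop j Ps ! k)) = (\<lambda>k. pnt (Ps ! (k + j)))" using j(1) by (simp add: add.commute)
    ultimately have "isat (\<lambda>k. pnt (Ps ! k)) (length Ps - j - 1 + j) (0 + j) \<phi>"
      using isat_shift[of "\<lambda>k. pnt (Ps ! k)" j "length Ps - j - 1" 0 \<phi>] by simp
    moreover have "length Ps - j - 1 + j = length Ps - 1" using j(1) by simp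
    ultimately show ?thesis using j(1) by (auto intro!: exI[of _ j])
  qed
  then show "\<exists>\<psi>. L_F # a = enc_ltl \<psi> \<and> \<psi> \<in> LTL_B (length os - 1) fragment \<and>
   (\<forall>Ps. X @ L_F # R = tabw Ps \<and> Ps \<noteq> [] \<and> table_points (length os) Ps \<longrightarrow> isat (\<lambda>k. pnt (Ps ! k)) (length Ps - 1) 0 \<psi>)"
    using \<phi>(1,2) by (intro exI[of _ "Finally \<phi>"]) (auto simp: LTL_B_simps)
qed

lemma s_zone_formula:
  assumes "s_zone_ok A B O'" "zerovec O' os"
  obtains rws bs where "A = encrows rws" "B = enc_list enc_int bs" "zone_cert rws bs (length os - 1)"
    "L_Zone # A @ B = enc_ltl (Zone (zone_of (length os - 1) rws bs))" "Zone (zone_of (length os - 1) rws bs) \<in> LTL_B (length os - 1) fragment"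
proof -
  obtain rws bs where rb: "A = encrows rws" "B = enc_list enc_int bs" "zone_cert rws bs (length os - 1)"
    using assms unfolding s_zone_ok_def by blast
  have "\<forall>row\<in>set rws. length row = length os - 1" using rb(3) by (simp add: zone_cert_def)
  then show ?thesis using that[OF rb] zone_cert_bounded[OF rb(3)] rb by (simp add: LTL_B_simps enc_zone_of)
qed

lemma s_sat_Zone_Nil: "s_zone_ok A B O' \<Longrightarrow> s_sat O' (L_Zone # A @ B) []"
proof (rule s_satI)
  fix os assume ok: "s_zone_ok A B O'" and os: "zerovec O' os"
  show "\<exists>\<phi>. L_Zone # A @ B = enc_ltl \<phi> \<and> \<phi> \<in> LTL_B (length os - 1) fragment \<and>
    (\<forall>Ps. [] = tabw Ps \<longrightarrow> Ps \<noteq> [] \<longrightarrow> table_points (length os) Ps \<longrightarrow> isat (\<lambda>k. pnt (Ps ! k)) (length Ps - 1) 0 \<phi>)"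
  proof (rule s_zone_formula[OF ok os])
    fix rws bs
    assume "L_Zone # A @ B = enc_ltl (Zone (zone_of (length os - 1) rws bs))"
      "Zone (zone_of (length os - 1) rws bs) \<in> LTL_B (length os - 1) fragment"
    then show ?thesis by (intro exI[of _ "Zone (zone_of (length os - 1) rws bs)"]) simp
  qed
qed

text \<open>\<open>PZoneAt\<close> tests the first vertex of the table in homogeneous form; dividing
  by the positive number \<open>- pval (p ! 0)\<close> gives the inequalities of the zone.\<close>

lemma s_sat_Zone:
  assumes "s_zone_ok A B O'" "s_zone_at A B w"
  shows "s_sat O' (L_Zone # A @ B) (L_F # w @ R)"
  unfolding s_sat_def
proof (intro allI impI)
  fix os assume os: "zerovec O' os"
  define n where "n = length os - 1"
  obtain rws bs where z: "A = encrows rws" "B = enc_list enc_int bs" "zone_cert rws bs n"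
    "L_Zone # A @ B = enc_ltl (Zone (zone_of n rws bs))" "Zone (zone_of n rws bs) \<in> LTL_B n fragment"
    using s_zone_formula[OF assms(1) os] unfolding n_def by blast
  have l: "length bs = length rws" "\<forall>row\<in>set rws. length row = n" using z(3) by (auto simp: zone_cert_def)
  obtain ps where ps: "isvec w ps" "\<forall>r<length rws. (\<Sum>i<length ps. (bs ! r # rws ! r) ! i * pval (ps ! i)) \<le> 0"
    using assms(2) z(1,2) unfolding s_zone_at_def by blast
  have "isat (\<lambda>k. pnt (Ps ! k)) (length Ps - 1) 0 (Zone (zone_of n rws bs))"
    if Ps: "L_F # w @ R = tabw Ps" "Ps \<noteq> []" "table_points (length os) Ps" for Ps
  proof -
    obtain p Ps' where p: "Ps = p # Ps'" using Ps(2) by (cases Ps) auto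
    have ok: "p \<in> lists {p. okP p}" "length p = Suc n" "pval (p ! 0) < 0"
      using Ps(3) p os by (auto simp: table_points_def n_def zerovec_def)
    have "enc_list encP ps @ R = enc_list encP p @ tabw Ps'" using Ps(1) p ps(1) by (simp add: tabw_def isvec_def)
    then have pp: "ps = p"
      using prefix_freeD[OF prefix_free_enc_list[OF prefix_free_encP], of ps p R "tabw Ps'"] ok(1) ps(1) by (simp add: isvec_def)
    have "pnt p \<in> zone_set (zone_of n rws bs)"
    proof -
      have car: "pnt p \<in> carrier_vec n" using ok(2) by (simp add: pnt_def)
      have "(\<Sum>j<n. of_int (rws ! r ! j) * pnt p $ j) \<le> of_int (bs ! r)" if r: "r < length rws" for r
      proof -
        let ?c = "real_of_int (- pval (p ! 0))"
        have c: "?c > 0" using ok(3) by simp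
        have "(\<Sum>i<Suc n. (bs ! r # rws ! r) ! i * pval (p ! i)) \<le> 0" using ps(2) r pp ok(2) by simp
        then have "(\<Sum>j<n. rws ! r ! j * pval (p ! Suc j)) \<le> bs ! r * (- pval (p ! 0))"
          by (simp add: sum.lessThan_Suc_shift del: sum.lessThan_Suc)
        then have "real_of_int (\<Sum>j<n. rws ! r ! j * pval (p ! Suc j)) \<le> of_int (bs ! r) * ?c"
          by (simp only: of_int_mult[symmetric] of_int_le_iff)
        then have "(\<Sum>j<n. of_int (rws ! r ! j) * of_int (pval (p ! Suc j))) / ?c \<le> of_int (bs ! r)"
          unfolding pos_divide_le_eq[OF c] by simp
        moreover have "(\<Sum>j<n. of_int (rws ! r ! j) * pnt p $ j) = (\<Sum>j<n. of_int (rws ! r ! j) * of_int (pval (p ! Suc j))) / ?c"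
          unfolding sum_divide_distrib using ok(2) by (intro sum.cong) (auto simp: pnt_def)
        ultimately show ?thesis by simp
      qed
      then show ?thesis using zone_of_iff[OF l car] by blast
    qed
    then show ?thesis using p by simp
  qed
  then show "\<exists>\<phi>. L_Zone # A @ B = enc_ltl \<phi> \<and> \<phi> \<in> LTL_B (length os - 1) fragment \<and>
   (\<forall>Ps. L_F # w @ R = tabw Ps \<and> Ps \<noteq> [] \<and> table_points (length os) Ps \<longrightarrow> isat (\<lambda>k. pnt (Ps ! k)) (length Ps - 1) 0 \<phi>)"
    using z(4,5) unfolding n_def by blast
qed

section \<open>From the premises of the top rule to an instance of the problem\<close>

lemma scaled_val: "scaled g f t \<Longrightarrow> g > 0 \<Longrightarrow> real_of_int (ival t) = real g * (of_int (fst f) / of_nat (snd f))"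
proof -
  assume "scaled g f t" "g > 0"
  then have "snd f > 0" "real_of_int (ival t * int (snd f)) = real_of_int (int g * fst f)" by (auto simp: scaled_def)
  then show ?thesis by (simp add: field_simps)
qed

lemma frac_vec_of_list:
  "list_all2 (scaled g) fs ts \<Longrightarrow> length ts = d \<Longrightarrow> frac_vec d (vec_of_list fs)"
  unfolding frac_vec_def by (auto simp: list_all2_conv_all_nth scaled_def vec_of_list_index intro!: carrier_vecI)

lemma val_vec_of_list:
  "i < length fs \<Longrightarrow> val_vec (vec_of_list fs) $ i = of_int (fst (fs ! i)) / of_nat (snd (fs ! i))"
  by (auto simp: val_vec_def vec_of_list_index case_prod_beta)

text \<open>Adding \<open>y\<close> times a row that was scaled by \<open>g\<close> to a vertex with
  denominator \<open>c\<close> is a step of real duration \<open>y * g / c\<close> in the original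
  mode.\<close>

lemma step_pnt:
  assumes mv: "moved y p p' ((L_Plus, []) # ts)" and sc: "list_all2 (scaled g) fs ts" "g > 0" and neg: "pval (p ! 0) < 0"
  shows "pval (p' ! 0) = pval (p ! 0)" "length p' = length p"
    "pnt p' = pnt p + (real y * real g / of_int (- pval (p ! 0))) \<cdot>\<^sub>v val_vec (vec_of_list fs)"
proof -
  have l: "length p = Suc (length ts)" "length p' = Suc (length ts)" "length fs = length ts"
    using mv sc(1) by (auto simp: moved_def list_all2_lengthD)
  have mvi: "pval (p' ! i) = pval (p ! i) + int y * ival (((L_Plus, []) # ts) ! i)" if "i < Suc (length ts)" for i
    using mv that by (auto simp: moved_def)
  show 0: "pval (p' ! 0) = pval (p ! 0)" using mvi[of 0] by simp
  show "length p' = length p" using l by simp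
  show "pnt p' = pnt p + (real y * real g / of_int (- pval (p ! 0))) \<cdot>\<^sub>v val_vec (vec_of_list fs)"
  proof (rule eq_vecI)
    show "dim_vec (pnt p') = dim_vec (pnt p + (real y * real g / of_int (- pval (p ! 0))) \<cdot>\<^sub>v val_vec (vec_of_list fs))"
      using l by (simp add: pnt_def val_vec_def)
    fix i assume "i < dim_vec (pnt p + (real y * real g / of_int (- pval (p ! 0))) \<cdot>\<^sub>v val_vec (vec_of_list fs))"
    then have i: "i < length ts" using l by (simp add: val_vec_def)
    have s: "real_of_int (ival (ts ! i)) = real g * (of_int (fst (fs ! i)) / of_nat (snd (fs ! i)))"
      using sc i l by (intro scaled_val) (auto simp: list_all2_conv_all_nth)
    have "pnt p' $ i = of_int (pval (p' ! Suc i)) / of_int (- pval (p ! 0))" using i l 0 by (simp add: pnt_def)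
    also have "real_of_int (pval (p' ! Suc i)) = of_int (pval (p ! Suc i)) + real y * real_of_int (ival (ts ! i))"
      using mvi[of "Suc i"] i by simp
    also have "(\<dots>) / of_int (- pval (p ! 0)) = pnt p $ i + real y * real g / of_int (- pval (p ! 0)) * val_vec (vec_of_list fs) $ i"
      unfolding s using i l by (simp add: pnt_def val_vec_of_list add_divide_distrib ac_simps)
    finally show "pnt p' $ i = (pnt p + (real y * real g / of_int (- pval (p ! 0))) \<cdot>\<^sub>v val_vec (vec_of_list fs)) $ i"
      using i l by (simp add: val_vec_def)
  qed
qed

text \<open>Here the premises of the conditional readings are discharged: \<open>PZeroVec\<close>
  provides the zero vector, \<open>PModes\<close> the rows of the modes, and \<open>PMove\<close>
  the start vertex.\<close>

lemma top_sound:
  assumes z: "s_zero (d1 @ L_1 # d2) t" "s_zero z t'" and sx: "s_scale (d1 @ L_1 # d2) X rx"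
    and O': "O' = L_Item # z @ L_End # z @ L_End # L_Item # z @ L_End # z @ L_End # O2" "s_zerovec O'"
    and ms: "s_modes O' (L_Item # m1) Rs" and start: "s_move (y1 @ L_1 # y2) O' P (L_Item # L_Minus # d1 @ L_1 # d2 @ L_End # rx)"
    and tab: "s_table Rs Rs P R" and sat: "s_sat O' \<Phi> (L_F # P @ R)"
  shows "L_Item # m1 @ X @ \<Phi> \<in> model_checking fragment"
proof -
  let ?D = "d1 @ L_1 # d2" and ?y = "val (y1 @ L_1 # y2)"
  have D: "bitw ?D" "val ?D > 0" and y: "?y > 0" using z(1) val_pos by (auto simp: s_zero_def)
  have bz: "bitw z" using z(2) by (simp add: s_zero_def)
  obtain os where os: "isvec O' os" "\<forall>p\<in>set os. pval p = 0" using O'(2) by (auto simp: s_zerovec_def)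
  have "length os \<ge> 2"
    using os(1) unfolding O'(1) isvec_Item[OF bz bz] by auto
  then have zv: "zerovec O' os" using os by (simp add: zerovec_def)
  define d where "d = length os - 1"
  have d: "length os = Suc d" "d \<ge> 1" using zv by (auto simp: d_def zerovec_def)
  obtain fs ts where x: "X = enc_list enc_frac fs" "isrow rx ts" "list_all2 (scaled (val ?D)) fs ts"
    using sx by (auto simp: s_scale_def)
  obtain os' ps ts' where st: "isvec O' os'" "isvec P ps" "isrow (L_Item # L_Minus # ?D @ L_End # rx) ts'" "moved ?y os' ps ts'"
    using start by (auto simp: s_move_def)
  have os': "os' = os" using isvec_unique[OF os(1), of "[]" os'] st(1) by simp
  have ts': "ts' = (L_Minus, ?D) # ts"
    using st(3) x(2) isrow_unique unfolding isrow_Item[OF D(1)] by auto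
  have lt: "length ts = d" "length ps = Suc d" using st(4) os' ts' d by (auto simp: moved_def)
  have os0: "pval (os ! i) = 0" if "i < Suc d" for i using os(2) that d(1) by simp
  \<comment> \<open>The start vertex is \<open>?y\<close> times the row made of \<open>- D\<close>
    and the scaled point, so passing to Euclidean coordinates returns the input point.\<close>
  have ps0: "pval (ps ! 0) = - int ?y * int (val ?D)" and psi: "\<And>i. i < d \<Longrightarrow> pval (ps ! Suc i) = int ?y * ival (ts ! i)"
    using st(4) os' ts' lt os0 d(1) by (auto simp: moved_def simp del: val.simps)
  have neg: "pval (ps ! 0) < 0" using ps0 y D(2) by (simp add: mult_neg_pos)
  let ?x = "vec_of_list fs"
  have lfs: "length fs = d" using x(3) lt(1) by (simp add: list_all2_lengthD)
  have px: "pnt ps = val_vec ?x"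
  proof (rule eq_vecI)
    fix i assume "i < dim_vec (val_vec ?x)"
    then have i: "i < d" using lfs by (simp add: val_vec_def)
    have s: "real_of_int (ival (ts ! i)) = real (val ?D) * (of_int (fst (fs ! i)) / of_nat (snd (fs ! i)))"
      using x(3) i lfs D(2) by (intro scaled_val) (auto simp: list_all2_conv_all_nth)
    have "pnt ps $ i = of_int (int ?y * ival (ts ! i)) / (real ?y * real (val ?D))" using i lt ps0 psi by (simp add: pnt_def)
    also have "\<dots> = of_int (fst (fs ! i)) / of_nat (snd (fs ! i))" using s y D(2) by simp
    finally show "pnt ps $ i = val_vec ?x $ i" using i lfs by (simp add: val_vec_of_list)
  qed (use lt lfs in \<open>simp add: pnt_def val_vec_def\<close>)
  obtain fss tss where m: "L_Item # m1 = enc_list (enc_list enc_frac) fss" "Rs = enc_list (enc_list encI) tss"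
   "tss \<in> lists (lists {t. okI t})" "list_all2 (\<lambda>fs ts. \<exists>g>0. list_all2 (scaled g) fs ts) fss tss"
   "\<forall>ts\<in>set tss. length ts + 1 = length os"
    using ms os(1) unfolding s_modes_def by blast
  let ?ms = "map vec_of_list fss" and ?M = "val_vec ` set (map vec_of_list fss)"
  have fss: "\<exists>ts g. length ts = d \<and> g > 0 \<and> list_all2 (scaled g) fs ts" if fsin: "fs \<in> set fss" for fs
  proof -
    obtain i where i: "i < length fss" "fss ! i = fs" using fsin by (auto simp: in_set_conv_nth)
    obtain g where g: "g > 0" "list_all2 (scaled g) (fss ! i) (tss ! i)" using list_all2_nthD[OF m(4) i(1)] by blast
    have "tss ! i \<in> set tss" using i(1) list_all2_lengthD[OF m(4)] by simp
    then have "length (tss ! i) = d" using m(5) d(1) by fastforce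
    then show ?thesis using g i(2) by blast
  qed
  have fm: "\<forall>v\<in>set ?ms. frac_vec d v"
  proof
    fix v assume "v \<in> set ?ms"
    then obtain fs where "fs \<in> set fss" "v = vec_of_list fs" by auto
    then show "frac_vec d v" using fss[of fs] frac_vec_of_list by blast
  qed
  have car: "?M \<subseteq> carrier_vec d" using fm by (auto simp: frac_vec_def val_vec_def)
  have ne: "fss \<noteq> []" using m(1) by (cases fss) auto
  have fx: "frac_vec d ?x" using frac_vec_of_list[OF x(3) lt(1)] .
  obtain Ps where Ps: "R = tabw Ps" "Ps \<in> lists (lists {p. okP p})" "linked (set tss) (ps # Ps)"
    using tab[unfolded s_table_def, rule_format, of tss tss ps] m(2,3) st(2) by auto
  let ?Q = "ps # Ps"
  have stepk: "\<exists>fs g y. fs \<in> set fss \<and> g > 0 \<and> (\<exists>ts. list_all2 (scaled g) fs ts \<and> moved y (?Q ! k) (?Q ! Suc k) ((L_Plus, []) # ts))"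
    if k: "Suc k < length ?Q" for k
  proof -
    obtain y ts where t: "ts \<in> set tss" "moved y (?Q ! k) (?Q ! Suc k) ((L_Plus, []) # ts)"
      using Ps(3) k unfolding linked_def step_row_def by blast
    then obtain i where i: "i < length tss" "tss ! i = ts" by (auto simp: in_set_conv_nth)
    then have "i < length fss" using list_all2_lengthD[OF m(4)] by simp
    then obtain g where "g > 0" "list_all2 (scaled g) (fss ! i) ts" "fss ! i \<in> set fss"
      using list_all2_nthD[OF m(4), of i] i(2) by auto
    then show ?thesis using t(2) by blast
  qed
  \<comment> \<open>Every edge preserves the length and the homogenising coordinate of a vertex, so
    all denominators stay positive.\<close>
  have inv: "length (?Q ! k) = Suc d \<and> pval (?Q ! k ! 0) < 0" if "k < length ?Q" for k
    using that
  proof (induction k)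
    case (Suc k)
    then obtain fs g y ts where "g > 0" "list_all2 (scaled g) fs ts" "moved y (?Q ! k) (?Q ! Suc k) ((L_Plus, []) # ts)"
      using stepk[of k] by auto
    then show ?case using step_pnt(1,2)[of y "?Q ! k" "?Q ! Suc k" ts g fs] Suc by auto
  qed (use neg lt in auto)
  have tp: "table_points (length os) ?Q"
    unfolding table_points_def
  proof
    fix p assume p: "p \<in> set ?Q"
    then obtain k where "k < length ?Q" "?Q ! k = p" by (metis in_set_conv_nth)
    then have "length p = Suc d \<and> pval (p ! 0) < 0" using inv[of k] by simp
    then show "p \<in> lists {p. okP p} \<and> length p = length os \<and> pval (p ! 0) < 0"
      using p Ps(2) st(2) d(1) by (auto simp: isvec_def)
  qed
  obtain \<phi> where \<phi>: "\<Phi> = enc_ltl \<phi>" "\<phi> \<in> LTL_B d fragment"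
    "\<And>Ps. L_F # P @ R = tabw Ps \<Longrightarrow> Ps \<noteq> [] \<Longrightarrow> table_points (length os) Ps \<Longrightarrow> isat (\<lambda>k. pnt (Ps ! k)) (length Ps - 1) 0 \<phi>"
    using sat zv unfolding s_sat_def d_def by blast
  have "L_F # P @ R = tabw ?Q" using Ps(1) st(2) by (simp add: tabw_def isvec_def)
  then have is0: "isat (\<lambda>k. pnt (?Q ! k)) (length Ps) 0 \<phi>" using \<phi>(3)[of ?Q] tp by simp
  have "\<exists>l v. l \<ge> 0 \<and> v \<in> ?M \<and> pnt (?Q ! Suc k) = pnt (?Q ! k) + l \<cdot>\<^sub>v v" if k: "k < length Ps" for k
  proof -
    obtain fs g y ts where f: "fs \<in> set fss" "g > 0" "list_all2 (scaled g) fs ts" "moved y (?Q ! k) (?Q ! Suc k) ((L_Plus, []) # ts)"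
      using stepk[of k] k by auto
    have n: "pval (?Q ! k ! 0) < 0" using inv[of k] k by simp
    show ?thesis
      using step_pnt(3)[OF f(4,3,2) n] n f(1)
      by (intro exI[of _ "real y * real g / of_int (- pval (?Q ! k ! 0))"] exI[of _ "val_vec (vec_of_list fs)"])
        (auto intro!: divide_nonneg_neg mult_nonneg_nonneg simp: divide_nonneg_neg)
  qed
  then obtain l v where lv: "\<forall>k<length Ps. l k \<ge> 0 \<and> v k \<in> ?M \<and> pnt (?Q ! Suc k) = pnt (?Q ! k) + l k \<cdot>\<^sub>v v k"
    by metis
  have "models ?M (pnt (?Q ! 0)) \<phi>"
    using car ne lv is0 inv
    by (intro polygon_models[of ?M d "length Ps" "\<lambda>k. pnt (?Q ! k)" l v]) (auto simp: pnt_def less_Suc_eq_le)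
  then have "models ?M (val_vec ?x) \<phi>" using px by simp
  moreover have "enc_instance ?ms ?x \<phi> = L_Item # m1 @ X @ \<Phi>"
    using m(1) x(1) \<phi>(1) by (simp add: enc_instance_def o_def list_vec)
  ultimately show ?thesis
    unfolding model_checking_def using fm car fx \<phi>(2) d(2)
    by (intro CollectI exI[of _ d] exI[of _ ?ms] exI[of _ ?x] exI[of _ \<phi>]) (auto simp: is_mms_def)
qed

subsection \<open>Soundness of the rules\<close>

definition s_top where "s_top w \<longleftrightarrow> w \<in> model_checking fragment"

fun sem :: "(pred, letter) goal \<Rightarrow> bool" where
  "sem (p, ws) = (case p of
     PAdd \<Rightarrow> s_add (ws ! 0) (ws ! 1) (ws ! 2) (ws ! 3)
   | PZero \<Rightarrow> s_zero (ws ! 0) (ws ! 1)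
   | PMul \<Rightarrow> s_mul (ws ! 0) (ws ! 1) (ws ! 2)
   | PPos \<Rightarrow> s_pos (ws ! 0)
   | PNat \<Rightarrow> s_nat (ws ! 0)
   | PScale \<Rightarrow> s_scale (ws ! 0) (ws ! 1) (ws ! 2)
   | PMove \<Rightarrow> s_move (ws ! 0) (ws ! 1) (ws ! 2) (ws ! 3)
   | PModes \<Rightarrow> s_modes (ws ! 0) (ws ! 1) (ws ! 2)
   | PZeroVec \<Rightarrow> s_zerovec (ws ! 0)
   | PIntRow \<Rightarrow> s_introw (ws ! 0)
   | PComb \<Rightarrow> s_comb (ws ! 0) (ws ! 1) (ws ! 2) (ws ! 3)
   | PEqZero \<Rightarrow> s_eqzero (ws ! 0)
   | PDirs \<Rightarrow> s_dirs (ws ! 0) (ws ! 1) (ws ! 2) (ws ! 3)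
   | PZoneOK \<Rightarrow> s_zone_ok (ws ! 0) (ws ! 1) (ws ! 2)
   | PDot \<Rightarrow> s_dot (ws ! 0) (ws ! 1) (ws ! 2) (ws ! 3) (ws ! 4) (ws ! 5)
   | PZoneAt \<Rightarrow> s_zone_at (ws ! 0) (ws ! 1) (ws ! 2)
   | PTable \<Rightarrow> s_table (ws ! 0) (ws ! 1) (ws ! 2) (ws ! 3)
   | PSat \<Rightarrow> s_sat (ws ! 0) (ws ! 1) (ws ! 2)
   | PTop \<Rightarrow> s_top (ws ! 0))"

definition sound_clause :: "(pred, letter) clause \<Rightarrow> bool" where
  "sound_clause c \<longleftrightarrow> (\<forall>\<theta>. (\<forall>b\<in>set (snd c). sem (inst_goal \<theta> b)) \<longrightarrow> sem (inst_goal \<theta> (fst c)))"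

lemmas sound_simps = sound_clause_def inst_goal_def eval_nat_numeral signs_def

lemma sound_add_rules: "list_all sound_clause add_rules"
  by (simp add: add_rules_def sound_simps s_add_def)

lemma sound_num_rules: "list_all sound_clause num_rules"
  by (simp add: num_rules_def sound_simps s_zero_simps s_mul_Nil s_mul_0 s_pos_1 s_pos_Cons s_nat_intros) (blast intro: s_mul_1)

lemma sound_scale_rules: "list_all sound_clause scale_rules"
  by (simp add: scale_rules_def sound_simps s_scale_Nil) (blast intro: s_scale_Cons)

lemma sound_move_rules: "list_all sound_clause move_rules"
  by (simp add: move_rules_def sound_simps s_move_Nil) (blast intro: s_move_Plus s_move_Minus)

lemma sound_vec_rules: "list_all sound_clause vec_rules"
  by (simp add: vec_rules_def sound_simps s_modes_Nil s_zerovec_Nil s_eqzero_Nil)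
    (blast intro: s_modes_Cons[OF _ val_pos] s_zerovec_Cons s_eqzero_Cons)

lemma sound_comb_rules: "list_all sound_clause comb_rules"
  by (simp add: comb_rules_def sound_simps s_introw_Nil s_comb_Nil) (blast intro: s_introw_Cons s_comb_Cons)

lemma sound_zone_ok_rules: "list_all sound_clause zone_ok_rules"
  by (simp add: zone_ok_rules_def sound_simps s_dirs_Nil) (blast intro: s_zone_ok_empty s_zone_ok_dirs s_dirs_Cons)

lemma sound_zone_at_rules: "list_all sound_clause zone_at_rules"
  by (simp add: zone_at_rules_def sound_simps s_dot_Nil) (blast intro: s_dot_Plus s_dot_Minus s_zone_at_Nil s_zone_at_Cons)

lemma sound_table_rules: "list_all sound_clause table_rules"
  by (simp add: table_rules_def sound_simps s_table_Nil) (blast intro: s_table_step s_table_cycle)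

lemma sound_sat_rules: "list_all sound_clause sat_rules"
  by (simp add: sat_rules_def sound_simps s_sat_True s_sat_Conj s_sat_Disj1 s_sat_Disj2 s_sat_F s_sat_F_Nil s_sat_Zone_Nil s_sat_Zone)

lemma sound_top_rules: "list_all sound_clause top_rules"
  by (simp add: top_rules_def sound_simps s_top_def) (blast intro: top_sound)

lemma rules_sound:
  assumes "c \<in> set rules" "\<forall>b\<in>set (snd c). sem (inst_goal \<theta> b)"
  shows "sem (inst_goal \<theta> (fst c))"
proof -
  have "list_all sound_clause rules"
    by (simp add: rules_def sound_add_rules sound_num_rules sound_scale_rules sound_move_rules sound_vec_rules
        sound_comb_rules sound_zone_ok_rules sound_zone_at_rules sound_table_rules sound_sat_rules sound_top_rules)
  then have "sound_clause c" using assms(1) by (simp add: list_all_iff)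
  then show ?thesis using assms(2) by (simp add: sound_clause_def)
qed


section \<open>Completeness of the logic program\<close>

definition prv :: "nat \<Rightarrow> nat \<Rightarrow> (pred, letter) goal list \<Rightarrow> bool" where
  "prv K B gs \<longleftrightarrow> (\<exists>n\<le>B. drv (set rules) K n gs)"

definition sub :: "letter list list \<Rightarrow> nat \<Rightarrow> letter list" where
  "sub vs i = (if i < length vs then vs ! i else [])"

lemma prv_Nil: "prv K 0 []"
  unfolding prv_def using drv_Nil by blast

lemma prv_Cons: "prv K B [g] \<Longrightarrow> prv K B' gs \<Longrightarrow> prv K (B + B') (g # gs)"
  unfolding prv_def using drv_append[of "set rules" K _ "[g]" _ gs] by (metis add_mono append_Cons append_Nil)

lemma prv_mono: "prv K B gs \<Longrightarrow> B \<le> B' \<Longrightarrow> prv K B' gs"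
  unfolding prv_def by (meson le_trans)

text \<open>A rule is addressed by its position in a named sublist and a substitution by a list of
  values; in this form simplification can compute the goals of the instance.\<close>

lemma prv_nth:
  assumes "i < length R" "set R \<subseteq> set rules" "\<forall>v\<in>set vs. length v \<le> K" "prv K B (map (inst_goal (sub vs)) (snd (R ! i)))"
  shows "prv K (Suc B) [inst_goal (sub vs) (fst (R ! i))]"
proof -
  obtain n where n: "n \<le> B" "drv (set rules) K n (map (inst_goal (sub vs)) (snd (R ! i)) @ [])" using assms(4) by (auto simp: prv_def)
  have "R ! i \<in> set rules" using assms(1,2) nth_mem by blast
  then have "(fst (R ! i), snd (R ! i)) \<in> set rules" by simp
  moreover have "\<forall>j. length (sub vs j) \<le> K" using assms(3) by (auto simp: sub_def)
  ultimately have "drv (set rules) K (Suc n) (inst_goal (sub vs) (fst (R ! i)) # [])" using n(2) by (rule drv_rule)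
  then show ?thesis unfolding prv_def using n(1) by (intro exI[of _ "Suc n"]) auto
qed

lemma rules_subset:
  "set add_rules \<subseteq> set rules" "set num_rules \<subseteq> set rules" "set scale_rules \<subseteq> set rules" "set move_rules \<subseteq> set rules"
  "set vec_rules \<subseteq> set rules" "set comb_rules \<subseteq> set rules" "set zone_ok_rules \<subseteq> set rules" "set zone_at_rules \<subseteq> set rules"
  "set table_rules \<subseteq> set rules" "set sat_rules \<subseteq> set rules" "set top_rules \<subseteq> set rules"
  by (auto simp: rules_def)

lemmas prv_add_rule = prv_nth[OF _ rules_subset(1)]
lemmas prv_num_rule = prv_nth[OF _ rules_subset(2)]
lemmas prv_scale_rule = prv_nth[OF _ rules_subset(3)]
lemmas prv_move_rule = prv_nth[OF _ rules_subset(4)]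
lemmas prv_vec_rule = prv_nth[OF _ rules_subset(5)]
lemmas prv_comb_rule = prv_nth[OF _ rules_subset(6)]
lemmas prv_zone_ok_rule = prv_nth[OF _ rules_subset(7)]
lemmas prv_zone_at_rule = prv_nth[OF _ rules_subset(8)]
lemmas prv_table_rule = prv_nth[OF _ rules_subset(9)]
lemmas prv_sat_rule = prv_nth[OF _ rules_subset(10)]
lemmas prv_top_rule = prv_nth[OF _ rules_subset(11)]

lemmas rule_simps = inst_goal_def sub_def eval_nat_numeral signs_def

section \<open>Fixed-width numbers and derivations for arithmetic\<close>

abbreviation "bl c \<equiv> (if c then L_1 else L_0)"

fun fw :: "nat \<Rightarrow> nat \<Rightarrow> letter list" where
  "fw 0 n = []"
| "fw (Suc k) n = bl (odd n) # fw k (n div 2)"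

lemma length_fw [simp]: "length (fw k n) = k"
  by (induction k arbitrary: n) auto

lemma bitw_fw [simp]: "bitw (fw k n)"
  by (induction k arbitrary: n) auto

lemma val_fw: "n < 2 ^ k \<Longrightarrow> val (fw k n) = n"
proof (induction k arbitrary: n)
  case (Suc k)
  then have "n div 2 < 2 ^ k" by auto
  then have "val (fw k (n div 2)) = n div 2" by (rule Suc.IH)
  then show ?case by simp
qed simp

lemma fw_append_0: "n < 2 ^ k \<Longrightarrow> fw k n @ [L_0] = fw (Suc k) n"
proof (induction k arbitrary: n)
  case (Suc k)
  then have "n div 2 < 2 ^ k" by auto
  then show ?case using Suc.IH[of "n div 2"] by simp
qed simp

text \<open>Supplies the values for patterns with \<open>b1\<close> in the middle, by which rules
  demand a positive number.\<close>

lemma fw_pos_split: "0 < n \<Longrightarrow> n < 2 ^ k \<Longrightarrow> \<exists>a b. fw k n = a @ L_1 # b"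
proof (induction k arbitrary: n)
  case (Suc k)
  show ?case
  proof (cases "odd n")
    case False
    then have "0 < n div 2" "n div 2 < 2 ^ k" using Suc.prems by (auto elim!: evenE)
    then obtain a b where "fw k (n div 2) = a @ L_1 # b" using Suc.IH by blast
    then show ?thesis using False by (intro exI[of _ "L_0 # a"] exI[of _ b]) auto
  qed (intro exI[of _ "[]"] exI[of _ "fw k (n div 2)"], simp)
qed simp

lemma prv_zero: "bitw w \<Longrightarrow> length w \<le> K \<Longrightarrow> prv K (Suc (length w)) [(PZero, [w, fw (length w) 0])]"
proof (induction w)
  case Nil
  show ?case using prv_num_rule[of 0 "[]" K 0] prv_Nil by (simp add: num_rules_def rule_simps)
next
  case (Cons a w)
  then have IH: "prv K (Suc (length w)) [(PZero, [w, fw (length w) 0])]" by auto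
  show ?case
  proof (cases "a = L_0")
    case True
    then show ?thesis using prv_num_rule[of 1 "[w, fw (length w) 0]" K "Suc (length w)"] IH Cons.prems
      by (simp add: num_rules_def rule_simps)
  next
    case False
    then show ?thesis using prv_num_rule[of 2 "[w, fw (length w) 0]" K "Suc (length w)"] IH Cons.prems
      by (simp add: num_rules_def rule_simps)
  qed
qed

lemma prv_add_step:
  assumes "length x \<le> K" "length y \<le> K" "length z \<le> K"
    "prv K B [(PAdd, [[bl ((a \<and> b) \<or> (a \<and> c) \<or> (b \<and> c))], x, y, z])]"
  shows "prv K (Suc B) [(PAdd, [[bl c], bl a # x, bl b # y, bl ((a \<noteq> b) \<noteq> c) # z])]"
proof -
  \<comment> \<open>After the axiom, the eight addition rules are listed in the binary order of
    carry, first and second digit.\<close>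
  show ?thesis
    using assms prv_add_rule[of "1 + (if c then 4 else 0) + (if a then 2 else 0) + (if b then 1 else 0)" "[x, y, z]" K B]
    by (cases a; cases b; cases c; simp add: add_rules_def rule_simps)
qed

lemma add_div_2:
  fixes x y c :: nat
  assumes "c \<le> 1"
  shows "((odd x \<and> odd y) \<or> (odd x \<and> c = 1) \<or> (odd y \<and> c = 1) \<longrightarrow> (x + y + c) div 2 = x div 2 + y div 2 + 1) \<and>
    (\<not> ((odd x \<and> odd y) \<or> (odd x \<and> c = 1) \<or> (odd y \<and> c = 1)) \<longrightarrow> (x + y + c) div 2 = x div 2 + y div 2)"
proof -
  define i where "i = x mod 2"
  define j where "j = y mod 2"
  have ij: "i = 0 \<or> i = 1" "j = 0 \<or> j = 1" "c = 0 \<or> c = 1" using assms by (auto simp: i_def j_def)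
  have od: "odd x \<longleftrightarrow> i = 1" "odd y \<longleftrightarrow> j = 1" by (auto simp: i_def j_def odd_iff_mod_2_eq_one)
  have "x + y + c = 2 * (x div 2 + y div 2) + (i + j + c)" unfolding i_def j_def by presburger
  then have "(x + y + c) div 2 = x div 2 + y div 2 + (i + j + c) div 2" by simp
  then show ?thesis using ij unfolding od by (elim disjE) simp_all
qed

lemma prv_add:
  "x + y + of_bool c < 2 ^ k \<Longrightarrow> k \<le> K \<Longrightarrow> prv K (Suc k) [(PAdd, [[bl c], fw k x, fw k y, fw k (x + y + of_bool c)])]"
proof (induction k arbitrary: x y c)
  case 0
  then show ?case using prv_add_rule[of 0 "[]" K 0] prv_Nil by (simp add: add_rules_def rule_simps)
next
  case (Suc k)
  let ?c = "(odd x \<and> odd y) \<or> (odd x \<and> c) \<or> (odd y \<and> c)"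
  have eq: "(x + y + of_bool c) div 2 = x div 2 + y div 2 + of_bool ?c"
    using add_div_2[of "of_bool c" x y] by (cases c) auto
  have od: "odd (x + y + of_bool c) = ((odd x \<noteq> odd y) \<noteq> c)" by (cases c) auto
  have "(x + y + of_bool c) div 2 < 2 ^ k" using Suc.prems(1) by auto
  then have "prv K (Suc k) [(PAdd, [[bl ?c], fw k (x div 2), fw k (y div 2), fw k ((x + y + of_bool c) div 2)])]"
    unfolding eq using Suc.prems(2) by (intro Suc.IH) auto
  then show ?case using prv_add_step[of "fw k (x div 2)" K "fw k (y div 2)" "fw k ((x + y + of_bool c) div 2)" "Suc k" "odd x" "odd y" c]
    using Suc.prems(2) od by simp
qed

text \<open>The functions \<open>cM\<close>, \<open>cMv\<close>, \<dots>, \<open>cTop\<close> bound the number of rule applications in terms of the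
  bound \<open>K\<close> on the lengths of words.\<close>

definition cM :: "nat \<Rightarrow> nat" where "cM K = (K + 1) * (K + 3)"

definition chk :: "int \<Rightarrow> pred" where "chk z = (if z < 0 then PPos else PNat)"

subsection \<open>Vectors\<close>

definition vecw :: "nat \<Rightarrow> (nat \<times> nat) list \<Rightarrow> letter list" where
  "vecw k ps = enc_list encP (map (\<lambda>(p, q). (fw k p, fw k q)) ps)"

lemma vecw_simps [simp]: "vecw k [] = [L_End]" "vecw k ((p, q) # ps) = L_Item # fw k p @ L_End # fw k q @ L_End # vecw k ps"
  by (auto simp: vecw_def)

lemma length_vecw: "length (vecw k ps) = (2 * k + 3) * length ps + 1"
  by (induction ps) auto

definition small :: "nat \<Rightarrow> (nat \<times> nat) list \<Rightarrow> bool" where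
  "small k ps \<longleftrightarrow> (\<forall>(p, q)\<in>set ps. p < 2 ^ k \<and> q < 2 ^ k)"

lemma small_simps [simp]: "small k []" "small k ((p, q) # ps) \<longleftrightarrow> p < 2 ^ k \<and> q < 2 ^ k \<and> small k ps"
  by (auto simp: small_def)

fun mv :: "nat \<Rightarrow> (nat \<times> nat) list \<Rightarrow> (letter \<times> letter list) list \<Rightarrow> (nat \<times> nat) list" where
  "mv y ((p, q) # ps) ((s, a) # ts) = (if s = L_Minus then (p, q + val a * y) else (p + val a * y, q)) # mv y ps ts"
| "mv y _ _ = []"

lemma length_mv [simp]: "length (mv y ps ts) = min (length ps) (length ts)"
  by (induction y ps ts rule: mv.induct) auto

text \<open>The two parts of a coordinate can only grow, so if the result fits into \<open>k\<close>
  digits, so does everything before it. Overflow thus has to be excluded for final values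
  only.\<close>

lemma small_mvD: "small k (mv y ps ts) \<Longrightarrow> length ps = length ts \<Longrightarrow> small k ps"
  by (induction y ps ts rule: mv.induct) (auto split: if_splits)

definition cMv :: "nat \<Rightarrow> nat" where "cMv K = cM K + 2 * K + 3"

lemma enc_int_bits: "enc_int z = (if z < 0 then L_Minus else L_Plus) # bits (nat \<bar>z\<bar>) @ [L_End]"
  by (simp add: enc_int_def enc_nat_def)

fun cmb :: "nat list \<Rightarrow> int list list \<Rightarrow> int list \<Rightarrow> (nat \<times> nat) list \<Rightarrow> (nat \<times> nat) list" where
  "cmb (y # ys) (r # rs) (b # bs) ps = cmb ys rs bs (mv y ps (map int_code (b # r)))"
| "cmb _ _ _ ps = ps"

lemma small_cmbD:
  "small k (cmb ys rs bs ps) \<Longrightarrow> \<forall>r\<in>set rs. length r + 1 = length ps \<Longrightarrow> small k ps"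
proof (induction ys rs bs ps rule: cmb.induct)
  case (1 y ys r rs b bs ps)
  then have "small k (mv y ps (map int_code (b # r)))" by (intro "1.IH") auto
  then show ?case using small_mvD 1(3) by (metis length_Cons length_map list.set_intros(1) Suc_eq_plus1)
qed auto

definition cC :: "nat \<Rightarrow> nat" where "cC K = (K + 3) + (K + 3) * (K + 1) + cMv K * (K + 1)"

lemma length_enc_list_ge: "length xs < length (enc_list f xs)"
  by (induction xs) auto

lemma enc_list_int_code: "enc_list encI (map int_code zs) = enc_list enc_int zs"
  by (simp add: enc_list_map enc_int_code)

context
  fixes K k :: nat
  assumes k1: "k \<ge> 1" and kK: "k \<le> K"
begin

lemma prv_plus: "x + y < 2 ^ k \<Longrightarrow> prv K (K + 1) [(PAdd, [[L_0], fw k x, fw k y, fw k (x + y)])]"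
  using prv_add[of x y False k K] kK by (auto intro: prv_mono)

lemma prv_zero_fw: "prv K (K + 1) [(PZero, [fw k x, fw k 0])]"
  using prv_zero[of "fw k x" K] kK by (auto intro: prv_mono)

lemma prv_mul_aux:
  "bitw a \<Longrightarrow> length a \<le> K \<Longrightarrow> b < 2 ^ k \<Longrightarrow> val a * b < 2 ^ k \<Longrightarrow>
    prv K ((length a + 1) * (K + 3)) [(PMul, [a, fw k b, fw k (val a * b)])]"
proof (induction a)
  case Nil
  have "prv K (Suc (K + 1 + 0)) [(PMul, [[], fw k b, fw k 0])]"
    using prv_num_rule[of 3 "[fw k b, fw k 0]" K "K + 1 + 0"] prv_zero_fw[of b] kK by (simp add: num_rules_def rule_simps)
  then show ?case by (auto intro: prv_mono)
next
  case (Cons x a)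
  obtain k' where k': "k = Suc k'" using k1 by (cases k) auto
  let ?m = "val a * b"
  have m: "2 * ?m < 2 ^ k" using Cons.prems(4) by (auto simp: algebra_simps split: if_splits)
  then have m': "?m < 2 ^ k'" using k' by simp
  \<comment> \<open>As the product is below \<open>2 ^ k'\<close>, its leading digit is 0 and can be
    shifted out, in the form that the rules for \<open>PMul\<close> expect.\<close>
  have e1: "fw k ?m = fw k' ?m @ [L_0]" using fw_append_0[OF m'] k' by simp
  have e2: "fw k (2 * ?m) = L_0 # fw k' ?m" using k' by simp
  have IH: "prv K ((length a + 1) * (K + 3)) [(PMul, [a, fw k b, fw k' ?m @ [L_0]])]"
    using Cons.IH Cons.prems m e1 by auto
  show ?case
  proof (cases "x = L_1")
    case False
    then have "x = L_0" using Cons.prems(1) by auto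
    then have "prv K (Suc ((length a + 1) * (K + 3))) [(PMul, [x # a, fw k b, L_0 # fw k' ?m])]"
      using prv_num_rule[of 4 "[a, fw k b, fw k' ?m]" K "(length a + 1) * (K + 3)"] IH Cons.prems kK k'
      by (simp add: num_rules_def rule_simps)
    then show ?thesis using False by (auto intro: prv_mono simp flip: e2 simp: mult.assoc)
  next
    case True
    then have p: "2 * ?m + b < 2 ^ k" using Cons.prems(4) by (simp add: algebra_simps)
    have 2: "prv K (K + 1) [(PAdd, [[L_0], L_0 # fw k' ?m, fw k b, fw k (2 * ?m + b)])]"
      using prv_plus[OF p] e2 by simp
    have "prv K (Suc ((length a + 1) * (K + 3) + (K + 1))) [(PMul, [L_1 # a, fw k b, fw k (2 * ?m + b)])]"
      using prv_num_rule[of 5 "[a, fw k b, fw k' ?m, fw k (2 * ?m + b)]" K "(length a + 1) * (K + 3) + (K + 1)"]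
        prv_Cons[OF IH 2] Cons.prems kK k'
      by (simp add: num_rules_def rule_simps)
    moreover have "2 * ?m + b = val (x # a) * b" using True by (simp add: algebra_simps)
    ultimately show ?thesis using True by (auto intro: prv_mono)
  qed
qed

lemma prv_mul: "bitw a \<Longrightarrow> length a \<le> K \<Longrightarrow> b < 2 ^ k \<Longrightarrow> val a * b < 2 ^ k \<Longrightarrow> prv K (cM K) [(PMul, [a, fw k b, fw k (val a * b)])]"
  by (rule prv_mono[OF prv_mul_aux]) (auto simp: cM_def)

lemma prv_pos: "n > 0 \<Longrightarrow> length (bits n) \<le> K \<Longrightarrow> prv K (Suc (length (bits n))) [(PPos, [bits n])]"
proof (induction n rule: less_induct)
  case (less n)
  define m where "m = n div 2"
  consider "n = 1" | "n = 2 * m" "m > 0" | "n = Suc (2 * m)" "m > 0" 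
  proof -
    have "n = 2 * m \<or> n = Suc (2 * m)" unfolding m_def by presburger
    then show thesis using that less.prems(1) by (cases "m = 0") auto
  qed
  then show ?case
  proof cases
    case 1
    have "bits 1 = [L_1]" using bits_double(2)[of 0] by simp
    moreover have "prv K (Suc 0) [(PPos, [[L_1]])]" using prv_num_rule[of 6 "[]" K 0] prv_Nil by (simp add: num_rules_def rule_simps)
    ultimately show ?thesis using 1 by (auto intro: prv_mono)
  next
    case 2
    then have b: "bits n = L_0 # bits m" by simp
    then have "prv K (Suc (length (bits m))) [(PPos, [bits m])]" using less 2 by simp
    then show ?thesis using prv_num_rule[of 7 "[bits m]" K "Suc (length (bits m))"] b less.prems by (simp add: num_rules_def rule_simps)
  next
    case 3
    then have b: "bits n = L_1 # bits m" by simp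
    then have "prv K (Suc (length (bits m))) [(PPos, [bits m])]" using less 3 by simp
    then show ?thesis using prv_num_rule[of 8 "[bits m]" K "Suc (length (bits m))"] b less.prems by (simp add: num_rules_def rule_simps)
  qed
qed

lemma prv_chk: "length (bits (nat \<bar>z\<bar>)) \<le> K \<Longrightarrow> prv K (K + 2) [(chk z, [bits (nat \<bar>z\<bar>)])]"
proof -
  assume l: "length (bits (nat \<bar>z\<bar>)) \<le> K"
  show ?thesis
  proof (cases "z = 0")
    case True
    have "prv K (Suc 0) [(PNat, [[]])]" using prv_num_rule[of 9 "[]" K 0] prv_Nil by (simp add: num_rules_def rule_simps)
    then show ?thesis using True by (auto simp: chk_def intro: prv_mono)
  next
    case False
    then have p: "prv K (K + 1) [(PPos, [bits (nat \<bar>z\<bar>)])]" using prv_pos[of "nat \<bar>z\<bar>"] l by (auto intro: prv_mono)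
    show ?thesis
    proof (cases "z < 0")
      case True
      then show ?thesis using p by (auto simp: chk_def intro: prv_mono)
    next
      case False
      then show ?thesis using prv_num_rule[of 10 "[bits (nat \<bar>z\<bar>)]" K "K + 1"] p l by (simp add: num_rules_def rule_simps chk_def)
    qed
  qed
qed

lemma prv_move:
  "length ps = length ts \<Longrightarrow> \<forall>t\<in>set ts. okI t \<Longrightarrow> small k (mv y ps ts) \<Longrightarrow> y < 2 ^ k \<Longrightarrow> length (vecw k ps) \<le> K \<Longrightarrow>
    length (enc_list encI ts) \<le> K \<Longrightarrow>
    prv K (cMv K * (length ts + 1)) [(PMove, [fw k y, vecw k ps, vecw k (mv y ps ts), enc_list encI ts])]"
proof (induction y ps ts rule: mv.induct)
  case (1 y p q ps s a ts)
  let ?B = "cMv K * (length ts + 1)"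
  have IH: "prv K ?B [(PMove, [fw k y, vecw k ps, vecw k (mv y ps ts), enc_list encI ts])]"
    using 1 by (auto split: if_splits)
  have ok: "s = L_Plus \<or> s = L_Minus" "bitw a" "length a \<le> K" using 1 by auto
  have ls: "length (vecw k (mv y ps ts)) \<le> K" using 1 by (simp add: length_vecw)
  have lps: "length (vecw k ps) \<le> K" "length (enc_list encI ts) \<le> K" using 1 by auto
  have prod: "val a * y < 2 ^ k" using 1 by (auto split: if_splits)
  have m: "prv K (cM K) [(PMul, [a, fw k y, fw k (val a * y)])]" using prv_mul[OF ok(2,3) _ prod] 1 by simp
  show ?case
  proof (cases "s = L_Minus")
    case True
    have sm: "q + val a * y < 2 ^ k" using 1 True by auto
    have step: "prv K B [(PMul, [a, fw k y, fw k (val a * y)]), (PAdd, [[L_0], fw k q, fw k (val a * y), fw k (q + val a * y)]), (PZero, [fw k p, fw k 0]),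
       (PMove, [fw k y, vecw k ps, vecw k (mv y ps ts), enc_list encI ts])] \<Longrightarrow>
       prv K (Suc B) [(PMove, [fw k y, vecw k ((p, q) # ps), vecw k ((p, q + val a * y) # mv y ps ts), enc_list encI ((s, a) # ts)])]" for B
      using prv_move_rule[of 2 "[fw k y, fw k q, fw k p, vecw k ps, fw k (q + val a * y), vecw k (mv y ps ts), a, enc_list encI ts, fw k (val a * y), fw k 0]" K B]
        kK ok ls lps True
      by (simp add: move_rules_def rule_simps)
    have "prv K (Suc (cM K + (K + 1 + (K + 1 + ?B)))) [(PMove, [fw k y, vecw k ((p, q) # ps), vecw k ((p, q + val a * y) # mv y ps ts), enc_list encI ((s, a) # ts)])]"
      by (rule step[OF prv_Cons[OF m prv_Cons[OF prv_plus[OF sm] prv_Cons[OF prv_zero_fw[of p] IH]]]])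
    then show ?thesis using True by (auto intro!: prv_mono simp: cMv_def algebra_simps)
  next
    case False
    then have s: "s = L_Plus" using ok by simp
    have sm: "p + val a * y < 2 ^ k" using 1 s by auto
    have step: "prv K B [(PMul, [a, fw k y, fw k (val a * y)]), (PAdd, [[L_0], fw k p, fw k (val a * y), fw k (p + val a * y)]), (PZero, [fw k q, fw k 0]),
       (PMove, [fw k y, vecw k ps, vecw k (mv y ps ts), enc_list encI ts])] \<Longrightarrow>
       prv K (Suc B) [(PMove, [fw k y, vecw k ((p, q) # ps), vecw k ((p + val a * y, q) # mv y ps ts), enc_list encI ((s, a) # ts)])]" for B
      using prv_move_rule[of 1 "[fw k y, fw k p, fw k q, vecw k ps, fw k (p + val a * y), vecw k (mv y ps ts), a, enc_list encI ts, fw k (val a * y), fw k 0]" K B]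
        kK ok ls lps s
      by (simp add: move_rules_def rule_simps)
    have "prv K (Suc (cM K + (K + 1 + (K + 1 + ?B)))) [(PMove, [fw k y, vecw k ((p, q) # ps), vecw k ((p + val a * y, q) # mv y ps ts), enc_list encI ((s, a) # ts)])]"
      by (rule step[OF prv_Cons[OF m prv_Cons[OF prv_plus[OF sm] prv_Cons[OF prv_zero_fw[of q] IH]]]])
    then show ?thesis using s by (auto intro!: prv_mono simp: cMv_def algebra_simps)
  qed
next
  case ("2_1" y ts)
  have "prv K (Suc 0) [(PMove, [fw k y, [L_End], [L_End], [L_End]])]"
    using prv_move_rule[of 0 "[fw k y]" K 0] prv_Nil kK by (simp add: move_rules_def rule_simps)
  then show ?case using "2_1" by (auto intro: prv_mono simp: cMv_def)
next
  case ("2_2" y ps)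
  have "prv K (Suc 0) [(PMove, [fw k y, [L_End], [L_End], [L_End]])]"
    using prv_move_rule[of 0 "[fw k y]" K 0] prv_Nil kK by (simp add: move_rules_def rule_simps)
  then show ?case using "2_2" by (auto intro: prv_mono simp: cMv_def)
qed

lemma prv_eqzero: "\<forall>(p, q)\<in>set ps. p = q \<Longrightarrow> length (vecw k ps) \<le> K \<Longrightarrow> prv K ((K + 2) * (length ps + 1)) [(PEqZero, [vecw k ps])]"
proof (induction ps)
  case Nil
  have "prv K (Suc 0) [(PEqZero, [[L_End]])]"
    using prv_vec_rule[of 4 "[]" K 0] prv_Nil by (simp add: vec_rules_def rule_simps)
  then show ?case by (auto intro: prv_mono)
next
  case (Cons a ps)
  obtain p where a: "a = (p, p)" using Cons.prems by (cases a) auto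
  let ?B = "(K + 2) * (length ps + 1)"
  have IH: "prv K ?B [(PEqZero, [vecw k ps])]" using Cons by (auto simp: a)
  have "prv K (Suc (K + 1 + ?B)) [(PEqZero, [vecw k ((p, p) # ps)])]"
    using prv_vec_rule[of 5 "[fw k p, vecw k ps, fw k 0]" K "K + 1 + ?B"] prv_Cons[OF prv_zero_fw[of p] IH] kK Cons.prems a
    by (simp add: vec_rules_def rule_simps)
  then show ?case by (auto intro!: prv_mono simp: a algebra_simps)
qed

lemma prv_zerovec: "length (vecw k (replicate n (0, 0))) \<le> K \<Longrightarrow> prv K ((K + 2) * (n + 1)) [(PZeroVec, [vecw k (replicate n (0, 0))])]"
proof (induction n)
  case 0
  have "prv K (Suc 0) [(PZeroVec, [[L_End]])]"
    using prv_vec_rule[of 2 "[]" K 0] prv_Nil by (simp add: vec_rules_def rule_simps)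
  then show ?case by (auto intro: prv_mono)
next
  case (Suc n)
  let ?B = "(K + 2) * (n + 1)"
  have IH: "prv K ?B [(PZeroVec, [vecw k (replicate n (0, 0))])]" using Suc by auto
  have "prv K (Suc (K + 1 + ?B)) [(PZeroVec, [vecw k ((0, 0) # replicate n (0, 0))])]"
    using prv_vec_rule[of 3 "[fw k 0, vecw k (replicate n (0, 0))]" K "K + 1 + ?B"] prv_Cons[OF prv_zero_fw[of 0] IH] kK Suc.prems
    by (simp add: vec_rules_def rule_simps)
  then show ?case by (auto intro!: prv_mono simp: algebra_simps)
qed

lemma prv_introw: "length (enc_list enc_int zs) \<le> K \<Longrightarrow> prv K ((K + 3) * (length zs + 1)) [(PIntRow, [enc_list enc_int zs])]"
proof (induction zs)
  case Nil
  have "prv K (Suc 0) [(PIntRow, [[L_End]])]"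
    using prv_comb_rule[of 0 "[]" K 0] prv_Nil by (simp add: comb_rules_def rule_simps)
  then show ?case by (auto intro: prv_mono)
next
  case (Cons z zs)
  let ?B = "(K + 3) * (length zs + 1)"
  have IH: "prv K ?B [(PIntRow, [enc_list enc_int zs])]" using Cons by auto
  have l: "length (bits (nat \<bar>z\<bar>)) \<le> K" "length (enc_list enc_int zs) \<le> K"
    using Cons.prems enc_int_bits[of z] by (auto split: if_splits)
  have step: "prv K B [(chk z, [bits (nat \<bar>z\<bar>)]), (PIntRow, [enc_list enc_int zs])] \<Longrightarrow>
    prv K (Suc B) [(PIntRow, [enc_list enc_int (z # zs)])]" for B
    using prv_comb_rule[of "if z < 0 then 3 else 2" "[bits (nat \<bar>z\<bar>), enc_list enc_int zs]" K B] l enc_int_bits[of z]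
    by (auto simp: comb_rules_def rule_simps chk_def)
  have "prv K (Suc (K + 2 + ?B)) [(PIntRow, [enc_list enc_int (z # zs)])]"
    by (rule step[OF prv_Cons[OF prv_chk[OF l(1)] IH]])
  then show ?case by (auto intro!: prv_mono simp: algebra_simps)
qed

lemma prv_comb:
  "length ys = length rs \<Longrightarrow> length bs = length rs \<Longrightarrow> \<forall>r\<in>set rs. length r + 1 = length ps \<Longrightarrow> \<forall>y\<in>set ys. y < 2 ^ k \<Longrightarrow>
   small k (cmb ys rs bs ps) \<Longrightarrow> length (vecw k ps) \<le> K \<Longrightarrow> \<forall>r\<in>set rs. \<forall>b\<in>set bs. length (enc_list enc_int (b # r)) \<le> K \<Longrightarrow>
   length (encrows rs) \<le> K \<Longrightarrow> length (enc_list enc_int bs) \<le> K \<Longrightarrow>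
   prv K (cC K * (length rs + 1)) [(PComb, [encrows rs, enc_list enc_int bs, vecw k ps, vecw k (cmb ys rs bs ps)])]"
proof (induction ys rs bs ps rule: cmb.induct)
  case (1 y ys r rs b bs ps)
  let ?ts = "map int_code (b # r)"
  let ?W = "mv y ps ?ts" and ?F = "cmb ys rs bs (mv y ps ?ts)"
  let ?B = "cC K * (length rs + 1)"
  have lp: "length ps = length ?ts" using 1 by simp
  have lw: "length (vecw k ?W) \<le> K" "length (vecw k ?F) \<le> K"
  proof -
    have "length (cmb ys rs bs qs) = length qs" if "\<forall>r\<in>set rs. length r + 1 = length qs" for ys rs bs qs
      using that by (induction ys rs bs qs rule: cmb.induct) auto
    then have "length ?F = length ?W" using 1(4) lp by simp
    then show "length (vecw k ?W) \<le> K" "length (vecw k ?F) \<le> K" using 1(7) lp by (auto simp: length_vecw)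
  qed
  have sW: "small k ?W" using small_cmbD[of k ys rs bs ?W] 1 lp by simp
  have IH: "prv K ?B [(PComb, [encrows rs, enc_list enc_int bs, vecw k ?W, vecw k ?F])]"
    using 1 lp lw by (intro "1.IH") (auto simp: encrows_def)
  have row: "length (enc_list enc_int (b # r)) \<le> K" using 1 by simp
  have mvp: "prv K (cMv K * (K + 1)) [(PMove, [fw k y, vecw k ps, vecw k ?W, enc_list enc_int (b # r)])]"
  proof (rule prv_mono)
    show "prv K (cMv K * (length ?ts + 1)) [(PMove, [fw k y, vecw k ps, vecw k ?W, enc_list enc_int (b # r)])]"
      using prv_move[of ps ?ts y] lp sW 1 row unfolding enc_list_int_code by auto
    have "length ?ts < length (enc_list enc_int (b # r))" using length_enc_list_ge[of "b # r" enc_int] by simp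
    then show "cMv K * (length ?ts + 1) \<le> cMv K * (K + 1)" using row by (intro mult_le_mono2) simp
  qed
  have irow: "prv K ((K + 3) * (K + 1)) [(PIntRow, [enc_list enc_int r])]"
  proof (rule prv_mono)
    show "prv K ((K + 3) * (length r + 1)) [(PIntRow, [enc_list enc_int r])]" using prv_introw row by simp
    have "length r < length (enc_list enc_int r)" by (rule length_enc_list_ge)
    then show "(K + 3) * (length r + 1) \<le> (K + 3) * (K + 1)" using row by (intro mult_le_mono2) simp
  qed
  have lb: "length (bits (nat \<bar>b\<bar>)) \<le> K" "length (enc_list enc_int r) \<le> K" using row enc_int_bits[of b] by (auto split: if_splits)
  have lr: "length (encrows rs) \<le> K" "length (enc_list enc_int bs) \<le> K" using 1(9,10) by (auto simp: encrows_def)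
  have lps: "length (vecw k ps) \<le> K" using 1(7) .
  have step: "prv K B [(chk b, [bits (nat \<bar>b\<bar>)]), (PIntRow, [enc_list enc_int r]), (PMove, [fw k y, vecw k ps, vecw k ?W, enc_list enc_int (b # r)]),
     (PComb, [encrows rs, enc_list enc_int bs, vecw k ?W, vecw k ?F])] \<Longrightarrow>
     prv K (Suc B) [(PComb, [encrows (r # rs), enc_list enc_int (b # bs), vecw k ps, vecw k ?F])]" for B
    using prv_comb_rule[of "if b < 0 then 5 else 4"
       "[enc_list enc_int r, encrows rs, bits (nat \<bar>b\<bar>), enc_list enc_int bs, vecw k ps, vecw k ?F, fw k y, vecw k ?W]" K B]
      lw kK lb lr lps enc_int_bits[of b]
    by (auto simp: comb_rules_def rule_simps chk_def encrows_def)
  have "prv K (Suc (K + 2 + ((K + 3) * (K + 1) + (cMv K * (K + 1) + ?B)))) [(PComb, [encrows (r # rs), enc_list enc_int (b # bs), vecw k ps, vecw k ?F])]"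
    by (rule step[OF prv_Cons[OF prv_chk[OF lb(1)] prv_Cons[OF irow prv_Cons[OF mvp IH]]]])
  then show ?case by (auto intro!: prv_mono simp: cC_def algebra_simps)
qed (use prv_comb_rule[of 1 "[vecw k _]" K 0] prv_Nil in \<open>auto simp: comb_rules_def rule_simps encrows_def cC_def intro: prv_mono\<close>)

end


section \<open>Values and sizes of the vectors and scalar products in a derivation\<close>

fun pvl :: "nat \<times> nat \<Rightarrow> int" where "pvl (p, q) = int p - int q"

definition le_all :: "nat \<Rightarrow> (nat \<times> nat) list \<Rightarrow> bool" where
  "le_all S ps \<longleftrightarrow> (\<forall>(p, q)\<in>set ps. p \<le> S \<and> q \<le> S)"

lemma le_all_simps [simp]: "le_all S []" "le_all S ((p, q) # ps) \<longleftrightarrow> p \<le> S \<and> q \<le> S \<and> le_all S ps"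
  "le_all S (ps @ qs) \<longleftrightarrow> le_all S ps \<and> le_all S qs"
  by (auto simp: le_all_def)

lemma le_all_replicate [simp]: "le_all S (replicate n (0, 0))"
  by (auto simp: le_all_def)

lemma le_all_mono: "le_all S ps \<Longrightarrow> S \<le> S' \<Longrightarrow> le_all S' ps"
  unfolding le_all_def by fastforce

lemma le_all_small: "le_all S ps \<Longrightarrow> S < 2 ^ k \<Longrightarrow> small k ps"
  unfolding le_all_def small_def by (auto intro: le_less_trans)

lemma le_all_mv: "le_all S ps \<Longrightarrow> \<forall>(s, a)\<in>set ts. val a \<le> M \<Longrightarrow> y \<le> Y \<Longrightarrow> le_all (S + M * Y) (mv y ps ts)"
proof (induction y ps ts rule: mv.induct)
  case (1 y p q ps s a ts)
  have "val a * y \<le> M * Y" using 1 by (intro mult_le_mono) auto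
  then show ?case using 1 by auto
qed auto

lemma pvl_mv: "length ps = length ts \<Longrightarrow> j < length ts \<Longrightarrow> pvl (mv y ps ts ! j) = pvl (ps ! j) + int y * ival (ts ! j)"
proof (induction y ps ts arbitrary: j rule: mv.induct)
  case (1 y p q ps s a ts)
  then show ?case by (cases j) (auto simp: algebra_simps)
qed auto

lemma length_cmb:
  "\<forall>r\<in>set rs. length r + 1 = length ps \<Longrightarrow> length (cmb ys rs bs ps) = length ps"
  by (induction ys rs bs ps rule: cmb.induct) (auto simp del: length_mv, auto)

lemma le_all_cmb:
  "le_all S ps \<Longrightarrow> \<forall>r\<in>set rs. \<forall>z\<in>set r. nat \<bar>z\<bar> \<le> M \<Longrightarrow> \<forall>z\<in>set bs. nat \<bar>z\<bar> \<le> M \<Longrightarrow> \<forall>y\<in>set ys. y \<le> Y \<Longrightarrow>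
    le_all (S + length rs * (M * Y)) (cmb ys rs bs ps)"
proof (induction ys rs bs ps arbitrary: S rule: cmb.induct)
  case (1 y ys r rs b bs ps)
  have "le_all (S + M * Y) (mv y ps (map int_code (b # r)))"
    using 1 by (intro le_all_mv) (auto simp: int_code_def)
  then have "le_all (S + M * Y + length rs * (M * Y)) (cmb (y # ys) (r # rs) (b # bs) ps)"
    using 1(1)[of "S + M * Y"] 1(3-5) by auto
  then show ?case by (simp add: add.assoc)
qed (auto intro: le_all_mono)

lemma pvl_cmb:
  "length ys = length rs \<Longrightarrow> length bs = length rs \<Longrightarrow> \<forall>r\<in>set rs. length r + 1 = length ps \<Longrightarrow> j < length ps \<Longrightarrow>
   pvl (cmb ys rs bs ps ! j) = pvl (ps ! j) + (\<Sum>r<length rs. int (ys ! r) * (bs ! r # rs ! r) ! j)"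
proof (induction ys rs bs ps rule: cmb.induct)
  case (1 y ys r rs b bs ps)
  let ?ts = "map int_code (b # r)"
  have l: "length ps = length ?ts" using 1 by simp
  have "ival (?ts ! j) = (b # r) ! j" using 1(5) l by (cases j) auto
  then have "pvl (mv y ps ?ts ! j) = pvl (ps ! j) + int y * (b # r) ! j" using pvl_mv[OF l, of j y] 1(5) l by simp
  then show ?case using 1 l by (simp add: sum.lessThan_Suc_shift del: sum.lessThan_Suc)
qed auto

fun dt :: "(letter \<times> letter list) list \<Rightarrow> (nat \<times> nat) list \<Rightarrow> nat \<times> nat \<Rightarrow> nat \<times> nat" where
  "dt ((s, a) # ts) ((u, v) # ps) (p, q) =
     dt ts ps (if s = L_Minus then (p + val a * v, q + val a * u) else (p + val a * u, q + val a * v))"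
| "dt _ _ pq = pq"

lemma dt_mono: "fst pq \<le> fst (dt ts ps pq) \<and> snd pq \<le> snd (dt ts ps pq)"
proof (induction ts ps pq rule: dt.induct)
  case (1 s a ts u v ps p q)
  then show ?case by (fastforce split: if_splits)
qed auto

lemma pvl_dt: "length ts = length ps \<Longrightarrow> pvl (dt ts ps pq) = pvl pq + (\<Sum>i<length ts. ival (ts ! i) * pvl (ps ! i))"
proof (induction ts ps pq rule: dt.induct)
  case (1 s a ts u v ps p q)
  then show ?case by (simp add: sum.lessThan_Suc_shift del: sum.lessThan_Suc) (simp add: algebra_simps)
qed auto

lemma dt_bound:
  "\<forall>(s, a)\<in>set ts. val a \<le> M \<Longrightarrow> le_all S ps \<Longrightarrow> fst pq \<le> R \<and> snd pq \<le> R \<Longrightarrow>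
    fst (dt ts ps pq) \<le> R + length ts * (M * S) \<and> snd (dt ts ps pq) \<le> R + length ts * (M * S)"
proof (induction ts ps pq arbitrary: R rule: dt.induct)
  case (1 s a ts u v ps p q)
  have "val a * u \<le> M * S" "val a * v \<le> M * S" using 1(2,3) by (auto intro!: mult_le_mono)
  moreover note "1.IH"[of "R + M * S"]
  ultimately show ?case using 1(2-4) by (auto simp: add.assoc split: if_splits)
qed (auto intro: trans_le_add1)

definition cD :: "nat \<Rightarrow> nat" where "cD K = 2 * cM K + 2 * K + 3"
definition cZA :: "nat \<Rightarrow> nat" where "cZA K = 2 * K + 4 + cD K * (K + 1)"
definition cDir :: "nat \<Rightarrow> nat" where "cDir K = 1 + 6 * (K + 1) + 2 * (cC K * (K + 1)) + 2 * ((K + 2) * (K + 1))"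
definition cZO :: "nat \<Rightarrow> nat" where "cZO K = 2 * K + 3 + cC K * (K + 1) + (K + 2) * (K + 1) + cDir K * (K + 1)"

definition zitem :: "nat \<Rightarrow> letter list" where "zitem k = L_Item # fw k 0 @ L_End # fw k 0 @ [L_End]"

lemma vecw_zeros: "vecw k (replicate i (0, 0) @ ps) = concat (replicate i (zitem k)) @ vecw k ps"
  by (induction i) (auto simp: zitem_def vecw_simps)

context
  fixes K k :: nat
  assumes k1: "k \<ge> 1" and kK: "k \<le> K"
begin

lemma prv_dot:
  "length ts = length ps \<Longrightarrow> \<forall>t\<in>set ts. okI t \<Longrightarrow> small k ps \<Longrightarrow> fst (dt ts ps (p, q)) < 2 ^ k \<Longrightarrow> snd (dt ts ps (p, q)) < 2 ^ k \<Longrightarrow>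
   length (vecw k ps) \<le> K \<Longrightarrow> length (enc_list encI ts) \<le> K \<Longrightarrow>
   prv K (cD K * (length ts + 1)) [(PDot, [enc_list encI ts, vecw k ps, fw k p, fw k q,
      fw k (fst (dt ts ps (p, q))), fw k (snd (dt ts ps (p, q)))])]"
proof (induction ts arbitrary: ps p q)
  case Nil
  have "prv K (Suc 0) [(PDot, [[L_End], [L_End], fw k p, fw k q, fw k p, fw k q])]"
    using prv_zone_at_rule[of 0 "[fw k p, fw k q]" K 0] prv_Nil kK by (simp add: zone_at_rules_def rule_simps)
  then show ?case using Nil by (auto intro: prv_mono simp: cD_def)
next
  case (Cons t ts)
  obtain s a where t: "t = (s, a)" by (cases t)
  obtain u v ps' where ps: "ps = (u, v) # ps'" using Cons.prems(1) by (cases ps) auto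
  let ?B = "cD K * (length ts + 1)"
  have ok: "s = L_Plus \<or> s = L_Minus" "bitw a" "length a \<le> K" "length (vecw k ps') \<le> K" "length (enc_list encI ts) \<le> K"
    using Cons.prems by (auto simp: t ps)
  have uv: "u < 2 ^ k" "v < 2 ^ k" using Cons.prems(3) ps by auto
  show ?case
  proof (cases "s = L_Minus")
    case True
    let ?p = "p + val a * v" and ?q = "q + val a * u"
    have d: "dt (t # ts) ps (p, q) = dt ts ps' (?p, ?q)" using t ps True by simp
    have le: "?p < 2 ^ k" "?q < 2 ^ k" using dt_mono[of "(?p, ?q)" ts ps'] Cons.prems(4,5) unfolding d by auto
    have m1: "prv K (cM K) [(PMul, [a, fw k v, fw k (val a * v)])]" and m2: "prv K (cM K) [(PMul, [a, fw k u, fw k (val a * u)])]"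
      using prv_mul[OF k1 kK ok(2,3)] uv le by auto
    have IH: "prv K ?B [(PDot, [enc_list encI ts, vecw k ps', fw k ?p, fw k ?q, fw k (fst (dt ts ps' (?p, ?q))), fw k (snd (dt ts ps' (?p, ?q)))])]"
      using Cons.prems ok d ps by (intro Cons.IH) auto
    let ?f = "fw k (fst (dt ts ps' (?p, ?q)))" and ?g = "fw k (snd (dt ts ps' (?p, ?q)))"
    have step: "prv K B [(PMul, [a, fw k v, fw k (val a * v)]), (PAdd, [[L_0], fw k p, fw k (val a * v), fw k ?p]),
       (PMul, [a, fw k u, fw k (val a * u)]), (PAdd, [[L_0], fw k q, fw k (val a * u), fw k ?q]),
       (PDot, [enc_list encI ts, vecw k ps', fw k ?p, fw k ?q, ?f, ?g])] \<Longrightarrow>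
      prv K (Suc B) [(PDot, [enc_list encI (t # ts), vecw k ps, fw k p, fw k q, ?f, ?g])]" for B
      using prv_zone_at_rule[of 2 "[a, enc_list encI ts, fw k u, fw k v, vecw k ps', fw k p, fw k q, ?f, ?g, fw k (val a * v), fw k (val a * u), fw k ?p, fw k ?q]" K B]
        kK ok True by (simp add: zone_at_rules_def rule_simps t ps)
    have "prv K (Suc (cM K + (K + 1 + (cM K + (K + 1 + ?B))))) [(PDot, [enc_list encI (t # ts), vecw k ps, fw k p, fw k q, ?f, ?g])]"
      by (rule step[OF prv_Cons[OF m1 prv_Cons[OF prv_plus[OF k1 kK le(1)] prv_Cons[OF m2 prv_Cons[OF prv_plus[OF k1 kK le(2)] IH]]]]])
    then show ?thesis unfolding d by (auto intro!: prv_mono simp: cD_def algebra_simps)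
  next
    case False
    then have s: "s = L_Plus" using ok by simp
    let ?p = "p + val a * u" and ?q = "q + val a * v"
    have d: "dt (t # ts) ps (p, q) = dt ts ps' (?p, ?q)" using t ps s by simp
    have le: "?p < 2 ^ k" "?q < 2 ^ k" using dt_mono[of "(?p, ?q)" ts ps'] Cons.prems(4,5) unfolding d by auto
    have m1: "prv K (cM K) [(PMul, [a, fw k u, fw k (val a * u)])]" and m2: "prv K (cM K) [(PMul, [a, fw k v, fw k (val a * v)])]"
      using prv_mul[OF k1 kK ok(2,3)] uv le by auto
    have IH: "prv K ?B [(PDot, [enc_list encI ts, vecw k ps', fw k ?p, fw k ?q, fw k (fst (dt ts ps' (?p, ?q))), fw k (snd (dt ts ps' (?p, ?q)))])]"
      using Cons.prems ok d ps by (intro Cons.IH) auto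
    let ?f = "fw k (fst (dt ts ps' (?p, ?q)))" and ?g = "fw k (snd (dt ts ps' (?p, ?q)))"
    have step: "prv K B [(PMul, [a, fw k u, fw k (val a * u)]), (PAdd, [[L_0], fw k p, fw k (val a * u), fw k ?p]),
       (PMul, [a, fw k v, fw k (val a * v)]), (PAdd, [[L_0], fw k q, fw k (val a * v), fw k ?q]),
       (PDot, [enc_list encI ts, vecw k ps', fw k ?p, fw k ?q, ?f, ?g])] \<Longrightarrow>
      prv K (Suc B) [(PDot, [enc_list encI (t # ts), vecw k ps, fw k p, fw k q, ?f, ?g])]" for B
      using prv_zone_at_rule[of 1 "[a, enc_list encI ts, fw k u, fw k v, vecw k ps', fw k p, fw k q, ?f, ?g, fw k (val a * u), fw k (val a * v), fw k ?p, fw k ?q]" K B]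
        kK ok s by (simp add: zone_at_rules_def rule_simps t ps)
    have "prv K (Suc (cM K + (K + 1 + (cM K + (K + 1 + ?B))))) [(PDot, [enc_list encI (t # ts), vecw k ps, fw k p, fw k q, ?f, ?g])]"
      by (rule step[OF prv_Cons[OF m1 prv_Cons[OF prv_plus[OF k1 kK le(1)] prv_Cons[OF m2 prv_Cons[OF prv_plus[OF k1 kK le(2)] IH]]]]])
    then show ?thesis unfolding d by (auto intro!: prv_mono simp: cD_def algebra_simps)
  qed
qed

lemma prv_dot_K:
  assumes "length ts = length ps" "\<forall>t\<in>set ts. okI t" "small k ps" "fst (dt ts ps (p, q)) < 2 ^ k" "snd (dt ts ps (p, q)) < 2 ^ k"
    "length (vecw k ps) \<le> K" "length (enc_list encI ts) \<le> K"
  shows "prv K (cD K * (K + 1)) [(PDot, [enc_list encI ts, vecw k ps, fw k p, fw k q, fw k (fst (dt ts ps (p, q))), fw k (snd (dt ts ps (p, q)))])]"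
proof (rule prv_mono[OF prv_dot[OF assms]])
  have "length ts < K" using length_enc_list_ge[of ts encI] assms(7) by simp
  then show "cD K * (length ts + 1) \<le> cD K * (K + 1)" by (intro mult_le_mono2) simp
qed

lemma prv_zone_at:
  assumes "length bs = length rs" "small k ps" "length (vecw k ps) \<le> K"
    "\<forall>r<length rs. length (rs ! r) + 1 = length ps \<and> (\<Sum>i<length ps. (bs ! r # rs ! r) ! i * pvl (ps ! i)) \<le> 0"
    "\<forall>r\<in>set rs. \<forall>b\<in>set bs. length (enc_list enc_int (b # r)) \<le> K \<and> snd (dt (map int_code (b # r)) ps (0, 0)) < 2 ^ k"
    "length (encrows rs) \<le> K" "length (enc_list enc_int bs) \<le> K"
  shows "prv K (cZA K * (length rs + 1)) [(PZoneAt, [encrows rs, enc_list enc_int bs, vecw k ps])]"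
  using assms
proof (induction rs arbitrary: bs)
  case Nil
  \<comment> \<open>A row of zeros is the argument with which \<open>PDot\<close> confirms that the
    point is a vector.\<close>
  let ?ts = "replicate (length ps) (L_Plus, [])"
  have d: "dt (replicate n (L_Plus, [])) qs (0, 0) = (0, 0)" if "length qs = n" for n qs
    using that by (induction n arbitrary: qs) (auto simp: length_Suc_conv)
  have "length (enc_list encI (replicate n (L_Plus, []))) = 3 * n + 1" for n by (induction n) auto
  then have l: "length (enc_list encI ?ts) \<le> K" using Nil.prems(3)
    unfolding length_vecw by (simp add: algebra_simps)
  have dd: "prv K (cD K * (K + 1)) [(PDot, [enc_list encI ?ts, vecw k ps, fw k 0, fw k 0, fw k 0, fw k 0])]"
    using prv_dot_K[of ?ts ps 0 0] Nil.prems(2,3) l unfolding d[OF refl] by simp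
  have step: "prv K B [(PDot, [enc_list encI ?ts, vecw k ps, fw k 0, fw k 0, fw k 0, fw k 0])] \<Longrightarrow>
    prv K (Suc B) [(PZoneAt, [[L_End], [L_End], vecw k ps])]" for B
    using prv_zone_at_rule[of 3 "[vecw k ps, enc_list encI ?ts, fw k 0, fw k 0, fw k 0]" K B] kK l Nil.prems(3) by (simp add: zone_at_rules_def rule_simps)
  have "bs = []" using Nil.prems(1) by simp
  moreover have "Suc (cD K * (K + 1)) \<le> cZA K" by (simp add: cZA_def)
  ultimately show ?case using prv_mono[OF step[OF dd]] by (simp add: encrows_def)
next
  case (Cons r rs)
  obtain b bs' where bs: "bs = b # bs'" using Cons.prems(1) by (cases bs) auto
  let ?ts = "map int_code (b # r)"
  let ?f = "fst (dt ?ts ps (0, 0))" and ?g = "snd (dt ?ts ps (0, 0))"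
  let ?B = "cZA K * (length rs + 1)"
  have IH: "prv K ?B [(PZoneAt, [encrows rs, enc_list enc_int bs', vecw k ps])]"
    using Cons.prems unfolding bs by (intro Cons.IH) (auto simp: encrows_def)
  have r0: "length r + 1 = length ps" "(\<Sum>i<length ps. (b # r) ! i * pvl (ps ! i)) \<le> 0"
    using Cons.prems(4)[rule_format, of 0] bs by auto
  have row: "length (enc_list enc_int (b # r)) \<le> K" "?g < 2 ^ k" using Cons.prems(5) bs by auto
  have iv: "ival (?ts ! i) = (b # r) ! i" if "i < length ?ts" for i using that by (cases i) auto
  have "pvl (dt ?ts ps (0, 0)) = (\<Sum>i<length ps. (b # r) ! i * pvl (ps ! i))"
  proof -
    have "(\<Sum>i<length ?ts. ival (?ts ! i) * pvl (ps ! i)) = (\<Sum>i<length ps. (b # r) ! i * pvl (ps ! i))"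
      by (rule sum.cong) (use r0(1) iv in \<open>auto simp del: list.map\<close>)
    then show ?thesis using pvl_dt[of ?ts ps "(0, 0)"] r0(1) by simp
  qed
  then have fg: "?f \<le> ?g" using r0(2) by (cases "dt ?ts ps (0, 0)") auto
  have dd: "prv K (cD K * (K + 1)) [(PDot, [enc_list enc_int (b # r), vecw k ps, fw k 0, fw k 0, fw k ?f, fw k ?g])]"
    using prv_dot_K[of ?ts ps 0 0] Cons.prems r0(1) row fg unfolding enc_list_int_code by auto
  \<comment> \<open>The guessed difference of the accumulators is \<open>?g - ?f\<close>, which is
    meaningful because the scalar product is at most 0.\<close>
  have pl: "prv K (K + 1) [(PAdd, [[L_0], fw k ?f, fw k (?g - ?f), fw k ?g])]"
    using prv_plus[OF k1 kK, of ?f "?g - ?f"] fg row(2) by simp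
  have lb: "length (bits (nat \<bar>b\<bar>)) \<le> K" "length (enc_list enc_int r) \<le> K" using row enc_int_bits[of b] by (auto split: if_splits)
  have lr: "length (encrows rs) \<le> K" "length (enc_list enc_int bs') \<le> K" using Cons.prems(6,7) bs by (auto simp: encrows_def)
  have lps: "length (vecw k ps) \<le> K" using Cons.prems(3) .
  have step: "prv K B [(chk b, [bits (nat \<bar>b\<bar>)]), (PDot, [enc_list enc_int (b # r), vecw k ps, fw k 0, fw k 0, fw k ?f, fw k ?g]),
     (PAdd, [[L_0], fw k ?f, fw k (?g - ?f), fw k ?g]), (PZoneAt, [encrows rs, enc_list enc_int bs', vecw k ps])] \<Longrightarrow>
    prv K (Suc B) [(PZoneAt, [encrows (r # rs), enc_list enc_int bs, vecw k ps])]" for B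
    using prv_zone_at_rule[of "if b < 0 then 5 else 4" "[enc_list enc_int r, encrows rs, bits (nat \<bar>b\<bar>), enc_list enc_int bs', vecw k ps, fw k 0, fw k ?f, fw k ?g, fw k (?g - ?f)]" K B]
      kK lb lr lps enc_int_bits[of b]
    by (auto simp: zone_at_rules_def rule_simps chk_def encrows_def bs)
  have "prv K (Suc (K + 2 + (cD K * (K + 1) + (K + 1 + ?B)))) [(PZoneAt, [encrows (r # rs), enc_list enc_int bs, vecw k ps])]"
    by (rule step[OF prv_Cons[OF prv_chk[OF k1 kK lb(1)] prv_Cons[OF dd prv_Cons[OF pl IH]]]])
  then show ?case by (auto intro!: prv_mono simp: cZA_def algebra_simps)
qed

subsection \<open>Boundedness certificates\<close>

text \<open>\<open>m\<close> counts the coordinates still to be treated, so the current one is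
  \<open>n - Suc m\<close>. In \<open>cert\<close> one number \<open>c\<close> serves both signs,
  because the rule for \<open>PDirs\<close> uses the same variables for it twice.\<close>

lemma prv_dirs:
  assumes rs: "length bs = length rs" "\<forall>r\<in>set rs. length r = n"
    and cert: "\<And>i. i < n \<Longrightarrow> \<exists>c ys ys'. 0 < c \<and> c < 2 ^ k \<and> length ys = length rs \<and> length ys' = length rs \<and>
       (\<forall>y\<in>set ys \<union> set ys'. y < 2 ^ k) \<and>
       small k (cmb ys rs bs ((0, 0) # replicate i (0, 0) @ (c, 0) # replicate (n - Suc i) (0, 0))) \<and>
       (\<forall>(p, q)\<in>set (tl (cmb ys rs bs ((0, 0) # replicate i (0, 0) @ (c, 0) # replicate (n - Suc i) (0, 0)))). p = q) \<and>
       small k (cmb ys' rs bs ((0, 0) # replicate i (0, 0) @ (0, c) # replicate (n - Suc i) (0, 0))) \<and>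
       (\<forall>(p, q)\<in>set (tl (cmb ys' rs bs ((0, 0) # replicate i (0, 0) @ (0, c) # replicate (n - Suc i) (0, 0)))). p = q)"
    and K: "(2 * k + 3) * (n + 1) + 1 \<le> K" "\<forall>r\<in>set rs. \<forall>b\<in>set bs. length (enc_list enc_int (b # r)) \<le> K"
      "length (encrows rs) \<le> K" "length (enc_list enc_int bs) \<le> K"
  shows "m \<le> n \<Longrightarrow> prv K (cDir K * (m + 1)) [(PDirs, [encrows rs, enc_list enc_int bs, concat (replicate (n - m) (zitem k)), vecw k (replicate m (0, 0))])]"
proof (induction m)
  case 0
  have lz: "length (concat (replicate n (zitem k))) \<le> K"
  proof -
    have "length (concat (replicate n (zitem k))) = (2 * k + 3) * n" by (simp add: length_concat zitem_def sum_list_replicate algebra_simps)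
    then show ?thesis using K(1) by simp
  qed
  have base: "prv K (Suc 0) [(PDirs, [encrows rs, enc_list enc_int bs, concat (replicate n (zitem k)), [L_End]])]"
    using prv_zone_ok_rule[of 0 "[encrows rs, enc_list enc_int bs, concat (replicate n (zitem k))]" K 0] prv_Nil lz K by (simp add: zone_ok_rules_def rule_simps)
  have "Suc 0 \<le> cDir K * (0 + 1)" by (simp add: cDir_def)
  from prv_mono[OF base this] show ?case by simp
next
  case (Suc m)
  have nK: "n + 1 \<le> K"
  proof -
    have "1 * (n + 1) \<le> (2 * k + 3) * (n + 1)" by (rule mult_le_mono1) simp
    also have "\<dots> \<le> K" using K(1) by (rule add_leD1)
    finally show ?thesis by simp
  qed
  define i where "i = n - Suc m"
  have i: "i < n" "n - Suc i = m" "n - m = Suc i" using Suc.prems by (auto simp: i_def)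
  let ?X = "concat (replicate i (zitem k))" and ?Y = "vecw k (replicate m (0, 0))"
  let ?B = "cDir K * (m + 1)"
  have IH: "prv K ?B [(PDirs, [encrows rs, enc_list enc_int bs, ?X @ (zitem k), ?Y])]"
    using Suc i by (simp add: replicate_append_same[symmetric])
  obtain c ys ys' where c: "0 < c" "c < 2 ^ k" "length ys = length rs" "length ys' = length rs" "\<forall>y\<in>set ys \<union> set ys'. y < 2 ^ k"
    and f: "small k (cmb ys rs bs ((0, 0) # replicate i (0, 0) @ (c, 0) # replicate m (0, 0)))"
       "\<forall>(p, q)\<in>set (tl (cmb ys rs bs ((0, 0) # replicate i (0, 0) @ (c, 0) # replicate m (0, 0)))). p = q"
       "small k (cmb ys' rs bs ((0, 0) # replicate i (0, 0) @ (0, c) # replicate m (0, 0)))"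
       "\<forall>(p, q)\<in>set (tl (cmb ys' rs bs ((0, 0) # replicate i (0, 0) @ (0, c) # replicate m (0, 0)))). p = q"
    using cert[OF i(1)] unfolding i(2) by blast
  obtain c1 c2 where cw: "fw k c = c1 @ L_1 # c2" using fw_pos_split c(1,2) by blast
  have lc: "length c1 \<le> K" "length c2 \<le> K" using arg_cong[OF cw, of length] kK by auto
  have comb: "\<exists>p q W. prv K (cC K * (K + 1)) [(PComb, [encrows rs, enc_list enc_int bs, vecw k ((0, 0) # replicate i (0, 0) @ (u, v) # replicate m (0, 0)),
        L_Item # fw k p @ L_End # fw k q @ L_End # vecw k W])] \<and> prv K ((K + 2) * (K + 1)) [(PEqZero, [vecw k W])] \<and> length (vecw k W) \<le> K"
    if u: "length zs = length rs" "\<forall>y\<in>set zs. y < 2 ^ k" "small k (cmb zs rs bs ((0, 0) # replicate i (0, 0) @ (u, v) # replicate m (0, 0)))"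
      "\<forall>(p, q)\<in>set (tl (cmb zs rs bs ((0, 0) # replicate i (0, 0) @ (u, v) # replicate m (0, 0)))). p = q" for zs u v
  proof -
    let ?ps = "(0, 0) # replicate i (0, 0) @ (u, v) # replicate m (0, 0)"
    have lps: "length ?ps = n + 1" using i by simp
    have rl: "\<forall>r\<in>set rs. length r + 1 = length ?ps" using rs(2) lps by simp
    have lf: "length (cmb zs rs bs ?ps) = n + 1" using length_cmb[OF rl] lps by simp
    obtain p q W where W: "cmb zs rs bs ?ps = (p, q) # W" using lf by (cases "cmb zs rs bs ?ps") auto
    have lw: "length W = n" using lf W by simp
    have "prv K (cC K * (length rs + 1)) [(PComb, [encrows rs, enc_list enc_int bs, vecw k ?ps, vecw k (cmb zs rs bs ?ps)])]"
      using rl rs u K lps by (intro prv_comb[OF k1 kK]) (auto simp: length_vecw)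
    moreover have "length rs < K" using length_enc_list_ge[of rs "enc_list enc_int"] K(3) by (simp add: encrows_def)
    then have "cC K * (length rs + 1) \<le> cC K * (K + 1)" by (intro mult_le_mono2) simp
    ultimately have 1: "prv K (cC K * (K + 1)) [(PComb, [encrows rs, enc_list enc_int bs, vecw k ?ps, L_Item # fw k p @ L_End # fw k q @ L_End # vecw k W])]"
      unfolding W vecw_simps by (rule prv_mono)
    have lv: "length (vecw k W) \<le> K" using lw K(1) by (simp add: length_vecw)
    have "prv K ((K + 2) * (length W + 1)) [(PEqZero, [vecw k W])]" using u(4) W lv by (intro prv_eqzero[OF k1 kK]) auto
    moreover have "(K + 2) * (length W + 1) \<le> (K + 2) * (K + 1)" using lw nK by (intro mult_le_mono2) simp
    ultimately have 2: "prv K ((K + 2) * (K + 1)) [(PEqZero, [vecw k W])]" by (rule prv_mono)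
    show ?thesis using 1 2 lv by blast
  qed
  obtain p q W where 1: "prv K (cC K * (K + 1)) [(PComb, [encrows rs, enc_list enc_int bs, vecw k ((0, 0) # replicate i (0, 0) @ (c, 0) # replicate m (0, 0)),
        L_Item # fw k p @ L_End # fw k q @ L_End # vecw k W])]" "prv K ((K + 2) * (K + 1)) [(PEqZero, [vecw k W])]" "length (vecw k W) \<le> K"
    using comb[OF c(3) _ f(1,2)] c(5) by blast
  obtain p' q' W' where 2: "prv K (cC K * (K + 1)) [(PComb, [encrows rs, enc_list enc_int bs, vecw k ((0, 0) # replicate i (0, 0) @ (0, c) # replicate m (0, 0)),
        L_Item # fw k p' @ L_End # fw k q' @ L_End # vecw k W'])]" "prv K ((K + 2) * (K + 1)) [(PEqZero, [vecw k W'])]" "length (vecw k W') \<le> K"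
    using comb[OF c(4) _ f(3,4)] c(5) by blast
  have e1: "vecw k ((0, 0) # replicate i (0, 0) @ (c, 0) # replicate m (0, 0)) =
    L_Item # fw k 0 @ L_End # fw k 0 @ L_End # ?X @ L_Item # c1 @ L_1 # c2 @ L_End # fw k 0 @ L_End # ?Y"
    by (simp add: vecw_simps vecw_zeros cw)
  have e2: "vecw k ((0, 0) # replicate i (0, 0) @ (0, c) # replicate m (0, 0)) =
    L_Item # fw k 0 @ L_End # fw k 0 @ L_End # ?X @ L_Item # fw k 0 @ L_End # c1 @ L_1 # c2 @ L_End # ?Y"
    by (simp add: vecw_simps vecw_zeros cw)
  have lX: "length ?X \<le> K"
  proof -
    have "length ?X = (2 * k + 3) * i" by (simp add: length_concat zitem_def sum_list_replicate algebra_simps)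
    also have "\<dots> \<le> (2 * k + 3) * (n + 1)" using i(1) by (intro mult_le_mono2) simp
    finally show ?thesis using K(1) by simp
  qed
  have "(2 * k + 3) * m \<le> (2 * k + 3) * (n + 1)" using Suc.prems by (intro mult_le_mono2) simp
  then have lY: "length ?Y \<le> K" using K(1) by (simp add: length_vecw)
  have zc: "prv K (K + 1) [(PZero, [c1 @ L_1 # c2, fw k 0])]" using prv_zero_fw[OF k1 kK, of c] cw by simp
  note z = prv_zero_fw[OF k1 kK]
  have step: "prv K B [(PZero, [fw k 0, fw k 0]), (PZero, [c1 @ L_1 # c2, fw k 0]),
     (PComb, [encrows rs, enc_list enc_int bs, vecw k ((0, 0) # replicate i (0, 0) @ (c, 0) # replicate m (0, 0)), L_Item # fw k p @ L_End # fw k q @ L_End # vecw k W]),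
     (PZero, [fw k p, fw k 0]), (PZero, [fw k q, fw k 0]), (PEqZero, [vecw k W]),
     (PComb, [encrows rs, enc_list enc_int bs, vecw k ((0, 0) # replicate i (0, 0) @ (0, c) # replicate m (0, 0)), L_Item # fw k p' @ L_End # fw k q' @ L_End # vecw k W']),
     (PZero, [fw k p', fw k 0]), (PZero, [fw k q', fw k 0]), (PEqZero, [vecw k W']),
     (PDirs, [encrows rs, enc_list enc_int bs, ?X @ (zitem k), ?Y])] \<Longrightarrow>
    prv K (Suc B) [(PDirs, [encrows rs, enc_list enc_int bs, ?X, L_Item # fw k 0 @ L_End # fw k 0 @ L_End # ?Y])]" for B
    unfolding e1 e2
    using prv_zone_ok_rule[of 1 "[encrows rs, enc_list enc_int bs, ?X, fw k 0, ?Y, c1, c2, fw k 0, fw k p, fw k q, vecw k W, fw k 0, fw k 0, fw k p', fw k q', vecw k W', fw k 0, fw k 0]" K B]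
      kK lX lY lc 1(3) 2(3) K(3,4)
    by (simp add: zone_ok_rules_def rule_simps zitem_def)
  note all = step[OF prv_Cons[OF z prv_Cons[OF zc prv_Cons[OF 1(1) prv_Cons[OF z prv_Cons[OF z prv_Cons[OF 1(2)
    prv_Cons[OF 2(1) prv_Cons[OF z prv_Cons[OF z prv_Cons[OF 2(2) IH]]]]]]]]]]]
  have "n - Suc m = i" by (simp add: i_def)
  moreover have "cDir K * (Suc m + 1) = cDir K * (m + 1) + cDir K" by simp
  ultimately show ?case using prv_mono[OF all, of "cDir K * (Suc m + 1)"] by (simp add: cDir_def)
qed

lemma solution_bound_mono: "m \<le> m' \<Longrightarrow> solution_bound m n M \<le> solution_bound m' n M"
  unfolding solution_bound_def by (intro mult_le_mono2 power_mono mult_le_mono1) auto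

lemma eq_pairs: "\<forall>j<length W. pvl (W ! j) = 0 \<Longrightarrow> \<forall>(p, q)\<in>set W. p = q"
  by (auto simp: in_set_conv_nth) (metis pvl.simps eq_iff_diff_eq_0 of_nat_eq_iff)

text \<open>The combination cancels the entry \<open>(u, v)\<close>. As \<open>Y\<close> bounds the
  multipliers and the start values, each row adds at most \<open>M * Y\<close> to a part of a
  coordinate, which gives the bound required to be below \<open>2 ^ k\<close>.\<close>

lemma dir_certificate:
  assumes "length bs = length rs" "\<forall>r\<in>set rs. length r = n" "i < n" "length ys = length rs"
    and sum: "\<forall>j<n. (\<Sum>r<length rs. int (ys ! r) * rs ! r ! j) = (if j = i then - pvl (u, v) else 0)"
    and M: "\<forall>r\<in>set rs. \<forall>z\<in>set r. nat \<bar>z\<bar> \<le> M" "\<forall>z\<in>set bs. nat \<bar>z\<bar> \<le> M" "\<forall>y\<in>set ys. y \<le> Y" "u \<le> Y" "v \<le> Y" "Y + length rs * (M * Y) < 2 ^ k"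
  defines "F \<equiv> cmb ys rs bs ((0, 0) # replicate i (0, 0) @ (u, v) # replicate (n - Suc i) (0, 0))"
  shows "small k F" "\<forall>(p, q)\<in>set (tl F). p = q"
proof -
  let ?ps = "(0, 0) # replicate i (0, 0) @ (u, v) # replicate (n - Suc i) (0, 0)"
  have lps: "length ?ps = Suc n" using assms(3) by simp
  have rl: "\<forall>r\<in>set rs. length r + 1 = length ?ps" using assms(2) lps by simp
  have "le_all Y ?ps" using M(4,5) by simp
  then have "le_all (Y + length rs * (M * Y)) F" unfolding F_def using M(1-3) by (intro le_all_cmb)
  then show "small k F" using M(6) by (rule le_all_small)
  have lF: "length F = Suc n" unfolding F_def using length_cmb[OF rl] lps by simp
  have "pvl (tl F ! j) = 0" if "j < length (tl F)" for j
  proof -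
    have j: "j < n" using that lF by simp
    have "pvl (?ps ! Suc j) = (if j = i then pvl (u, v) else 0)" using j by (auto simp: nth_append nth_Cons')
    moreover have "pvl (F ! Suc j) = pvl (?ps ! Suc j) + (\<Sum>r<length rs. int (ys ! r) * (bs ! r # rs ! r) ! Suc j)"
      unfolding F_def by (rule pvl_cmb) (use assms(1,4) rl lps j in auto)
    ultimately have "pvl (F ! Suc j) = 0" using sum j by (auto simp del: pvl.simps)
    then show ?thesis using j lF by (simp add: nth_tl)
  qed
  then show "\<forall>(p, q)\<in>set (tl F). p = q" by (intro eq_pairs) blast
qed

text \<open>Farkas' lemma provides real multipliers, and \<open>small_solution\<close> turns them
  into small integers. For an empty zone the right-hand sides give one equation more, hence
  \<open>n + 1\<close>; \<open>Y\<close> is a square because two denominators get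
  multiplied.\<close>

lemma prv_zone_ok:
  assumes rs: "length bs = length rs" "\<forall>r\<in>set rs. length r = n" and n: "n \<ge> 1" and bnd: "bounded_zone (zone_of n rs bs)"
    and M: "\<forall>r\<in>set rs. \<forall>z\<in>set r. nat \<bar>z\<bar> \<le> M" "\<forall>z\<in>set bs. nat \<bar>z\<bar> \<le> M" "M \<ge> 1"
  defines "Y \<equiv> solution_bound (n + 1) (length rs) M * solution_bound (n + 1) (length rs) M"
  assumes k: "Y + length rs * (M * Y) < 2 ^ k"
    and K: "(2 * k + 3) * (n + 1) + 1 \<le> K" "\<forall>r\<in>set rs. \<forall>b\<in>set bs. length (enc_list enc_int (b # r)) \<le> K"
      "length (encrows rs) \<le> K" "length (enc_list enc_int bs) \<le> K"
  shows "prv K (cZO K) [(PZoneOK, [encrows rs, enc_list enc_int bs, vecw k (replicate (n + 1) (0, 0))])]"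
proof -
  let ?m = "length rs" and ?SB = "solution_bound (n + 1) (length rs) M"
  have SB1: "?SB \<ge> 1" using M(3) by (simp add: solution_bound_def Suc_le_eq)
  have SBY: "?SB \<le> Y" using SB1 by (simp add: Y_def)
  have Yk: "Y < 2 ^ k" using k by simp
  obtain Bd where Bd: "\<forall>x\<in>zone_set (zone_of n rs bs). \<forall>i<dim_vec x. \<bar>x $ i\<bar> \<le> Bd" using bnd by (auto simp: bounded_zone_def)
  have bp: "\<bar>x i\<bar> \<le> Bd" if "\<forall>r<?m. lin n (\<lambda>j. of_int (rs ! r ! j)) x \<le> of_int (bs ! r)" "i < n" for x i
  proof -
    have "vec n x \<in> zone_set (zone_of n rs bs)"
      using that(1) by (subst zone_of_iff[OF rs]) (auto simp: lin_def cong: sum.cong_simp)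
    then show ?thesis using Bd that(2) by fastforce
  qed
  have len0: "length (vecw k (replicate (n + 1) (0, 0))) \<le> K" using K(1) unfolding length_vecw by simp
  have lm: "?m < K" using length_enc_list_ge[of rs "enc_list enc_int"] K(3) by (simp add: encrows_def)
  have mem: "nat \<bar>rs ! r ! j\<bar> \<le> M" "nat \<bar>bs ! r\<bar> \<le> M" if "r < ?m" "j < n" for r j
    using M(1,2) rs that by (auto simp: all_set_conv_all_nth)
  have memb: "nat \<bar>bs ! r\<bar> \<le> M" if "r < ?m" for r using M(2) rs(1) that by (auto simp: all_set_conv_all_nth)
  have nK: "n + 1 \<le> K"
  proof -
    have "1 * (n + 1) \<le> (2 * k + 3) * (n + 1)" by (rule mult_le_mono1) simp
    also have "\<dots> \<le> K" using K(1) by (rule add_leD1)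
    finally show ?thesis by simp
  qed
  have "(\<exists>y. (\<forall>r<?m. y r \<ge> 0) \<and> (\<forall>j<n. (\<Sum>r<?m. y r * of_int (rs ! r ! j)) = 0) \<and> (\<Sum>r<?m. y r * of_int (bs ! r)) = (-1::real)) \<or>
    (\<forall>i<n. \<forall>e\<in>{1, -1}. \<exists>y. (\<forall>r<?m. y r \<ge> 0) \<and> (\<forall>j<n. (\<Sum>r<?m. y r * of_int (rs ! r ! j)) = (if j = i then e else (0::real))))"
    by (rule bounded_polyhedron_certificate) (rule bp)
  then consider (empty) y where "\<forall>r<?m. y r \<ge> 0" "\<forall>j<n. (\<Sum>r<?m. y r * of_int (rs ! r ! j)) = 0" "(\<Sum>r<?m. y r * of_int (bs ! r)) = (-1::real)"
    | (dirs) "\<forall>i<n. \<forall>e\<in>{1, -1}. \<exists>y. (\<forall>r<?m. y r \<ge> 0) \<and> (\<forall>j<n. (\<Sum>r<?m. y r * of_int (rs ! r ! j)) = (if j = i then e else (0::real)))"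
    by blast
  then show ?thesis
  proof cases
    case empty
    have "\<exists>D X. D > 0 \<and> (\<forall>i\<in>{..<n + 1}. (\<Sum>r\<in>{..<?m}. (bs ! r # rs ! r) ! i * int (X r)) = int D * (if i = 0 then -1 else 0)) \<and>
       D \<le> solution_bound (card {..<n + 1}) (card {..<?m}) M \<and> (\<forall>r\<in>{..<?m}. X r \<le> solution_bound (card {..<n + 1}) (card {..<?m}) M)"
    proof (rule small_solution[where x = y])
      show "\<forall>i\<in>{..<n + 1}. (\<Sum>r\<in>{..<?m}. real_of_int ((bs ! r # rs ! r) ! i) * y r) = real_of_int (if i = 0 then -1 else 0)"
      proof
        fix i assume "i \<in> {..<n + 1}"
        then show "(\<Sum>r\<in>{..<?m}. real_of_int ((bs ! r # rs ! r) ! i) * y r) = real_of_int (if i = 0 then -1 else 0)"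
          using empty(2,3) by (cases i) (auto simp: mult.commute)
      qed
      show "\<forall>i\<in>{..<n + 1}. \<forall>r\<in>{..<?m}. \<bar>(bs ! r # rs ! r) ! i\<bar> \<le> int M"
      proof (intro ballI)
        fix i r assume "i \<in> {..<n + 1}" "r \<in> {..<?m}"
        then show "\<bar>(bs ! r # rs ! r) ! i\<bar> \<le> int M" using mem[of r "i - 1"] memb[of r] by (cases i) auto
      qed
    qed (use empty(1) M(3) in auto)
    then obtain D X where D: "D > 0" "\<And>i. i < n + 1 \<Longrightarrow> (\<Sum>r<?m. (bs ! r # rs ! r) ! i * int (X r)) = int D * (if i = 0 then -1 else 0)"
      "D \<le> ?SB" "\<And>r. r < ?m \<Longrightarrow> X r \<le> ?SB" by auto
    define ys where "ys = map X [0..<?m]"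
    let ?ps = "replicate (n + 1) (0, 0) :: (nat \<times> nat) list"
    define F where "F = cmb ys rs bs ?ps"
    have rl: "\<forall>r\<in>set rs. length r + 1 = length ?ps" using rs(2) by simp
    have ly: "length ys = ?m" by (simp add: ys_def)
    have yY: "\<forall>y\<in>set ys. y \<le> Y" using le_trans[OF D(4) SBY] by (auto simp: ys_def)
    have "le_all (0 + ?m * (M * Y)) F" unfolding F_def using M(1,2) yY by (intro le_all_cmb le_all_replicate)
    then have sF: "small k F" by (rule le_all_small) (use k in simp)
    have lF: "length F = n + 1" unfolding F_def using length_cmb[OF rl] by simp
    have pF: "pvl (F ! j) = int D * (if j = 0 then -1 else 0)" if "j < n + 1" for j
    proof -
      have "pvl (F ! j) = pvl (?ps ! j) + (\<Sum>r<?m. int (ys ! r) * (bs ! r # rs ! r) ! j)"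
        unfolding F_def by (rule pvl_cmb) (use rs(1) ly rl that in auto)
      also have "pvl (?ps ! j) = 0" using that by (simp del: replicate_Suc replicate.simps)
      also have "(\<Sum>r<?m. int (ys ! r) * (bs ! r # rs ! r) ! j) = int D * (if j = 0 then -1 else 0)"
        unfolding D(2)[OF that, symmetric] by (intro sum.cong) (auto simp: ys_def mult.commute)
      finally show ?thesis by simp
    qed
    obtain p q W where F: "F = (p, q) # W" using lF by (cases F) auto
    have pq: "q = p + D" using pF[of 0] F by simp
    have "pvl (W ! j) = 0" if "j < length W" for j using pF[of "Suc j"] F lF that by simp
    then have Weq: "\<forall>(p, q)\<in>set W. p = q" by (intro eq_pairs) blast
    have lW: "length W = n" using lF F by simp
    have lvW: "length (vecw k W) \<le> K" using K(1) lW unfolding length_vecw by simp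
    have q: "q < 2 ^ k" using sF F by simp
    obtain t1 t2 where t: "fw k D = t1 @ L_1 # t2" using fw_pos_split[of D k] D(1) pq q by auto
    have lt: "length t1 \<le> K" "length t2 \<le> K" using arg_cong[OF t, of length] kK by auto
    have c1: "prv K (cC K * (K + 1)) [(PComb, [encrows rs, enc_list enc_int bs, vecw k ?ps, L_Item # fw k p @ L_End # fw k q @ L_End # vecw k W])]"
    proof (rule prv_mono)
      have "prv K (cC K * (?m + 1)) [(PComb, [encrows rs, enc_list enc_int bs, vecw k ?ps, vecw k (cmb ys rs bs ?ps)])]"
        using rl rs(1) ly sF K len0 yY Yk unfolding F_def by (intro prv_comb[OF k1 kK]) (auto intro: le_less_trans simp del: replicate_Suc)
      then show "prv K (cC K * (?m + 1)) [(PComb, [encrows rs, enc_list enc_int bs, vecw k ?ps, L_Item # fw k p @ L_End # fw k q @ L_End # vecw k W])]"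
        unfolding F_def[symmetric] F vecw_simps .
      show "cC K * (?m + 1) \<le> cC K * (K + 1)" using lm by (intro mult_le_mono2) simp
    qed
    have c2: "prv K ((K + 2) * (K + 1)) [(PEqZero, [vecw k W])]"
    proof (rule prv_mono[OF prv_eqzero[OF k1 kK Weq lvW]])
      show "(K + 2) * (length W + 1) \<le> (K + 2) * (K + 1)" using lW nK by (intro mult_le_mono2) simp
    qed
    have c3: "prv K (K + 1) [(PAdd, [[L_0], fw k p, t1 @ L_1 # t2, fw k q])]"
      using prv_plus[OF k1 kK, of p D] pq q t by simp
    have step: "prv K B [(PComb, [encrows rs, enc_list enc_int bs, vecw k ?ps, L_Item # fw k p @ L_End # fw k q @ L_End # vecw k W]),
       (PEqZero, [vecw k W]), (PAdd, [[L_0], fw k p, t1 @ L_1 # t2, fw k q])] \<Longrightarrow>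
       prv K (Suc B) [(PZoneOK, [encrows rs, enc_list enc_int bs, vecw k ?ps])]" for B
      using prv_zone_ok_rule[of 2 "[encrows rs, enc_list enc_int bs, vecw k ?ps, fw k p, fw k q, vecw k W, t1, t2]" K B]
        kK K(3,4) len0 lvW lt by (simp add: zone_ok_rules_def rule_simps)
    show ?thesis
      by (rule prv_mono[OF step[OF prv_Cons[OF c1 prv_Cons[OF c2 c3]]]]) (simp add: cZO_def)
  next
    case dirs
    have sol: "\<exists>D ys. 0 < D \<and> D \<le> ?SB \<and> length ys = ?m \<and> (\<forall>y\<in>set ys. y \<le> ?SB) \<and>
        (\<forall>j<n. (\<Sum>r<?m. int (ys ! r) * rs ! r ! j) = (if j = i then e * int D else 0))"
      if i: "i < n" and e: "e \<in> {1, -1}" for i and e :: int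
    proof -
      obtain y where y: "\<forall>r<?m. y r \<ge> 0" "\<forall>j<n. (\<Sum>r<?m. y r * of_int (rs ! r ! j)) = (if j = i then of_int e else (0::real))"
      proof -
        have "real_of_int e \<in> {1, -1}" using e by auto
        then show thesis using dirs i that by blast
      qed
      have "\<exists>D X. D > 0 \<and> (\<forall>j\<in>{..<n}. (\<Sum>r\<in>{..<?m}. rs ! r ! j * int (X r)) = int D * (if j = i then e else 0)) \<and>
         D \<le> solution_bound (card {..<n}) (card {..<?m}) M \<and> (\<forall>r\<in>{..<?m}. X r \<le> solution_bound (card {..<n}) (card {..<?m}) M)"
      proof (rule small_solution[where x = y])
        show "\<forall>j\<in>{..<n}. (\<Sum>r\<in>{..<?m}. real_of_int (rs ! r ! j) * y r) = real_of_int (if j = i then e else 0)"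
        proof
          fix j assume "j \<in> {..<n}"
          then show "(\<Sum>r\<in>{..<?m}. real_of_int (rs ! r ! j) * y r) = real_of_int (if j = i then e else 0)"
            using y(2)[rule_format, of j] by (auto simp: mult.commute)
        qed
        show "\<forall>j\<in>{..<n}. \<forall>r\<in>{..<?m}. \<bar>rs ! r ! j\<bar> \<le> int M"
          using mem(1) by (auto simp: nat_le_iff)
        show "\<forall>j\<in>{..<n}. \<bar>if j = i then e else 0\<bar> \<le> int M" using e M(3) by auto
      qed (use y(1) M(3) in auto)
      then obtain D X where D: "D > 0" "\<And>j. j < n \<Longrightarrow> (\<Sum>r<?m. rs ! r ! j * int (X r)) = int D * (if j = i then e else 0)"
        "D \<le> solution_bound n ?m M" "\<And>r. r < ?m \<Longrightarrow> X r \<le> solution_bound n ?m M" by auto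
      have le: "solution_bound n ?m M \<le> ?SB" by (rule solution_bound_mono) simp
      have "(\<Sum>r<?m. int (map X [0..<?m] ! r) * rs ! r ! j) = (if j = i then e * int D else 0)" if "j < n" for j
      proof -
        have "(\<Sum>r<?m. int (map X [0..<?m] ! r) * rs ! r ! j) = (\<Sum>r<?m. rs ! r ! j * int (X r))"
          by (intro sum.cong) (auto simp: mult.commute)
        then show ?thesis using D(2)[OF that] by simp
      qed
      moreover have "X r \<le> ?SB" if "r < ?m" for r using le_trans[OF D(4)[OF that] le] .
      moreover have "D \<le> ?SB" using D(3) le by (rule le_trans)
      ultimately show ?thesis using D(1) by (intro exI[of _ D] exI[of _ "map X [0..<?m]"]) auto
    qed
    have cert: "\<exists>c ys ys'. 0 < c \<and> c < 2 ^ k \<and> length ys = ?m \<and> length ys' = ?m \<and>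
       (\<forall>y\<in>set ys \<union> set ys'. y < 2 ^ k) \<and>
       small k (cmb ys rs bs ((0, 0) # replicate i (0, 0) @ (c, 0) # replicate (n - Suc i) (0, 0))) \<and>
       (\<forall>(p, q)\<in>set (tl (cmb ys rs bs ((0, 0) # replicate i (0, 0) @ (c, 0) # replicate (n - Suc i) (0, 0)))). p = q) \<and>
       small k (cmb ys' rs bs ((0, 0) # replicate i (0, 0) @ (0, c) # replicate (n - Suc i) (0, 0))) \<and>
       (\<forall>(p, q)\<in>set (tl (cmb ys' rs bs ((0, 0) # replicate i (0, 0) @ (0, c) # replicate (n - Suc i) (0, 0)))). p = q)"
      if i: "i < n" for i
    proof -
      obtain D ys where D: "0 < D" "D \<le> ?SB" "length ys = ?m" "\<forall>y\<in>set ys. y \<le> ?SB"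
        "\<forall>j<n. (\<Sum>r<?m. int (ys ! r) * rs ! r ! j) = (if j = i then (-1) * int D else 0)" using sol[OF i, of "-1"] by auto
      obtain D' ys' where D': "0 < D'" "D' \<le> ?SB" "length ys' = ?m" "\<forall>y\<in>set ys'. y \<le> ?SB"
        "\<forall>j<n. (\<Sum>r<?m. int (ys' ! r) * rs ! r ! j) = (if j = i then 1 * int D' else 0)" using sol[OF i, of 1] by auto
      \<comment> \<open>The solutions for the two signs have different denominators; scaling each by
        the denominator of the other makes \<open>D * D'\<close> common to both.\<close>
      let ?c = "D * D'" and ?zs = "map (\<lambda>y. D' * y) ys" and ?zs' = "map (\<lambda>y. D * y) ys'"
      have c: "?c \<le> Y" unfolding Y_def using D(2) D'(2) by (rule mult_le_mono)
      have z: "\<forall>y\<in>set ?zs. y \<le> Y" "\<forall>y\<in>set ?zs'. y \<le> Y"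
        using D D' by (auto simp: Y_def intro!: mult_le_mono)
      have s1: "(\<Sum>r<?m. int (?zs ! r) * rs ! r ! j) = (if j = i then - pvl (?c, 0) else 0)" if "j < n" for j
      proof -
        have "(\<Sum>r<?m. int (?zs ! r) * rs ! r ! j) = int D' * (\<Sum>r<?m. int (ys ! r) * rs ! r ! j)"
          unfolding sum_distrib_left by (intro sum.cong) (auto simp: D(3) mult.assoc)
        then show ?thesis using D(5) that by auto
      qed
      have s2: "(\<Sum>r<?m. int (?zs' ! r) * rs ! r ! j) = (if j = i then - pvl (0, ?c) else 0)" if "j < n" for j
      proof -
        have "(\<Sum>r<?m. int (?zs' ! r) * rs ! r ! j) = int D * (\<Sum>r<?m. int (ys' ! r) * rs ! r ! j)"
          unfolding sum_distrib_left by (intro sum.cong) (auto simp: D'(3) mult.assoc)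
        then show ?thesis using D'(5) that by auto
      qed
      show ?thesis
        using dir_certificate[of bs rs n i ?zs ?c 0 M Y, OF rs i _ _ M(1,2) z(1) c _ k]
          dir_certificate[of bs rs n i ?zs' 0 ?c M Y, OF rs i _ _ M(1,2) z(2) _ c k] s1 s2 D D' c z Yk
        by (intro exI[of _ ?c] exI[of _ ?zs] exI[of _ ?zs']) (auto intro: le_less_trans simp del: pvl.simps)
    qed
    have pd: "prv K (cDir K * (n + 1)) [(PDirs, [encrows rs, enc_list enc_int bs, [], vecw k (replicate n (0, 0))])]"
      using prv_dirs[OF rs cert K, of n] by simp
    have pd': "prv K (cDir K * (K + 1)) [(PDirs, [encrows rs, enc_list enc_int bs, [], vecw k (replicate n (0, 0))])]"
      by (rule prv_mono[OF pd]) (use nK in \<open>intro mult_le_mono2, simp\<close>)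
    have ln: "length (vecw k (replicate n (0, 0))) \<le> K" using K(1) unfolding length_vecw by simp
    have step: "prv K B [(PZero, [fw k 0, fw k 0]), (PDirs, [encrows rs, enc_list enc_int bs, [], vecw k (replicate n (0, 0))])] \<Longrightarrow>
       prv K (Suc B) [(PZoneOK, [encrows rs, enc_list enc_int bs, vecw k (replicate (n + 1) (0, 0))])]" for B
      using prv_zone_ok_rule[of 3 "[encrows rs, enc_list enc_int bs, fw k 0, vecw k (replicate n (0, 0))]" K B]
        kK K(3,4) ln by (simp add: zone_ok_rules_def rule_simps)
    show ?thesis
      by (rule prv_mono[OF step[OF prv_Cons[OF prv_zero_fw[OF k1 kK] pd']]]) (simp add: cZO_def)
  qed
qed

end


subsection \<open>Scaled rows and tables\<close>

text \<open>The product instead of the least common multiple: divisibility is immediate, and the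
  number of digits is still polynomial.\<close>

definition gden :: "frac list \<Rightarrow> nat" where "gden fs = prod_list (map snd fs)"

fun scl :: "nat \<Rightarrow> nat \<Rightarrow> frac \<Rightarrow> letter \<times> letter list" where
  "scl k g (p, q) = (if p < 0 then L_Minus else L_Plus, fw k (nat \<bar>p\<bar> * g div q))"

definition srow :: "nat \<Rightarrow> frac list \<Rightarrow> (letter \<times> letter list) list" where
  "srow k fs = map (scl k (gden fs)) fs"

lemma length_srow [simp]: "length (srow k fs) = length fs"
  by (simp add: srow_def)

lemma okI_scl [simp]: "okI (scl k g f)"
  by (cases f) auto

lemma okI_srow: "\<forall>t\<in>set (srow k fs). okI t"
  by (auto simp: srow_def simp del: okI.simps)

lemma length_enc_srow: "length (enc_list encI (map (scl k g) fs)) = (k + 3) * length fs + 1"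
  by (induction fs) auto

lemma gden_dvd: "f \<in> set fs \<Longrightarrow> snd f dvd gden fs"
  unfolding gden_def by (induction fs) auto

lemma gden_pos: "\<forall>f\<in>set fs. snd f > 0 \<Longrightarrow> gden fs > 0"
  unfolding gden_def by (induction fs) auto

text \<open>The modes are used in cyclic order, as in \<open>models_polygon\<close>;
  \<open>y i\<close> is the integer multiple of the scaled mode row on edge \<open>i\<close>, after
  all denominators have been cleared.\<close>

fun pts :: "nat \<Rightarrow> frac list list \<Rightarrow> (nat \<Rightarrow> nat) \<Rightarrow> (nat \<times> nat) list \<Rightarrow> nat \<Rightarrow> (nat \<times> nat) list" where
  "pts k fss y P 0 = P"
| "pts k fss y P (Suc i) = mv (y i) (pts k fss y P i) ((L_Plus, []) # srow k (fss ! (i mod length fss)))"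

lemma length_pts:
  assumes "fss \<noteq> []" "\<forall>fs\<in>set fss. length fs = n" "length P = n + 1"
  shows "length (pts k fss y P i) = n + 1"
proof (induction i)
  case (Suc i)
  have "fss ! (i mod length fss) \<in> set fss" using assms(1) by simp
  then have "length (fss ! (i mod length fss)) = n" using assms(2) by blast
  then show ?case using Suc by simp
qed (simp add: assms(3))

lemma length_enc_list_drop: "length (enc_list f (drop j xs)) \<le> length (enc_list f xs)"
proof (induction xs arbitrary: j)
  case (Cons x xs)
  show ?case
  proof (cases j)
    case (Suc i)
    then show ?thesis using Cons[of i] by simp
  qed simp
qed simp

definition tab :: "nat \<Rightarrow> (nat \<Rightarrow> (nat \<times> nat) list) \<Rightarrow> nat \<Rightarrow> nat \<Rightarrow> letter list" where
  "tab k Q i N = concat (map (\<lambda>j. L_F # vecw k (Q j)) [i..<Suc N])"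

lemma tab_Cons: "i \<le> N \<Longrightarrow> tab k Q i N = L_F # vecw k (Q i) @ tab k Q (Suc i) N"
  by (simp add: tab_def upt_rec[of i "Suc N"] del: upt_Suc)

lemma tab_Nil [simp]: "tab k Q (Suc N) N = []"
  by (simp add: tab_def)

lemma tab_split: "i \<le> j \<Longrightarrow> j \<le> N \<Longrightarrow> \<exists>X. tab k Q i N = X @ tab k Q j N"
proof -
  assume "i \<le> j" "j \<le> N"
  then have "[i..<Suc N] = [i..<j] @ [j..<Suc N]" using upt_add_eq_append[of i j "Suc N - j"] by simp
  then show ?thesis unfolding tab_def by auto
qed

lemma length_tab:
  assumes "\<forall>j\<le>N. length (Q j) = n + 1"
  shows "length (tab k Q i N) \<le> (N + 1) * ((2 * k + 3) * (n + 1) + 2)"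
proof -
  have "length (tab k Q i N) = (\<Sum>j\<leftarrow>[i..<Suc N]. length (L_F # vecw k (Q j)))"
    by (simp add: tab_def length_concat o_def del: upt_Suc)
  also have "\<dots> \<le> (\<Sum>j\<leftarrow>[i..<Suc N]. (2 * k + 3) * (n + 1) + 2)"
    using assms by (intro sum_list_mono) (auto simp: length_vecw)
  also have "\<dots> = (Suc N - i) * ((2 * k + 3) * (n + 1) + 2)" by (simp add: sum_list_triv del: upt_Suc)
  also have "\<dots> \<le> (N + 1) * ((2 * k + 3) * (n + 1) + 2)" by (rule mult_le_mono1) simp
  finally show ?thesis .
qed

lemma le_all_mv_0: "le_all S ps \<Longrightarrow> le_all S (mv 0 ps ts)"
  by (induction "0::nat" ps ts rule: mv.induct) auto

definition cSc :: "nat \<Rightarrow> nat" where "cSc K = 2 * K + 4 + 2 * cM K"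
definition cMo :: "nat \<Rightarrow> nat" where "cMo K = 1 + cSc K * (K + 1) + cMv K * (K + 1)"
definition cT :: "nat \<Rightarrow> nat" where "cT K = 2 + cMv K * (K + 1)"
definition cS :: "nat \<Rightarrow> nat" where "cS K = 1 + cZO K + cZA K * (K + 1)"
definition cTop :: "nat \<Rightarrow> nat" where
  "cTop K = 1 + 2 * (K + 1) + cSc K * (K + 1) + (K + 2) * (K + 1) + cMo K * (K + 1) + cMv K * (K + 1) + (cT K * K + 1) + cS K * K"

definition rows_ok :: "nat \<Rightarrow> nat \<Rightarrow> frac list \<Rightarrow> bool" where
  "rows_ok k n fs \<longleftrightarrow> length fs = n \<and> gden fs < 2 ^ k \<and> (\<forall>(p, q)\<in>set fs. q > 0 \<and> nat \<bar>p\<bar> * gden fs < 2 ^ k)"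

text \<open>What the rules for formulas need about a zone: one derivation of its boundedness, and
  derivations of membership for the vertices that lie in it.\<close>

definition zone_proofs :: "nat \<Rightarrow> nat \<Rightarrow> letter list \<Rightarrow> (nat \<Rightarrow> (nat \<times> nat) list) \<Rightarrow> (nat \<Rightarrow> real vec) \<Rightarrow> nat \<Rightarrow> zone \<Rightarrow> bool" where
  "zone_proofs K k O' Q P N z \<longleftrightarrow> (\<exists>A B. enc_zone z = A @ B \<and> prv K (cZO K) [(PZoneOK, [A, B, O'])] \<and>
     (\<forall>i\<le>N. P i \<in> zone_set z \<longrightarrow> prv K (cZA K * (K + 1)) [(PZoneAt, [A, B, vecw k (Q i)])]))"

context
  fixes K k :: nat
  assumes k1: "k \<ge> 1" and kK: "k \<le> K"
begin

lemma prv_scale: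
  "g < 2 ^ k \<Longrightarrow> \<forall>(p, q)\<in>set fs. q > 0 \<and> q dvd g \<and> nat \<bar>p\<bar> * g < 2 ^ k \<Longrightarrow> length (enc_list enc_frac fs) \<le> K \<Longrightarrow>
    length (enc_list encI (map (scl k g) fs)) \<le> K \<Longrightarrow>
    prv K (cSc K * (length fs + 1)) [(PScale, [fw k g, enc_list enc_frac fs, enc_list encI (map (scl k g) fs)])]"
proof (induction fs)
  case Nil
  have "prv K (Suc 0) [(PScale, [fw k g, [L_End], [L_End]])]"
    using prv_scale_rule[of 0 "[fw k g]" K 0] prv_Nil kK by (simp add: scale_rules_def rule_simps)
  moreover have "Suc 0 \<le> cSc K" by (simp add: cSc_def)
  ultimately show ?case by (simp add: prv_mono)
next
  case (Cons f fs)
  obtain p q where f: "f = (p, q)" by (cases f)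
  let ?a = "nat \<bar>p\<bar>" and ?B = "cSc K * (length fs + 1)"
  define t where "t = ?a * g div q"
  have q: "q > 0" "q dvd g" "?a * g < 2 ^ k" using Cons.prems(2) f by auto
  have qt: "q * t = ?a * g" unfolding t_def using q(2) by (simp add: dvd_mult)
  have "t \<le> q * t" using q(1) by simp
  then have t2: "t < 2 ^ k" using qt q(3) by simp
  have lens: "length (bits ?a) \<le> K" "length (bits q) \<le> K" "length (enc_list enc_frac fs) \<le> K" "length (enc_list encI (map (scl k g) fs)) \<le> K"
  proof -
    have "length (enc_frac f) + length (enc_list enc_frac fs) \<le> K" using Cons.prems(3) by simp
    moreover have "length (bits ?a) + length (bits q) \<le> length (enc_frac f)" by (simp add: f enc_frac_def enc_int_bits[of p] enc_nat_def)
    ultimately show "length (bits ?a) \<le> K" "length (bits q) \<le> K" "length (enc_list enc_frac fs) \<le> K" by linarith+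
    show "length (enc_list encI (map (scl k g) fs)) \<le> K" using Cons.prems(4) by simp
  qed
  have IH: "prv K ?B [(PScale, [fw k g, enc_list enc_frac fs, enc_list encI (map (scl k g) fs)])]"
    using Cons lens by auto
  have c1: "prv K (K + 2) [(chk p, [bits ?a])]" using prv_chk[OF k1 kK lens(1)] .
  have c2: "prv K (K + 1) [(PPos, [bits q])]" using prv_pos[OF k1 kK q(1) lens(2)] lens(2) by (rule_tac prv_mono) auto
  have c3: "prv K (cM K) [(PMul, [bits q, fw k t, fw k (?a * g)])]"
    using prv_mul[OF k1 kK bitw_bits lens(2) t2] qt q(3) by simp
  have c4: "prv K (cM K) [(PMul, [bits ?a, fw k g, fw k (?a * g)])]"
    using prv_mul[OF k1 kK bitw_bits lens(1) Cons.prems(1)] q(3) by simp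
  have step: "prv K B [(chk p, [bits ?a]), (PPos, [bits q]), (PMul, [bits q, fw k t, fw k (?a * g)]), (PMul, [bits ?a, fw k g, fw k (?a * g)]),
     (PScale, [fw k g, enc_list enc_frac fs, enc_list encI (map (scl k g) fs)])] \<Longrightarrow>
     prv K (Suc B) [(PScale, [fw k g, enc_list enc_frac (f # fs), enc_list encI (map (scl k g) (f # fs))])]" for B
    using prv_scale_rule[of "if p < 0 then 2 else 1" "[fw k g, bits ?a, bits q, enc_list enc_frac fs, fw k t, enc_list encI (map (scl k g) fs), fw k (?a * g)]" K B]
      kK lens enc_int_bits[of p]
    by (auto simp: scale_rules_def rule_simps chk_def f enc_frac_def enc_nat_def t_def)
  have "prv K (Suc (K + 2 + (K + 1 + (cM K + (cM K + ?B))))) [(PScale, [fw k g, enc_list enc_frac (f # fs), enc_list encI (map (scl k g) (f # fs))])]"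
    by (rule step[OF prv_Cons[OF c1 prv_Cons[OF c2 prv_Cons[OF c3 prv_Cons[OF c4 IH]]]]])
  then show ?case by (rule prv_mono) (simp add: cSc_def)
qed

lemma prv_move_K:
  assumes "length ps = length ts" "\<forall>t\<in>set ts. okI t" "small k (mv y ps ts)" "y < 2 ^ k" "length (vecw k ps) \<le> K" "length (enc_list encI ts) \<le> K"
  shows "prv K (cMv K * (K + 1)) [(PMove, [fw k y, vecw k ps, vecw k (mv y ps ts), enc_list encI ts])]"
proof (rule prv_mono[OF prv_move[OF k1 kK assms]])
  have "length ts < K" using length_enc_list_ge[of ts encI] assms(6) by simp
  then show "cMv K * (length ts + 1) \<le> cMv K * (K + 1)" by (intro mult_le_mono2) simp
qed

lemma row_lengths:
  assumes "(2 * k + 3) * (n + 1) + 1 \<le> K" "length fs = n"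
  shows "length (enc_list encI (map (scl k g) fs)) \<le> K" "length (enc_list encI ((L_Plus, []) # map (scl k g) fs)) \<le> K"
    "length w = k \<Longrightarrow> length (enc_list encI ((L_Minus, w) # map (scl k g) fs)) \<le> K" "n + 1 \<le> K"
proof -
  have "(k + 3) * (n + 1) \<le> (2 * k + 3) * (n + 1)" by (rule mult_le_mono1) simp
  then have *: "(k + 3) * (n + 1) + 1 \<le> K" using assms(1) by linarith
  then show "length (enc_list encI (map (scl k g) fs)) \<le> K" "length (enc_list encI ((L_Plus, []) # map (scl k g) fs)) \<le> K"
    "length w = k \<Longrightarrow> length (enc_list encI ((L_Minus, w) # map (scl k g) fs)) \<le> K"
    using assms(2) by (auto simp: length_enc_srow)
  have "1 * (n + 1) \<le> (k + 3) * (n + 1)" by (rule mult_le_mono1) simp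
  then show "n + 1 \<le> K" using * by simp
qed

lemma prv_scale_K:
  assumes "rows_ok k n fs" "length (enc_list enc_frac fs) \<le> K" "(2 * k + 3) * (n + 1) + 1 \<le> K"
  shows "prv K (cSc K * (K + 1)) [(PScale, [fw k (gden fs), enc_list enc_frac fs, enc_list encI (srow k fs)])]"
proof (rule prv_mono)
  have r: "length fs = n" "gden fs < 2 ^ k" "\<forall>(p, q)\<in>set fs. q > 0 \<and> nat \<bar>p\<bar> * gden fs < 2 ^ k" using assms(1) by (auto simp: rows_ok_def)
  have "\<forall>(p, q)\<in>set fs. q > 0 \<and> q dvd gden fs \<and> nat \<bar>p\<bar> * gden fs < 2 ^ k" using r(3) gden_dvd by fastforce
  then show "prv K (cSc K * (length fs + 1)) [(PScale, [fw k (gden fs), enc_list enc_frac fs, enc_list encI (srow k fs)])]"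
    unfolding srow_def using r(2) assms(2) row_lengths(1)[OF assms(3) r(1)] by (intro prv_scale)
  have "length fs < length (enc_list enc_frac fs)" by (rule length_enc_list_ge)
  then show "cSc K * (length fs + 1) \<le> cSc K * (K + 1)" using assms(2) by (intro mult_le_mono2) simp
qed

lemma rows_ok_pos: "rows_ok k n fs \<Longrightarrow> \<exists>a b. fw k (gden fs) = a @ L_1 # b \<and> length a \<le> K \<and> length b \<le> K"
proof -
  assume r: "rows_ok k n fs"
  then have "\<forall>f\<in>set fs. snd f > 0" by (auto simp: rows_ok_def)
  then have "0 < gden fs" by (rule gden_pos)
  moreover have "gden fs < 2 ^ k" using r by (simp add: rows_ok_def)
  ultimately obtain a b where ab: "fw k (gden fs) = a @ L_1 # b" using fw_pos_split by meson
  have "length a \<le> K" "length b \<le> K" using arg_cong[OF ab, of length] kK by auto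
  then show ?thesis using ab by blast
qed

lemma prv_modes:
  assumes K: "(2 * k + 3) * (n + 1) + 1 \<le> K"
  shows "\<forall>fs\<in>set fss. rows_ok k n fs \<Longrightarrow> length (enc_list (enc_list enc_frac) fss) \<le> K \<Longrightarrow>
     length (enc_list (enc_list encI) (map (srow k) fss)) \<le> K \<Longrightarrow>
     prv K (cMo K * (length fss + 1)) [(PModes, [vecw k (replicate (n + 1) (0, 0)), enc_list (enc_list enc_frac) fss, enc_list (enc_list encI) (map (srow k) fss)])]"
proof (induction fss)
  case Nil
  have lO: "length (vecw k (replicate (n + 1) (0, 0))) \<le> K" using K unfolding length_vecw by simp
  have "prv K (Suc 0) [(PModes, [vecw k (replicate (n + 1) (0, 0)), [L_End], [L_End]])]"
    using prv_vec_rule[of 0 "[vecw k (replicate (n + 1) (0, 0))]" K 0] prv_Nil lO by (simp add: vec_rules_def rule_simps)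
  moreover have "Suc 0 \<le> cMo K" by (simp add: cMo_def)
  ultimately show ?case by (simp add: prv_mono)
next
  case (Cons fs fss)
  let ?O = "replicate (n + 1) (0, 0) :: (nat \<times> nat) list" and ?ts = "(L_Plus, []) # srow k fs"
  let ?W = "mv 0 ?O ?ts" and ?M = "enc_list (enc_list enc_frac) fss" and ?R = "enc_list (enc_list encI) (map (srow k) fss)"
  let ?B = "cMo K * (length fss + 1)"
  have r: "rows_ok k n fs" "length fs = n" using Cons.prems(1) by (auto simp: rows_ok_def)
  have lO: "length (vecw k ?O) \<le> K" using K unfolding length_vecw by simp
  have lW: "length (vecw k ?W) \<le> K" using K r(2) unfolding length_vecw by simp
  have lens: "length (enc_list enc_frac fs) \<le> K" "length ?M \<le> K" "length ?R \<le> K" using Cons.prems(2,3) by auto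
  have IH: "prv K ?B [(PModes, [vecw k ?O, ?M, ?R])]" using Cons lens by auto
  obtain a b where ab: "fw k (gden fs) = a @ L_1 # b" "length a \<le> K" "length b \<le> K" using rows_ok_pos[OF r(1)] by blast
  have sc: "prv K (cSc K * (K + 1)) [(PScale, [a @ L_1 # b, enc_list enc_frac fs, enc_list encI (srow k fs)])]"
    using prv_scale_K[OF r(1) lens(1) K] ab by simp
  have "le_all 0 ?W" by (intro le_all_mv_0 le_all_replicate)
  then have sW: "small k ?W" by (rule le_all_small) simp
  have lr: "length (enc_list encI (srow k fs)) \<le> K" "length (enc_list encI ?ts) \<le> K"
    using row_lengths(1,2)[OF K r(2), of "gden fs"] by (simp_all add: srow_def)
  have mv: "prv K (cMv K * (K + 1)) [(PMove, [fw k 0, vecw k ?O, vecw k ?W, enc_list encI ?ts])]"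
    using okI_srow[of k fs] sW lO lr r(2) by (intro prv_move_K) auto
  have step: "prv K B [(PScale, [a @ L_1 # b, enc_list enc_frac fs, enc_list encI (srow k fs)]),
     (PMove, [fw k 0, vecw k ?O, vecw k ?W, enc_list encI ?ts]), (PModes, [vecw k ?O, ?M, ?R])] \<Longrightarrow>
     prv K (Suc B) [(PModes, [vecw k ?O, enc_list (enc_list enc_frac) (fs # fss), enc_list (enc_list encI) (map (srow k) (fs # fss))])]" for B
    using prv_vec_rule[of 1 "[vecw k ?O, enc_list enc_frac fs, ?M, enc_list encI (srow k fs), ?R, a, b, fw k 0, vecw k ?W]" K B]
      kK lO lW lens ab lr by (simp add: vec_rules_def rule_simps)
  have "prv K (Suc (cSc K * (K + 1) + (cMv K * (K + 1) + ?B))) [(PModes, [vecw k ?O, enc_list (enc_list enc_frac) (fs # fss), enc_list (enc_list encI) (map (srow k) (fs # fss))])]"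
    by (rule step[OF prv_Cons[OF sc prv_Cons[OF mv IH]]])
  then show ?case by (rule prv_mono) (simp add: cMo_def)
qed

text \<open>Induction on the number of remaining edges. The first argument lists the rows from
  position \<open>i mod length fss\<close> on; when a pass ends, one further application of the
  cyclic rule restores the full list.\<close>

lemma prv_table:
  assumes K: "(2 * k + 3) * (n + 1) + 1 \<le> K" and fss: "fss \<noteq> []" "\<forall>fs\<in>set fss. length fs = n"
    and lR: "length (enc_list (enc_list encI) (map (srow k) fss)) \<le> K" and P0: "length P = n + 1"
    and y: "\<forall>i<N. y i < 2 ^ k" and sm: "\<forall>i\<le>N. small k (pts k fss y P i)" and lT: "(N + 1) * ((2 * k + 3) * (n + 1) + 2) \<le> K"
  defines "Q \<equiv> pts k fss y P" and "Rs \<equiv> enc_list (enc_list encI) (map (srow k) fss)"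
  shows "i \<le> N \<Longrightarrow> prv K (cT K * (N - i) + 1) [(PTable, [enc_list (enc_list encI) (drop (i mod length fss) (map (srow k) fss)), Rs, vecw k (Q i), tab k Q (Suc i) N])]"
proof -
  let ?tss = "map (srow k) fss" and ?n = "length fss"
  have lQ: "length (Q j) = n + 1" for j unfolding Q_def by (rule length_pts[OF fss P0])
  have lvQ: "length (vecw k (Q j)) \<le> K" for j using K lQ unfolding length_vecw by simp
  have ltab: "length (tab k Q j N) \<le> K" for j using length_tab[of N Q n k j] lQ lT by (meson le_trans)
  have ldrop: "length (enc_list (enc_list encI) (drop j ?tss)) \<le> K" for j
    using length_enc_list_drop lR by (rule le_trans)
  show "i \<le> N \<Longrightarrow> prv K (cT K * (N - i) + 1) [(PTable, [enc_list (enc_list encI) (drop (i mod ?n) ?tss), Rs, vecw k (Q i), tab k Q (Suc i) N])]"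
  proof (induction "N - i" arbitrary: i)
  case 0
  then have i: "i = N" by simp
  have "prv K (Suc 0) [(PTable, [enc_list (enc_list encI) (drop (i mod ?n) ?tss), Rs, vecw k (Q i), []])]"
    using prv_table_rule[of 0 "[enc_list (enc_list encI) (drop (i mod ?n) ?tss), Rs, vecw k (Q i)]" K 0] prv_Nil ldrop lvQ lR
    by (simp add: table_rules_def rule_simps Rs_def)
  then show ?case using i by (simp add: prv_mono)
next
  case (Suc m)
  then have i: "i < N" by simp
  define j where "j = i mod ?n"
  have j: "j < ?n" using fss(1) by (simp add: j_def)
  let ?ts = "srow k (fss ! j)"
  have lf: "length (fss ! j) = n" using fss(2) j by simp
  let ?B = "cT K * (N - Suc i) + 1"
  let ?g = "\<lambda>w. (PTable, [w, Rs, vecw k (Q (Suc i)), tab k Q (Suc (Suc i)) N])"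
  have IH: "prv K ?B [?g (enc_list (enc_list encI) (drop (Suc i mod ?n) ?tss))]"
    using Suc.hyps(1)[of "Suc i"] Suc.hyps(2) i by simp
  have nxt: "prv K (Suc ?B) [?g (enc_list (enc_list encI) (drop (Suc j) ?tss))]"
  proof (cases "Suc j = ?n")
    case True
    then have "Suc i mod ?n = 0" by (simp add: j_def mod_Suc)
    then have 0: "prv K ?B [?g Rs]" using IH by (simp add: Rs_def)
    have "prv K B [?g Rs] \<Longrightarrow> prv K (Suc B) [?g [L_End]]" for B
      using prv_table_rule[of 2 "[[], [], Rs, vecw k (Q (Suc i)), [], tab k Q (Suc (Suc i)) N]" K B] lvQ ltab lR
      by (simp add: table_rules_def rule_simps Rs_def)
    then show ?thesis using 0 True by simp
  next
    case False
    then have "Suc i mod ?n = Suc j" by (simp add: j_def mod_Suc)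
    then show ?thesis using IH by (simp add: prv_mono)
  qed
  have QS: "Q (Suc i) = mv (y i) (Q i) ((L_Plus, []) # ?ts)" by (simp add: Q_def j_def)
  have lr: "length (enc_list encI ?ts) \<le> K" "length (enc_list encI ((L_Plus, []) # ?ts)) \<le> K"
    using row_lengths(1,2)[OF K lf, of "gden (fss ! j)"] by (simp_all add: srow_def)
  have mvp: "prv K (cMv K * (K + 1)) [(PMove, [fw k (y i), vecw k (Q i), vecw k (Q (Suc i)), enc_list encI ((L_Plus, []) # ?ts)])]"
    unfolding QS
  proof (rule prv_move_K)
    show "small k (mv (y i) (Q i) ((L_Plus, []) # ?ts))" using sm i QS unfolding Q_def by (metis Suc_leI)
  qed (use lQ lf okI_srow[of k "fss ! j"] y i lvQ lr in auto)
  have dr: "enc_list (enc_list encI) (drop j ?tss) = L_Item # enc_list encI ?ts @ enc_list (enc_list encI) (drop (Suc j) ?tss)"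
    using j by (simp add: Cons_nth_drop_Suc[symmetric])
  have tb: "tab k Q (Suc i) N = L_F # vecw k (Q (Suc i)) @ tab k Q (Suc (Suc i)) N" using i by (intro tab_Cons) simp
  have step: "prv K B [(PMove, [fw k (y i), vecw k (Q i), vecw k (Q (Suc i)), enc_list encI ((L_Plus, []) # ?ts)]), ?g (enc_list (enc_list encI) (drop (Suc j) ?tss))] \<Longrightarrow>
     prv K (Suc B) [(PTable, [enc_list (enc_list encI) (drop j ?tss), Rs, vecw k (Q i), tab k Q (Suc i) N])]" for B
    unfolding dr tb
    using prv_table_rule[of 1 "[enc_list encI ?ts, enc_list (enc_list encI) (drop (Suc j) ?tss), Rs, vecw k (Q i), vecw k (Q (Suc i)), tab k Q (Suc (Suc i)) N, fw k (y i)]" K B]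
      lvQ ltab lR lr ldrop kK by (simp add: table_rules_def rule_simps Rs_def)
  have "prv K (Suc (cMv K * (K + 1) + Suc ?B)) [(PTable, [enc_list (enc_list encI) (drop j ?tss), Rs, vecw k (Q i), tab k Q (Suc i) N])]"
    by (rule step[OF prv_Cons[OF mvp nxt]])
  moreover have "N - i = Suc (N - Suc i)" using i by simp
  ultimately show ?case unfolding j_def by (elim prv_mono) (simp add: cT_def)
  qed
qed

subsection \<open>Formulas\<close>

text \<open>Meant for the disjunct that is not followed: its zones still have to be certified as
  bounded.\<close>

lemma prv_sat_Nil:
  assumes lO: "length O' \<le> K"
  shows "ops \<phi> \<subseteq> fragment \<Longrightarrow> \<forall>z\<in>zones \<phi>. zone_proofs K k O' Q P N z \<Longrightarrow> length (enc_ltl \<phi>) \<le> K \<Longrightarrow>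
    prv K (cS K * length (enc_ltl \<phi>)) [(PSat, [O', enc_ltl \<phi>, []])]"
proof (induction \<phi>)
  case TrueF
  have p: "prv K (Suc 0) [(PSat, [O', [L_True], []])]"
    using prv_sat_rule[of 0 "[O', []]" K 0] prv_Nil lO by (simp add: sat_rules_def rule_simps)
  show ?case unfolding enc_ltl.simps by (rule prv_mono[OF p]) (simp add: cS_def)
next
  case (Zone z)
  obtain A B where z: "enc_zone z = A @ B" "prv K (cZO K) [(PZoneOK, [A, B, O'])]" using Zone.prems(2) by (auto simp: zone_proofs_def)
  have l: "length A \<le> K" "length B \<le> K" using Zone.prems(3) z(1) by auto
  have "prv K (Suc (cZO K)) [(PSat, [O', enc_ltl (Zone z), []])]"
    using prv_sat_rule[of 7 "[O', [], A, B]" K "cZO K"] z lO l by (simp add: sat_rules_def rule_simps)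
  moreover have "Suc (cZO K) \<le> cS K * 1" by (simp add: cS_def)
  moreover have "cS K * 1 \<le> cS K * length (enc_ltl (Zone z))" by (intro mult_le_mono2) simp
  ultimately show ?case by (meson prv_mono le_trans)
next
  case (Conj \<phi> \<psi>)
  have l: "length (enc_ltl \<phi>) \<le> K" "length (enc_ltl \<psi>) \<le> K" using Conj.prems(3) by auto
  have 1: "prv K (cS K * length (enc_ltl \<phi>)) [(PSat, [O', enc_ltl \<phi>, []])]" "prv K (cS K * length (enc_ltl \<psi>)) [(PSat, [O', enc_ltl \<psi>, []])]"
    using Conj l by auto
  have "prv K B [(PSat, [O', enc_ltl \<phi>, []]), (PSat, [O', enc_ltl \<psi>, []])] \<Longrightarrow> prv K (Suc B) [(PSat, [O', enc_ltl (Conj \<phi> \<psi>), []])]" for B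
    using prv_sat_rule[of 1 "[O', [], enc_ltl \<phi>, enc_ltl \<psi>]" K B] lO l by (simp add: sat_rules_def rule_simps)
  from this[OF prv_Cons[OF 1]] show ?case by (rule prv_mono) (simp add: cS_def algebra_simps)
next
  case (Disj \<phi> \<psi>)
  have l: "length (enc_ltl \<phi>) \<le> K" "length (enc_ltl \<psi>) \<le> K" using Disj.prems(3) by auto
  have 1: "prv K (cS K * length (enc_ltl \<phi>)) [(PSat, [O', enc_ltl \<phi>, []])]" "prv K (cS K * length (enc_ltl \<psi>)) [(PSat, [O', enc_ltl \<psi>, []])]"
    using Disj l by auto
  have "prv K B [(PSat, [O', enc_ltl \<phi>, []]), (PSat, [O', enc_ltl \<psi>, []])] \<Longrightarrow> prv K (Suc B) [(PSat, [O', enc_ltl (Disj \<phi> \<psi>), []])]" for B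
    using prv_sat_rule[of 2 "[O', [], enc_ltl \<phi>, enc_ltl \<psi>]" K B] lO l by (simp add: sat_rules_def rule_simps)
  from this[OF prv_Cons[OF 1]] show ?case by (rule prv_mono) (simp add: cS_def algebra_simps)
next
  case (Finally \<phi>)
  have l: "length (enc_ltl \<phi>) \<le> K" using Finally.prems(3) by auto
  have 1: "prv K (cS K * length (enc_ltl \<phi>)) [(PSat, [O', enc_ltl \<phi>, []])]" using Finally l by auto
  have "prv K B [(PSat, [O', enc_ltl \<phi>, []])] \<Longrightarrow> prv K (Suc B) [(PSat, [O', enc_ltl (Finally \<phi>), []])]" for B
    using prv_sat_rule[of 5 "[O', [], enc_ltl \<phi>]" K B] lO l by (simp add: sat_rules_def rule_simps)
  from this[OF 1] show ?case by (rule prv_mono) (simp add: cS_def algebra_simps)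
qed auto

text \<open>A witness of \<open>F\<close> at vertex \<open>j\<close> becomes a split of the table
  word in front of that vertex.\<close>

lemma prv_sat:
  assumes lO: "length O' \<le> K" and lT: "\<And>i. length (tab k Q i N) \<le> K" and lQ: "\<And>i. length (vecw k (Q i)) \<le> K"
  shows "isat P N i \<phi> \<Longrightarrow> i \<le> N \<Longrightarrow> ops \<phi> \<subseteq> fragment \<Longrightarrow> \<forall>z\<in>zones \<phi>. zone_proofs K k O' Q P N z \<Longrightarrow> length (enc_ltl \<phi>) \<le> K \<Longrightarrow>
    prv K (cS K * length (enc_ltl \<phi>)) [(PSat, [O', enc_ltl \<phi>, tab k Q i N])]"
proof (induction \<phi> arbitrary: i)
  case TrueF
  have p: "prv K (Suc 0) [(PSat, [O', [L_True], tab k Q i N])]"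
    using prv_sat_rule[of 0 "[O', tab k Q i N]" K 0] prv_Nil lO lT by (simp add: sat_rules_def rule_simps)
  show ?case unfolding enc_ltl.simps by (rule prv_mono[OF p]) (simp add: cS_def)
next
  case (Zone z)
  obtain A B where z: "enc_zone z = A @ B" "prv K (cZO K) [(PZoneOK, [A, B, O'])]" "prv K (cZA K * (K + 1)) [(PZoneAt, [A, B, vecw k (Q i)])]"
    using Zone.prems by (auto simp: zone_proofs_def)
  have l: "length A \<le> K" "length B \<le> K" using Zone.prems(5) z(1) by auto
  have t: "tab k Q i N = L_F # vecw k (Q i) @ tab k Q (Suc i) N" using Zone.prems(2) by (rule tab_Cons)
  have "prv K B' [(PZoneOK, [A, B, O']), (PZoneAt, [A, B, vecw k (Q i)])] \<Longrightarrow> prv K (Suc B') [(PSat, [O', enc_ltl (Zone z), tab k Q i N])]" for B'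
    unfolding t using prv_sat_rule[of 6 "[O', [], A, B, vecw k (Q i), tab k Q (Suc i) N]" K B'] z(1) lO l lT lQ by (simp add: sat_rules_def rule_simps)
  from this[OF prv_Cons[OF z(2,3)]] have "prv K (cS K) [(PSat, [O', enc_ltl (Zone z), tab k Q i N])]"
    by (rule prv_mono) (simp add: cS_def)
  moreover have "cS K * 1 \<le> cS K * length (enc_ltl (Zone z))" by (intro mult_le_mono2) simp
  ultimately show ?case by (metis prv_mono nat_mult_1_right)
next
  case (Conj \<phi> \<psi>)
  have l: "length (enc_ltl \<phi>) \<le> K" "length (enc_ltl \<psi>) \<le> K" using Conj.prems by auto
  have 1: "prv K (cS K * length (enc_ltl \<phi>)) [(PSat, [O', enc_ltl \<phi>, tab k Q i N])]" "prv K (cS K * length (enc_ltl \<psi>)) [(PSat, [O', enc_ltl \<psi>, tab k Q i N])]"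
    using Conj l by auto
  have "prv K B [(PSat, [O', enc_ltl \<phi>, tab k Q i N]), (PSat, [O', enc_ltl \<psi>, tab k Q i N])] \<Longrightarrow> prv K (Suc B) [(PSat, [O', enc_ltl (Conj \<phi> \<psi>), tab k Q i N])]" for B
    using prv_sat_rule[of 1 "[O', tab k Q i N, enc_ltl \<phi>, enc_ltl \<psi>]" K B] lO l lT by (simp add: sat_rules_def rule_simps)
  from this[OF prv_Cons[OF 1]] show ?case by (rule prv_mono) (simp add: cS_def algebra_simps)
next
  case (Disj \<phi> \<psi>)
  have l: "length (enc_ltl \<phi>) \<le> K" "length (enc_ltl \<psi>) \<le> K" using Disj.prems by auto
  have n: "prv K (cS K * length (enc_ltl \<phi>)) [(PSat, [O', enc_ltl \<phi>, []])]" "prv K (cS K * length (enc_ltl \<psi>)) [(PSat, [O', enc_ltl \<psi>, []])]"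
  proof -
    have o: "ops \<phi> \<subseteq> fragment" "ops \<psi> \<subseteq> fragment" and zs: "\<forall>z\<in>zones \<phi>. zone_proofs K k O' Q P N z" "\<forall>z\<in>zones \<psi>. zone_proofs K k O' Q P N z"
      using Disj.prems(3,4) by auto
    show "prv K (cS K * length (enc_ltl \<phi>)) [(PSat, [O', enc_ltl \<phi>, []])]" by (rule prv_sat_Nil[OF lO o(1) zs(1) l(1)])
    show "prv K (cS K * length (enc_ltl \<psi>)) [(PSat, [O', enc_ltl \<psi>, []])]" by (rule prv_sat_Nil[OF lO o(2) zs(2) l(2)])
  qed
  have "prv K (Suc (cS K * length (enc_ltl \<phi>) + cS K * length (enc_ltl \<psi>))) [(PSat, [O', enc_ltl (Disj \<phi> \<psi>), tab k Q i N])]"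
  proof (cases "isat P N i \<phi>")
    case True
    have 1: "prv K (cS K * length (enc_ltl \<phi>)) [(PSat, [O', enc_ltl \<phi>, tab k Q i N])]" using Disj.IH(1)[OF True] Disj.prems l by auto
    have "prv K B [(PSat, [O', enc_ltl \<phi>, tab k Q i N]), (PSat, [O', enc_ltl \<psi>, []])] \<Longrightarrow> prv K (Suc B) [(PSat, [O', enc_ltl (Disj \<phi> \<psi>), tab k Q i N])]" for B
      using prv_sat_rule[of 2 "[O', tab k Q i N, enc_ltl \<phi>, enc_ltl \<psi>]" K B] lO l lT by (simp add: sat_rules_def rule_simps)
    from this[OF prv_Cons[OF 1 n(2)]] show ?thesis .
  next
    case False
    then have "isat P N i \<psi>" using Disj.prems(1) by simp
    then have 1: "prv K (cS K * length (enc_ltl \<psi>)) [(PSat, [O', enc_ltl \<psi>, tab k Q i N])]" using Disj.IH(2) Disj.prems l by auto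
    have "prv K B [(PSat, [O', enc_ltl \<phi>, []]), (PSat, [O', enc_ltl \<psi>, tab k Q i N])] \<Longrightarrow> prv K (Suc B) [(PSat, [O', enc_ltl (Disj \<phi> \<psi>), tab k Q i N])]" for B
      using prv_sat_rule[of 3 "[O', tab k Q i N, enc_ltl \<phi>, enc_ltl \<psi>]" K B] lO l lT by (simp add: sat_rules_def rule_simps)
    from this[OF prv_Cons[OF n(1) 1]] show ?thesis .
  qed
  then show ?case by (rule prv_mono) (simp add: cS_def algebra_simps)
next
  case (Finally \<phi>)
  obtain j where j: "i \<le> j" "j \<le> N" "isat P N j \<phi>" using Finally.prems(1) by auto
  have l: "length (enc_ltl \<phi>) \<le> K" using Finally.prems by auto
  have 1: "prv K (cS K * length (enc_ltl \<phi>)) [(PSat, [O', enc_ltl \<phi>, tab k Q j N])]" using Finally.IH[OF j(3,2)] Finally.prems l by auto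
  have t: "tab k Q j N = L_F # vecw k (Q j) @ tab k Q (Suc j) N" using j(2) by (rule tab_Cons)
  obtain X where X: "tab k Q i N = X @ tab k Q j N" using tab_split[OF j(1,2)] by blast
  have lX: "length X \<le> K" "length (vecw k (Q j) @ tab k Q (Suc j) N) \<le> K" using lT[of i] lT[of j] X t by auto
  have "prv K B [(PSat, [O', enc_ltl \<phi>, tab k Q j N])] \<Longrightarrow> prv K (Suc B) [(PSat, [O', enc_ltl (Finally \<phi>), tab k Q i N])]" for B
    unfolding X t using prv_sat_rule[of 4 "[O', X, enc_ltl \<phi>, vecw k (Q j) @ tab k Q (Suc j) N]" K B] lO l lX by (simp add: sat_rules_def rule_simps)
  from this[OF 1] show ?case by (rule prv_mono) (simp add: cS_def algebra_simps)
qed auto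

lemma prv_top:
  assumes K: "(2 * k + 3) * (n + 1) + 1 \<le> K" and n: "n \<ge> 1" and fss: "fss \<noteq> []" "\<forall>fs\<in>set fss. rows_ok k n fs" and fs: "rows_ok k n fs"
    and lR: "length (enc_list (enc_list encI) (map (srow k) fss)) \<le> K"
    and y: "\<forall>i<N. y i < 2 ^ k" and E: "0 < E" "E < 2 ^ k"
    and lT: "(N + 1) * ((2 * k + 3) * (n + 1) + 2) \<le> K" and lw: "length (enc_list (enc_list enc_frac) fss @ enc_list enc_frac fs @ enc_ltl \<phi>) \<le> K"
  defines "O' \<equiv> replicate (n + 1) (0, 0)"
  defines "Q \<equiv> pts k fss y (mv E O' ((L_Minus, fw k (gden fs)) # srow k fs))"
  assumes sm: "\<forall>i\<le>N. small k (Q i)" and sat: "isat P N 0 \<phi>" and ops: "ops \<phi> \<subseteq> fragment" and z: "\<forall>z\<in>zones \<phi>. zone_proofs K k (vecw k O') Q P N z"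
  shows "prv K (cTop K) [(PTop, [enc_list (enc_list enc_frac) fss @ enc_list enc_frac fs @ enc_ltl \<phi>])]"
proof -
  let ?Rs = "enc_list (enc_list encI) (map (srow k) fss)" and ?M = "enc_list (enc_list enc_frac) fss"
  let ?rx = "enc_list encI (srow k fs)" and ?ts = "(L_Minus, fw k (gden fs)) # srow k fs"
  have lens: "length ?M \<le> K" "length (enc_list enc_frac fs) \<le> K" "length (enc_ltl \<phi>) \<le> K" using lw by auto
  have lf: "length fs = n" "\<forall>fs\<in>set fss. length fs = n" using fs fss by (auto simp: rows_ok_def)
  have nK: "n + 1 \<le> K" using row_lengths(4)[OF K lf(1)] .
  have lr: "length ?rx \<le> K" "length (enc_list encI ?ts) \<le> K"
    using row_lengths(1)[OF K lf(1), of "gden fs"] row_lengths(3)[OF K lf(1), of "fw k (gden fs)" "gden fs"] by (simp_all add: srow_def)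
  obtain a b where ab: "fw k (gden fs) = a @ L_1 # b" "length a \<le> K" "length b \<le> K" using rows_ok_pos[OF fs] by blast
  obtain a' b' where ab': "fw k E = a' @ L_1 # b'" using fw_pos_split[OF E] by meson
  have lab': "length a' \<le> K" "length b' \<le> K" using arg_cong[OF ab', of length] kK by auto
  have Q0: "Q 0 = mv E O' ?ts" by (simp add: Q_def)
  have lQ: "length (Q j) = n + 1" for j unfolding Q_def by (rule length_pts[OF fss(1) lf(2)]) (simp add: O'_def lf(1))
  have lvQ: "length (vecw k (Q j)) \<le> K" for j using K lQ unfolding length_vecw by simp
  have ltab: "length (tab k Q j N) \<le> K" for j using length_tab[of N Q n k j] lQ lT by (meson le_trans)
  have lO: "length (vecw k O') \<le> K" using K unfolding length_vecw O'_def by simp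
  have Owd: "vecw k O' = L_Item # fw k 0 @ L_End # fw k 0 @ L_End # L_Item # fw k 0 @ L_End # fw k 0 @ L_End # vecw k (replicate (n - 1) (0, 0))"
    using n by (cases n) (auto simp: O'_def)
  have lO2: "length (vecw k (replicate (n - 1) (0, 0))) \<le> K" using lO Owd by simp
  obtain m1 where m1: "?M = L_Item # m1" using fss(1) by (cases fss) auto
  have lm1: "length m1 \<le> K" using lens(1) m1 by simp
  have c1: "prv K (K + 1) [(PZero, [a @ L_1 # b, fw k 0])]" using prv_zero_fw[OF k1 kK, of "gden fs"] ab by simp
  have c2: "prv K (K + 1) [(PZero, [fw k 0, fw k 0])]" by (rule prv_zero_fw[OF k1 kK])
  have c3: "prv K (cSc K * (K + 1)) [(PScale, [a @ L_1 # b, enc_list enc_frac fs, ?rx])]" using prv_scale_K[OF fs lens(2) K] ab by simp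
  have c4: "prv K ((K + 2) * (K + 1)) [(PZeroVec, [vecw k O'])]"
  proof (rule prv_mono)
    show "prv K ((K + 2) * ((n + 1) + 1)) [(PZeroVec, [vecw k O'])]" using prv_zerovec[OF k1 kK, of "n + 1"] lO by (simp add: O'_def)
    have "n + 1 < K" using K row_lengths(4)[OF K lf(1)] k1 by (cases "n + 1 = K") (auto simp: algebra_simps)
    then show "(K + 2) * ((n + 1) + 1) \<le> (K + 2) * (K + 1)" by (intro mult_le_mono2) simp
  qed
  have c5: "prv K (cMo K * (K + 1)) [(PModes, [vecw k O', ?M, ?Rs])]"
  proof (rule prv_mono)
    show "prv K (cMo K * (length fss + 1)) [(PModes, [vecw k O', ?M, ?Rs])]" unfolding O'_def by (rule prv_modes[OF K fss(2) lens(1) lR])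
    have "length fss < K" using length_enc_list_ge[of fss "enc_list enc_frac"] lens(1) by simp
    then show "cMo K * (length fss + 1) \<le> cMo K * (K + 1)" by (intro mult_le_mono2) simp
  qed
  have c6: "prv K (cMv K * (K + 1)) [(PMove, [a' @ L_1 # b', vecw k O', vecw k (Q 0), enc_list encI ?ts])]"
    unfolding Q0 ab'[symmetric]
  proof (rule prv_move_K)
    show "small k (mv E O' ?ts)" using sm Q0 by (metis le0)
  qed (use lf(1) okI_srow[of k fs] E lO lr in \<open>auto simp: O'_def\<close>)
  have c7: "prv K (cT K * K + 1) [(PTable, [?Rs, ?Rs, vecw k (Q 0), tab k Q (Suc 0) N])]"
  proof (rule prv_mono)
    show "prv K (cT K * (N - 0) + 1) [(PTable, [?Rs, ?Rs, vecw k (Q 0), tab k Q (Suc 0) N])]"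
      using prv_table[OF K fss(1) lf(2) lR _ y _ lT, of "Q 0" 0] sm lQ[of 0] unfolding Q_def Q0 by simp
    have "N * 1 \<le> (N + 1) * ((2 * k + 3) * (n + 1) + 2)" by (intro mult_le_mono) auto
    then have "N \<le> K" using lT by linarith
    then show "cT K * (N - 0) + 1 \<le> cT K * K + 1" by simp
  qed
  have c8: "prv K (cS K * K) [(PSat, [vecw k O', enc_ltl \<phi>, tab k Q 0 N])]"
  proof (rule prv_mono)
    show "prv K (cS K * length (enc_ltl \<phi>)) [(PSat, [vecw k O', enc_ltl \<phi>, tab k Q 0 N])]"
      by (rule prv_sat[OF lO ltab lvQ sat _ ops z lens(3)]) simp
  qed (use lens(3) in simp)
  have t0: "tab k Q 0 N = L_F # vecw k (Q 0) @ tab k Q (Suc 0) N" by (rule tab_Cons) simp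
  have step: "prv K B [(PZero, [a @ L_1 # b, fw k 0]), (PZero, [fw k 0, fw k 0]), (PScale, [a @ L_1 # b, enc_list enc_frac fs, ?rx]),
      (PZeroVec, [vecw k O']), (PModes, [vecw k O', ?M, ?Rs]), (PMove, [a' @ L_1 # b', vecw k O', vecw k (Q 0), enc_list encI ?ts]),
      (PTable, [?Rs, ?Rs, vecw k (Q 0), tab k Q (Suc 0) N]), (PSat, [vecw k O', enc_ltl \<phi>, tab k Q 0 N])] \<Longrightarrow>
    prv K (Suc B) [(PTop, [?M @ enc_list enc_frac fs @ enc_ltl \<phi>])]" for B
    unfolding Owd t0 m1
    using prv_top_rule[of 0 "[m1, enc_list enc_frac fs, enc_ltl \<phi>, a, b, fw k 0, ?rx, fw k 0, vecw k (replicate (n - 1) (0, 0)), ?Rs, a', b', vecw k (Q 0), tab k Q (Suc 0) N, fw k 0]" K B]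
      kK lm1 lens ab lab' lr lO2 lR lvQ ltab by (simp add: top_rules_def rule_simps)
  show ?thesis
    by (rule prv_mono[OF step[OF prv_Cons[OF c1 prv_Cons[OF c2 prv_Cons[OF c3 prv_Cons[OF c4 prv_Cons[OF c5 prv_Cons[OF c6 prv_Cons[OF c7 c8]]]]]]]]])
      (simp add: cTop_def)
qed

end


section \<open>Small certificates\<close>

text \<open>Closure properties are enough to see that bounds such as \<open>cTop\<close> are
  polynomial, without ever writing the polynomials out.\<close>

definition polyf :: "(nat \<Rightarrow> nat) \<Rightarrow> bool" where
  "polyf f \<longleftrightarrow> (\<exists>p. \<forall>n. f n = poly p n)"

lemma polyf_intros:
  "polyf (\<lambda>n. n)" "polyf (\<lambda>n. c)" "polyf f \<Longrightarrow> polyf g \<Longrightarrow> polyf (\<lambda>n. f n + g n)"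
  "polyf f \<Longrightarrow> polyf g \<Longrightarrow> polyf (\<lambda>n. f n * g n)"
proof -
  have "\<forall>n :: nat. n = poly [:0, 1:] n" "\<forall>n. c = poly [:c:] n" by simp_all
  then show "polyf (\<lambda>n. n)" "polyf (\<lambda>n. c)" unfolding polyf_def by blast+
  assume "polyf f" "polyf g"
  then obtain p q where "\<forall>n. f n = poly p n" "\<forall>n. g n = poly q n" unfolding polyf_def by blast
  then have "\<forall>n. f n + g n = poly (p + q) n" "\<forall>n. f n * g n = poly (p * q) n" by simp_all
  then show "polyf (\<lambda>n. f n + g n)" "polyf (\<lambda>n. f n * g n)" unfolding polyf_def by blast+
qed

lemma length_enc_list_mem: "x \<in> set xs \<Longrightarrow> length (f x) < length (enc_list f xs)"
  by (induction xs) auto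

lemma val_less: "val a < 2 ^ length a"
  by (induction a) auto

lemma nat_less_power_bits: "length (bits m) \<le> L \<Longrightarrow> m < 2 ^ L"
  using val_less[of "bits m"] by (auto intro: less_le_trans power_increasing)

text \<open>Uses \<open>n! \<le> n ^ n\<close> and \<open>a < 2 ^ a\<close>: the factorial
  contributes \<open>a * a\<close> to the exponent and the power contributes
  \<open>(a + 2 * ex) * a\<close>.\<close>

lemma solution_bound_le:
  assumes "m \<le> a" "n \<le> a" "M \<le> 2 ^ ex" "1 \<le> M"
  shows "solution_bound m n M \<le> 2 ^ ((2 * a + 2 * ex) * a)"
proof -
  have a: "a < 2 ^ a" by (rule less_exp)
  have "fact n \<le> n ^ n" using fact_le_power[of n, where ?'a = nat] by simp
  also have "n ^ n \<le> ((2 :: nat) ^ a) ^ n" using le_trans[OF assms(2) less_imp_le[OF a]] by (intro power_mono) auto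
  also have "\<dots> \<le> (2 ^ a) ^ a" using assms(2) by (intro power_increasing) auto
  finally have 1: "fact n \<le> ((2 :: nat) ^ a) ^ a" .
  have "(m + 1) * M ^ 2 \<le> 2 ^ a * (2 ^ ex) ^ 2"
    using assms(3) le_less_trans[OF assms(1) a] by (intro mult_le_mono power_mono) auto
  then have "((m + 1) * M ^ 2) ^ n \<le> (2 ^ a * (2 ^ ex) ^ 2) ^ n" by (intro power_mono) auto
  also have "\<dots> \<le> (2 ^ a * (2 ^ ex) ^ 2) ^ a" using assms(2) by (intro power_increasing) auto
  finally have "solution_bound m n M \<le> (2 ^ a) ^ a * (2 ^ a * (2 ^ ex) ^ 2) ^ a"
    unfolding solution_bound_def using 1 by (intro mult_le_mono)
  also have "\<dots> = 2 ^ ((2 * a + 2 * ex) * a)"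
    by (simp add: power_mult_distrib power_mult[symmetric] power_add[symmetric] algebra_simps)
  finally show ?thesis .
qed

lemma finite_zones: "finite (zones \<phi>)"
  by (induction \<phi>) auto

lemma zones_length:
  "card (zones \<phi>) \<le> length (enc_ltl \<phi>)" "z \<in> zones \<phi> \<Longrightarrow> length (enc_zone z) \<le> length (enc_ltl \<phi>)"
proof -
  show "card (zones \<phi>) \<le> length (enc_ltl \<phi>)"
  proof (induction \<phi>)
    case (Conj \<phi> \<psi>) then show ?case using card_Un_le[of "zones \<phi>" "zones \<psi>"] by simp
  next
    case (Disj \<phi> \<psi>) then show ?case using card_Un_le[of "zones \<phi>" "zones \<psi>"] by simp
  next
    case (Until \<phi> \<psi>) then show ?case using card_Un_le[of "zones \<phi>" "zones \<psi>"] by simp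
  qed auto
  show "z \<in> zones \<phi> \<Longrightarrow> length (enc_zone z) \<le> length (enc_ltl \<phi>)" by (induction \<phi>) auto
qed

lemma modal_count_length: "modal_count \<phi> \<le> length (enc_ltl \<phi>)"
  by (induction \<phi>) auto

text \<open>The step lengths are \<open>l p / g p\<close> because the modes are \<open>R p / g p\<close>; keeping all vertices in the
  zones in which they lie is a linear system for them, whose small solution is \<open>\<Lambda> p / E\<close>.\<close>

lemma small_polygon:
  fixes X :: "nat \<Rightarrow> int" and R :: "nat \<Rightarrow> nat \<Rightarrow> int" and D :: nat and g :: "nat \<Rightarrow> nat" and l :: "nat \<Rightarrow> real"
  defines "h \<equiv> \<lambda>E \<Lambda> i j. int E * X j + (\<Sum>p<i. int (D * \<Lambda> p) * R p j)"
  assumes D: "D > 0" and g: "\<forall>p. g p > 0" and l: "\<forall>p<N. l p \<ge> 0"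
    and sat: "isat (\<lambda>i. vec n (\<lambda>j. of_int (X j) / of_nat D + (\<Sum>p<i. l p * (of_int (R p j) / of_nat (g p))))) N 0 \<phi>"
    and zs: "\<forall>z\<in>zones \<phi>. is_zone n z \<and> dim_row (fst z) \<le> L \<and>
      (\<forall>r<dim_row (fst z). \<bar>snd z $ r\<bar> \<le> int B \<and> (\<forall>j<n. \<bar>fst z $$ (r, j)\<bar> \<le> int B))" and card: "card (zones \<phi>) \<le> L"
    and H: "\<forall>j<n. \<bar>X j\<bar> \<le> int H" "\<forall>p. \<forall>j<n. \<bar>R p j\<bar> \<le> int H" "D \<le> H"
    and M: "H * (n * (B * H)) \<le> M" "H * B + n * (B * H) \<le> M" "1 \<le> M"
    and S: "\<And>m. m \<le> (N + 1) * (L * L) \<Longrightarrow> solution_bound m (N + m) M \<le> S"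
  shows "\<exists>E \<Lambda>. 0 < E \<and> E \<le> S \<and> (\<forall>p<N. \<Lambda> p \<le> S) \<and> isat (\<lambda>i. vec n (\<lambda>j. of_int (h E \<Lambda> i j) / of_nat (D * E))) N 0 \<phi>"
proof -
  define P :: "nat \<Rightarrow> real vec" where "P = (\<lambda>i. vec n (\<lambda>j. of_int (X j) / of_nat D + (\<Sum>p<i. l p * (of_int (R p j) / of_nat (g p)))))"
  let ?Z = "SIGMA i:{..N}. SIGMA z:zones \<phi>. {..<L}"
  \<comment> \<open>Only memberships that hold on the given polygon become constraints; by
    \<open>isat_mono\<close> they suffice to keep the formula true.\<close>
  define I where "I = {(i, z, r). i \<le> N \<and> z \<in> zones \<phi> \<and> r < dim_row (fst z) \<and> P i \<in> zone_set z}"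
  define s where "s = (\<lambda>(z :: zone) r v. \<Sum>j<n. fst z $$ (r, j) * v j :: int)"
  \<comment> \<open>The inequality of row \<open>r\<close> at vertex \<open>i\<close>, multiplied by
    the denominator \<open>D\<close> of the start point. Edges behind vertex \<open>i\<close> get
    the coefficient 0.\<close>
  define A where "A = (\<lambda>(i :: nat, z :: zone, r) p. if p < i then int D * s z r (R p) else 0)"
  define b where "b = (\<lambda>(i :: nat, z :: zone, r). int D * snd z $ r - s z r X)"
  have sub: "I \<subseteq> {..N} \<times> zones \<phi> \<times> {..<L}" using zs by (fastforce simp: I_def)
  have fin: "finite ({..N} \<times> zones \<phi> \<times> {..<L})" by (simp add: finite_zones)
  have finI: "finite I" using sub fin by (rule finite_subset)
  have "card I \<le> card ({..N} \<times> zones \<phi> \<times> {..<L})" using fin sub by (rule card_mono)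
  also have "\<dots> = (N + 1) * (card (zones \<phi>) * L)" by (simp add: card_cartesian_product)
  also have "\<dots> \<le> (N + 1) * (L * L)" using card by (intro mult_le_mono) auto
  finally have cI: "card I \<le> (N + 1) * (L * L)" .
  have cs: "\<bar>s z r v\<bar> \<le> int (n * (B * H))" if "z \<in> zones \<phi>" "r < dim_row (fst z)" "\<forall>j<n. \<bar>v j\<bar> \<le> int H" for z r v
  proof -
    have "\<bar>s z r v\<bar> \<le> (\<Sum>j<n. \<bar>fst z $$ (r, j) * v j\<bar>)" unfolding s_def by (rule sum_abs)
    also have "\<dots> \<le> (\<Sum>j<n. int B * int H)" using zs that unfolding abs_mult by (intro sum_mono mult_mono) auto
    finally show ?thesis by simp
  qed
  have split: "(\<Sum>p<N. if p < i then f p else 0) = (\<Sum>p<i. f p)" if "i \<le> N" for i and f :: "nat \<Rightarrow> 'z::comm_monoid_add"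
    using that by (intro sum.mono_neutral_cong_right) auto
  have "\<exists>E \<Lambda>. 0 < E \<and> (\<forall>t\<in>I. (\<Sum>p\<in>{..<N}. A t p * int (\<Lambda> p)) \<le> int E * b t) \<and>
      E \<le> solution_bound (card I) (card {..<N} + card I) M \<and> (\<forall>p\<in>{..<N}. \<Lambda> p \<le> solution_bound (card I) (card {..<N} + card I) M)"
  proof (rule small_solution_ineq[OF finI, where x = "\<lambda>p. l p / of_nat (g p)"])
    show "\<forall>p\<in>{..<N}. 0 \<le> l p / real (g p)" using l g by simp
    show "\<forall>t\<in>I. (\<Sum>p\<in>{..<N}. real_of_int (A t p) * (l p / real (g p))) \<le> real_of_int (b t)"
    proof
      fix t assume "t \<in> I"
      then obtain i z r where t: "t = (i, z, r)" "i \<le> N" "z \<in> zones \<phi>" "r < dim_row (fst z)" "P i \<in> zone_set z" by (auto simp: I_def)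
      have "P i \<in> carrier_vec n" by (simp add: P_def)
      then have "(\<Sum>j<n. of_int (fst z $$ (r, j)) * P i $ j) \<le> real_of_int (snd z $ r)" using zone_set_iff[of n z "P i"] zs t(3,4,5) by auto
      then have "real D * (\<Sum>j<n. of_int (fst z $$ (r, j)) * P i $ j) \<le> real D * real_of_int (snd z $ r)" by (intro mult_left_mono) auto
      moreover have "real D * (\<Sum>j<n. of_int (fst z $$ (r, j)) * P i $ j) = real_of_int (s z r X) + (\<Sum>p<i. real D * real_of_int (s z r (R p)) * (l p / real (g p)))"
      proof -
        have "real D * (\<Sum>j<n. of_int (fst z $$ (r, j)) * P i $ j) =
          (\<Sum>j<n. of_int (fst z $$ (r, j)) * of_int (X j) + (\<Sum>p<i. of_int (fst z $$ (r, j)) * (real D * (of_int (R p j) * (l p / real (g p))))))"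
          unfolding sum_distrib_left by (intro sum.cong refl) (use D in \<open>simp add: P_def distrib_left sum_distrib_left mult_ac\<close>)
        also have "\<dots> = real_of_int (s z r X) + (\<Sum>p<i. \<Sum>j<n. of_int (fst z $$ (r, j)) * (real D * (of_int (R p j) * (l p / real (g p)))))"
          unfolding sum.distrib by (subst sum.swap) (simp add: s_def)
        also have "(\<Sum>p<i. \<Sum>j<n. of_int (fst z $$ (r, j)) * (real D * (of_int (R p j) * (l p / real (g p))))) = (\<Sum>p<i. real D * real_of_int (s z r (R p)) * (l p / real (g p)))"
          by (intro sum.cong refl) (simp add: s_def sum_distrib_left sum_distrib_right mult_ac)
        finally show ?thesis .
      qed
      moreover have "(\<Sum>p<N. real_of_int (A t p) * (l p / real (g p))) = (\<Sum>p<i. real D * real_of_int (s z r (R p)) * (l p / real (g p)))"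
      proof -
        have "(\<Sum>p<N. real_of_int (A t p) * (l p / real (g p))) = (\<Sum>p<N. if p < i then real D * real_of_int (s z r (R p)) * (l p / real (g p)) else 0)"
          by (intro sum.cong refl) (simp add: A_def t(1))
        then show ?thesis unfolding split[OF t(2)] .
      qed
      ultimately show "(\<Sum>p\<in>{..<N}. real_of_int (A t p) * (l p / real (g p))) \<le> real_of_int (b t)" by (simp add: b_def t(1))
    qed
    show "\<forall>t\<in>I. \<forall>p\<in>{..<N}. \<bar>A t p\<bar> \<le> int M"
    proof (intro ballI)
      fix t p assume "t \<in> I"
      then obtain i z r where t: "t = (i, z, r)" "z \<in> zones \<phi>" "r < dim_row (fst z)" by (auto simp: I_def)
      have "\<bar>s z r (R p)\<bar> \<le> int (n * (B * H))" using cs[OF t(2,3)] H(2) by blast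
      then have "int D * \<bar>s z r (R p)\<bar> \<le> int H * int (n * (B * H))" using H(3) by (intro mult_mono) auto
      also have "\<dots> \<le> int M" using M(1) by (simp flip: of_nat_mult)
      finally show "\<bar>A t p\<bar> \<le> int M" by (simp add: A_def t(1) abs_mult)
    qed
    show "\<forall>t\<in>I. \<bar>b t\<bar> \<le> int M"
    proof
      fix t assume "t \<in> I"
      then obtain i z r where t: "t = (i, z, r)" "z \<in> zones \<phi>" "r < dim_row (fst z)" by (auto simp: I_def)
      have 1: "\<bar>s z r X\<bar> \<le> int (n * (B * H))" using cs[OF t(2,3)] H(1) by blast
      have "int D * \<bar>snd z $ r\<bar> \<le> int H * int B" using H(3) zs t(2,3) by (intro mult_mono) auto
      then have "\<bar>int D * snd z $ r\<bar> \<le> int (H * B)" by (simp add: abs_mult)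
      then have "\<bar>b t\<bar> \<le> int (H * B + n * (B * H))" using 1 by (simp add: b_def t(1))
      also have "\<dots> \<le> int M" using M(2) by (simp only: of_nat_le_iff)
      finally show "\<bar>b t\<bar> \<le> int M" .
    qed
  qed (use M(3) in auto)
  then obtain E \<Lambda> where E: "0 < E" "\<forall>t\<in>I. (\<Sum>p<N. A t p * int (\<Lambda> p)) \<le> int E * b t"
    "E \<le> solution_bound (card I) (N + card I) M" "\<forall>p<N. \<Lambda> p \<le> solution_bound (card I) (N + card I) M" by auto
  have ES: "E \<le> S" "\<forall>p<N. \<Lambda> p \<le> S" using E(3,4) S[OF cI] by (auto intro: le_trans)
  have "isat (\<lambda>i. vec n (\<lambda>j. of_int (h E \<Lambda> i j) / of_nat (D * E))) N 0 \<phi>"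
  proof (rule isat_mono[OF sat[folded P_def]])
    show "\<forall>i\<le>N. \<forall>z\<in>zones \<phi>. P i \<in> zone_set z \<longrightarrow> vec n (\<lambda>j. of_int (h E \<Lambda> i j) / of_nat (D * E)) \<in> zone_set z"
    proof (intro allI ballI impI)
      fix i z assume i: "i \<le> N" and z: "z \<in> zones \<phi>" and Pi: "P i \<in> zone_set z"
      let ?v = "vec n (\<lambda>j. real_of_int (h E \<Lambda> i j) / real (D * E))"
      have "(\<Sum>j<n. of_int (fst z $$ (r, j)) * ?v $ j) \<le> real_of_int (snd z $ r)" if r: "r < dim_row (fst z)" for r
      proof -
        have "(i, z, r) \<in> I" using i z Pi r by (simp add: I_def)
        then have *: "(\<Sum>p<N. A (i, z, r) p * int (\<Lambda> p)) \<le> int E * b (i, z, r)" using E(2) by blast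
        have "(\<Sum>p<N. A (i, z, r) p * int (\<Lambda> p)) = (\<Sum>p<N. if p < i then int D * s z r (R p) * int (\<Lambda> p) else 0)"
          by (intro sum.cong refl) (simp add: A_def)
        then have "(\<Sum>p<N. A (i, z, r) p * int (\<Lambda> p)) = (\<Sum>p<i. int D * s z r (R p) * int (\<Lambda> p))" unfolding split[OF i] .
        moreover have "s z r (h E \<Lambda> i) = int E * s z r X + (\<Sum>p<i. int D * s z r (R p) * int (\<Lambda> p))"
        proof -
          have "s z r (h E \<Lambda> i) = (\<Sum>j<n. int E * (fst z $$ (r, j) * X j)) + (\<Sum>j<n. \<Sum>p<i. fst z $$ (r, j) * (int (D * \<Lambda> p) * R p j))"
            unfolding s_def h_def by (simp add: distrib_left sum_distrib_left sum.distrib mult_ac)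
          also have "\<dots> = int E * s z r X + (\<Sum>p<i. \<Sum>j<n. fst z $$ (r, j) * (int (D * \<Lambda> p) * R p j))"
            by (subst sum.swap) (simp add: s_def sum_distrib_left)
          also have "(\<Sum>p<i. \<Sum>j<n. fst z $$ (r, j) * (int (D * \<Lambda> p) * R p j)) = (\<Sum>p<i. int D * s z r (R p) * int (\<Lambda> p))"
            by (intro sum.cong refl) (simp add: s_def sum_distrib_left sum_distrib_right mult_ac)
          finally show ?thesis .
        qed
        ultimately have "s z r (h E \<Lambda> i) \<le> int (D * E) * snd z $ r" using * by (simp add: b_def algebra_simps)
        then have le: "real_of_int (s z r (h E \<Lambda> i)) \<le> real (D * E) * real_of_int (snd z $ r)"
          by (metis of_int_le_iff of_int_mult of_int_of_nat_eq)
        have "(\<Sum>j<n. of_int (fst z $$ (r, j)) * ?v $ j) = real_of_int (s z r (h E \<Lambda> i)) / real (D * E)"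
          by (simp add: s_def sum_divide_distrib)
        also have "\<dots> \<le> real_of_int (snd z $ r)" using le D E(1) by (simp add: divide_le_eq mult_ac)
        finally show ?thesis .
      qed
      moreover have "is_zone n z" "?v \<in> carrier_vec n" using zs z by auto
      ultimately show "?v \<in> zone_set z" by (simp add: zone_set_iff)
    qed
  qed simp
  then show ?thesis using E(1) ES by blast
qed

subsection \<open>Integer coordinates of the points\<close>

text \<open>Dividing \<open>gden gs\<close> first makes exactness visible; by
  \<open>ival_srow\<close> the result agrees with \<open>scl\<close>, which multiplies before it
  divides.\<close>

definition rowi :: "frac list \<Rightarrow> nat \<Rightarrow> int" where
  "rowi gs j = fst (gs ! j) * int (gden gs div snd (gs ! j))"

lemma rowi_val:
  assumes "\<forall>f\<in>set gs. snd f > 0" "j < length gs"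
  shows "real_of_int (rowi gs j) / real (gden gs) = real_of_int (fst (gs ! j)) / real (snd (gs ! j))"
proof -
  have m: "gs ! j \<in> set gs" using assms(2) by simp
  obtain c where c: "gden gs = snd (gs ! j) * c" using gden_dvd[OF m] by auto
  have "snd (gs ! j) > 0" "gden gs > 0" using assms(1) m gden_pos[OF assms(1)] by auto
  then show ?thesis using c by (simp add: rowi_def)
qed

lemma ival_srow:
  assumes "rows_ok k n gs" "j < n"
  shows "ival (srow k gs ! j) = rowi gs j"
proof -
  obtain p q where f: "gs ! j = (p, q)" by (cases "gs ! j")
  have m: "(p, q) \<in> set gs" using assms f by (metis nth_mem rows_ok_def)
  have q: "q > 0" "nat \<bar>p\<bar> * gden gs < 2 ^ k" using assms(1) m by (auto simp: rows_ok_def)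
  have d: "q dvd gden gs" using gden_dvd[OF m] by simp
  have "nat \<bar>p\<bar> * gden gs div q < 2 ^ k" using div_le_dividend q(2) by (rule le_less_trans)
  then have "val (fw k (nat \<bar>p\<bar> * gden gs div q)) = nat \<bar>p\<bar> * (gden gs div q)"
    using d by (simp add: val_fw div_mult_swap)
  then show ?thesis using assms f by (simp add: srow_def rows_ok_def rowi_def)
qed

lemma val_srow:
  assumes "rows_ok k n gs" "\<forall>(p, q)\<in>set gs. nat \<bar>p\<bar> * gden gs \<le> H" "(s, a) \<in> set (srow k gs)"
  shows "val a \<le> H"
proof -
  obtain p q where m: "(p, q) \<in> set gs" "a = fw k (nat \<bar>p\<bar> * gden gs div q)" using assms(3) by (auto simp: srow_def)
  have le: "nat \<bar>p\<bar> * gden gs div q \<le> nat \<bar>p\<bar> * gden gs" by (rule div_le_dividend)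
  have b: "nat \<bar>p\<bar> * gden gs < 2 ^ k" "nat \<bar>p\<bar> * gden gs \<le> H" using assms(1,2) m(1) by (auto simp: rows_ok_def)
  show ?thesis unfolding m(2) val_fw[OF le_less_trans[OF le b(1)]] using le b(2) by (rule le_trans)
qed

lemma rowi_le:
  assumes "\<forall>(p, q)\<in>set gs. nat \<bar>p\<bar> * gden gs \<le> H" "j < length gs"
  shows "\<bar>rowi gs j\<bar> \<le> int H"
proof -
  obtain p q where f: "gs ! j = (p, q)" by (cases "gs ! j")
  have m: "(p, q) \<in> set gs" using assms(2) f by (metis nth_mem)
  have "\<bar>rowi gs j\<bar> = int (nat \<bar>p\<bar> * (gden gs div q))" by (simp add: rowi_def f abs_mult)
  also have "\<dots> \<le> int (nat \<bar>p\<bar> * gden gs)" by (simp add: mult_left_mono)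
  also have "\<dots> \<le> int H" using bspec[OF assms(1) m] by (simp only: of_nat_le_iff prod.case)
  finally show ?thesis .
qed

lemma pvl_pts:
  assumes "fss \<noteq> []" "\<forall>gs\<in>set fss. rows_ok k n gs" "length P = n + 1"
  shows "pvl (pts k fss y P i ! 0) = pvl (P ! 0)"
    "j < n \<Longrightarrow> pvl (pts k fss y P i ! Suc j) = pvl (P ! Suc j) + (\<Sum>p<i. int (y p) * rowi (fss ! (p mod length fss)) j)"
proof -
  have r: "rows_ok k n (fss ! (i mod length fss))" for i
    using assms(1,2) by (meson length_greater_0_conv mod_less_divisor nth_mem)
  have lr: "length (fss ! (i mod length fss)) = n" for i using r[of i] by (simp add: rows_ok_def)
  have "\<forall>gs\<in>set fss. length gs = n" using assms(2) by (auto simp: rows_ok_def)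
  then have lp: "length (pts k fss y P i) = n + 1" for i using length_pts[OF assms(1) _ assms(3)] by blast
  show "pvl (pts k fss y P i ! 0) = pvl (P ! 0)"
  proof (induction i)
    case (Suc i)
    then show ?case using lp[of i] lr[of i] by (simp add: pvl_mv)
  qed simp
  show "pvl (pts k fss y P i ! Suc j) = pvl (P ! Suc j) + (\<Sum>p<i. int (y p) * rowi (fss ! (p mod length fss)) j)" if "j < n"
  proof (induction i)
    case (Suc i)
    then show ?case using lp[of i] lr[of i] that by (simp add: pvl_mv ival_srow[OF r])
  qed simp
qed

lemma le_all_pts:
  assumes "fss \<noteq> []" "\<forall>gs\<in>set fss. rows_ok k n gs \<and> (\<forall>(p, q)\<in>set gs. nat \<bar>p\<bar> * gden gs \<le> H)" "le_all T P" "\<forall>p<i. y p \<le> Y"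
  shows "le_all (T + i * (H * Y)) (pts k fss y P i)"
  using assms(4)
proof (induction i)
  case (Suc i)
  let ?gs = "fss ! (i mod length fss)"
  have m: "?gs \<in> set fss" using assms(1) by simp
  have "\<forall>(s, a)\<in>set ((L_Plus, []) # srow k ?gs). val a \<le> H" using val_srow[of k n ?gs H] assms(2) m by auto
  then have "le_all (T + i * (H * Y) + H * Y) (mv (y i) (pts k fss y P i) ((L_Plus, []) # srow k ?gs))"
    using Suc by (intro le_all_mv) auto
  then show ?case by (simp add: algebra_simps)
qed (simp add: assms(3))


section \<open>Sizes of encoded zones and fractions, and of their certificates\<close>

lemma zone_listsE:
  assumes "is_zone n z" "length (enc_zone z) \<le> L"
  obtains rs bs where "z = zone_of n rs bs" "length bs = length rs" "\<forall>r\<in>set rs. length r = n"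
    "enc_zone z = encrows rs @ enc_list enc_int bs" "length rs \<le> L"
    "\<forall>r\<in>set rs. \<forall>a\<in>set r. nat \<bar>a\<bar> \<le> 2 ^ L" "\<forall>b\<in>set bs. nat \<bar>b\<bar> \<le> 2 ^ L"
    "\<forall>r\<in>set rs. \<forall>b\<in>set bs. length (enc_list enc_int (b # r)) \<le> L"
proof -
  obtain m where m: "fst z \<in> carrier_mat m n" "snd z \<in> carrier_vec m" using assms(1) by (auto simp: is_zone_def)
  define rs where "rs = mat_to_list (fst z)"
  define bs where "bs = list_of_vec (snd z)"
  have z: "z = zone_of n rs bs"
  proof (rule prod_eqI)
    show "fst z = fst (zone_of n rs bs)" using m(1)
      by (intro eq_matI) (auto simp: zone_of_def rs_def mat_to_list_def mat_of_rows_list_def)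
    show "snd z = snd (zone_of n rs bs)" by (simp add: zone_of_def bs_def vec_list)
  qed
  have l: "length bs = length rs" "\<forall>r\<in>set rs. length r = n" using m by (auto simp: rs_def bs_def mat_to_list_def)
  have ez: "enc_zone z = encrows rs @ enc_list enc_int bs" using enc_zone_of[OF l(2), of bs] z by simp
  have sum: "length (encrows rs) + length (enc_list enc_int bs) \<le> L" using assms(2) ez by simp
  have int_le: "nat \<bar>a\<bar> \<le> 2 ^ L" if "length (enc_int a) \<le> L" for a
    using nat_less_power_bits[of "nat \<bar>a\<bar>" L] that by (simp add: enc_int_bits)
  have row: "length (enc_list enc_int r) < length (encrows rs)" if "r \<in> set rs" for r
    unfolding encrows_def using that by (rule length_enc_list_mem)
  have b: "length (enc_int b) < length (enc_list enc_int bs)" if "b \<in> set bs" for b using that by (rule length_enc_list_mem)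
  show thesis
  proof (rule that[OF z l ez])
    have "length rs < length (encrows rs)" unfolding encrows_def by (rule length_enc_list_ge)
    then show "length rs \<le> L" using sum by simp
    show "\<forall>r\<in>set rs. \<forall>a\<in>set r. nat \<bar>a\<bar> \<le> 2 ^ L"
    proof (intro ballI int_le)
      fix r a assume "r \<in> set rs" "a \<in> set r"
      then show "length (enc_int a) \<le> L" using row[of r] length_enc_list_mem[of a r enc_int] sum by linarith
    qed
    show "\<forall>b\<in>set bs. nat \<bar>b\<bar> \<le> 2 ^ L"
    proof (intro ballI int_le)
      fix x assume "x \<in> set bs"
      then show "length (enc_int x) \<le> L" using b[of x] sum by linarith
    qed
    show "\<forall>r\<in>set rs. \<forall>b\<in>set bs. length (enc_list enc_int (b # r)) \<le> L"
    proof (intro ballI)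
      fix r x assume "r \<in> set rs" "x \<in> set bs"
      then show "length (enc_list enc_int (x # r)) \<le> L" using row[of r] b[of x] sum by simp
    qed
  qed
qed

text \<open>The exponent that \<open>solution_bound_le\<close> gives for the multipliers of a zone,
  with \<open>a = L + 1\<close> and entries up to \<open>2 ^ L\<close>.\<close>

definition uZ :: "nat \<Rightarrow> nat" where "uZ L = (2 * (L + 1) + 2 * L) * (L + 1)"

text \<open>\<open>c\<close> is the common denominator of the vertices and \<open>S\<close> bounds
  their integer coordinates. The two conditions on \<open>k\<close> leave room for the combinations
  with Farkas multipliers and for the scalar products of \<open>PDot\<close>.\<close>

lemma zone_proofs_bounded:
  assumes k1: "1 \<le> k" and kK: "k \<le> K" and n: "n \<ge> 1" "n \<le> L" and z: "is_zone n z" "bounded_zone z" "length (enc_zone z) \<le> L"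
    and L: "L \<le> K" and k: "2 * L + 2 * uZ L < k" and K: "(2 * k + 3) * (n + 1) + 1 \<le> K"
    and Q: "\<forall>i\<le>N. length (Q i) = n + 1 \<and> le_all S (Q i) \<and> pvl (Q i ! 0) = - int c \<and> (\<forall>j<n. pvl (Q i ! Suc j) = h i j)" and c: "c > 0"
    and S: "(n + 1) * (2 ^ L * S) < 2 ^ k"
  shows "zone_proofs K k (vecw k (replicate (n + 1) (0, 0))) Q (\<lambda>i. vec n (\<lambda>j. of_int (h i j) / of_nat c)) N z"
proof -
  obtain rs bs where zo: "z = zone_of n rs bs" and l: "length bs = length rs" "\<forall>r\<in>set rs. length r = n"
    and ez: "enc_zone z = encrows rs @ enc_list enc_int bs" and lr: "length rs \<le> L"
    and M: "\<forall>r\<in>set rs. \<forall>a\<in>set r. nat \<bar>a\<bar> \<le> 2 ^ L" "\<forall>b\<in>set bs. nat \<bar>b\<bar> \<le> 2 ^ L"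
    and rb: "\<forall>r\<in>set rs. \<forall>b\<in>set bs. length (enc_list enc_int (b # r)) \<le> L"
    by (rule zone_listsE[OF z(1,3)])
  have le: "length (encrows rs) \<le> K" "length (enc_list enc_int bs) \<le> K" using ez z(3) L by auto
  have rb': "\<forall>r\<in>set rs. \<forall>b\<in>set bs. length (enc_list enc_int (b # r)) \<le> K" using rb L by (meson le_trans)
  let ?B = "solution_bound (n + 1) (length rs) (2 ^ L)"
  have B: "?B \<le> 2 ^ uZ L" unfolding uZ_def by (rule solution_bound_le) (use n lr in auto)
  have "?B * ?B + length rs * (2 ^ L * (?B * ?B)) = (1 + length rs * 2 ^ L) * (?B * ?B)" by (simp add: algebra_simps)
  also have "\<dots> \<le> (2 ^ L * 2 ^ L) * (2 ^ uZ L * 2 ^ uZ L)"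
  proof (intro mult_le_mono B)
    have "1 + length rs * 2 ^ L \<le> (1 + length rs) * 2 ^ L" by simp
    also have "\<dots> \<le> 2 ^ L * 2 ^ L" using le_less_trans[OF lr less_exp[of L]] by (intro mult_le_mono1) simp
    finally show "1 + length rs * 2 ^ L \<le> 2 ^ L * 2 ^ L" .
  qed
  also have "\<dots> = (2 :: nat) ^ (2 * L + 2 * uZ L)" by (simp add: power_add[symmetric] mult_2)
  also have "\<dots> < 2 ^ k" using k by simp
  finally have Yk: "?B * ?B + length rs * (2 ^ L * (?B * ?B)) < 2 ^ k" .
  have ok: "prv K (cZO K) [(PZoneOK, [encrows rs, enc_list enc_int bs, vecw k (replicate (n + 1) (0, 0))])]"
    using prv_zone_ok[OF k1 kK l n(1) _ M _ Yk K rb' le] z(2) zo by simp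
  have Sk: "S < 2 ^ k"
  proof -
    have "1 * (1 * S) \<le> (n + 1) * (2 ^ L * S)" by (intro mult_le_mono) auto
    then show ?thesis using S by simp
  qed
  have "prv K (cZA K * (K + 1)) [(PZoneAt, [encrows rs, enc_list enc_int bs, vecw k (Q i)])]"
    if i: "i \<le> N" and mem: "vec n (\<lambda>j. real_of_int (h i j) / real c) \<in> zone_set z" for i
  proof (rule prv_mono[OF prv_zone_at[OF k1 kK l(1)]])
    have lQ: "length (Q i) = n + 1" and aQ: "le_all S (Q i)" and pQ: "pvl (Q i ! 0) = - int c" "\<And>j. j < n \<Longrightarrow> pvl (Q i ! Suc j) = h i j"
      using Q i by auto
    show "small k (Q i)" using aQ Sk by (rule le_all_small)
    show "length (vecw k (Q i)) \<le> K" using K lQ unfolding length_vecw by simp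
    show "\<forall>r<length rs. length (rs ! r) + 1 = length (Q i) \<and> (\<Sum>j<length (Q i). (bs ! r # rs ! r) ! j * pvl (Q i ! j)) \<le> 0"
    proof (intro allI impI conjI)
      fix r assume r: "r < length rs"
      then show "length (rs ! r) + 1 = length (Q i)" using l(2) lQ by simp
      have "(\<Sum>j<n. of_int (rs ! r ! j) * vec n (\<lambda>j. real_of_int (h i j) / real c) $ j) \<le> real_of_int (bs ! r)"
        using zone_of_iff[OF l, of "vec n (\<lambda>j. real_of_int (h i j) / real c)"] mem zo r by auto
      moreover have "(\<Sum>j<n. of_int (rs ! r ! j) * vec n (\<lambda>j. real_of_int (h i j) / real c) $ j) = real_of_int (\<Sum>j<n. rs ! r ! j * h i j) / real c"
        by (simp add: sum_divide_distrib)
      ultimately have "real_of_int (\<Sum>j<n. rs ! r ! j * h i j) \<le> real_of_int (bs ! r) * real c" using c by (simp add: divide_le_eq)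
      then have *: "(\<Sum>j<n. rs ! r ! j * h i j) \<le> bs ! r * int c" by (metis of_int_le_iff of_int_mult of_int_of_nat_eq)
      have "(\<Sum>j<length (Q i). (bs ! r # rs ! r) ! j * pvl (Q i ! j)) = bs ! r * (- int c) + (\<Sum>j<n. rs ! r ! j * h i j)"
        using pQ by (simp add: lQ sum.lessThan_Suc_shift del: sum.lessThan_Suc)
      then show "(\<Sum>j<length (Q i). (bs ! r # rs ! r) ! j * pvl (Q i ! j)) \<le> 0" using * by simp
    qed
    show "\<forall>r\<in>set rs. \<forall>b\<in>set bs. length (enc_list enc_int (b # r)) \<le> K \<and> snd (dt (map int_code (b # r)) (Q i) (0, 0)) < 2 ^ k"
    proof (intro ballI conjI)
      fix r b assume r: "r \<in> set rs" "b \<in> set bs"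
      then show "length (enc_list enc_int (b # r)) \<le> K" using rb' by blast
      have "\<forall>(s, a)\<in>set (map int_code (b # r)). val a \<le> 2 ^ L" using M r by (auto simp: int_code_def)
      from dt_bound[OF this aQ, of "(0, 0)" 0] have "snd (dt (map int_code (b # r)) (Q i) (0, 0)) \<le> (n + 1) * (2 ^ L * S)"
        using l(2) r(1) by simp
      then show "snd (dt (map int_code (b # r)) (Q i) (0, 0)) < 2 ^ k" using S by (rule le_less_trans)
    qed
    show "cZA K * (length rs + 1) \<le> cZA K * (K + 1)" using lr L by (intro mult_le_mono2) simp
  qed (use le in auto)
  then show ?thesis unfolding zone_proofs_def using ez ok by blast
qed

text \<open>A word of length \<open>L\<close> contains at most \<open>L\<close> denominators of at
  most \<open>L\<close> digits each, so their product stays within \<open>2 ^ (L * L)\<close>; a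
  numerator adds \<open>L\<close> digits.\<close>

lemma frac_bounds:
  assumes pos: "\<forall>f\<in>set gs. snd f > 0" and len: "length (enc_list enc_frac gs) \<le> L"
  shows "length gs \<le> L" "gden gs \<le> 2 ^ (L * L)" "\<forall>(p, q)\<in>set gs. nat \<bar>p\<bar> * gden gs \<le> 2 ^ (L * L + L)"
proof -
  show l: "length gs \<le> L" using length_enc_list_ge[of gs enc_frac] len by simp
  have f: "nat \<bar>p\<bar> \<le> 2 ^ L" "q \<le> 2 ^ L" if "(p, q) \<in> set gs" for p q
  proof -
    have "length (enc_frac (p, q)) \<le> L" using length_enc_list_mem[OF that, of enc_frac] len by simp
    then have "length (bits (nat \<bar>p\<bar>)) \<le> L" "length (bits q) \<le> L" by (simp_all add: enc_frac_def enc_int_bits[of p] enc_nat_def)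
    then show "nat \<bar>p\<bar> \<le> 2 ^ L" "q \<le> 2 ^ L" using nat_less_power_bits less_imp_le by blast+
  qed
  have "gden gs' \<le> (2 ^ L) ^ length gs'" if "set gs' \<subseteq> set gs" for gs'
    using that
  proof (induction gs')
    case (Cons g gs')
    then have "snd g \<le> 2 ^ L" using f[of "fst g" "snd g"] by simp
    then show ?case using Cons by (simp add: gden_def mult_le_mono)
  qed (simp add: gden_def)
  then have "gden gs \<le> (2 ^ L) ^ length gs" by simp
  also have "\<dots> \<le> (2 ^ L) ^ L" using l by (intro power_increasing) auto
  finally show g: "gden gs \<le> 2 ^ (L * L)" by (simp add: power_mult)
  show "\<forall>(p, q)\<in>set gs. nat \<bar>p\<bar> * gden gs \<le> 2 ^ (L * L + L)"
  proof clarify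
    fix p q assume "(p, q) \<in> set gs"
    then have "nat \<bar>p\<bar> * gden gs \<le> 2 ^ L * 2 ^ (L * L)" using f g by (intro mult_le_mono) auto
    then show "nat \<bar>p\<bar> * gden gs \<le> 2 ^ (L * L + L)" by (simp add: power_add mult.commute)
  qed
qed

text \<open>For an input of length \<open>L\<close>, the linear system for the step lengths has coefficients at most
  \<open>2 ^ eM L\<close>, at most \<open>aS L\<close> unknowns (with slack variables), and a solution of size at most \<open>2 ^ sS L\<close>;
  \<open>kk L\<close> binary digits suffice for the numbers of a certificate, and \<open>KK L\<close> letters for all its words.\<close>

definition eM :: "nat \<Rightarrow> nat" where "eM L = 2 * (L * L) + 4 * L"
definition aS :: "nat \<Rightarrow> nat" where "aS L = L * L + (L * L + 1) * (L * L)"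
definition sS :: "nat \<Rightarrow> nat" where "sS L = (2 * aS L + 2 * eM L) * aS L"
definition kk :: "nat \<Rightarrow> nat" where "kk L = 1 + 2 * L + L * L + 2 * (L * L + L) + sS L + 2 * uZ L"
definition KK :: "nat \<Rightarrow> nat" where "KK L = (L * L + 1) * ((2 * kk L + 3) * (L + 1) + 2) + L + 1"

lemma polyf_kk: "polyf KK" "polyf (\<lambda>L. cTop (KK L))"
proof -
  have k: "polyf kk" unfolding kk_def[abs_def] sS_def uZ_def aS_def eM_def by (intro polyf_intros)
  then show K: "polyf KK" unfolding KK_def[abs_def] by (intro polyf_intros)
  then show "polyf (\<lambda>L. cTop (KK L))"
    unfolding cTop_def cS_def cT_def cMo_def cSc_def cZO_def cDir_def cZA_def cD_def cM_def cMv_def cC_def by (intro polyf_intros)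
qed


lemma length_enc_rows:
  "\<forall>gs\<in>set fss. length gs = n \<Longrightarrow> length (enc_list (enc_list encI) (map (srow k) fss)) = length fss * ((k + 3) * n + 2) + 1"
  by (induction fss) (auto simp: srow_def length_enc_srow)

lemma KK_bounds:
  assumes "n \<le> L" "m \<le> L" "N \<le> L * L"
  shows "kk L \<le> KK L" "L \<le> KK L" "(2 * kk L + 3) * (n + 1) + 1 \<le> KK L" "(N + 1) * ((2 * kk L + 3) * (n + 1) + 2) \<le> KK L"
    "m * ((kk L + 3) * n + 2) + 1 \<le> KK L"
proof -
  let ?c = "(2 * kk L + 3) * (L + 1) + 2"
  have c: "(2 * kk L + 3) * (n + 1) \<le> (2 * kk L + 3) * (L + 1)" using assms(1) by (intro mult_le_mono2) simp
  have 1: "1 * ?c \<le> (L * L + 1) * ?c" by (rule mult_le_mono1) simp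
  have 2: "(2 * kk L + 3) * 1 \<le> (2 * kk L + 3) * (L + 1)" by (rule mult_le_mono2) simp
  have "?c + L + 1 \<le> KK L" using 1 by (simp only: KK_def mult_1 add_le_mono1)
  moreover define u where "u = (2 * kk L + 3) * (L + 1)"
  ultimately have u: "u + 2 + L + 1 \<le> KK L" "2 * kk L + 3 \<le> u" "(2 * kk L + 3) * (n + 1) \<le> u" using 2 c by simp_all
  show "kk L \<le> KK L" "L \<le> KK L" using u(1,2) by linarith+
  show "(2 * kk L + 3) * (n + 1) + 1 \<le> KK L" using u(1,3) by linarith
  have "(N + 1) * ((2 * kk L + 3) * (n + 1) + 2) \<le> (L * L + 1) * ?c" using assms(3) c by (intro mult_le_mono) auto
  then show "(N + 1) * ((2 * kk L + 3) * (n + 1) + 2) \<le> KK L" by (simp add: KK_def)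
  have "(kk L + 3) * n \<le> (2 * kk L + 3) * (L + 1)" using assms(1) by (intro mult_le_mono) auto
  moreover have "m \<le> L * L + 1" using assms(2) le_square[of L] by linarith
  ultimately have "m * ((kk L + 3) * n + 2) \<le> (L * L + 1) * ?c" by (intro mult_le_mono) auto
  then show "m * ((kk L + 3) * n + 2) + 1 \<le> KK L" by (simp add: KK_def)
qed

lemma instance_provable:
  assumes ms: "\<forall>m\<in>set ms. frac_vec d m" "is_mms d (val_vec ` set ms)" and x: "frac_vec d x"
    and \<phi>: "\<phi> \<in> LTL_B d fragment" and sat: "models (val_vec ` set ms) (val_vec x) \<phi>"
  defines "w \<equiv> enc_instance ms x \<phi>"
  shows "prv (KK (length w)) (cTop (KK (length w))) [(PTop, [w])]"
proof -
  define L fss fs where "L = length w" and "fss = map list_of_vec ms" and "fs = list_of_vec x"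
  have w: "w = enc_list (enc_list enc_frac) fss @ enc_list enc_frac fs @ enc_ltl \<phi>"
    by (simp add: w_def enc_instance_def fss_def fs_def)
  have lens: "length (enc_list (enc_list enc_frac) fss) \<le> L" "length (enc_list enc_frac fs) \<le> L" "length (enc_ltl \<phi>) \<le> L"
    unfolding L_def w by simp_all
  have d: "d \<ge> 1" using ms(2) by (simp add: is_mms_def)
  have fv: "length (list_of_vec v) = d \<and> (\<forall>f\<in>set (list_of_vec v). snd f > 0) \<and> (\<forall>j<d. list_of_vec v ! j = v $ j)" if "frac_vec d v" for v
  proof -
    have v: "v \<in> carrier_vec d" "\<forall>i<d. snd (v $ i) > 0" using that by (auto simp: frac_vec_def)
    have "\<forall>f\<in>set (list_of_vec v). snd f > 0"
    proof
      fix f assume "f \<in> set (list_of_vec v)"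
      then obtain i where "i < d" "f = v $ i" using v(1) by (auto simp: in_set_conv_nth list_of_vec_index)
      then show "snd f > 0" using v(2) by simp
    qed
    then show ?thesis using v(1) by (simp add: list_of_vec_index)
  qed
  have fss: "\<forall>gs\<in>set fss. length gs = d \<and> (\<forall>f\<in>set gs. snd f > 0)" and fs: "length fs = d" "\<forall>f\<in>set fs. snd f > 0"
    using fv ms(1) x by (auto simp: fss_def fs_def)
  have lfss: "length fss \<le> L" using length_enc_list_ge[of fss "enc_list enc_frac"] lens(1) by simp
  \<comment> \<open>Bounds the denominators and all scaled coordinates of the modes and of the start
    point.\<close>
  define H where "H = (2 :: nat) ^ (L * L + L)"
  have H1: "H \<ge> 1" by (simp add: H_def)
  have gb: "gden gs \<le> H" "\<forall>(p, q)\<in>set gs. nat \<bar>p\<bar> * gden gs \<le> H" "length gs \<le> L"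
    if "\<forall>f\<in>set gs. snd f > 0" "length (enc_list enc_frac gs) \<le> L" for gs
  proof -
    have "(2 :: nat) ^ (L * L) \<le> H" unfolding H_def by (rule power_increasing) auto
    then show "gden gs \<le> H" using frac_bounds(2)[OF that] by simp
  qed (use frac_bounds[OF that] in \<open>auto simp: H_def\<close>)
  have lg: "length (enc_list enc_frac gs) \<le> L" if "gs \<in> set fss" for gs
    using length_enc_list_mem[OF that, of "enc_list enc_frac"] lens(1) by simp
  have dL: "d \<le> L" using gb(3)[OF fs(2) lens(2)] fs(1) by simp
  define k where "k = kk L"
  have Hk: "H < 2 ^ k" unfolding H_def by (rule power_strict_increasing) (auto simp: k_def kk_def)
  have ro: "rows_ok k d gs" if "length gs = d" "\<forall>f\<in>set gs. snd f > 0" "length (enc_list enc_frac gs) \<le> L" for gs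
    unfolding rows_ok_def using that gb[OF that(2,3)] Hk by (auto intro: le_less_trans)
  have rfss: "\<forall>gs\<in>set fss. rows_ok k d gs" and rfs: "rows_ok k d fs" using ro fss fs lens lg by auto
  have "set (map val_vec ms) \<subseteq> carrier_vec d" "val_vec x \<in> carrier_vec d" "ops \<phi> \<subseteq> fragment" "models (set (map val_vec ms)) (val_vec x) \<phi>"
    using ms x sat \<phi> by (auto simp: is_mms_def LTL_B_def frac_vec_def val_vec_def)
  note mp = models_polygon[OF this(1,2,4,3)]
  have "length fss = length (map val_vec ms)" by (simp add: fss_def)
  note mp = mp[folded this]
  have ne: "fss \<noteq> []" using mp by (simp add: fss_def)
  obtain N l where N: "N \<le> modal_count \<phi> * length fss" and l: "\<forall>p<N. l p \<ge> 0"
    and pis: "isat (polygon d (val_vec x) (\<lambda>p. map val_vec ms ! (p mod length fss)) l) N 0 \<phi>" using mp by blast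
  have "N \<le> L * L" using N modal_count_length[of \<phi>] lens(3) lfss by (meson le_trans mult_le_mono)
  note NL = this
  define D X g R where "D = gden fs" and "X = rowi fs" and "g = (\<lambda>p. gden (fss ! (p mod length fss)))" and "R = (\<lambda>p. rowi (fss ! (p mod length fss)))"
  have mem: "fss ! (p mod length fss) \<in> set fss" for p using ne by simp
  have D: "D > 0" "D \<le> H" using gden_pos[OF fs(2)] gb(1)[OF fs(2) lens(2)] by (simp_all add: D_def)
  have g: "\<forall>p. g p > 0" unfolding g_def using bspec[OF fss mem] gden_pos by blast
  have vv: "val_vec v $ j = of_int (rowi (list_of_vec v) j) / of_nat (gden (list_of_vec v))" if "frac_vec d v" "j < d" for v j
    using rowi_val[of "list_of_vec v" j] fv[OF that(1)] that by (auto simp: val_vec_def frac_vec_def split: prod.splits)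
  have mv: "map val_vec ms ! (p mod length fss) $ j = of_int (R p j) / of_nat (g p)" if "j < d" for p j
  proof -
    have p: "p mod length fss < length ms" using ne by (simp add: fss_def)
    then show ?thesis using vv[of "ms ! (p mod length fss)" j] ms(1) that by (simp add: R_def g_def fss_def)
  qed
  have "polygon d (val_vec x) (\<lambda>p. map val_vec ms ! (p mod length fss)) l =
      (\<lambda>i. vec d (\<lambda>j. of_int (X j) / of_nat D + (\<Sum>p<i. l p * (of_int (R p j) / of_nat (g p)))))"
    unfolding polygon_def by (intro ext eq_vecI) (auto simp: vv[OF x] mv X_def D_def fs_def)
  then have pis': "isat (\<lambda>i. vec d (\<lambda>j. of_int (X j) / of_nat D + (\<Sum>p<i. l p * (of_int (R p j) / of_nat (g p))))) N 0 \<phi>"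
    using pis by simp
  have zo: "is_zone d z" "bounded_zone z" "length (enc_zone z) \<le> L" if "z \<in> zones \<phi>" for z
    using \<phi> that zones_length(2)[OF that] lens(3) by (auto simp: LTL_B_def)
  have zs: "\<forall>z\<in>zones \<phi>. is_zone d z \<and> dim_row (fst z) \<le> L \<and>
      (\<forall>r<dim_row (fst z). \<bar>snd z $ r\<bar> \<le> int (2 ^ L) \<and> (\<forall>j<d. \<bar>fst z $$ (r, j)\<bar> \<le> int (2 ^ L)))"
  proof
    fix z assume z: "z \<in> zones \<phi>"
    obtain rs bs where zo': "z = zone_of d rs bs" and l: "length bs = length rs" "\<forall>r\<in>set rs. length r = d"
      and lr: "length rs \<le> L" and M: "\<forall>r\<in>set rs. \<forall>a\<in>set r. nat \<bar>a\<bar> \<le> 2 ^ L" "\<forall>b\<in>set bs. nat \<bar>b\<bar> \<le> 2 ^ L"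
      by (rule zone_listsE[OF zo(1,3)[OF z]])
    have dr: "dim_row (fst z) = length rs" by (simp add: zo' zone_of_def mat_of_rows_list_def)
    have "\<bar>snd z $ r\<bar> \<le> int (2 ^ L) \<and> (\<forall>j<d. \<bar>fst z $$ (r, j)\<bar> \<le> int (2 ^ L))" if r: "r < length rs" for r
    proof (intro conjI allI impI)
      have "snd z $ r = bs ! r" by (simp add: zo' zone_of_def vec_of_list_index)
      then show "\<bar>snd z $ r\<bar> \<le> int (2 ^ L)" using M(2) l(1) r nth_mem[of r bs] by (simp add: nat_le_iff)
      fix j assume j: "j < d"
      have "fst z $$ (r, j) = rs ! r ! j" using r j by (simp add: zo' zone_of_def mat_of_rows_list_def)
      moreover have "rs ! r ! j \<in> set (rs ! r)" using l(2) r j by simp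
      moreover have "rs ! r \<in> set rs" using r by simp
      ultimately have "nat \<bar>fst z $$ (r, j)\<bar> \<le> 2 ^ L" using M(1) by simp
      then show "\<bar>fst z $$ (r, j)\<bar> \<le> int (2 ^ L)" by (simp add: nat_le_iff)
    qed
    then show "is_zone d z \<and> dim_row (fst z) \<le> L \<and>
      (\<forall>r<dim_row (fst z). \<bar>snd z $ r\<bar> \<le> int (2 ^ L) \<and> (\<forall>j<d. \<bar>fst z $$ (r, j)\<bar> \<le> int (2 ^ L)))"
      using zo(1)[OF z] lr by (simp add: dr)
  qed
  have cz: "card (zones \<phi>) \<le> L" using zones_length(1)[of \<phi>] lens(3) by simp
  define S where "S = (2 :: nat) ^ sS L"
  have pe: "(2 :: nat) ^ a \<le> 2 ^ b" if "a \<le> b" for a b using that by (intro power_increasing) auto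
  have L2: "d \<le> 2 ^ L" "d + 1 \<le> 2 ^ L" using le_less_trans[OF dL less_exp[of L]] by auto
  have S: "solution_bound m (N + m) (2 ^ eM L) \<le> S" if "m \<le> (N + 1) * (L * L)" for m
  proof -
    have "(N + 1) * (L * L) \<le> (L * L + 1) * (L * L)" using NL by (intro mult_le_mono1) simp
    with that have "m \<le> (L * L + 1) * (L * L)" by (rule le_trans)
    then have "m \<le> aS L" "N + m \<le> aS L" using NL unfolding aS_def by linarith+
    then show ?thesis unfolding S_def sS_def by (intro solution_bound_le) auto
  qed
  \<comment> \<open>A coefficient of the system is \<open>D\<close> times a sum of \<open>d\<close>
    products of a zone entry, at most \<open>2 ^ L\<close>, and a scaled coordinate, at most
    \<open>H\<close>.\<close>
  have M1: "H * (d * (2 ^ L * H)) \<le> 2 ^ eM L"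
  proof -
    have "H * (d * (2 ^ L * H)) \<le> H * (2 ^ L * (2 ^ L * H))" using L2 by (intro mult_le_mono) auto
    also have "\<dots> = 2 ^ eM L" by (simp add: H_def eM_def power_add[symmetric] mult_2 algebra_simps)
    finally show ?thesis .
  qed
  have M2: "H * 2 ^ L + d * (2 ^ L * H) \<le> 2 ^ eM L"
  proof -
    have "H * 2 ^ L + d * (2 ^ L * H) = (d + 1) * (2 ^ L * H)" by (simp add: algebra_simps)
    also have "\<dots> \<le> 2 ^ L * (2 ^ L * H)" using L2 by (intro mult_le_mono1)
    also have "\<dots> = 2 ^ (L + (L + (L * L + L)))" by (simp add: H_def power_add)
    also have "\<dots> \<le> 2 ^ eM L" by (rule pe) (simp add: eM_def)
    finally show ?thesis .
  qed
  have HX: "\<forall>j<d. \<bar>X j\<bar> \<le> int H" using rowi_le[OF gb(2)[OF fs(2) lens(2)]] fs(1) by (simp add: X_def)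
  have HR: "\<forall>p. \<forall>j<d. \<bar>R p j\<bar> \<le> int H"
  proof (intro allI impI)
    fix p j assume j: "j < d"
    have f: "\<forall>f\<in>set (fss ! (p mod length fss)). snd f > 0" "length (fss ! (p mod length fss)) = d" using fss mem[of p] by auto
    show "\<bar>R p j\<bar> \<le> int H" unfolding R_def using rowi_le[OF gb(2)[OF f(1) lg[OF mem]]] f(2) j by simp
  qed
  define h where "h = (\<lambda>E \<Lambda> i j. int E * X j + (\<Sum>p<i. int (D * \<Lambda> p) * R p j))"
  obtain E \<Lambda> where E: "0 < E" "E \<le> S" "\<forall>p<N. \<Lambda> p \<le> S"
    and isE: "isat (\<lambda>i. vec d (\<lambda>j. real_of_int (h E \<Lambda> i j) / real (D * E))) N 0 \<phi>"
    using small_polygon[OF D(1) g l pis' zs cz HX HR D(2) M1 M2 _ S] unfolding h_def by auto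
  \<comment> \<open>Over the common denominator \<open>D * E\<close> the start point
    \<open>X / D\<close> has numerators \<open>E * X\<close>, and an edge of length
    \<open>\<Lambda> p / E\<close> along \<open>R p\<close> becomes the integer multiple
    \<open>D * \<Lambda> p\<close>.\<close>
  define y P0 where "y = (\<lambda>p. D * \<Lambda> p)" and "P0 = mv E (replicate (d + 1) (0, 0)) ((L_Minus, fw k (gden fs)) # srow k fs)"
  define Q where "Q = pts k fss y P0"
  have ls: "length (srow k fs) = d" using fs(1) by simp
  have lP0: "length P0 = d + 1" by (simp add: P0_def fs(1))
  have lfd: "\<forall>gs\<in>set fss. length gs = d" using fss by blast
  have lQ: "length (Q i) = d + 1" for i unfolding Q_def by (rule length_pts[OF ne lfd lP0])
  have vD: "val (fw k (gden fs)) = D" using D(2) Hk by (simp add: val_fw D_def)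
  have aP: "le_all (0 + H * S) P0" unfolding P0_def
  proof (rule le_all_mv)
    show "\<forall>(s, a)\<in>set ((L_Minus, fw k (gden fs)) # srow k fs). val a \<le> H"
      using val_srow[OF rfs gb(2)[OF fs(2) lens(2)]] vD D(2) by auto
  qed (use E(2) in auto)
  \<comment> \<open>Bounds all entries of the vertices: the start and each of at most
    \<open>N\<close> edges contribute at most \<open>H * (H * S)\<close>.\<close>
  define T where "T = (N + 1) * (H * (H * S))"
  have y: "y p \<le> H * S" if "p < N" for p unfolding y_def using D(2) E(3) that by (intro mult_le_mono) auto
  have aQ: "le_all T (Q i)" if "i \<le> N" for i
  proof -
    have "le_all (H * S + i * (H * (H * S))) (Q i)" unfolding Q_def
    proof (rule le_all_pts[OF ne])
      show "\<forall>gs\<in>set fss. rows_ok k d gs \<and> (\<forall>(p, q)\<in>set gs. nat \<bar>p\<bar> * gden gs \<le> H)" using rfss fss gb(2) lg by blast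
    qed (use aP y that in auto)
    moreover have "H * S + i * (H * (H * S)) \<le> T"
    proof -
      have "1 * (H * S) \<le> H * (H * S)" "i * (H * (H * S)) \<le> N * (H * (H * S))" using H1 that by (blast intro: mult_le_mono1)+
      then have "1 * (H * S) + i * (H * (H * S)) \<le> H * (H * S) + N * (H * (H * S))" by (rule add_le_mono)
      then show ?thesis unfolding T_def by (simp only: distrib_right mult_1 add.commute)
    qed
    ultimately show ?thesis by (rule le_all_mono)
  qed
  \<comment> \<open>The factors \<open>d + 1\<close> and \<open>2 ^ L\<close> account for scalar
    products of a vertex with a row of a zone, so \<open>kk L\<close> digits suffice for these as
    well.\<close>
  have Tk: "(d + 1) * (2 ^ L * T) < 2 ^ k"
  proof -
    have "N + 1 \<le> 2 ^ (L * L)" using le_less_trans[OF NL less_exp[of "L * L"]] by simp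
    then have "(d + 1) * (2 ^ L * T) \<le> 2 ^ L * (2 ^ L * (2 ^ (L * L) * (H * (H * S))))" using L2 unfolding T_def by (intro mult_le_mono) auto
    also have "\<dots> = 2 ^ (L + (L + (L * L + ((L * L + L) + ((L * L + L) + sS L)))))" by (simp add: H_def S_def power_add)
    also have "\<dots> < 2 ^ k" by (rule power_strict_increasing) (auto simp: k_def kk_def)
    finally show ?thesis .
  qed
  have TT: "T < 2 ^ k"
  proof -
    have "1 * (1 * T) \<le> (d + 1) * (2 ^ L * T)" by (intro mult_le_mono) auto
    then show ?thesis using Tk by simp
  qed
  have HST: "H * S \<le> T" "S \<le> T"
  proof -
    have "1 * (1 * (H * S)) \<le> (N + 1) * (H * (H * S))" using H1 by (intro mult_le_mono) auto
    then show HST: "H * S \<le> T" by (simp add: T_def)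
    have "1 * S \<le> H * S" using H1 by (rule mult_le_mono1)
    then show "S \<le> T" using HST unfolding mult_1 by (rule le_trans)
  qed
  have P0: "pvl (P0 ! 0) = - int (D * E)" "\<And>j. j < d \<Longrightarrow> pvl (P0 ! Suc j) = int E * X j"
  proof -
    have l': "length (replicate (d + 1) (0 :: nat, 0 :: nat)) = length ((L_Minus, fw k (gden fs)) # srow k fs)" by (simp add: fs(1))
    show "pvl (P0 ! 0) = - int (D * E)" unfolding P0_def using pvl_mv[OF l', of 0 E] vD by (simp add: mult.commute)
    show "pvl (P0 ! Suc j) = int E * X j" if "j < d" for j unfolding P0_def
      using pvl_mv[OF l', of "Suc j" E] that ival_srow[OF rfs that] ls
      by (simp add: X_def del: replicate.simps replicate_Suc)
  qed
  have pQ: "pvl (Q i ! 0) = - int (D * E)" "\<And>j. j < d \<Longrightarrow> pvl (Q i ! Suc j) = h E \<Lambda> i j" for i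
    using pvl_pts[OF ne rfss lP0, where y = y and i = i] P0 by (simp_all add: Q_def h_def y_def R_def)
  note KB = KK_bounds[OF dL lfss NL, folded k_def]
  have k1: "1 \<le> k" by (simp add: k_def kk_def)
  have zp: "\<forall>z\<in>zones \<phi>. zone_proofs (KK L) k (vecw k (replicate (d + 1) (0, 0))) Q (\<lambda>i. vec d (\<lambda>j. real_of_int (h E \<Lambda> i j) / real (D * E))) N z"
  proof
    fix z assume z: "z \<in> zones \<phi>"
    show "zone_proofs (KK L) k (vecw k (replicate (d + 1) (0, 0))) Q (\<lambda>i. vec d (\<lambda>j. real_of_int (h E \<Lambda> i j) / real (D * E))) N z"
    proof (rule zone_proofs_bounded[OF k1 KB(1) d dL zo[OF z] KB(2) _ KB(3) _ _ Tk])
      show "2 * L + 2 * uZ L < k" by (simp add: k_def kk_def)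
      show "\<forall>i\<le>N. length (Q i) = d + 1 \<and> le_all T (Q i) \<and> pvl (Q i ! 0) = - int (D * E) \<and> (\<forall>j<d. pvl (Q i ! Suc j) = h E \<Lambda> i j)"
        using lQ aQ pQ by blast
      show "D * E > 0" using D(1) E(1) by simp
    qed
  qed
  have "prv (KK L) (cTop (KK L)) [(PTop, [enc_list (enc_list enc_frac) fss @ enc_list enc_frac fs @ enc_ltl \<phi>])]"
  proof (rule prv_top[OF k1 KB(1) KB(3) d ne rfss rfs _ _ E(1) _ KB(4) _ _ isE _ zp[unfolded Q_def P0_def]])
    show "length (enc_list (enc_list encI) (map (srow k) fss)) \<le> KK L" using length_enc_rows[OF lfd] KB(5) by simp
    show "\<forall>i<N. y i < 2 ^ k" using y HST(1) TT by (meson le_less_trans)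
    show "E < 2 ^ k" using E(2) HST(2) TT by linarith
    show "length (enc_list (enc_list enc_frac) fss @ enc_list enc_frac fs @ enc_ltl \<phi>) \<le> KK L" using KB(2) unfolding L_def w .
    show "\<forall>i\<le>N. small k (pts k fss y (mv E (replicate (d + 1) (0, 0)) ((L_Minus, fw k (gden fs)) # srow k fs)) i)"
      using aQ le_all_small TT unfolding Q_def P0_def by blast
    show "ops \<phi> \<subseteq> fragment" using \<phi> by (simp add: LTL_B_def)
  qed
  then show ?thesis unfolding L_def w .
qed

theorem theorem5:
  shows "in_NP (model_checking {Op_F, Op_Conj, Op_Disj})"
proof -
  obtain K q :: "nat poly" where K: "\<And>n. KK n = poly K n" and q: "\<And>n. cTop (KK n) = poly q n"
    using polyf_kk unfolding polyf_def by metis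
  show ?thesis
  proof (rule logic_program_in_NP[of rules sem PTop _ q K])
    show "sem (inst_goal \<theta> (fst c))" if "c \<in> set rules" "\<forall>b\<in>set (snd c). sem (inst_goal \<theta> b)" for c \<theta>
      using that by (rule rules_sound)
    show "w \<in> model_checking fragment" if "sem (PTop, [w])" for w using that by (simp add: s_top_def)
    fix w :: "letter list" assume "w \<in> model_checking fragment"
    then have "prv (KK (length w)) (cTop (KK (length w))) [(PTop, [w])]"
      unfolding model_checking_def by (auto intro: instance_provable)
    then show "\<exists>n\<le>poly q (length w). drv (set rules) (poly K (length w)) n [(PTop, [w])]"
      by (simp add: prv_def K[symmetric] q[symmetric])
  qed
qed

end
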